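(* For any fixed value $T$, the UCM configuration LP with bound $T$ can be solved (i.e., it can be decided whether it is feasible and, if so, a feasible solution computed) in time polynomial in $m$ and $k$.
   Context: Setting: scores $\alpha_0\le\cdots\le\alpha_{m-1}$, nonnegative integers bounded by a polynomial in $m$; candidates $c_1,\ldots,c_m$ with initial integer scores $\sigma_1,\ldots,\sigma_m$; $k$ unweighted manipulators; $[m]=\{1,\ldots,m\}$, $[m]_0=\{0,\ldots,m-1\}$. A configuration is a vector $C=(C_0,\ldots,C_{m-1})$ of nonnegative integers with $\sum_jC_j=k$. For a bound $T$, $\mathcal{C}_i(T)$ is the set of configurations with $\sum_jC_j\alpha_j\le T-\sigma_i$. The UCM configuration LP has variables $x_{i,C}\ge0$ for $i\in[m]$, $C\in\mathcal{C}_i(T)$ (exponentially many), and constraints $\sum_{C\in\mathcal{C}_i(T)}x_{i,C}\le1$ for all $i\in[m]$ and $\sum_{i}\sum_{C\in\mathcal{C}_i(T)}C_jx_{i,C}\ge k$ for all $j\in[m]_0$. *)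

theory Defs
  imports Complex_Main "HOL-Computational_Algebra.Polynomial"
begin

section \<open>The configuration LP\<close>

text \<open>
  The number of candidates is \<open>m = length \<alpha>\<close>. Candidates are numbered from 0, so
  \<open>\<sigma> ! 0\<close>, \<open>\<sigma> ! 1\<close>, \<dots> are the scores written $\sigma_1, \sigma_2, \ldots$ on paper.
\<close>

definition configs :: "nat \<Rightarrow> nat \<Rightarrow> nat list set" where
  "configs m k = {C. length C = m \<and> sum_list C = k}"

definition bounded_configs :: "nat list \<Rightarrow> int list \<Rightarrow> nat \<Rightarrow> int \<Rightarrow> nat \<Rightarrow> nat list set" where
  "bounded_configs \<alpha> \<sigma> k T i =
     {C \<in> configs (length \<alpha>) k. (\<Sum>j<length \<alpha>. int (C ! j) * int (\<alpha> ! j)) \<le> T - \<sigma> ! i}"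

text \<open>Only the values \<open>x i C\<close> with \<open>i < m\<close> and \<open>C \<in> bounded_configs \<alpha> \<sigma> k T i\<close> are LP variables.\<close>

definition lp_feasible ::
  "nat list \<Rightarrow> int list \<Rightarrow> nat \<Rightarrow> int \<Rightarrow> (nat \<Rightarrow> nat list \<Rightarrow> real) \<Rightarrow> bool" where
  "lp_feasible \<alpha> \<sigma> k T x \<longleftrightarrow>
     (\<forall>i<length \<alpha>. \<forall>C\<in>bounded_configs \<alpha> \<sigma> k T i. 0 \<le> x i C) \<and>
     (\<forall>i<length \<alpha>. (\<Sum>C\<in>bounded_configs \<alpha> \<sigma> k T i. x i C) \<le> 1) \<and>
     (\<forall>j<length \<alpha>. (\<Sum>i<length \<alpha>. \<Sum>C\<in>bounded_configs \<alpha> \<sigma> k T i. real (C ! j) * x i C) \<ge> real k)"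

text \<open>The sums above range over finite sets.\<close>

lemma finite_configs: "finite (configs m k)"
proof (rule finite_subset)
  show "configs m k \<subseteq> {C. set C \<subseteq> {..k} \<and> length C = m}"
    by (auto simp: configs_def member_le_sum_list)
  show "finite {C. set C \<subseteq> {..k} \<and> length C = m}"
    by (rule finite_lists_length_eq) simp
qed

lemma finite_bounded_configs: "finite (bounded_configs \<alpha> \<sigma> k T i)"
  by (rule finite_subset[OF _ finite_configs]) (auto simp: bounded_configs_def)


section \<open>Random access machines\<close>

text \<open>
  Time is measured on the random access machine of Cook and Reckhow (1973), with structured
  control flow in place of jumps. Cells hold arbitrary integers, and every instruction and every
  test costs one unit. Addition and subtraction are the only arithmetic, so one step lengthens
  the longest number in memory by at most one bit; a run of \<open>t\<close> steps can therefore be simulated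
  by a Turing machine in time polynomial in \<open>t\<close> and the bit length of the input. A unit-cost
  multiplication would destroy this property.

  \<open>Load i j\<close> is \<open>X\<^sub>i := X\<^bsub>X\<^sub>j\<^esub>\<close> and \<open>Store i j\<close> is \<open>X\<^bsub>X\<^sub>i\<^esub> := X\<^sub>j\<close>. Addresses are integers, so
  indirect addressing is total.
\<close>

type_synonym mem = "int \<Rightarrow> int"

datatype prog =
    Const int int
  | Add int int int
  | Sub int int int
  | Load int int
  | Store int int
  | Seq prog prog
  | IfPos int prog prog
  | WhilePos int prog

text \<open>\<open>exec c s t s'\<close>: started in memory \<open>s\<close>, the program \<open>c\<close> halts after \<open>t\<close> steps in memory \<open>s'\<close>.\<close>

inductive exec :: "prog \<Rightarrow> mem \<Rightarrow> nat \<Rightarrow> mem \<Rightarrow> bool" where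
  Const: "exec (Const i n) s 1 (s(i := n))"
| Add: "exec (Add i j l) s 1 (s(i := s j + s l))"
| Sub: "exec (Sub i j l) s 1 (s(i := s j - s l))"
| Load: "exec (Load i j) s 1 (s(i := s (s j)))"
| Store: "exec (Store i j) s 1 (s(s i := s j))"
| Seq: "\<lbrakk>exec c1 s t1 s'; exec c2 s' t2 s''\<rbrakk> \<Longrightarrow> exec (Seq c1 c2) s (t1 + t2) s''"
| IfTrue: "\<lbrakk>s i > 0; exec c1 s t s'\<rbrakk> \<Longrightarrow> exec (IfPos i c1 c2) s (1 + t) s'"
| IfFalse: "\<lbrakk>s i \<le> 0; exec c2 s t s'\<rbrakk> \<Longrightarrow> exec (IfPos i c1 c2) s (1 + t) s'"
| WhileFalse: "s i \<le> 0 \<Longrightarrow> exec (WhilePos i c) s 1 s"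
| WhileTrue: "\<lbrakk>s i > 0; exec c s t1 s'; exec (WhilePos i c) s' t2 s''\<rbrakk>
    \<Longrightarrow> exec (WhilePos i c) s (1 + t1 + t2) s''"

inductive_cases ConstE: "exec (Const i n) s t s'"
inductive_cases AddE: "exec (Add i j l) s t s'"
inductive_cases SubE: "exec (Sub i j l) s t s'"
inductive_cases LoadE: "exec (Load i j) s t s'"
inductive_cases StoreE: "exec (Store i j) s t s'"
inductive_cases SeqE: "exec (Seq c1 c2) s t s'"
inductive_cases IfE: "exec (IfPos i c1 c2) s t s'"
inductive_cases WhileE: "exec (WhilePos i c) s t s'"

lemma exec_deterministic: "exec c s t s' \<Longrightarrow> exec c s u s'' \<Longrightarrow> u = t \<and> s'' = s'"
proof (induction arbitrary: u s'' rule: exec.induct)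
  case (Const i n s)
  then show ?case by (rule ConstE) simp
next
  case (Add i j l s)
  then show ?case by (rule AddE) simp
next
  case (Sub i j l s)
  then show ?case by (rule SubE) simp
next
  case (Load i j s)
  then show ?case by (rule LoadE) simp
next
  case (Store i j s)
  then show ?case by (rule StoreE) simp
next
  case (Seq c1 s t1 s' c2 t2 s1)
  from Seq.prems obtain u1 r u2 where
    u: "exec c1 s u1 r" "exec c2 r u2 s''" "u = u1 + u2" by (rule SeqE)
  from Seq.IH(1)[OF u(1)] Seq.IH(2) u(2,3) show ?case by simp
next
  case (IfTrue s i c1 t s' c2)
  from IfTrue.prems obtain v where "exec c1 s v s''" "u = 1 + v"
    by (rule IfE) (use IfTrue.hyps(1) in simp_all)
  with IfTrue.IH show ?case by simp
next
  case (IfFalse s i c2 t s' c1)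
  from IfFalse.prems obtain v where "exec c2 s v s''" "u = 1 + v"
    by (rule IfE) (use IfFalse.hyps(1) in simp_all)
  with IfFalse.IH show ?case by simp
next
  case (WhileFalse s i c)
  from WhileFalse.prems show ?case
    by (rule WhileE) (use WhileFalse.hyps in simp_all)
next
  case (WhileTrue s i c t1 s' t2 s1)
  from WhileTrue.prems obtain u1 r u2 where
    u: "exec c s u1 r" "exec (WhilePos i c) r u2 s''" "u = 1 + u1 + u2"
    by (rule WhileE) (use WhileTrue.hyps(1) in simp_all)
  from WhileTrue.IH(1)[OF u(1)] WhileTrue.IH(2) u(2,3) show ?case by simp
qed


section \<open>Input and output\<close>

definition mem_of :: "int list \<Rightarrow> mem" where
  "mem_of w = (\<lambda>a. if 0 \<le> a \<and> a < int (length w) then w ! nat a else 0)"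

definition holds :: "mem \<Rightarrow> int list \<Rightarrow> bool" where
  "holds s w \<longleftrightarrow> (\<forall>a<length w. s (int a) = w ! a)"

definition lp_input :: "nat list \<Rightarrow> int list \<Rightarrow> nat \<Rightarrow> int \<Rightarrow> mem" where
  "lp_input \<alpha> \<sigma> k T = mem_of ([int (length \<alpha>), int k, T] @ map int \<alpha> @ \<sigma>)"

text \<open>
  A solution has exponentially many coordinates and is output as a sparse list: an entry
  \<open>(i, C, a, b)\<close> contributes \<open>a / b\<close> to \<open>x i C\<close>, and a variable without an entry is 0. As every entry
  has \<open>b > 0\<close> while memory is initially 0 outside the input, all entries have to be
  written out (or overlap the input).
\<close>

type_synonym lp_entry = "nat \<times> nat list \<times> int \<times> int"

fun encode_entry :: "lp_entry \<Rightarrow> int list" where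
  "encode_entry (i, C, a, b) = int i # map int C @ [a, b]"

definition sparse_value :: "lp_entry list \<Rightarrow> nat \<Rightarrow> nat list \<Rightarrow> real" where
  "sparse_value es i C = (\<Sum>(i', C', a, b)\<leftarrow>es. if i' = i \<and> C' = C then real_of_int a / real_of_int b else 0)"

definition outputs_solution :: "nat list \<Rightarrow> int list \<Rightarrow> nat \<Rightarrow> int \<Rightarrow> mem \<Rightarrow> bool" where
  "outputs_solution \<alpha> \<sigma> k T s \<longleftrightarrow>
     (\<exists>es. holds s (1 # int (length es) # concat (map encode_entry es)) \<and>
           (\<forall>(i, C, a, b)\<in>set es. i < length \<alpha> \<and> C \<in> bounded_configs \<alpha> \<sigma> k T i \<and> b > 0) \<and>
           lp_feasible \<alpha> \<sigma> k T (sparse_value es))"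

definition outputs_infeasible :: "mem \<Rightarrow> bool" where
  "outputs_infeasible s \<longleftrightarrow> s 0 = 0"

definition solves_lp :: "nat list \<Rightarrow> int list \<Rightarrow> nat \<Rightarrow> int \<Rightarrow> mem \<Rightarrow> bool" where
  "solves_lp \<alpha> \<sigma> k T s \<longleftrightarrow>
     (if \<exists>x. lp_feasible \<alpha> \<sigma> k T x then outputs_solution \<alpha> \<sigma> k T s else outputs_infeasible s)"

text \<open>A \<open>nat poly poly\<close> is a polynomial in two variables.\<close>

definition poly2 :: "nat poly poly \<Rightarrow> nat \<Rightarrow> nat \<Rightarrow> nat" where
  "poly2 p x y = poly (poly p [:y:]) x"

end

theory Submission
  imports Defs "HOL-Library.FuncSet"
begin

text \<open>
  If there are at least one candidate and one manipulator, adding up the covering constraints shows that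
  all constraints hold with equality. So a solution assigns to every candidate \<open>i\<close> a point of the
  convex hull of its configurations. A configuration is a path in a layered graph whose nodes record
  the candidate, the score index, and the number and total score of the votes placed so far; as the scores are
  polynomially bounded, this graph has polynomial size, and the LP becomes a flow problem with side
  constraints. Homogenised, the question is whether an integer system \<open>A x = 0\<close>, \<open>x \<ge> 0\<close> has a
  solution in which one given coordinate is positive.

  Chubanov's algorithm keeps weights \<open>W\<close> such that \<open>x l \<le> W l / 2 ^ L\<close> for all solutions \<open>x\<close> in the
  unit box. Given the orthogonal projection onto the kernel of \<open>A\<close> with its columns scaled by \<open>W\<close>, a
  perceptron either finds a positive kernel vector, or after \<open>4 n ^ 3\<close> steps exhibits a
  coordinate that is at most half its bound, so that its weight can be halved. By Siegel's lemma (a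
  pigeonhole argument) a coordinate that is positive in some solution is at least \<open>2 ^ (- L)\<close> in some
  solution in the box; hence a weight that drops below 1 may be set to 0, and there are at most
  \<open>n (L + 1)\<close> phases. The same lemma bounds the denominator of the projection, which therefore
  keeps polynomially many bits if the fractions are reduced after each row. Finally the integer
  flow is decomposed into paths, which are the entries of the sparse output.

  The program is written in a small loop language in which every loop, multiplication and division
  is cut off at one common bound \<open>N\<close>. A program then runs in time polynomial in \<open>N\<close> for
  syntactic reasons, and the sizes of numbers only matter for correctness.
\<close>

section \<open>Small integer solutions of linear systems\<close>

text \<open>What shapes the development is that one run must both decide and solve, on a machine
  that can only add and subtract. The vector in which the method ends has maximal support: it is
  positive in every coordinate that is positive in some nonnegative solution. So the sign of the
  homogenising coordinate decides, and if it is positive, the same vector with that coordinate as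
  common denominator is the flow to be decomposed; nothing is rounded. Tightness is what lets
  equations replace the inequalities of the LP. Denominators would multiply from row to row of the
  elimination, but an orthogonal projection is unique, so its reduced denominator depends on the
  scaled matrix alone. All sizes are measured by a number \<open>b\<close> above \<open>m\<close>,
  \<open>k\<close> and every total score: \<open>2 ^ (b ^ 14)\<close> covers the bound of Siegel's
  lemma for the unscaled matrix, \<open>2 ^ (b ^ 29)\<close> the numbers met in the elimination, and
  \<open>N = b ^ 64\<close> has room for their bit lengths, the perceptron steps, the phases and the
  array sizes at once. As \<open>N\<close> cuts off every loop, it must be known before compiled
  code can run, and is computed by repeated addition.\<close>

lemma siegel:
  fixes A :: "'r \<Rightarrow> 's \<Rightarrow> int" and M :: nat
  assumes fin: "finite Q" "finite S" and card: "card Q < card S"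
    and A: "\<And>r l. r \<in> Q \<Longrightarrow> l \<in> S \<Longrightarrow> \<bar>A r l\<bar> \<le> int M"
  shows "\<exists>h. (\<exists>l\<in>S. h l \<noteq> 0) \<and> (\<forall>l\<in>S. \<bar>h l\<bar> \<le> int ((2 * card S * M + 1) ^ card Q)) \<and>
     (\<forall>r\<in>Q. (\<Sum>l\<in>S. A r l * h l) = 0)"
proof -
  define c where "c = card S"
  define q where "q = card Q"
  \<comment> \<open>The side of the box is chosen so that
    \<open>(2 c M H + 1) ^ q \<le> ((2 c M + 1) H) ^ q = H ^ (q + 1)\<close>. This is less than
    \<open>(H + 1) ^ c\<close> because \<open>c \<ge> q + 1\<close>, so two points of the box have
    the same image.\<close>
  define H where "H = (2 * c * M + 1) ^ q"
  have H: "H \<ge> 1" by (simp add: H_def)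
  let ?D = "PiE S (\<lambda>_. {0..int H})"
  let ?E = "PiE Q (\<lambda>_. {- int (c * M * H)..int (c * M * H)})"
  let ?f = "\<lambda>h. restrict (\<lambda>r. \<Sum>l\<in>S. A r l * h l) Q"
  have "nat (int H + 1) = H + 1" by linarith
  then have cD: "card ?D = (H + 1) ^ c" using fin by (simp add: card_PiE c_def)
  have cE: "card ?E = (2 * c * M * H + 1) ^ q"
  proof -
    have "nat (int (c * M * H) + 1 + int (c * M * H)) = 2 * c * M * H + 1" by linarith
    then show ?thesis using fin by (simp add: card_PiE q_def add.commute add.left_commute del: of_nat_mult)
  qed
  have "(2 * c * M * H + 1) ^ q \<le> ((2 * c * M + 1) * H) ^ q"
    using H by (intro power_mono) (auto simp: algebra_simps)
  also have "\<dots> = H ^ Suc q" by (simp only: power_mult_distrib H_def[symmetric] power_Suc)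
  also have "\<dots> < (H + 1) ^ Suc q" by (intro power_strict_mono) auto
  also have "\<dots> \<le> (H + 1) ^ c" using card by (intro power_increasing) (auto simp: c_def q_def)
  finally have less: "card ?E < card ?D" by (simp only: cD cE)
  have sub: "?f ` ?D \<subseteq> ?E"
  proof clarify
    fix h assume h: "h \<in> ?D"
    show "?f h \<in> ?E"
    proof (intro restrict_PiE_iff[THEN iffD2] ballI)
      fix r assume r: "r \<in> Q"
      have "\<bar>\<Sum>l\<in>S. A r l * h l\<bar> \<le> (\<Sum>l\<in>S. \<bar>A r l * h l\<bar>)" by (rule sum_abs)
      also have "\<dots> \<le> (\<Sum>l\<in>S. int (M * H))"
      proof (rule sum_mono)
        fix l assume l: "l \<in> S"
        then have "\<bar>h l\<bar> \<le> int H" using PiE_mem[OF h l] by auto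
        then show "\<bar>A r l * h l\<bar> \<le> int (M * H)" using A[OF r l] by (auto simp: abs_mult intro!: mult_mono)
      qed
      also have "\<dots> = int (c * M * H)" by (simp add: c_def)
      finally show "(\<Sum>l\<in>S. A r l * h l) \<in> {- int (c * M * H)..int (c * M * H)}" by auto
    qed
  qed
  have "finite ?E" using fin by (intro finite_PiE) auto
  have "\<not> inj_on ?f ?D"
  proof
    assume "inj_on ?f ?D"
    then have "card ?D \<le> card ?E" using card_inj_on_le[OF _ sub \<open>finite ?E\<close>] by blast
    then show False using less by simp
  qed
  then obtain h h' where h: "h \<in> ?D" "h' \<in> ?D" "?f h = ?f h'" "h \<noteq> h'" unfolding inj_on_def by blast
  have "\<exists>l\<in>S. h l \<noteq> h' l"
    using h(1,2,4) by (metis PiE_ext)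
  moreover have "\<bar>h l - h' l\<bar> \<le> int H" if "l \<in> S" for l
    using PiE_mem[OF h(1) that] PiE_mem[OF h(2) that] by auto
  moreover have "(\<Sum>l\<in>S. A r l * (h l - h' l)) = 0" if "r \<in> Q" for r
    using fun_cong[OF h(3), of r] that by (simp add: right_diff_distrib sum_subtractf)
  ultimately show ?thesis
    by (intro exI[of _ "\<lambda>l. h l - h' l"]) (auto simp: H_def c_def q_def)
qed

definition kern :: "(nat \<Rightarrow> nat \<Rightarrow> int) \<Rightarrow> nat set \<Rightarrow> nat set \<Rightarrow> (nat \<Rightarrow> real) \<Rightarrow> bool" where
  "kern A Q S x \<longleftrightarrow> (\<forall>r\<in>Q. (\<Sum>l\<in>S. real_of_int (A r l) * x l) = 0)"

text \<open>The bound of Siegel's lemma for \<open>d\<close> equations in \<open>d + 1\<close>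
  unknowns with coefficients up to \<open>M\<close>.\<close>

definition siegel_bound :: "nat \<Rightarrow> nat \<Rightarrow> nat" where
  "siegel_bound d M = (2 * (d + 1) * M + 1) ^ d"

text \<open>A row set of least size with the same kernel is independent: a row with a nonzero
  coefficient in a dependency vanishes wherever the other rows do, so it could be dropped.\<close>

lemma independent_rows:
  assumes "finite Q"
  shows "\<exists>Q'\<subseteq>Q. (\<forall>x. kern A Q' S x \<longrightarrow> kern A Q S x) \<and>
    (\<forall>w :: nat \<Rightarrow> real. (\<forall>l\<in>S. (\<Sum>r\<in>Q'. w r * real_of_int (A r l)) = 0) \<longrightarrow> (\<forall>r\<in>Q'. w r = 0))"
proof -
  let ?P = "\<lambda>Q'. Q' \<subseteq> Q \<and> (\<forall>x. kern A Q' S x \<longrightarrow> kern A Q S x)"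
  have "?P Q" by simp
  then obtain Q' where Q': "?P Q'" "\<And>Q''. ?P Q'' \<Longrightarrow> card Q' \<le> card Q''"
    using ex_has_least_nat[of ?P Q card] by blast
  have fin: "finite Q'" using Q' assms finite_subset by blast
  show ?thesis
  proof (intro exI[of _ Q'] conjI allI impI ballI)
    show "Q' \<subseteq> Q" "kern A Q' S x \<Longrightarrow> kern A Q S x" for x using Q' by auto
    fix w :: "nat \<Rightarrow> real" and r
    assume w: "\<forall>l\<in>S. (\<Sum>r\<in>Q'. w r * real_of_int (A r l)) = 0" and r: "r \<in> Q'"
    show "w r = 0"
    proof (rule ccontr)
      assume nz: "w r \<noteq> 0"
      have "?P (Q' - {r})"
      proof (intro conjI allI impI)
        show "Q' - {r} \<subseteq> Q" using Q' by blast
        fix x assume x: "kern A (Q' - {r}) S x"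
        have "w r * (\<Sum>l\<in>S. real_of_int (A r l) * x l) = (\<Sum>s\<in>Q'. w s * (\<Sum>l\<in>S. real_of_int (A s l) * x l))"
          using x by (subst sum.remove[OF fin r]) (simp add: kern_def)
        also have "\<dots> = (\<Sum>l\<in>S. (\<Sum>s\<in>Q'. w s * real_of_int (A s l)) * x l)"
          by (simp add: sum_distrib_left sum_distrib_right mult.assoc) (rule sum.swap)
        also have "\<dots> = 0" using w by simp
        finally have "kern A Q' S x" using x nz by (auto simp: kern_def)
        then show "kern A Q S x" using Q' by blast
      qed
      then have "card Q' \<le> card (Q' - {r})" using Q' by blast
      then show False using card_Diff1_less[OF fin r] by simp
    qed
  qed
qed

text \<open>The system \<open>p + A\<^sup>T w = t e\<^sub>j\<close>, \<open>A p = 0\<close> with independent rows has one more unknown than equations,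
  so Siegel's lemma gives a small solution; \<open>t \<noteq> 0\<close> because otherwise \<open>p\<close> is orthogonal to itself. Thus
  \<open>p / t\<close> is the projection of \<open>e\<^sub>j\<close> onto the kernel.\<close>

lemma kernel_denominator:
  fixes A :: "nat \<Rightarrow> nat \<Rightarrow> int" and M :: nat
  assumes fin: "finite Q" "finite S" and j: "j \<in> S" and M: "1 \<le> M"
    and A: "\<And>r l. r \<in> Q \<Longrightarrow> l \<in> S \<Longrightarrow> \<bar>A r l\<bar> \<le> int M"
  shows "\<exists>p t. 1 \<le> t \<and> t \<le> int (siegel_bound (card S + card Q) M) \<and>
    (\<forall>r\<in>Q. (\<Sum>l\<in>S. A r l * p l) = 0) \<and>
    (\<forall>x. kern A Q S x \<longrightarrow> real_of_int t * x j = (\<Sum>l\<in>S. real_of_int (p l) * x l))"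
proof -
  obtain Q' where Q': "Q' \<subseteq> Q" "\<And>x. kern A Q' S x \<Longrightarrow> kern A Q S x"
    and ind: "\<And>w :: nat \<Rightarrow> real. \<forall>l\<in>S. (\<Sum>r\<in>Q'. w r * real_of_int (A r l)) = 0 \<Longrightarrow> \<forall>r\<in>Q'. w r = 0"
    using independent_rows[OF fin(1), of A S] by blast
  have fQ': "finite Q'" using Q'(1) fin finite_subset by blast
  have cQ': "card Q' \<le> card Q" using Q'(1) fin card_mono by blast
  \<comment> \<open>The two blocks of equations and the three blocks of unknowns are indexed by sums
    of types: equation \<open>Inl i\<close> is coordinate \<open>i\<close> of
    \<open>p + A^T w - t e_j = 0\<close>, equation \<open>Inr s\<close> is row \<open>s\<close> of
    \<open>A p = 0\<close>, and the unknowns are \<open>p\<close>, \<open>w\<close>,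
    \<open>t\<close> in this order. The coefficients 0, 1 and -1 are covered by
    \<open>1 \<le> M\<close>.\<close>
  define B :: "nat + nat \<Rightarrow> nat + nat + unit \<Rightarrow> int" where
    "B r l = (case r of Inl i \<Rightarrow> (case l of Inl i' \<Rightarrow> of_bool (i = i') | Inr (Inl s) \<Rightarrow> A s i | Inr (Inr _) \<Rightarrow> - of_bool (i = j))
       | Inr s \<Rightarrow> (case l of Inl i \<Rightarrow> A s i | _ \<Rightarrow> 0))" for r l
  let ?U = "S <+> (Q' <+> {()})"
  let ?V = "S <+> Q'"
  have bnd: "\<bar>B r l\<bar> \<le> int M" if "r \<in> ?V" "l \<in> ?U" for r l
    using that M A Q'(1) unfolding B_def by (auto split: sum.splits)
  have cU: "card ?U = card S + card Q' + 1" using fin fQ' by (simp add: card_Plus)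
  have cV: "card ?V = card S + card Q'" using fin fQ' by (simp add: card_Plus)
  obtain h where h: "\<exists>l\<in>?U. h l \<noteq> 0" "\<forall>l\<in>?U. \<bar>h l\<bar> \<le> int ((2 * card ?U * M + 1) ^ card ?V)"
    "\<forall>r\<in>?V. (\<Sum>l\<in>?U. B r l * h l) = 0"
    using siegel[of ?V ?U B M] bnd fin fQ' cU cV by (auto simp del: Plus_def)
  have sU: "(\<Sum>l\<in>?U. g l) = (\<Sum>l\<in>S. g (Inl l)) + ((\<Sum>r\<in>Q'. g (Inr (Inl r))) + g (Inr (Inr ())))"
    for g :: "nat + nat + unit \<Rightarrow> int"
    using fin fQ' by (simp add: sum.Plus)
  define \<tau> where "\<tau> = h (Inr (Inr ()))"
  define p where "p l = h (Inl l)" for l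
  define w where "w r = h (Inr (Inl r))" for r
  have e1: "p l + (\<Sum>r\<in>Q'. A r l * w r) = of_bool (l = j) * \<tau>" if "l \<in> S" for l
  proof -
    have "(\<Sum>l'\<in>?U. B (Inl l) l' * h l') = 0" using h(3) that by blast
    then have "(\<Sum>l'\<in>S. of_bool (l = l') * p l') + ((\<Sum>r\<in>Q'. A r l * w r) - of_bool (l = j) * \<tau>) = 0"
      unfolding sU by (simp add: B_def p_def w_def \<tau>_def)
    moreover have "(\<Sum>l'\<in>S. of_bool (l = l') * p l') = p l"
      using fin that by (simp add: sum.remove[of S l] of_bool_def sum.neutral)
    ultimately show ?thesis by simp
  qed
  have e2: "(\<Sum>l\<in>S. A r l * p l) = 0" if "r \<in> Q'" for r
  proof -
    have "(\<Sum>l'\<in>?U. B (Inr r) l' * h l') = 0" using h(3) that by blast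
    then show ?thesis unfolding sU by (simp add: B_def p_def)
  qed
  have e3: "kern A Q S (\<lambda>l. real_of_int (p l))"
  proof (rule Q'(2))
    show "kern A Q' S (\<lambda>l. real_of_int (p l))" unfolding kern_def
    proof
      fix r assume "r \<in> Q'"
      then have "real_of_int (\<Sum>l\<in>S. A r l * p l) = 0" using e2 by simp
      then show "(\<Sum>l\<in>S. real_of_int (A r l) * real_of_int (p l)) = 0" by simp
    qed
  qed
  have e4: "real_of_int \<tau> * x j = (\<Sum>l\<in>S. real_of_int (p l) * x l)" if x: "kern A Q S x" for x
  proof -
    have "(\<Sum>l\<in>S. real_of_int (p l + (\<Sum>r\<in>Q'. A r l * w r)) * x l) = (\<Sum>l\<in>S. real_of_int (of_bool (l = j) * \<tau>) * x l)"
      using e1 by (intro sum.cong) auto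
    also have "\<dots> = real_of_int \<tau> * x j"
      using fin j by (subst sum.remove[OF fin(2) j]) (simp add: sum.neutral)
    finally have "real_of_int \<tau> * x j = (\<Sum>l\<in>S. real_of_int (p l) * x l) + (\<Sum>l\<in>S. (\<Sum>r\<in>Q'. real_of_int (A r l) * real_of_int (w r)) * x l)"
      by (simp add: algebra_simps sum.distrib)
    also have "(\<Sum>l\<in>S. (\<Sum>r\<in>Q'. real_of_int (A r l) * real_of_int (w r)) * x l) = (\<Sum>r\<in>Q'. real_of_int (w r) * (\<Sum>l\<in>S. real_of_int (A r l) * x l))"
      unfolding sum_distrib_left sum_distrib_right by (subst sum.swap) (simp add: algebra_simps)
    also have "\<dots> = 0" using x Q'(1) by (intro sum.neutral) (auto simp: kern_def)
    finally show ?thesis by simp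
  qed
  have nz: "\<tau> \<noteq> 0"
  proof
    assume t0: "\<tau> = 0"
    have "(\<Sum>l\<in>S. real_of_int (p l) * real_of_int (p l)) = 0" using e4[OF e3] t0 by simp
    then have "\<forall>l\<in>S. real_of_int (p l) * real_of_int (p l) = 0"
      using fin by (subst (asm) sum_nonneg_eq_0_iff) auto
    then have p0: "p l = 0" if "l \<in> S" for l using that by auto
    have "w r = 0" if r: "r \<in> Q'" for r
    proof -
      have "\<forall>r\<in>Q'. real_of_int (w r) = 0"
      proof (rule ind, rule ballI)
        fix l assume "l \<in> S"
        then have "(\<Sum>r\<in>Q'. A r l * w r) = 0" using e1 p0 t0 by simp
        then have "real_of_int (\<Sum>r\<in>Q'. A r l * w r) = 0" by simp
        then show "(\<Sum>r\<in>Q'. real_of_int (w r) * real_of_int (A r l)) = 0" by (simp add: mult.commute)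
      qed
      then show ?thesis using r by simp
    qed
    then show False using h(1) p0 t0 by (auto simp: p_def w_def \<tau>_def)
  qed
  have b: "\<bar>\<tau>\<bar> \<le> int (siegel_bound (card S + card Q) M)"
  proof -
    have "\<bar>\<tau>\<bar> \<le> int ((2 * card ?U * M + 1) ^ card ?V)" using h(2) by (auto simp: \<tau>_def)
    also have "(2 * card ?U * M + 1) ^ card ?V \<le> (2 * (card S + card Q + 1) * M + 1) ^ card ?V"
      unfolding cU using cQ' by (intro power_mono add_mono mult_mono) auto
    also have "\<dots> \<le> siegel_bound (card S + card Q) M"
      unfolding siegel_bound_def cV using cQ' M by (intro power_increasing) auto
    finally show ?thesis by simp
  qed
  have e5: "(\<Sum>l\<in>S. A r l * p l) = 0" if "r \<in> Q" for r
  proof -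
    have "real_of_int (\<Sum>l\<in>S. A r l * p l) = 0" using e3 that by (simp add: kern_def)
    then show ?thesis by (simp only: of_int_eq_0_iff)
  qed
  \<comment> \<open>Siegel's lemma leaves the sign of \<open>\<tau>\<close> open, so
    \<open>p\<close> and \<open>\<tau>\<close> are both multiplied by it.\<close>
  show ?thesis
  proof (intro exI[of _ "\<bar>\<tau>\<bar>"] exI[of _ "\<lambda>l. sgn \<tau> * p l"] conjI ballI allI impI)
    show "1 \<le> \<bar>\<tau>\<bar>" "\<bar>\<tau>\<bar> \<le> int (siegel_bound (card S + card Q) M)" using nz b by auto
    show "(\<Sum>l\<in>S. A r l * (sgn \<tau> * p l)) = 0" if "r \<in> Q" for r
      using e5[OF that] by (simp add: mult.left_commute[of _ "sgn \<tau>"] flip: sum_distrib_left)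
    show "real_of_int \<bar>\<tau>\<bar> * x j = (\<Sum>l\<in>S. real_of_int (sgn \<tau> * p l) * x l)" if "kern A Q S x" for x
    proof -
      have "real_of_int \<bar>\<tau>\<bar> * x j = real_of_int (sgn \<tau>) * (real_of_int \<tau> * x j)"
        by (metis abs_sgn mult.assoc mult.commute of_int_mult)
      also have "\<dots> = (\<Sum>l\<in>S. real_of_int (sgn \<tau> * p l) * x l)"
        unfolding e4[OF that] by (simp add: sum_distrib_left mult.assoc)
      finally show ?thesis .
    qed
  qed
qed

lemma kern_lincomb: "kern A Q S x \<Longrightarrow> kern A Q S y \<Longrightarrow> kern A Q S (\<lambda>l. a * x l + b * y l)"
proof -
  assume x: "kern A Q S x" and y: "kern A Q S y"
  have "(\<Sum>l\<in>S. real_of_int (A r l) * (a * x l + b * y l)) =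
    a * (\<Sum>l\<in>S. real_of_int (A r l) * x l) + b * (\<Sum>l\<in>S. real_of_int (A r l) * y l)" for r
    by (simp add: sum_distrib_left sum.distrib algebra_simps)
  then show ?thesis using x y by (simp add: kern_def)
qed

text \<open>A solution with \<open>x j > 0\<close> of minimal support spans the kernel on its support, so it is
  proportional to the integer vector of the previous lemma.\<close>

lemma basic_solution:
  fixes A :: "nat \<Rightarrow> nat \<Rightarrow> int" and M :: nat
  assumes fin: "finite Q" "finite S" and M: "1 \<le> M"
    and A: "\<And>r l. r \<in> Q \<Longrightarrow> l \<in> S \<Longrightarrow> \<bar>A r l\<bar> \<le> int M"
    and x: "kern A Q S x" "\<And>l. l \<in> S \<Longrightarrow> 0 \<le> x l" and j: "j \<in> S" "0 < x j"
  obtains y where "kern A Q S y" "\<And>l. 0 \<le> y l" "\<And>l. y l \<le> 1" "1 \<le> y j * real (siegel_bound (card S + card Q) M)"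
proof -
  let ?P = "\<lambda>y. kern A Q S y \<and> (\<forall>l\<in>S. 0 \<le> y l) \<and> 0 < y j"
  let ?supp = "\<lambda>y. {l\<in>S. 0 < y l}"
  obtain y where y: "?P y" and min: "\<And>y'. ?P y' \<Longrightarrow> card (?supp y) \<le> card (?supp y')"
    using ex_has_least_nat[of ?P x "\<lambda>y. card (?supp y)"] x j by blast
  define S' where "S' = ?supp y"
  have S': "finite S'" "S' \<subseteq> S" "j \<in> S'" using fin y j by (auto simp: S'_def)
  have sub: "(\<Sum>l\<in>S. f l) = (\<Sum>l\<in>S'. f l)" if "\<And>l. l \<in> S \<Longrightarrow> l \<notin> S' \<Longrightarrow> f l = 0" for f :: "nat \<Rightarrow> real"
    using that S' fin by (intro sum.mono_neutral_right) auto
  have ext: "kern A Q S u \<longleftrightarrow> kern A Q S' u" if "\<And>l. l \<in> S \<Longrightarrow> l \<notin> S' \<Longrightarrow> u l = 0" for u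
    unfolding kern_def using sub[of "\<lambda>l. real_of_int (A r l) * u l" for r] that by simp
  have yz: "y l = 0" if "l \<in> S" "l \<notin> S'" for l using that y by (force simp: S'_def)
  \<comment> \<open>The ratio test of the simplex method: subtracting from \<open>y\<close> the
    largest multiple of \<open>u\<close> that keeps it nonnegative empties a coordinate and leaves
    \<open>y j\<close> as it is, against the minimality of the support.\<close>
  have noup: "\<not> 0 < u l0" if u: "kern A Q S' u" "u j = 0" "l0 \<in> S'" for u l0
  proof
    assume pos: "0 < u l0"
    define T where "T = {l\<in>S'. 0 < u l}"
    have T: "finite T" "T \<noteq> {}" using S' u(3) pos by (auto simp: T_def)
    have "Min ((\<lambda>l. y l / u l) ` T) \<in> (\<lambda>l. y l / u l) ` T" using T by (intro Min_in) auto
    then obtain l1 where l1': "l1 \<in> T" "Min ((\<lambda>l. y l / u l) ` T) = y l1 / u l1" by blast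
    have l1: "l1 \<in> T" "\<And>l. l \<in> T \<Longrightarrow> y l1 / u l1 \<le> y l / u l"
      using l1' T(1) by (auto simp flip: l1'(2))
    define c where "c = y l1 / u l1"
    define u' where "u' l = (if l \<in> S' then u l else 0)" for l
    have ku: "kern A Q S u'" using u(1) ext[of u'] by (simp add: u'_def kern_def)
    define w where "w l = 1 * y l + (- c) * u' l" for l
    have kw: "kern A Q S w" unfolding w_def[abs_def] using y ku by (intro kern_lincomb) auto
    have c0: "0 \<le> c" using l1(1) y S' by (auto simp: c_def T_def)
    have nn: "0 \<le> w l" if "l \<in> S" for l
    proof (cases "l \<in> T")
      case True
      then have "c * u l \<le> y l" using l1(2)[OF True] by (simp add: c_def T_def field_simps)
      then show ?thesis using True by (simp add: w_def u'_def T_def)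
    next
      case False
      then have "u' l \<le> 0" by (auto simp: u'_def T_def)
      then have "c * u' l \<le> 0" using c0 by (simp add: mult_nonneg_nonpos)
      then show ?thesis using y that by (auto simp: w_def)
    qed
    have "w j = y j" using u(2) S' by (simp add: w_def u'_def)
    then have Pw: "?P w" using kw nn y by auto
    have "?supp w \<subset> S'"
    proof
      show "?supp w \<subseteq> S'"
      proof
        fix l assume "l \<in> ?supp w"
        then have "l \<in> S" "0 < w l" by auto
        then show "l \<in> S'" using yz[of l] by (cases "l \<in> S'") (auto simp: w_def u'_def)
      qed
      have "w l1 = 0" using l1(1) by (simp add: w_def u'_def c_def T_def)
      then show "?supp w \<noteq> S'" using l1(1) by (auto simp: T_def)
    qed
    then have "card (?supp w) < card S'" using S'(1) by (rule psubset_card_mono[rotated])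
    then show False using min[OF Pw] by (simp add: S'_def)
  qed
  obtain p t where p: "1 \<le> t" "t \<le> int (siegel_bound (card S' + card Q) M)"
    "\<And>r. r \<in> Q \<Longrightarrow> (\<Sum>l\<in>S'. A r l * p l) = 0"
    "\<And>x. kern A Q S' x \<Longrightarrow> real_of_int t * x j = (\<Sum>l\<in>S'. real_of_int (p l) * x l)"
    using kernel_denominator[OF fin(1) S'(1,3) M, of A] A S'(2) by blast
  have kp: "kern A Q S' (\<lambda>l. real_of_int (p l))"
    unfolding kern_def
  proof
    fix r assume "r \<in> Q"
    then have "real_of_int (\<Sum>l\<in>S'. A r l * p l) = 0" using p(3) by simp
    then show "(\<Sum>l\<in>S'. real_of_int (A r l) * real_of_int (p l)) = 0" by simp
  qed
  have ky: "kern A Q S' y" using y ext yz by blast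
  define \<mu> where "\<mu> = p j / y j"
  have yj: "0 < y j" using y by blast
  \<comment> \<open>The vector \<open>p - \<mu> y\<close> vanishes at \<open>j\<close>. Excluding
    positive entries both for it and for its negative makes it zero on the support.\<close>
  have pr: "real_of_int (p l) = \<mu> * y l" if l: "l \<in> S'" for l
  proof -
    have "kern A Q S' (\<lambda>l. 1 * real_of_int (p l) + (- \<mu>) * y l)" by (intro kern_lincomb kp ky)
    from noup[OF this _ l] yj have a: "\<not> 0 < 1 * real_of_int (p l) + (- \<mu>) * y l" by (simp add: \<mu>_def)
    have "kern A Q S' (\<lambda>l. (-1) * real_of_int (p l) + \<mu> * y l)" by (intro kern_lincomb kp ky)
    from noup[OF this _ l] yj have b: "\<not> 0 < (-1) * real_of_int (p l) + \<mu> * y l" by (simp add: \<mu>_def)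
    from a b show ?thesis by simp
  qed
  have "real_of_int t * y j = \<mu> * (\<Sum>l\<in>S'. y l * y l)"
    unfolding p(4)[OF ky] by (simp add: pr sum_distrib_left mult.assoc)
  moreover have "0 < real_of_int t * y j" using p(1) yj by simp
  moreover have "0 \<le> (\<Sum>l\<in>S'. y l * y l)" by (intro sum_nonneg) auto
  ultimately have mu: "0 < \<mu>" by (simp add: zero_less_mult_iff)
  have pp: "1 \<le> p l" if "l \<in> S'" for l
  proof -
    have "0 < real_of_int (p l)" using pr[OF that] mu that by (simp add: S'_def)
    then show ?thesis by linarith
  qed
  \<comment> \<open>For \<open>p\<close> itself the defining identity reads
    \<open>t * p j = p . p\<close>, so each \<open>p i * p i\<close> is at most
    \<open>t * p j\<close>. Taking \<open>i = j\<close> gives \<open>p j \<le> t\<close>, and then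
    every entry is at most \<open>t\<close>.\<close>
  have pt: "p l \<le> t" if "l \<in> S'" for l
  proof -
    have le: "p i * p i \<le> t * p j" if "i \<in> S'" for i
    proof -
      have "real_of_int (p i * p i) \<le> (\<Sum>l\<in>S'. real_of_int (p l) * real_of_int (p l))"
        using member_le_sum[OF that, of "\<lambda>l. real_of_int (p l) * real_of_int (p l)"] S' by simp
      also have "\<dots> = real_of_int (t * p j)" using p(4)[OF kp] by simp
      finally show ?thesis by (simp only: of_int_le_iff)
    qed
    have "p j \<le> t" using le[OF S'(3)] pp[OF S'(3)] by simp
    then have "t * p j \<le> t * t" using p(1) by simp
    then have "p l * p l \<le> t * t" using le[OF that] by simp
    then show ?thesis using p(1) pp[OF that] by (simp add: power2_eq_square[symmetric] power2_le_iff_abs_le)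
  qed
  define z where "z l = (if l \<in> S' then p l / t else 0)" for l
  have kz: "kern A Q S z"
  proof (subst ext)
    show "z l = 0" if "l \<notin> S'" for l using that by (simp add: z_def)
    have "kern A Q S' (\<lambda>l. (1 / t) * real_of_int (p l) + 0 * real_of_int (p l))" by (intro kern_lincomb kp)
    then show "kern A Q S' z" by (simp add: kern_def z_def)
  qed
  show thesis
  proof (rule that[OF kz])
    show "0 \<le> z l" for l using pp[of l] p(1) by (auto simp: z_def)
    show "z l \<le> 1" for l using pt[of l] p(1) by (auto simp: z_def)
    have "t \<le> int (siegel_bound (card S + card Q) M)"
    proof -
      have "siegel_bound (card S' + card Q) M \<le> siegel_bound (card S + card Q) M"
      proof -
        have c: "card S' \<le> card S" using S' fin by (simp add: card_mono)
        have "(2 * (card S' + card Q + 1) * M + 1) ^ (card S' + card Q) \<le> (2 * (card S + card Q + 1) * M + 1) ^ (card S' + card Q)"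
          using c by (intro power_mono add_mono mult_mono) auto
        also have "\<dots> \<le> (2 * (card S + card Q + 1) * M + 1) ^ (card S + card Q)"
          using c by (intro power_increasing) auto
        finally show ?thesis by (simp add: siegel_bound_def)
      qed
      then show ?thesis using p(2) by linarith
    qed
    then have "real_of_int t \<le> real (siegel_bound (card S + card Q) M)" by linarith
    moreover have "real_of_int t * 1 \<le> real (siegel_bound (card S + card Q) M) * p j"
      using calculation pp[OF S'(3)] by (intro mult_mono) auto
    ultimately show "1 \<le> z j * real (siegel_bound (card S + card Q) M)"
      using p(1) S'(3) by (simp add: z_def field_simps)
  qed
qed

section \<open>Integer multiples of the projection onto the kernel\<close>

text \<open>\<open>G / q\<close> is the orthogonal projection onto the vectors supported on \<open>S\<close> that the rows in \<open>Q\<close> annihilate.\<close>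

definition is_proj :: "(nat \<Rightarrow> nat \<Rightarrow> int) \<Rightarrow> nat set \<Rightarrow> nat set \<Rightarrow> (nat \<Rightarrow> nat \<Rightarrow> int) \<Rightarrow> int \<Rightarrow> bool" where
  "is_proj A Q S G q \<longleftrightarrow> 0 < q \<and> (\<forall>i j. G i j = G j i) \<and> (\<forall>i j. i \<notin> S \<longrightarrow> G i j = 0) \<and>
     (\<forall>r\<in>Q. \<forall>j. (\<Sum>l\<in>S. A r l * G l j) = 0) \<and>
     (\<forall>x. kern A Q S x \<longrightarrow> (\<forall>j\<in>S. (\<Sum>l\<in>S. real_of_int (G j l) * x l) = real_of_int q * x j))"

lemma is_projD:
  assumes "is_proj A Q S G q"
  shows "0 < q" "G i j = G j i" "i \<notin> S \<Longrightarrow> G i j = 0" "j \<notin> S \<Longrightarrow> G i j = 0"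
    "r \<in> Q \<Longrightarrow> (\<Sum>l\<in>S. A r l * G l j) = 0"
    "kern A Q S x \<Longrightarrow> j \<in> S \<Longrightarrow> (\<Sum>l\<in>S. real_of_int (G j l) * x l) = real_of_int q * x j"
proof -
  show "0 < q" "i \<notin> S \<Longrightarrow> G i j = 0" 
    "r \<in> Q \<Longrightarrow> (\<Sum>l\<in>S. A r l * G l j) = 0"
    "kern A Q S x \<Longrightarrow> j \<in> S \<Longrightarrow> (\<Sum>l\<in>S. real_of_int (G j l) * x l) = real_of_int q * x j"
    using assms unfolding is_proj_def by blast+
  show s: "G i j = G j i" for i j using assms unfolding is_proj_def by blast
  show "j \<notin> S \<Longrightarrow> G i j = 0" using assms s[of i j] unfolding is_proj_def by metis
qed

lemma is_proj_int:
  assumes P: "is_proj A Q S G q" and x: "\<And>r. r \<in> Q \<Longrightarrow> (\<Sum>l\<in>S. A r l * x l) = 0" and j: "j \<in> S"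
  shows "(\<Sum>l\<in>S. G j l * x l) = q * x j"
proof -
  have "kern A Q S (\<lambda>l. real_of_int (x l))"
    unfolding kern_def
  proof
    fix r assume "r \<in> Q"
    then have "real_of_int (\<Sum>l\<in>S. A r l * x l) = 0" using x by simp
    then show "(\<Sum>l\<in>S. real_of_int (A r l) * real_of_int (x l)) = 0" by simp
  qed
  from is_projD(6)[OF P this j] have "real_of_int (\<Sum>l\<in>S. G j l * x l) = real_of_int (q * x j)" by simp
  then show ?thesis by (simp only: of_int_eq_iff)
qed

lemma is_proj_empty:
  assumes "finite S" shows "is_proj A {} S (\<lambda>i j. of_bool (i = j \<and> i \<in> S)) 1"
  using assms by (auto simp: is_proj_def sum.remove[of S] sum.neutral)

text \<open>Idempotence \<open>P P = P\<close> of \<open>P = G / q\<close>: the columns of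
  \<open>G\<close> lie in the kernel, on which \<open>G\<close> multiplies by
  \<open>q\<close>.\<close>

lemma is_proj_square: 
  assumes "is_proj A Q S G q" shows "(\<Sum>l\<in>S. G i l * G l j) = q * G i j"
proof (cases "i \<in> S")
  case True
  then show ?thesis using is_proj_int[OF assms, of "\<lambda>l. G l j" i] is_projD(5)[OF assms] by simp
next
  case False
  then show ?thesis using is_projD(3)[OF assms] by simp
qed

text \<open>By idempotence column \<open>j\<close> has squared length \<open>q * G j j\<close>. This
  bounds first the diagonal entry and then the rest of the column.\<close>

lemma is_proj_le:
  assumes "is_proj A Q S G q" "finite S" shows "\<bar>G i j\<bar> \<le> q"
proof -
  have *: "G i j * G i j \<le> q * G j j" if "i \<in> S" for i
  proof -
    have "G i j * G i j \<le> (\<Sum>l\<in>S. G l j * G l j)"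
      using member_le_sum[OF that, of "\<lambda>l. G l j * G l j"] assms(2) by simp
    also have "\<dots> = (\<Sum>l\<in>S. G j l * G l j)" using is_projD(2)[OF assms(1)] by metis
    finally show ?thesis unfolding is_proj_square[OF assms(1)] .
  qed
  have q: "0 < q" using is_projD(1)[OF assms(1)] .
  show ?thesis
  proof (cases "i \<in> S \<and> j \<in> S")
    case True
    have "G j j * G j j \<le> q * G j j" using *[of j] True by simp
    then have "G j j \<le> q" using q by (cases "G j j > 0") auto
    then have "q * G j j \<le> q * q" using q by simp
    then have "G i j * G i j \<le> q * q" using *[of i] True by simp
    then show ?thesis using q abs_le_square_iff[of "G i j" q] by (simp add: power2_eq_square)
  next
    case False
    then show ?thesis using is_projD(3,4)[OF assms(1)] q by auto
  qed
qed

text \<open>Here \<open>u\<close> is \<open>q\<close> times the projection of row \<open>r\<close>,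
  and \<open>|u|^2 = q * b\<close>. If \<open>b = 0\<close>, the row already vanishes on the kernel.
  Otherwise the direction \<open>u\<close> is removed: \<open>G / q - u u^T / |u|^2\<close>, written
  over the denominator \<open>b * q\<close>.\<close>

lemma is_proj_step:
  assumes P: "is_proj A Q S G q" and fin: "finite S"
    and u: "\<And>j. u j = (\<Sum>l\<in>S. A r l * G l j)" and b: "b = (\<Sum>j\<in>S. A r j * u j)"
  shows "0 \<le> b" "b = 0 \<Longrightarrow> is_proj A (insert r Q) S G q"
    "0 < b \<Longrightarrow> is_proj A (insert r Q) S (\<lambda>i j. b * G i j - u i * u j) (b * q)"
proof -
  note q = is_projD(1)[OF P]
  have ku: "(\<Sum>l\<in>S. A s l * u l) = 0" if "s \<in> Q" for s
  proof -
    have "(\<Sum>l\<in>S. A s l * u l) = (\<Sum>l'\<in>S. A r l' * (\<Sum>l\<in>S. A s l * G l l'))"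
      unfolding u sum_distrib_left by (subst sum.swap) (simp add: algebra_simps is_projD(2)[OF P])
    then show ?thesis using is_projD(5)[OF P that] by simp
  qed
  have uu: "(\<Sum>j\<in>S. u j * u j) = q * b"
  proof -
    have "(\<Sum>j\<in>S. u j * u j) = (\<Sum>l\<in>S. A r l * (\<Sum>j\<in>S. G l j * u j))"
      unfolding sum_distrib_left by (subst sum.swap) (simp add: u sum_distrib_right mult.assoc)
    also have "\<dots> = q * b"
      using is_proj_int[OF P ku] by (simp add: b sum_distrib_left mult.left_commute)
    finally show ?thesis .
  qed
  have "0 \<le> q * b" unfolding uu[symmetric] by (intro sum_nonneg) auto
  then show "0 \<le> b" using q by (simp add: zero_le_mult_iff)
  have u0: "u i = 0" if "i \<notin> S" for i using is_projD(4)[OF P that] by (simp add: u)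
  { assume "b = 0"
    then have "\<forall>j\<in>S. u j * u j = 0" using uu fin by (subst sum_nonneg_eq_0_iff[symmetric]) auto
    then have "u j = 0" for j using u0 by (cases "j \<in> S") auto
    then show "is_proj A (insert r Q) S G q" using P u unfolding is_proj_def kern_def by auto }
  { assume b0: "0 < b"
    show "is_proj A (insert r Q) S (\<lambda>i j. b * G i j - u i * u j) (b * q)"
      unfolding is_proj_def
    proof (intro conjI allI impI ballI)
      show "0 < b * q" using b0 q by simp
      show "b * G i j - u i * u j = b * G j i - u j * u i" for i j using is_projD(2)[OF P, of i j] by simp
      show "b * G i j - u i * u j = 0" if "i \<notin> S" for i j using u0 is_projD(3)[OF P] that by simp
      show "(\<Sum>l\<in>S. A s l * (b * G l j - u l * u j)) = 0" if s: "s \<in> insert r Q" for s j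
      proof -
        have "(\<Sum>l\<in>S. A s l * (b * G l j - u l * u j)) = b * (\<Sum>l\<in>S. A s l * G l j) - (\<Sum>l\<in>S. A s l * u l) * u j"
          by (simp add: sum_distrib_left sum_distrib_right sum_subtractf algebra_simps)
        then show ?thesis using s ku is_projD(5)[OF P] b u[of j] by auto
      qed
      fix x j assume x: "kern A (insert r Q) S x" and j: "j \<in> S"
      have kx: "kern A Q S x" and rx: "(\<Sum>l\<in>S. real_of_int (A r l) * x l) = 0" using x by (auto simp: kern_def)
      have ux: "(\<Sum>l\<in>S. real_of_int (u l) * x l) = 0"
      proof -
        have "(\<Sum>l\<in>S. real_of_int (u l) * x l) = (\<Sum>l'\<in>S. real_of_int (A r l') * (\<Sum>l\<in>S. real_of_int (G l' l) * x l))"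
          unfolding sum_distrib_left by (subst sum.swap) (simp add: u sum_distrib_right mult.assoc)
        also have "\<dots> = q * (\<Sum>l\<in>S. real_of_int (A r l) * x l)"
          using is_projD(6)[OF P kx] by (simp add: sum_distrib_left mult.left_commute)
        finally show ?thesis using rx by simp
      qed
      have "(\<Sum>l\<in>S. real_of_int (b * G j l - u j * u l) * x l) =
        real_of_int b * (\<Sum>l\<in>S. real_of_int (G j l) * x l) - real_of_int (u j) * (\<Sum>l\<in>S. real_of_int (u l) * x l)"
        by (simp add: sum_distrib_left sum_subtractf algebra_simps)
      then show "(\<Sum>l\<in>S. real_of_int (b * G j l - u j * u l) * x l) = real_of_int (b * q) * x j"
        using ux is_projD(6)[OF P kx j] by simp
    qed }
qed

lemma is_proj_reduce:
  assumes P: "is_proj A Q S G q" and g: "0 < g" "g dvd q" "\<And>i j. g dvd G i j"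
  shows "is_proj A Q S (\<lambda>i j. G i j div g) (q div g)"
proof -
  define G' where "G' i j = G i j div g" for i j
  define q' where "q' = q div g"
  have G: "G i j = g * G' i j" for i j using g(3) by (simp add: G'_def)
  have q: "q = g * q'" using g by (simp add: q'_def)
  show ?thesis
    unfolding is_proj_def
  proof (fold G'_def q'_def, intro conjI allI impI ballI)
    show "0 < q'" using is_projD(1)[OF P] g(1) q by (simp add: zero_less_mult_iff)
    show "G' i j = G' j i" for i j by (simp add: G'_def is_projD(2)[OF P, of i j])
    show "G' i j = 0" if "i \<notin> S" for i j using is_projD(3)[OF P that] by (simp add: G'_def)
    show "(\<Sum>l\<in>S. A r l * G' l j) = 0" if "r \<in> Q" for r j
    proof -
      have "g * (\<Sum>l\<in>S. A r l * G' l j) = 0"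
        using is_projD(5)[OF P that, of j] by (simp add: G sum_distrib_left mult.left_commute)
      then show ?thesis using g by simp
    qed
    fix x j assume x: "kern A Q S x" and j: "j \<in> S"
    have "real_of_int g * (\<Sum>l\<in>S. real_of_int (G' j l) * x l) = real_of_int g * (real_of_int q' * x j)"
      using is_projD(6)[OF P x j] by (simp add: G q sum_distrib_left mult.assoc)
    then show "(\<Sum>l\<in>S. real_of_int (G' j l) * x l) = real_of_int q' * x j" using g by simp
  qed
qed

text \<open>For each \<open>j\<close> some small \<open>t j\<close> makes \<open>t j\<close> times
  row \<open>j\<close> of \<open>G / q\<close> integral, so the product \<open>T\<close> of all
  \<open>t j\<close> clears every denominator. Thus \<open>q\<close> divides \<open>T * q\<close>
  and all \<open>T * G i j\<close>, hence their gcd, which is \<open>T\<close> when \<open>G\<close>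
  and \<open>q\<close> are reduced.\<close>

lemma is_proj_denominator:
  assumes P: "is_proj A Q S G q" and fin: "finite Q" "finite S" and M: "1 \<le> M"
    and A: "\<And>r l. r \<in> Q \<Longrightarrow> l \<in> S \<Longrightarrow> \<bar>A r l\<bar> \<le> int M"
    and red: "Gcd (insert q {G i j | i j. True}) = 1"
  shows "q \<le> int (siegel_bound (card S + card Q) M ^ card S)"
proof -
  let ?H = "siegel_bound (card S + card Q) M"
  have "\<forall>j\<in>S. \<exists>t p. 1 \<le> t \<and> t \<le> int ?H \<and> (\<forall>r\<in>Q. (\<Sum>l\<in>S. A r l * p l) = 0) \<and>
    (\<forall>x. kern A Q S x \<longrightarrow> real_of_int t * x j = (\<Sum>l\<in>S. real_of_int (p l) * x l))"
  proof
    fix j assume j: "j \<in> S"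
    show "\<exists>t p. 1 \<le> t \<and> t \<le> int ?H \<and> (\<forall>r\<in>Q. (\<Sum>l\<in>S. A r l * p l) = 0) \<and>
    (\<forall>x. kern A Q S x \<longrightarrow> real_of_int t * x j = (\<Sum>l\<in>S. real_of_int (p l) * x l))"
      using kernel_denominator[of Q S j M A, OF fin j M A] by (subst ex_comm) simp
  qed
  then obtain t p where tp: "\<And>j. j \<in> S \<Longrightarrow> 1 \<le> t j \<and> t j \<le> int ?H \<and> (\<forall>r\<in>Q. (\<Sum>l\<in>S. A r l * p j l) = 0) \<and>
    (\<forall>x. kern A Q S x \<longrightarrow> real_of_int (t j) * x j = (\<Sum>l\<in>S. real_of_int (p j l) * x l))"
    unfolding bchoice_iff by blast
  define T where "T = (\<Prod>j\<in>S. t j)"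
  have T: "1 \<le> T" using tp by (auto simp: T_def intro!: prod_ge_1)
  have dv: "q dvd T * G i j" for i j
  proof (cases "i \<in> S \<and> j \<in> S")
    case True
    have kG: "kern A Q S (\<lambda>l. real_of_int (G l j))"
      unfolding kern_def
    proof
      fix r assume "r \<in> Q"
      then have "real_of_int (\<Sum>l\<in>S. A r l * G l j) = 0" using is_projD(5)[OF P] by simp
      then show "(\<Sum>l\<in>S. real_of_int (A r l) * real_of_int (G l j)) = 0" by simp
    qed
    have "real_of_int (t i) * real_of_int (G i j) = (\<Sum>l\<in>S. real_of_int (p i l) * real_of_int (G l j))"
      using tp kG True by blast
    then have "real_of_int (t i * G i j) = real_of_int (\<Sum>l\<in>S. p i l * G l j)" by simp
    then have "t i * G i j = (\<Sum>l\<in>S. p i l * G l j)" by (simp only: of_int_eq_iff)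
    also have "\<dots> = (\<Sum>l\<in>S. G j l * p i l)" using is_projD(2)[OF P] by (simp add: mult.commute)
    also have "\<dots> = q * p i j" using is_proj_int[OF P, of "p i" j] tp True by blast
    finally have "q dvd t i * G i j" by simp
    moreover have "t i dvd T" unfolding T_def using True fin by (simp add: dvd_prodI)
    ultimately show ?thesis by (meson dvd_trans mult_dvd_mono dvd_refl)
  next
    case False
    then show ?thesis using is_projD(3,4)[OF P] by auto
  qed
  have "q dvd Gcd ((*) T ` insert q {G i j | i j. True})"
    using dv by (intro Gcd_greatest) auto
  also have "\<dots> = T" unfolding Gcd_mult red using T by simp
  finally have "q \<le> T" using T by (simp add: zdvd_imp_le)
  also have "T \<le> (\<Prod>j\<in>S. int ?H)" unfolding T_def using tp by (intro prod_mono) force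
  also have "\<dots> = int (?H ^ card S)" by simp
  finally show ?thesis .
qed

section \<open>The perceptron phase\<close>

text \<open>Raising \<open>y k\<close> by one adds column \<open>k\<close> of \<open>G\<close> to
  \<open>z\<close>, and idempotence gives \<open>|z'|^2 = |z|^2 + 2 q z k + q G k k\<close>. The
  middle term is not positive by the choice of \<open>k\<close>, the last is at most
  \<open>q * q\<close>.\<close>

lemma perceptron_step:
  assumes P: "is_proj A Q S G q" and fin: "finite S"
    and z: "\<And>i. z i = (\<Sum>l\<in>S. y l * G l i)" "(\<Sum>i\<in>S. z i * z i) \<le> q * q * t"
    and k: "k \<in> S" "z k \<le> 0"
    and z': "\<And>i. z' i = (\<Sum>l\<in>S. (y(k := y k + 1)) l * G l i)"
  shows "(\<Sum>i\<in>S. z' i * z' i) \<le> q * q * (t + 1)"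
proof -
  note q = is_projD(1)[OF P]
  have e: "z' i = z i + G k i" for i
  proof -
    have 1: "(\<Sum>l\<in>S. y l * G l i) = y k * G k i + (\<Sum>l\<in>S - {k}. y l * G l i)"
      using k fin by (intro sum.remove)
    have "z' i = (y k + 1) * G k i + (\<Sum>l\<in>S - {k}. y l * G l i)"
      unfolding z' using k fin by (subst sum.remove[of S k]) (auto intro!: sum.cong)
    also have "\<dots> = G k i + (\<Sum>l\<in>S. y l * G l i)"
      unfolding 1 by (simp add: algebra_simps)
    finally show ?thesis by (simp add: z)
  qed
  have zk: "(\<Sum>i\<in>S. G k i * z i) = q * z k"
  proof -
    have "(\<Sum>i\<in>S. G k i * z i) = (\<Sum>l\<in>S. y l * (\<Sum>i\<in>S. G k i * G i l))"
      unfolding z(1) sum_distrib_left by (subst sum.swap) (simp add: algebra_simps is_projD(2)[OF P])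
    then show ?thesis unfolding is_proj_square[OF P]
      by (simp add: z(1) sum_distrib_left mult.left_commute is_projD(2)[OF P])
  qed
  have "(\<Sum>i\<in>S. z' i * z' i) = (\<Sum>i\<in>S. z i * z i) + 2 * (\<Sum>i\<in>S. G k i * z i) + (\<Sum>i\<in>S. G k i * G i k)"
    unfolding e by (simp add: sum_distrib_left sum.distrib algebra_simps is_projD(2)[OF P, of _ k])
  also have "\<dots> = (\<Sum>i\<in>S. z i * z i) + 2 * (q * z k) + q * G k k"
    unfolding zk is_proj_square[OF P] ..
  also have "\<dots> \<le> q * q * t + 0 + q * q"
    using z(2) k(2) q is_proj_le[OF P fin, of k k] by (intro add_mono mult_left_mono) (auto simp: mult_le_0_iff)
  finally show ?thesis by (simp add: algebra_simps)
qed

text \<open>Lagrange's identity: the double sum of the squares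
  \<open>(a i * b j - a j * b i)\<^sup>2\<close> is twice the difference of the two sides.\<close>

lemma sum_Cauchy_Schwarz:
  fixes a b :: "nat \<Rightarrow> real"
  shows "(\<Sum>i\<in>S. a i * b i)\<^sup>2 \<le> (\<Sum>i\<in>S. (a i)\<^sup>2) * (\<Sum>i\<in>S. (b i)\<^sup>2)"
proof -
  have "0 \<le> (\<Sum>i\<in>S. \<Sum>j\<in>S. (a i * b j - a j * b i)\<^sup>2)"
    by (intro sum_nonneg) auto
  also have "\<dots> = (\<Sum>i\<in>S. \<Sum>j\<in>S. (a i)\<^sup>2 * (b j)\<^sup>2 + (a j)\<^sup>2 * (b i)\<^sup>2 - 2 * ((a i * b i) * (a j * b j)))"
    by (intro sum.cong) (auto simp: power2_eq_square algebra_simps)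
  also have "\<dots> = (\<Sum>i\<in>S. \<Sum>j\<in>S. (a i)\<^sup>2 * (b j)\<^sup>2) + (\<Sum>i\<in>S. \<Sum>j\<in>S. (a j)\<^sup>2 * (b i)\<^sup>2)
      - 2 * (\<Sum>i\<in>S. \<Sum>j\<in>S. (a i * b i) * (a j * b j))"
    by (simp add: sum.distrib sum_subtractf sum_distrib_left)
  also have "(\<Sum>i\<in>S. \<Sum>j\<in>S. (a j)\<^sup>2 * (b i)\<^sup>2) = (\<Sum>i\<in>S. \<Sum>j\<in>S. (a i)\<^sup>2 * (b j)\<^sup>2)"
    by (rule sum.swap)
  also have "(\<Sum>i\<in>S. \<Sum>j\<in>S. (a i)\<^sup>2 * (b j)\<^sup>2) = (\<Sum>i\<in>S. (a i)\<^sup>2) * (\<Sum>i\<in>S. (b i)\<^sup>2)"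
    by (simp add: sum_product)
  also have "(\<Sum>i\<in>S. \<Sum>j\<in>S. (a i * b i) * (a j * b j)) = (\<Sum>i\<in>S. a i * b i)\<^sup>2"
    by (simp only: power2_eq_square sum_product)
  finally show ?thesis by simp
qed

text \<open>For \<open>x\<close> in the kernel,
  \<open>z . x = q (y . x) \<ge> q * y j * x j\<close>, while \<open>|z|^2 \<le> q^2 t\<close> and
  \<open>|x|^2 \<le> n\<close>. So Cauchy-Schwarz gives \<open>(y j * x j)^2 \<le> t n\<close>. With
  \<open>y j \<ge> t / n\<close> this becomes \<open>(x j)^2 \<le> n^3 / t\<close>, which is at most
  1/4; hence the number \<open>4 * n ^ 3\<close> of steps.\<close>

lemma perceptron_half:
  assumes P: "is_proj A Q S G q" and fin: "finite S"
    and z: "\<And>i. z i = (\<Sum>l\<in>S. y l * G l i)" "(\<Sum>i\<in>S. z i * z i) \<le> q * q * int t"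
    and y: "\<And>l. l \<in> S \<Longrightarrow> 0 \<le> y l" and n: "card S \<le> n" "4 * n ^ 3 \<le> t" "0 < t"
    and j: "j \<in> S" "int t \<le> y j * int n"
    and x: "kern A Q S x" "\<And>l. l \<in> S \<Longrightarrow> 0 \<le> x l" "\<And>l. l \<in> S \<Longrightarrow> x l \<le> 1"
  shows "2 * x j \<le> 1"
proof -
  have q: "0 < real_of_int q" using is_projD(1)[OF P] by simp
  have "(\<Sum>i\<in>S. real_of_int (z i) * x i) = (\<Sum>l\<in>S. real_of_int (y l) * (\<Sum>i\<in>S. real_of_int (G l i) * x i))"
    unfolding sum_distrib_left by (subst sum.swap) (simp add: z(1) sum_distrib_right mult.assoc)
  also have "\<dots> = real_of_int q * (\<Sum>l\<in>S. real_of_int (y l) * x l)"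
    using is_projD(6)[OF P x(1)] by (simp add: sum_distrib_left mult.left_commute)
  finally have zx: "(\<Sum>i\<in>S. real_of_int (z i) * x i) = real_of_int q * (\<Sum>l\<in>S. real_of_int (y l) * x l)" .
  have yx: "real_of_int (y j) * x j \<le> (\<Sum>l\<in>S. real_of_int (y l) * x l)"
    using member_le_sum[OF j(1), of "\<lambda>l. real_of_int (y l) * x l"] y x fin by simp
  have y0: "0 \<le> real_of_int (y j) * x j" using y x j by simp
  have "(real_of_int q * (real_of_int (y j) * x j))\<^sup>2 \<le> (\<Sum>i\<in>S. real_of_int (z i) * x i)\<^sup>2"
    unfolding zx using q yx y0 by (intro power_mono mult_left_mono) auto
  also have "\<dots> \<le> (\<Sum>i\<in>S. (real_of_int (z i))\<^sup>2) * (\<Sum>i\<in>S. (x i)\<^sup>2)" by (rule sum_Cauchy_Schwarz)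
  also have "\<dots> \<le> ((real_of_int q)\<^sup>2 * real t) * real n"
  proof (rule mult_mono)
    have "real_of_int (\<Sum>i\<in>S. z i * z i) \<le> real_of_int (q * q * int t)" using z(2) by (simp only: of_int_le_iff)
    then show "(\<Sum>i\<in>S. (real_of_int (z i))\<^sup>2) \<le> (real_of_int q)\<^sup>2 * real t" by (simp add: power2_eq_square)
    have "(\<Sum>i\<in>S. (x i)\<^sup>2) \<le> (\<Sum>i\<in>S. 1)" using x by (intro sum_mono) (simp add: power_le_one)
    then show "(\<Sum>i\<in>S. (x i)\<^sup>2) \<le> real n" using n by simp
  qed (auto intro: sum_nonneg)
  finally have "(real_of_int q)\<^sup>2 * (real_of_int (y j) * x j)\<^sup>2 \<le> (real_of_int q)\<^sup>2 * (real t * real n)"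
    by (simp add: power_mult_distrib mult.assoc)
  then have a: "(real_of_int (y j) * x j)\<^sup>2 \<le> real t * real n" using q by simp
  have "real t \<le> real_of_int (y j) * real n"
  proof -
    have "real_of_int (int t) \<le> real_of_int (y j * int n)" using j(2) by (simp only: of_int_le_iff)
    then show ?thesis by simp
  qed
  then have "real t * x j \<le> real_of_int (y j) * real n * x j" using x j by (intro mult_right_mono) auto
  then have "(real t * x j)\<^sup>2 \<le> (real_of_int (y j) * real n * x j)\<^sup>2" using x j by (intro power_mono) auto
  also have "\<dots> = (real_of_int (y j) * x j)\<^sup>2 * (real n)\<^sup>2" by (simp add: power_mult_distrib algebra_simps)
  also have "\<dots> \<le> real t * real n * (real n)\<^sup>2" using a by (intro mult_right_mono) auto
  also have "\<dots> = real t * real (n ^ 3)" by (simp add: power3_eq_cube power2_eq_square)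
  finally have "real t * (real t * (x j)\<^sup>2) \<le> real t * real (n ^ 3)" by (simp add: power2_eq_square algebra_simps)
  then have b: "real t * (x j)\<^sup>2 \<le> real (n ^ 3)" using n by simp
  have "real (4 * n ^ 3) \<le> real t" using n(2) by (simp only: of_nat_le_iff)
  then have "4 * (real t * (x j)\<^sup>2) \<le> real t" using b by simp
  then have "real t * (4 * (x j)\<^sup>2) \<le> real t * 1" by simp
  then have "(2 * x j)\<^sup>2 \<le> 1\<^sup>2" using n(3) by (simp add: power_mult_distrib)
  then show ?thesis by (rule power2_le_imp_le) simp
qed

section \<open>Weakest preconditions with time\<close>

text \<open>Runs are deterministic, so the existence of one run is total correctness. The step count
  is an argument of the postcondition, which lets functional claims and time bounds be proved
  together.\<close>

definition wpt :: "prog \<Rightarrow> (nat \<Rightarrow> mem \<Rightarrow> bool) \<Rightarrow> mem \<Rightarrow> bool" where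
  "wpt c Q s \<longleftrightarrow> (\<exists>t s'. exec c s t s' \<and> Q t s')"

lemma wpt_mono: "wpt c Q s \<Longrightarrow> (\<And>t s'. Q t s' \<Longrightarrow> Q' t s') \<Longrightarrow> wpt c Q' s"
  unfolding wpt_def by blast

lemma wpt_Const [simp]: "wpt (Const i n) Q s = Q 1 (s(i := n))"
  unfolding wpt_def by (rule iffI, elim exE conjE, erule ConstE, simp, intro exI conjI, rule exec.Const, assumption)

lemma wpt_Add [simp]: "wpt (Add i j l) Q s = Q 1 (s(i := s j + s l))"
  unfolding wpt_def by (rule iffI, elim exE conjE, erule AddE, simp, intro exI conjI, rule exec.Add, assumption)

lemma wpt_Sub [simp]: "wpt (Sub i j l) Q s = Q 1 (s(i := s j - s l))"
  unfolding wpt_def by (rule iffI, elim exE conjE, erule SubE, simp, intro exI conjI, rule exec.Sub, assumption)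

lemma wpt_Load [simp]: "wpt (Load i j) Q s = Q 1 (s(i := s (s j)))"
  unfolding wpt_def by (rule iffI, elim exE conjE, erule LoadE, simp, intro exI conjI, rule exec.Load, assumption)

lemma wpt_Store [simp]: "wpt (Store i j) Q s = Q 1 (s(s i := s j))"
  unfolding wpt_def by (rule iffI, elim exE conjE, erule StoreE, simp, intro exI conjI, rule exec.Store, assumption)

lemma wpt_Seq [simp]: "wpt (Seq a b) Q s = wpt a (\<lambda>t. wpt b (\<lambda>u. Q (t + u))) s"
proof
  assume "wpt (Seq a b) Q s"
  then show "wpt a (\<lambda>t. wpt b (\<lambda>u. Q (t + u))) s"
    unfolding wpt_def by (elim exE conjE SeqE) blast
next
  assume "wpt a (\<lambda>t. wpt b (\<lambda>u. Q (t + u))) s"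
  then obtain t r u s' where "exec a s t r" "exec b r u s'" "Q (t + u) s'"
    unfolding wpt_def by blast
  then show "wpt (Seq a b) Q s" unfolding wpt_def using exec.Seq by blast
qed

lemma wpt_If [simp]: "wpt (IfPos i a b) Q s =
    (if s i > 0 then wpt a (\<lambda>t. Q (1 + t)) s else wpt b (\<lambda>t. Q (1 + t)) s)" (is "_ = ?r")
proof
  assume "wpt (IfPos i a b) Q s"
  then obtain t s' where e: "exec (IfPos i a b) s t s'" "Q t s'" unfolding wpt_def by blast
  from e(1) show ?r by (rule IfE) (use e(2) in \<open>auto simp: wpt_def\<close>)
next
  assume r: ?r
  show "wpt (IfPos i a b) Q s"
  proof (cases "s i > 0")
    case True
    with r obtain t s' where "exec a s t s'" "Q (1 + t) s'" unfolding wpt_def by auto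
    with True show ?thesis unfolding wpt_def using exec.IfTrue by blast
  next
    case False
    with r obtain t s' where "exec b s t s'" "Q (1 + t) s'" unfolding wpt_def by auto
    with False show ?thesis unfolding wpt_def using exec.IfFalse[of s i b t s' a] by auto
  qed
qed

lemma wpt_While_stop: "s i \<le> 0 \<Longrightarrow> Q 1 s \<Longrightarrow> wpt (WhilePos i c) Q s"
  unfolding wpt_def using exec.WhileFalse by blast

lemma wpt_While_step:
  assumes "s i > 0" "wpt c (\<lambda>t. wpt (WhilePos i c) (\<lambda>u. Q (1 + t + u))) s"
  shows "wpt (WhilePos i c) Q s"
proof -
  from assms(2) obtain t r u s' where "exec c s t r" "exec (WhilePos i c) r u s'" "Q (1 + t + u) s'"
    unfolding wpt_def by blast
  then show ?thesis unfolding wpt_def using exec.WhileTrue[of s i] assms(1) by blast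
qed

text \<open>The invariant is indexed by the exact number of rounds left, so one induction yields
  both termination and time: the body and a test in each round, and the final failing test.\<close>

lemma wpt_While_count:
  assumes inv: "\<And>n s. I (Suc n) s \<Longrightarrow> s i > 0 \<and> wpt c (\<lambda>t s'. t \<le> B \<and> I n s') s"
    and fin: "\<And>s. I 0 s \<Longrightarrow> s i \<le> 0"
  shows "I n s \<Longrightarrow> wpt (WhilePos i c) (\<lambda>t s'. t \<le> 1 + n * (B + 1) \<and> I 0 s') s"
proof (induction n arbitrary: s)
  case 0
  then show ?case using fin[OF 0] by (auto intro: wpt_While_stop)
next
  case (Suc n)
  note a = inv[OF Suc.prems]
  show ?case
  proof (rule wpt_While_step)
    show "s i > 0" using a by blast
    show "wpt c (\<lambda>t. wpt (WhilePos i c) (\<lambda>u s'. 1 + t + u \<le> 1 + Suc n * (B + 1) \<and> I 0 s')) s"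
    proof (rule wpt_mono[OF conjunct2[OF a]])
      fix t s' assume t: "t \<le> B \<and> I n s'"
      then have "wpt (WhilePos i c) (\<lambda>t s'. t \<le> 1 + n * (B + 1) \<and> I 0 s') s'" using Suc.IH by blast
      then show "wpt (WhilePos i c) (\<lambda>u s'. 1 + t + u \<le> 1 + Suc n * (B + 1) \<and> I 0 s') s'"
        by (rule wpt_mono) (use t in auto)
    qed
  qed
qed

section \<open>A loop language\<close>

text \<open>\<open>Bound\<close> stands for the common cut-off \<open>N\<close>. Summation is an
  expression, so inner products need no accumulator in the state and evaluate directly to
  mathematical sums.\<close>

datatype exp =
    Num int
  | Bound
  | Rd nat exp
  | Plus exp exp
  | Minus exp exp
  | Mul exp exp
  | Div exp exp
  | Cond exp exp exp
  | Sum nat exp exp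

datatype com =
    Skip
  | Put nat exp exp
  | Comp com com
  | When exp com com
  | For nat exp com

type_synonym state = "nat \<times> nat \<Rightarrow> int"

text \<open>Operands outside the given range yield the junk value 0. The number of loop iterations that
  compute a product or a quotient is then \<open>N\<close>, whatever the operands are.\<close>

definition tmul :: "nat \<Rightarrow> int \<Rightarrow> int \<Rightarrow> int" where
  "tmul N x y = (if \<bar>x\<bar> < 2 ^ N then x * y else 0)"

definition tdiv :: "nat \<Rightarrow> int \<Rightarrow> int \<Rightarrow> int" where
  "tdiv N x y = (if 0 \<le> x \<and> x < 2 ^ N \<and> 0 < y then x div y else 0)"

text \<open>The state maps an array and an index to a value. Negative indices are read as 0. The array 2
  holds the scalar variables; a loop restores its variable at the end.\<close>

primrec eval :: "nat \<Rightarrow> exp \<Rightarrow> state \<Rightarrow> int" where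
  "eval N (Num c) st = c"
| "eval N Bound st = int N"
| "eval N (Rd a e) st = st (a, nat (eval N e st))"
| "eval N (Plus e f) st = eval N e st + eval N f st"
| "eval N (Minus e f) st = eval N e st - eval N f st"
| "eval N (Mul e f) st = tmul N (eval N e st) (eval N f st)"
| "eval N (Div e f) st = tdiv N (eval N e st) (eval N f st)"
| "eval N (Cond e f g) st = (if eval N e st > 0 then eval N f st else eval N g st)"
| "eval N (Sum v f e) st = (\<Sum>i<min N (nat (eval N f st)). eval N e (st((2, v) := int i)))"

primrec iter :: "(nat \<Rightarrow> 'a \<Rightarrow> 'a) \<Rightarrow> nat \<Rightarrow> 'a \<Rightarrow> 'a" where
  "iter f 0 x = x"
| "iter f (Suc n) x = f n (iter f n x)"

primrec den :: "nat \<Rightarrow> com \<Rightarrow> state \<Rightarrow> state" where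
  "den N Skip st = st"
| "den N (Put a e f) st = st((a, nat (eval N e st)) := eval N f st)"
| "den N (Comp c d) st = den N d (den N c st)"
| "den N (When e c d) st = (if eval N e st > 0 then den N c st else den N d st)"
| "den N (For v f c) st =
    (iter (\<lambda>i s. den N c (s((2, v) := int i))) (min N (nat (eval N f st))) st)((2, v) := st (2, v))"

text \<open>Array numbers must stay below 16: a negative address belongs to the array given by its
  residue modulo 16, and residue 0 is the compiler's own.\<close>

primrec wf_exp :: "exp \<Rightarrow> bool" where
  "wf_exp (Num c) = True"
| "wf_exp Bound = True"
| "wf_exp (Rd a e) = (a < 16 \<and> wf_exp e)"
| "wf_exp (Plus e f) = (wf_exp e \<and> wf_exp f)"
| "wf_exp (Minus e f) = (wf_exp e \<and> wf_exp f)"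
| "wf_exp (Mul e f) = (wf_exp e \<and> wf_exp f)"
| "wf_exp (Div e f) = (wf_exp e \<and> wf_exp f)"
| "wf_exp (Cond e f g) = (wf_exp e \<and> wf_exp f \<and> wf_exp g)"
| "wf_exp (Sum v f e) = (wf_exp f \<and> wf_exp e)"

primrec wf_com :: "com \<Rightarrow> bool" where
  "wf_com Skip = True"
| "wf_com (Put a e f) = (a < 16 \<and> wf_exp e \<and> wf_exp f)"
| "wf_com (Comp c d) = (wf_com c \<and> wf_com d)"
| "wf_com (When e c d) = (wf_exp e \<and> wf_com c \<and> wf_com d)"
| "wf_com (For v f c) = (wf_exp f \<and> wf_com c)"

section \<open>Compilation\<close>

text \<open>Array 0 is the input and output area of the machine. The arrays 1 to 15 are interleaved on
  the negative addresses. Array 16 is reserved for the compiler: it holds \<open>N\<close> at address \<open>-16\<close>,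
  \<open>2 ^ N\<close> at address \<open>-32\<close>, and after that the temporaries.\<close>

definition addr :: "nat \<Rightarrow> nat \<Rightarrow> int" where
  "addr a i = (if a = 0 then int i else - (16 * int i + int a))"

definition tmp :: "nat \<Rightarrow> int" where
  "tmp d = - 16 * (int d + 3)"

lemma tmp_eq [simp]: "tmp d = tmp d' \<longleftrightarrow> d = d'"
  by (auto simp: tmp_def)

lemma tmp_special [simp]: "tmp d \<noteq> -16" "tmp d \<noteq> -32" "-16 \<noteq> tmp d" "-32 \<noteq> tmp d"
  by (auto simp: tmp_def)

lemma addr_mod: assumes "a < 16" "a \<noteq> 0" shows "(- addr a i) mod 16 = int a" "(- addr a i) div 16 = int i"
  using assms by (auto simp: addr_def)

lemma addr_ne: assumes "a < 16" "0 < x" shows "addr a i \<noteq> - (16 * x)"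
proof (cases "a = 0")
  case True
  then show ?thesis using assms by (simp add: addr_def)
next
  case False
  then show ?thesis using addr_mod(1)[of a i] assms by auto
qed

lemma addr_special: "a < 16 \<Longrightarrow> addr a i \<noteq> -16" "a < 16 \<Longrightarrow> addr a i \<noteq> -32"
  using addr_ne[of a 1 i] addr_ne[of a 2 i] by auto

lemma addr_tmp: "a < 16 \<Longrightarrow> addr a i \<noteq> tmp d"
  using addr_ne[of a "int d + 3" i] by (auto simp: tmp_def)

lemma addr_inj: assumes "a < 16" "a' < 16" shows "addr a i = addr a' i' \<longleftrightarrow> a = a' \<and> i = i'"
proof
  assume e: "addr a i = addr a' i'"
  have "a = 0 \<longleftrightarrow> 0 \<le> addr a i" "a' = 0 \<longleftrightarrow> 0 \<le> addr a' i'" by (auto simp: addr_def)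
  then have "a = 0 \<longleftrightarrow> a' = 0" using e by simp
  then show "a = a' \<and> i = i'"
    using e addr_mod[of a i] addr_mod[of a' i'] assms by (cases "a = 0") (auto simp: addr_def)
qed simp

text \<open>Temporaries are left unconstrained, so compiled code may use them freely without leaving
  the relation.\<close>

definition rel :: "nat \<Rightarrow> state \<Rightarrow> mem \<Rightarrow> bool" where
  "rel N st s \<longleftrightarrow> (\<forall>a<16. \<forall>i. s (addr a i) = st (a, i)) \<and> s (-16) = int N \<and> s (-32) = 2 ^ N"

lemma rel_tmp [simp]: "rel N st (s(tmp d := x)) = rel N st s"
  unfolding rel_def by (simp add: addr_tmp cong: imp_cong conj_cong)

lemma rel_N [simp]: "rel N st s \<Longrightarrow> s (-16) = int N" "rel N st s \<Longrightarrow> s (-32) = 2 ^ N"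
  unfolding rel_def by blast+

lemma rel_get: "rel N st s \<Longrightarrow> a < 16 \<Longrightarrow> s (addr a i) = st (a, i)"
  unfolding rel_def by blast

lemma rel_put:
  assumes "rel N st s" "a < 16"
  shows "rel N (st((a, i) := x)) (s(addr a i := x))"
  unfolding rel_def
proof (intro conjI allI impI)
  fix b j :: nat assume "b < 16"
  then show "(s(addr a i := x)) (addr b j) = (st((a, i) := x)) (b, j)"
    using addr_inj[of b a j i] rel_get[OF assms(1), of b j] assms(2) by auto
next
  show "(s(addr a i := x)) (-16) = int N"
    using addr_special(1)[OF assms(2), of i] rel_N(1)[OF assms(1)] by auto
  show "(s(addr a i := x)) (-32) = 2 ^ N"
    using addr_special(2)[OF assms(2), of i] rel_N(2)[OF assms(1)] by auto
qed

text \<open>The machine has no empty instruction; a write to a free temporary takes its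
  place.\<close>

definition nop :: "nat \<Rightarrow> prog" where "nop d = Const (tmp d) 0"

text \<open>Negative indices become 0, as under \<open>nat\<close>. For an interleaved array four
  doublings multiply the index by 16.\<close>

definition c_addr :: "nat \<Rightarrow> nat \<Rightarrow> nat \<Rightarrow> prog" where
  "c_addr a d e = Seq (IfPos (tmp d) (nop e) (Const (tmp d) 0))
    (if a = 0 then nop e else
      Seq (Add (tmp d) (tmp d) (tmp d)) (Seq (Add (tmp d) (tmp d) (tmp d))
     (Seq (Add (tmp d) (tmp d) (tmp d)) (Seq (Add (tmp d) (tmp d) (tmp d))
     (Seq (Const (tmp e) (- int a)) (Sub (tmp d) (tmp e) (tmp d)))))))"

lemma c_addr: assumes "d \<noteq> e"
  shows "wpt (c_addr a d e) (\<lambda>t s'. t \<le> 10 \<and> (\<exists>x. s' = s(tmp e := x, tmp d := addr a (nat (s (tmp d)))))) s"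
proof -
  have ne: "e \<noteq> d" "d \<noteq> e" using assms by auto
  have upd: "\<exists>x. g = f(tmp e := x, tmp d := y)" if "g (tmp d) = y" "\<And>i. i \<noteq> tmp e \<Longrightarrow> i \<noteq> tmp d \<Longrightarrow> g i = f i" for f g :: mem and y
    by (rule exI[of _ "g (tmp e)"]) (use that ne in \<open>auto simp: fun_eq_iff\<close>)
  show ?thesis
    unfolding c_addr_def nop_def
    by (auto simp: ne addr_def intro!: upd)
qed

text \<open>Horner's scheme from the leading bit. The machine cannot shift right, but doubling the
  factor in \<open>tmp d\<close> and comparing it with \<open>2 ^ N\<close> (at address -32) pushes
  out its top bit. \<open>tmp (d+2)\<close> accumulates the product, \<open>tmp (d+4)\<close> holds
  1 and \<open>tmp (d+5)\<close> counts the rounds left.\<close>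

definition mul_body :: "nat \<Rightarrow> prog" where
  "mul_body d = Seq (Add (tmp (d+2)) (tmp (d+2)) (tmp (d+2)))
       (Seq (Add (tmp d) (tmp d) (tmp d))
       (Seq (Sub (tmp (d+3)) (tmp d) (-32))
       (Seq (Add (tmp (d+3)) (tmp (d+3)) (tmp (d+4)))
       (Seq (IfPos (tmp (d+3)) (Seq (Sub (tmp d) (tmp d) (-32)) (Add (tmp (d+2)) (tmp (d+2)) (tmp (d+1))))
               (nop (d+3)))
        (Sub (tmp (d+5)) (tmp (d+5)) (tmp (d+4)))))))"

definition mul_loop :: "nat \<Rightarrow> prog" where
  "mul_loop d = WhilePos (tmp (d+5)) (mul_body d)"

text \<open>A first factor that is not positive is treated by negating both factors. If its absolute
  value reaches \<open>2 ^ N\<close>, the counter stays 0 and so does the product. The second factor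
  may have any size because it is only added.\<close>

definition c_mul :: "nat \<Rightarrow> prog" where
  "c_mul d =
    Seq (Const (tmp (d+2)) 0)
   (Seq (Const (tmp (d+4)) 1)
   (Seq (IfPos (tmp d) (nop (d+3)) (Seq (Sub (tmp d) (tmp (d+2)) (tmp d)) (Sub (tmp (d+1)) (tmp (d+2)) (tmp (d+1)))))
   (Seq (Sub (tmp (d+3)) (-32) (tmp d))
   (Seq (Const (tmp (d+5)) 0)
   (Seq (IfPos (tmp (d+3)) (Add (tmp (d+5)) (-16) (tmp (d+2))) (nop (d+3)))
   (Seq (mul_loop d)
   (Seq (Const (tmp (d+3)) 0) (Add (tmp d) (tmp (d+2)) (tmp (d+3))))))))))"

text \<open>Binary long division: the leading bit of the dividend, obtained as for products, is
  shifted into the remainder \<open>tmp (d+6)\<close>. When the divisor \<open>tmp (d+1)\<close>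
  fits, it is subtracted and the new bit of the quotient \<open>tmp (d+2)\<close> is 1.\<close>

definition div_body :: "nat \<Rightarrow> prog" where
  "div_body d = Seq (Add (tmp (d+2)) (tmp (d+2)) (tmp (d+2)))
       (Seq (Add (tmp (d+6)) (tmp (d+6)) (tmp (d+6)))
       (Seq (Add (tmp d) (tmp d) (tmp d))
       (Seq (Sub (tmp (d+3)) (tmp d) (-32))
       (Seq (Add (tmp (d+3)) (tmp (d+3)) (tmp (d+4)))
       (Seq (IfPos (tmp (d+3)) (Seq (Sub (tmp d) (tmp d) (-32)) (Add (tmp (d+6)) (tmp (d+6)) (tmp (d+4))))
               (nop (d+3)))
       (Seq (Sub (tmp (d+3)) (tmp (d+6)) (tmp (d+1)))
       (Seq (Add (tmp (d+3)) (tmp (d+3)) (tmp (d+4)))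
       (Seq (IfPos (tmp (d+3)) (Seq (Sub (tmp (d+6)) (tmp (d+6)) (tmp (d+1))) (Add (tmp (d+2)) (tmp (d+2)) (tmp (d+4))))
               (nop (d+3)))
        (Sub (tmp (d+5)) (tmp (d+5)) (tmp (d+4)))))))))))"

definition div_loop :: "nat \<Rightarrow> prog" where
  "div_loop d = WhilePos (tmp (d+5)) (div_body d)"

definition c_div :: "nat \<Rightarrow> prog" where
  "c_div d =
    Seq (Const (tmp (d+2)) 0)
   (Seq (Const (tmp (d+4)) 1)
   (Seq (Const (tmp (d+5)) 0)
   (Seq (Const (tmp (d+6)) 0)
   (Seq (Add (tmp (d+7)) (tmp d) (tmp (d+4)))
   (Seq (Sub (tmp (d+3)) (-32) (tmp d))
   (Seq (IfPos (tmp (d+7)) (IfPos (tmp (d+3)) (IfPos (tmp (d+1)) (Add (tmp (d+5)) (-16) (tmp (d+2))) (nop (d+3))) (nop (d+3))) (nop (d+3)))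
   (Seq (div_loop d)
   (Seq (Const (tmp (d+3)) 0) (Add (tmp d) (tmp (d+2)) (tmp (d+3)))))))))))"

text \<open>\<open>d\<close> acts as a stack pointer: the result goes to temporary \<open>d\<close>,
  those below survive, those above are scratch space.\<close>

definition post :: "nat \<Rightarrow> nat \<Rightarrow> state \<Rightarrow> int \<Rightarrow> mem \<Rightarrow> nat \<Rightarrow> nat \<Rightarrow> mem \<Rightarrow> bool" where
  "post N d st v s B = (\<lambda>t s'. t \<le> B \<and> rel N st s' \<and> s' (tmp d) = v \<and> (\<forall>d'<d. s' (tmp d') = s (tmp d')))"

text \<open>\<open>r\<close> is a multiple of \<open>2 ^ N\<close> and smaller than it, hence 0:
  after \<open>N\<close> shifts nothing of the operand is left.\<close>

lemma pow_split: assumes "x * 2 ^ N = hi * 2 ^ N + (r::int)" "0 \<le> r" "r < 2 ^ N" shows "hi = x"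
proof -
  have "r = (x - hi) * 2 ^ N" using assms(1) by (simp add: algebra_simps)
  then have "r div 2 ^ N = x - hi" by simp
  moreover have "r div 2 ^ N = 0" using assms by simp
  ultimately show ?thesis by simp
qed

lemma mul_loop:
  assumes s: "rel N st s" "s (tmp (d+5)) = int N" "s (tmp (d+4)) = 1" "s (tmp (d+1)) = Y"
    "s (tmp d) = X" "0 \<le> X" "X < 2 ^ N" "s (tmp (d+2)) = 0"
  shows "wpt (mul_loop d) (\<lambda>t s'. t \<le> 1 + N * 11 \<and> rel N st s' \<and> s' (tmp (d+2)) = X * Y
    \<and> (\<forall>d'<d. s' (tmp d') = s (tmp d'))) s"
proof -
  \<comment> \<open>With \<open>n\<close> rounds left, \<open>hi\<close> is the number formed by the
    \<open>N - n\<close> leading bits of \<open>X\<close>, and the accumulator holds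
    \<open>hi * Y\<close>.\<close>
  define I where "I n s' \<longleftrightarrow> rel N st s' \<and> n \<le> N \<and> s' (tmp (d+5)) = int n \<and> s' (tmp (d+4)) = 1 \<and> s' (tmp (d+1)) = Y
      \<and> (\<exists>hi. X * 2 ^ (N - n) = hi * 2 ^ N + s' (tmp d) \<and> s' (tmp (d+2)) = hi * Y)
      \<and> 0 \<le> s' (tmp d) \<and> s' (tmp d) < 2 ^ N \<and> (\<forall>d'<d. s' (tmp d') = s (tmp d'))" for n s'
  have step: "s' (tmp (d+5)) > 0 \<and> wpt (mul_body d) (\<lambda>t s''. t \<le> 10 \<and> I n s'') s'" if I: "I (Suc n) s'" for n s'
  proof -
    from I obtain hi where hi: "X * 2 ^ (N - Suc n) = hi * 2 ^ N + s' (tmp d)" "s' (tmp (d+2)) = hi * Y"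
      unfolding I_def by blast
    from I have "N - n = Suc (N - Suc n)" unfolding I_def by auto
    then have h: "X * 2 ^ (N - n) = 2 * (hi * 2 ^ N + s' (tmp d))" using hi by simp
    have a: "\<exists>h. X * 2 ^ (N - n) = h * 2 ^ N + 2 * s' (tmp d) \<and> hi * Y + hi * Y = h * Y"
      by (rule exI[of _ "2 * hi"]) (use h in \<open>auto simp: algebra_simps\<close>)
    have b: "\<exists>h. X * 2 ^ (N - n) = h * 2 ^ N + (2 * s' (tmp d) - 2 ^ N) \<and> hi * Y + hi * Y + Y = h * Y"
      by (rule exI[of _ "2 * hi + 1"]) (use h in \<open>auto simp: algebra_simps\<close>)
    show ?thesis using I hi(2) a b unfolding I_def nop_def mul_body_def by auto
  qed
  have fin: "I 0 s' \<Longrightarrow> s' (tmp (d+5)) \<le> 0" for s' unfolding I_def by auto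
  have i: "I N s" using s unfolding I_def by auto
  have "wpt (mul_loop d) (\<lambda>t s''. t \<le> 1 + N * (10 + 1) \<and> I 0 s'') s"
    unfolding mul_loop_def
    by (rule wpt_While_count[of I]) (use step fin i in blast)+
  then show ?thesis
    apply (rule wpt_mono)
    using pow_split[of X N] unfolding I_def by auto
qed

lemma div_loop:
  assumes s: "rel N st s" "s (tmp (d+5)) = int N" "s (tmp (d+4)) = 1" "s (tmp (d+1)) = Y" "0 < Y"
    "s (tmp d) = X" "0 \<le> X" "X < 2 ^ N" "s (tmp (d+2)) = 0" "s (tmp (d+6)) = 0"
  shows "wpt (div_loop d) (\<lambda>t s'. t \<le> 1 + N * 15 \<and> rel N st s' \<and> s' (tmp (d+2)) = X div Y
    \<and> (\<forall>d'<d. s' (tmp d') = s (tmp d'))) s"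
proof -
  \<comment> \<open>The leading bits read so far form the number quotient times \<open>Y\<close>
    plus remainder.\<close>
  define I where "I n s' \<longleftrightarrow> rel N st s' \<and> n \<le> N \<and> s' (tmp (d+5)) = int n \<and> s' (tmp (d+4)) = 1 \<and> s' (tmp (d+1)) = Y
      \<and> X * 2 ^ (N - n) = (s' (tmp (d+2)) * Y + s' (tmp (d+6))) * 2 ^ N + s' (tmp d)
      \<and> 0 \<le> s' (tmp (d+6)) \<and> s' (tmp (d+6)) < Y
      \<and> 0 \<le> s' (tmp d) \<and> s' (tmp d) < 2 ^ N \<and> (\<forall>d'<d. s' (tmp d') = s (tmp d'))" for n s'
  have step: "s' (tmp (d+5)) > 0 \<and> wpt (div_body d) (\<lambda>t s''. t \<le> 14 \<and> I n s'') s'" if I: "I (Suc n) s'" for n s'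
  proof -
    from I have hi: "X * 2 ^ (N - Suc n) = (s' (tmp (d+2)) * Y + s' (tmp (d+6))) * 2 ^ N + s' (tmp d)"
      unfolding I_def by blast
    from I have "N - n = Suc (N - Suc n)" unfolding I_def by auto
    then have h: "X * 2 ^ (N - n) = 2 * ((s' (tmp (d+2)) * Y + s' (tmp (d+6))) * 2 ^ N + s' (tmp d))" using hi by simp
    show ?thesis using I unfolding I_def nop_def div_body_def by (auto simp: h algebra_simps)
  qed
  have fin: "I 0 s' \<Longrightarrow> s' (tmp (d+5)) \<le> 0" for s' unfolding I_def by auto
  have i: "I N s" using s unfolding I_def by auto
  have "wpt (div_loop d) (\<lambda>t s''. t \<le> 1 + N * (14 + 1) \<and> I 0 s'') s"
    unfolding div_loop_def
    by (rule wpt_While_count[of I]) (use step fin i in blast)+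
  then show ?thesis
  proof (rule wpt_mono)
    fix t s' assume a: "t \<le> 1 + N * (14 + 1) \<and> I 0 s'"
    have "s' (tmp (d+2)) * Y + s' (tmp (d+6)) = X"
      by (rule pow_split[of X N _ "s' (tmp d)"]) (use a in \<open>auto simp: I_def\<close>)
    moreover have "0 \<le> s' (tmp (d+6)) \<and> s' (tmp (d+6)) < Y" using a by (auto simp: I_def)
    ultimately have "s' (tmp (d+2)) = X div Y"
      by (intro int_div_pos_eq[symmetric, of _ _ _ "s' (tmp (d+6))"]) (auto simp: algebra_simps)
    then show "t \<le> 1 + N * 15 \<and> rel N st s' \<and> s' (tmp (d+2)) = X div Y \<and> (\<forall>d'<d. s' (tmp d') = s (tmp d'))"
      using a by (auto simp: I_def)
  qed
qed

lemma mul_loop_0: "s (tmp (d+5)) \<le> 0 \<Longrightarrow> Q 1 s \<Longrightarrow> wpt (mul_loop d) Q s"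
  unfolding mul_loop_def by (rule wpt_While_stop)

lemma div_loop_0: "s (tmp (d+5)) \<le> 0 \<Longrightarrow> Q 1 s \<Longrightarrow> wpt (div_loop d) Q s"
  unfolding div_loop_def by (rule wpt_While_stop)

lemma c_mul:
  assumes "rel N st s"
  shows "wpt (c_mul d) (post N d st (tmul N (s (tmp d)) (s (tmp (d+1)))) s (20 + 20 * N)) s"
proof (cases "\<bar>s (tmp d)\<bar> < 2 ^ N")
  case False
  then show ?thesis using assms
    by (auto simp: c_mul_def nop_def post_def tmul_def intro!: mul_loop_0)
next
  case True
  show ?thesis
  proof (cases "0 < s (tmp d)")
    case p: True
    then have "s (tmp d) < 2 ^ N" using True by simp
    with p True assms show ?thesis
      apply (simp add: c_mul_def nop_def)
      apply (rule wpt_mono, rule mul_loop[where N=N and st=st and X="s (tmp d)" and Y="s (tmp (d+1))"]; simp)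
      apply (auto simp: post_def tmul_def)[1]
      done
  next
    case n: False
    then have "0 < 2 ^ N + s (tmp d)" using True by simp
    with n True assms show ?thesis
      apply (simp add: c_mul_def nop_def)
      apply (rule wpt_mono, rule mul_loop[where N=N and st=st and X="- s (tmp d)" and Y="- s (tmp (d+1))"]; simp)
      apply (auto simp: post_def tmul_def)[1]
      done
  qed
qed

lemma c_div:
  assumes "rel N st s"
  shows "wpt (c_div d) (post N d st (tdiv N (s (tmp d)) (s (tmp (d+1)))) s (20 + 20 * N)) s"
proof (cases "0 \<le> s (tmp d) \<and> s (tmp d) < 2 ^ N \<and> 0 < s (tmp (d+1))")
  case False
  then show ?thesis using assms
    by (auto simp: c_div_def nop_def post_def tdiv_def intro!: div_loop_0)
next
  case True
  then show ?thesis using assms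
    apply (simp add: c_div_def nop_def)
    apply (rule wpt_mono, rule div_loop[where N=N and st=st and X="s (tmp d)" and Y="s (tmp (d+1))"]; simp)
    apply (auto simp: post_def tdiv_def)[1]
    done
qed

definition c_clamp :: "nat \<Rightarrow> prog" where
  "c_clamp d = Seq (Const (tmp d) 0)
     (Seq (IfPos (tmp (d+1)) (nop (d+2)) (Const (tmp (d+1)) 0))
     (Seq (Sub (tmp (d+2)) (-16) (tmp (d+1)))
          (IfPos (tmp (d+2)) (nop (d+3)) (Add (tmp (d+1)) (-16) (tmp d)))))"

lemma c_clamp: assumes "rel N st s"
  shows "wpt (c_clamp d) (\<lambda>t s'. t \<le> 6 \<and> rel N st s' \<and> s' (tmp d) = 0 \<and>
    s' (tmp (d+1)) = int (min N (nat (s (tmp (d+1))))) \<and> (\<forall>d'<d. s' (tmp d') = s (tmp d'))) s"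
  using assms by (auto simp: c_clamp_def nop_def min_def)

text \<open>Adding a cell that holds 0 serves as a move. In a sum, temporary \<open>d\<close>
  accumulates, \<open>d + 1\<close> counts the rounds left and \<open>d + 2\<close> keeps the old
  value of the summation variable, which is an ordinary cell of array 2 and is restored at the
  end.\<close>

primrec c_exp :: "exp \<Rightarrow> nat \<Rightarrow> prog" where
  "c_exp (Num c) d = Const (tmp d) c"
| "c_exp Bound d = Seq (Const (tmp d) 0) (Add (tmp d) (-16) (tmp d))"
| "c_exp (Rd a e) d = Seq (c_exp e d) (Seq (c_addr a d (d+1)) (Load (tmp d) (tmp d)))"
| "c_exp (Plus e f) d = Seq (c_exp e d) (Seq (c_exp f (d+1)) (Add (tmp d) (tmp d) (tmp (d+1))))"
| "c_exp (Minus e f) d = Seq (c_exp e d) (Seq (c_exp f (d+1)) (Sub (tmp d) (tmp d) (tmp (d+1))))"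
| "c_exp (Mul e f) d = Seq (c_exp e d) (Seq (c_exp f (d+1)) (c_mul d))"
| "c_exp (Div e f) d = Seq (c_exp e d) (Seq (c_exp f (d+1)) (c_div d))"
| "c_exp (Cond e f g) d = Seq (c_exp e d) (IfPos (tmp d) (c_exp f d) (c_exp g d))"
| "c_exp (Sum v f e) d =
    Seq (c_exp f (d+1))
   (Seq (c_clamp d)
   (Seq (Add (tmp (d+2)) (addr 2 v) (tmp d))
   (Seq (Const (addr 2 v) 0)
   (Seq (WhilePos (tmp (d+1))
      (Seq (c_exp e (d+3))
      (Seq (Add (tmp d) (tmp d) (tmp (d+3)))
      (Seq (Const (tmp (d+3)) 1)
      (Seq (Add (addr 2 v) (addr 2 v) (tmp (d+3)))
           (Sub (tmp (d+1)) (tmp (d+1)) (tmp (d+3))))))))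
   (Seq (Const (tmp (d+3)) 0)
        (Add (addr 2 v) (tmp (d+2)) (tmp (d+3))))))))"

text \<open>The costs of the two branches are added instead of maximised, so the bound is built from
  sums and products alone and is visibly polynomial in \<open>N\<close>.\<close>

primrec t_exp :: "exp \<Rightarrow> nat \<Rightarrow> nat" where
  "t_exp (Num c) N = 1"
| "t_exp Bound N = 2"
| "t_exp (Rd a e) N = t_exp e N + 11"
| "t_exp (Plus e f) N = t_exp e N + t_exp f N + 1"
| "t_exp (Minus e f) N = t_exp e N + t_exp f N + 1"
| "t_exp (Mul e f) N = t_exp e N + t_exp f N + (20 + 20 * N)"
| "t_exp (Div e f) N = t_exp e N + t_exp f N + (20 + 20 * N)"
| "t_exp (Cond e f g) N = t_exp e N + (t_exp f N + t_exp g N) + 1"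
| "t_exp (Sum v f e) N = t_exp f N + N * (t_exp e N + 5) + 20"

lemma post_conv: "post N d st v s B t s' \<longleftrightarrow>
   t \<le> B \<and> rel N st s' \<and> s' (tmp d) = v \<and> (\<forall>d'<d. s' (tmp d') = s (tmp d'))"
  by (simp add: post_def)

lemma addr_neq [simp]: "a < 16 \<Longrightarrow> addr a i \<noteq> -16" "a < 16 \<Longrightarrow> addr a i \<noteq> -32"
  "a < 16 \<Longrightarrow> -16 \<noteq> addr a i" "a < 16 \<Longrightarrow> -32 \<noteq> addr a i"
  "a < 16 \<Longrightarrow> addr a i \<noteq> tmp d" "a < 16 \<Longrightarrow> tmp d \<noteq> addr a i"
  using addr_special[of a i] addr_tmp[of a i d] by metis+

definition exp_ok :: "nat \<Rightarrow> state \<Rightarrow> exp \<Rightarrow> bool" where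
  "exp_ok N st e \<longleftrightarrow> (\<forall>s d. rel N st s \<longrightarrow> wpt (c_exp e d) (post N d st (eval N e st) s (t_exp e N)) s)"

lemma exp_okD:
  assumes "exp_ok N st e" "rel N st s"
    and "\<And>t s'. t \<le> t_exp e N \<Longrightarrow> rel N st s' \<Longrightarrow> s' (tmp d) = eval N e st \<Longrightarrow>
        \<forall>d'<d. s' (tmp d') = s (tmp d') \<Longrightarrow> Q t s'"
  shows "wpt (c_exp e d) Q s"
proof (rule wpt_mono)
  show "wpt (c_exp e d) (post N d st (eval N e st) s (t_exp e N)) s"
    using assms(1,2) unfolding exp_ok_def by blast
  fix t s' assume "post N d st (eval N e st) s (t_exp e N) t s'"
  then show "Q t s'" unfolding post_conv by (intro assms(3)) blast+
qed

lemma exp_ok2: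
  assumes "exp_ok N st e" "exp_ok N st f" "rel N st s"
    and "\<And>t s'. t \<le> t_exp e N + t_exp f N \<Longrightarrow> rel N st s' \<Longrightarrow> s' (tmp d) = eval N e st \<Longrightarrow>
       s' (tmp (d+1)) = eval N f st \<Longrightarrow> \<forall>d'<d. s' (tmp d') = s (tmp d') \<Longrightarrow> wpt c (\<lambda>u. Q (t + u)) s'"
  shows "wpt (Seq (c_exp e d) (Seq (c_exp f (d+1)) c)) Q s"
  unfolding wpt_Seq
proof (rule exp_okD[OF assms(1,3)])
  fix t s'
  assume 1: "t \<le> t_exp e N" "rel N st s'" "s' (tmp d) = eval N e st" "\<forall>d'<d. s' (tmp d') = s (tmp d')"
  show "wpt (c_exp f (d + 1)) (\<lambda>ta. wpt c (\<lambda>u. Q (t + (ta + u)))) s'"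
  proof (rule exp_okD[OF assms(2) 1(2)])
    fix u r
    assume 2: "u \<le> t_exp f N" "rel N st r" "r (tmp (d+1)) = eval N f st" "\<forall>d'<d+1. r (tmp d') = s' (tmp d')"
    have "wpt c (\<lambda>v. Q ((t + u) + v)) r"
      by (rule assms(4)) (use 1 2 in auto)
    then show "wpt c (\<lambda>v. Q (t + (u + v))) r" by (simp add: add.assoc)
  qed
qed

lemma c_sum:
  assumes e: "\<And>st. exp_ok N st e" and f: "exp_ok N st f" and s: "rel N st s"
  shows "wpt (c_exp (Sum v f e) d) (post N d st (eval N (Sum v f e) st) s (t_exp (Sum v f e) N)) s"
proof -
  define K where "K = min N (nat (eval N f st))"
  let ?e = "\<lambda>i. eval N e (st((2, v) := int i))"
  let ?body = "Seq (c_exp e (d+3))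
      (Seq (Add (tmp d) (tmp d) (tmp (d+3)))
      (Seq (Const (tmp (d+3)) 1)
      (Seq (Add (addr 2 v) (addr 2 v) (tmp (d+3)))
           (Sub (tmp (d+1)) (tmp (d+1)) (tmp (d+3))))))"
  define I where "I n s' \<longleftrightarrow> n \<le> K \<and> rel N (st((2, v) := int (K - n))) s' \<and> s' (tmp (d+1)) = int n
     \<and> s' (tmp (d+2)) = st (2, v) \<and> s' (tmp d) = (\<Sum>i<K - n. ?e i) \<and> (\<forall>d'<d. s' (tmp d') = s (tmp d'))" for n s'
  have loop: "wpt (WhilePos (tmp (d+1)) ?body) (\<lambda>t s'. t \<le> 1 + K * (t_exp e N + 4 + 1) \<and> I 0 s') s'" if "I K s'" for s'
  proof (rule wpt_While_count[of I])
    show "I K s'" by (rule that)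
  next
    fix s' assume "I 0 s'"
    then show "s' (tmp (d+1)) \<le> 0" by (simp add: I_def)
  next
    fix n s' assume I: "I (Suc n) s'"
    define j where "j = K - Suc n"
    have j: "K - n = Suc j" "j < K" using I by (auto simp: I_def j_def)
    have "wpt ?body (\<lambda>t s'. t \<le> t_exp e N + 4 \<and> I n s') s'"
      unfolding wpt_Seq[of "c_exp e (d+3)"]
    proof (rule exp_okD[OF e])
      show r: "rel N (st((2, v) := int j)) s'" using I unfolding I_def j_def by blast
      fix t r
      assume t: "t \<le> t_exp e N" "rel N (st((2, v) := int j)) r" "r (tmp (d+3)) = ?e j"
        "\<forall>d'<d+3. r (tmp d') = s' (tmp d')"
      have x: "r (addr 2 v) = int j" using rel_get[OF t(2), of 2 v] by simp
      have y: "rel N (st((2, v) := int (K - n))) (r(tmp d := a, tmp (d+3) := b, addr 2 v := int j + 1))" for a b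
      proof -
        have "rel N (st((2, v) := int j)) (r(tmp d := a, tmp (d+3) := b))" using t(2) by simp
        from rel_put[OF this, of 2 v "int j + 1"] show ?thesis by (simp add: j add.commute)
      qed
      show "wpt (Seq (Add (tmp d) (tmp d) (tmp (d+3)))
      (Seq (Const (tmp (d+3)) 1)
      (Seq (Add (addr 2 v) (addr 2 v) (tmp (d+3)))
           (Sub (tmp (d+1)) (tmp (d+1)) (tmp (d+3)))))) (\<lambda>u s'. t + u \<le> t_exp e N + 4 \<and> I n s') r"
        using I t x y by (simp add: I_def j lessThan_Suc add.commute flip: j_def)
    qed
    then show "0 < s' (tmp (d+1)) \<and> wpt ?body (\<lambda>t s'. t \<le> t_exp e N + 4 \<and> I n s') s'"
      using I by (simp add: I_def)
  qed
  have w: "rel N st (r(tmp (d+3) := 0, addr 2 v := st (2, v)))" if "I 0 r" for r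
  proof -
    have "rel N (st((2, v) := int K)) (r(tmp (d+3) := 0))" using that by (simp add: I_def)
    from rel_put[OF this, of 2 v "st (2, v)"] show ?thesis by simp
  qed
  \<comment> \<open>The actual number \<open>K\<close> of rounds depends on the state, whereas the
    time bound may only mention \<open>N\<close>.\<close>
  have KN: "K * B \<le> N * B" for B by (simp add: K_def)
  have loop2: "wpt (WhilePos (tmp (d+1)) ?body) (\<lambda>t s'. t \<le> 1 + N * (t_exp e N + 4 + 1) \<and> I 0 s') s'" if "I K s'" for s'
    by (rule wpt_mono[OF loop[OF that]], elim conjE, intro conjI, erule order_trans, rule add_left_mono, rule KN, assumption)
  have main: "wpt (Seq (Add (tmp (d+2)) (addr 2 v) (tmp d)) (Seq (Const (addr 2 v) 0)
     (Seq (WhilePos (tmp (d+1)) ?body) (Seq (Const (tmp (d+3)) 0) (Add (addr 2 v) (tmp (d+2)) (tmp (d+3)))))))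
     (\<lambda>t s'. t \<le> 5 + N * (t_exp e N + 5) \<and> rel N st s' \<and> s' (tmp d) = (\<Sum>i<K. ?e i) \<and> (\<forall>d'<d. s' (tmp d') = s (tmp d'))) r"
    if r: "rel N st r" "r (tmp d) = 0" "r (tmp (d+1)) = int K" "\<forall>d'<d. r (tmp d') = s (tmp d')" for r
  proof -
    have v: "r (addr 2 v) = st (2, v)" using rel_get[OF r(1)] by simp
    have i: "I K (r(tmp (Suc (Suc d)) := st (2, v), addr 2 v := 0))"
    proof -
      have "rel N st (r(tmp (Suc (Suc d)) := st (2, v)))" using r by simp
      from rel_put[OF this, of 2 v 0] show ?thesis using r by (simp add: I_def)
    qed
    show ?thesis using r v
      apply simp
      apply (rule wpt_mono[OF loop2[simplified]])
      using i apply simp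
      using w apply (simp add: I_def add.commute)
      done
  qed
  show ?thesis
    unfolding c_exp.simps wpt_Seq[of "c_exp f _"] wpt_Seq[of "c_clamp _"]
  proof (rule exp_okD[OF f s])
    fix t s1 assume 1: "t \<le> t_exp f N" "rel N st s1" "s1 (tmp (d+1)) = eval N f st" "\<forall>d'<d+1. s1 (tmp d') = s (tmp d')"
    show "wpt (c_clamp d) (\<lambda>u::nat. wpt (Seq (Add (tmp (d+2)) (addr 2 v) (tmp d)) (Seq (Const (addr 2 v) 0)
     (Seq (WhilePos (tmp (d+1)) ?body) (Seq (Const (tmp (d+3)) 0) (Add (addr 2 v) (tmp (d+2)) (tmp (d+3)))))))
       (\<lambda>ua::nat. post N d st (eval N (Sum v f e) st) s (t_exp (Sum v f e) N) (t + (u + ua)))) s1"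
    proof (rule wpt_mono[OF c_clamp[OF 1(2)]])
      fix u :: nat and r
      assume 2: "u \<le> 6 \<and> rel N st r \<and> r (tmp d) = 0 \<and>
        r (tmp (d+1)) = int (min N (nat (s1 (tmp (d+1))))) \<and> (\<forall>d'<d. r (tmp d') = s1 (tmp d'))"
      show "wpt (Seq (Add (tmp (d+2)) (addr 2 v) (tmp d)) (Seq (Const (addr 2 v) 0)
     (Seq (WhilePos (tmp (d+1)) ?body) (Seq (Const (tmp (d+3)) 0) (Add (addr 2 v) (tmp (d+2)) (tmp (d+3)))))))
       (\<lambda>ua::nat. post N d st (eval N (Sum v f e) st) s (t_exp (Sum v f e) N) (t + (u + ua))) r"
        by (rule wpt_mono[OF main]) (use 1 2 in \<open>auto simp: K_def post_conv\<close>)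
    qed
  qed
qed

lemma c_exp: "wf_exp e \<Longrightarrow> exp_ok N st e"
proof (induction e arbitrary: st)
  case (Num x)
  then show ?case by (simp add: exp_ok_def post_conv)
next
  case Bound
  then show ?case by (simp add: exp_ok_def post_conv)
next
  case (Rd a e)
  then have e: "exp_ok N st e" by simp
  show ?case unfolding exp_ok_def c_exp.simps wpt_Seq[of "c_exp e _"]
  proof (intro allI impI, rule exp_okD[OF e], assumption)
    fix s d t s'
    assume p: "t \<le> t_exp e N" "rel N st s'" "s' (tmp d) = eval N e st" "\<forall>d'<d. s' (tmp d') = s (tmp d')"
    have "wpt (c_addr a d (d+1)) (\<lambda>u::nat. wpt (Load (tmp d) (tmp d))
        (\<lambda>w::nat. post N d st (eval N (Rd a e) st) s (t_exp (Rd a e) N) (t + (u + w)))) s'"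
    proof (rule wpt_mono)
      show "wpt (c_addr a d (d+1)) (\<lambda>t r. t \<le> 10 \<and> (\<exists>x. r = s'(tmp (d+1) := x, tmp d := addr a (nat (s' (tmp d)))))) s'"
        by (rule c_addr) simp
      fix u :: nat and r assume u: "u \<le> 10 \<and> (\<exists>x. r = s'(tmp (d+1) := x, tmp d := addr a (nat (s' (tmp d)))))"
      then show "wpt (Load (tmp d) (tmp d))
        (\<lambda>w::nat. post N d st (eval N (Rd a e) st) s (t_exp (Rd a e) N) (t + (u + w))) r"
        using p Rd.prems by (auto simp: post_conv rel_get)
    qed
    then show "wpt (Seq (c_addr a d (d+1)) (Load (tmp d) (tmp d)))
       (\<lambda>u. post N d st (eval N (Rd a e) st) s (t_exp (Rd a e) N) (t + u)) s'" by simp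
  qed
next
  case (Plus e f)
  then have "exp_ok N st e" "exp_ok N st f" by auto
  then show ?case unfolding exp_ok_def[of N st "Plus e f"] c_exp.simps
    by (intro allI impI, rule exp_ok2) (simp_all add: post_conv)
next
  case (Minus e f)
  then have "exp_ok N st e" "exp_ok N st f" by auto
  then show ?case unfolding exp_ok_def[of N st "Minus e f"] c_exp.simps
    by (intro allI impI, rule exp_ok2) (simp_all add: post_conv)
next
  case (Mul e f)
  then have ok: "exp_ok N st e" "exp_ok N st f" by auto
  show ?case unfolding exp_ok_def[of N st "Mul e f"] c_exp.simps
    apply (intro allI impI, rule exp_ok2[OF ok], assumption)
    apply (rule wpt_mono[OF c_mul], assumption)
    apply (simp add: post_conv)
    done
next
  case (Div e f)
  then have ok: "exp_ok N st e" "exp_ok N st f" by auto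
  show ?case unfolding exp_ok_def[of N st "Div e f"] c_exp.simps
    apply (intro allI impI, rule exp_ok2[OF ok], assumption)
    apply (rule wpt_mono[OF c_div], assumption)
    apply (simp add: post_conv)
    done
next
  case (Cond e f g)
  then have ok: "exp_ok N st e" "exp_ok N st f" "exp_ok N st g" by auto
  show ?case unfolding exp_ok_def c_exp.simps wpt_Seq
  proof (intro allI impI, rule exp_okD[OF ok(1)], assumption)
    fix s d t s'
    assume p: "t \<le> t_exp e N" "rel N st s'" "s' (tmp d) = eval N e st" "\<forall>d'<d. s' (tmp d') = s (tmp d')"
    have "wpt (c_exp h d) (\<lambda>u. post N d st (eval N h st) s (t_exp (Cond e f g) N) (t + (1 + u))) s'"
      if "exp_ok N st h" "t_exp h N \<le> t_exp f N + t_exp g N" for h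
      by (rule exp_okD[OF that(1) p(2)]) (use p that(2) in \<open>simp add: post_conv\<close>)
    then show "wpt (IfPos (tmp d) (c_exp f d) (c_exp g d))
        (\<lambda>u. post N d st (eval N (Cond e f g) st) s (t_exp (Cond e f g) N) (t + u)) s'"
      using ok p(3) by simp
  qed
next
  case (Sum v f e)
  then show ?case using c_sum[of N e st f] unfolding exp_ok_def[of N st "Sum v f e"] by simp
qed

text \<open>Unlike in a sum, the counter of a loop lives in temporary \<open>d\<close> and is copied
  to the loop variable in every round, because the body may overwrite that variable.\<close>

primrec c_com :: "com \<Rightarrow> nat \<Rightarrow> prog" where
  "c_com Skip d = nop d"
| "c_com (Put a e f) d = Seq (c_exp e d) (Seq (c_exp f (d+1)) (Seq (c_addr a d (d+2)) (Store (tmp d) (tmp (d+1)))))"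
| "c_com (Comp b c) d = Seq (c_com b d) (c_com c d)"
| "c_com (When e b c) d = Seq (c_exp e d) (IfPos (tmp d) (c_com b d) (c_com c d))"
| "c_com (For v f c) d =
    Seq (c_exp f (d+1))
   (Seq (c_clamp d)
   (Seq (Add (tmp (d+2)) (addr 2 v) (tmp d))
   (Seq (WhilePos (tmp (d+1))
      (Seq (Const (tmp (d+3)) 0)
      (Seq (Add (addr 2 v) (tmp d) (tmp (d+3)))
      (Seq (c_com c (d+3))
      (Seq (Const (tmp (d+3)) 1)
      (Seq (Add (tmp d) (tmp d) (tmp (d+3)))
           (Sub (tmp (d+1)) (tmp (d+1)) (tmp (d+3)))))))))
   (Seq (Const (tmp (d+3)) 0)
        (Add (addr 2 v) (tmp (d+2)) (tmp (d+3)))))))"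

primrec t_com :: "com \<Rightarrow> nat \<Rightarrow> nat" where
  "t_com Skip N = 1"
| "t_com (Put a e f) N = t_exp e N + t_exp f N + 11"
| "t_com (Comp b c) N = t_com b N + t_com c N"
| "t_com (When e b c) N = t_exp e N + (t_com b N + t_com c N) + 1"
| "t_com (For v f c) N = t_exp f N + N * (t_com c N + 6) + 20"

definition com_ok :: "nat \<Rightarrow> com \<Rightarrow> bool" where
  "com_ok N c \<longleftrightarrow> (\<forall>st s d. rel N st s \<longrightarrow>
     wpt (c_com c d) (\<lambda>t s'. t \<le> t_com c N \<and> rel N (den N c st) s' \<and> (\<forall>d'<d. s' (tmp d') = s (tmp d'))) s)"

lemma com_okD:
  assumes "com_ok N c" "rel N st s"
    and "\<And>t s'. t \<le> t_com c N \<Longrightarrow> rel N (den N c st) s' \<Longrightarrow>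
        \<forall>d'<d. s' (tmp d') = s (tmp d') \<Longrightarrow> Q t s'"
  shows "wpt (c_com c d) Q s"
proof (rule wpt_mono)
  show "wpt (c_com c d) (\<lambda>t s'. t \<le> t_com c N \<and> rel N (den N c st) s' \<and> (\<forall>d'<d. s' (tmp d') = s (tmp d'))) s"
    using assms(1,2) unfolding com_ok_def by blast
  fix t s' assume "t \<le> t_com c N \<and> rel N (den N c st) s' \<and> (\<forall>d'<d. s' (tmp d') = s (tmp d'))"
  then show "Q t s'" by (intro assms(3)) blast+
qed

lemma c_for:
  assumes c: "com_ok N c" and f: "exp_ok N st f" and s: "rel N st s"
  shows "wpt (c_com (For v f c) d) (\<lambda>t s'. t \<le> t_com (For v f c) N \<and> rel N (den N (For v f c) st) s' \<and>
     (\<forall>d'<d. s' (tmp d') = s (tmp d'))) s"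
proof -
  define K where "K = min N (nat (eval N f st))"
  let ?it = "\<lambda>n. iter (\<lambda>i s. den N c (s((2, v) := int i))) n st"
  let ?body = "Seq (Const (tmp (d+3)) 0)
      (Seq (Add (addr 2 v) (tmp d) (tmp (d+3)))
      (Seq (c_com c (d+3))
      (Seq (Const (tmp (d+3)) 1)
      (Seq (Add (tmp d) (tmp d) (tmp (d+3)))
           (Sub (tmp (d+1)) (tmp (d+1)) (tmp (d+3)))))))"
  define I where "I n s' \<longleftrightarrow> n \<le> K \<and> rel N (?it (K - n)) s' \<and> s' (tmp (d+1)) = int n
     \<and> s' (tmp (d+2)) = st (2, v) \<and> s' (tmp d) = int (K - n) \<and> (\<forall>d'<d. s' (tmp d') = s (tmp d'))" for n s'
  have loop: "wpt (WhilePos (tmp (d+1)) ?body) (\<lambda>t s'. t \<le> 1 + K * (t_com c N + 5 + 1) \<and> I 0 s') s'" if "I K s'" for s'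
  proof (rule wpt_While_count[of I])
    show "I K s'" by (rule that)
  next
    fix s' assume "I 0 s'"
    then show "s' (tmp (d+1)) \<le> 0" by (simp add: I_def)
  next
    fix n s' assume I: "I (Suc n) s'"
    define j where "j = K - Suc n"
    have j: "K - n = Suc j" "j < K" using I by (auto simp: I_def j_def)
    have r: "rel N (?it j) s'" "s' (tmp d) = int j" using I unfolding I_def j_def by blast+
    let ?s = "s'(tmp (d+3) := 0, addr 2 v := int j)"
    have r': "rel N ((?it j)((2, v) := int j)) ?s"
      using r(1) by (intro rel_put) simp_all
    have "wpt (c_com c (d+3)) (\<lambda>t. wpt (Seq (Const (tmp (d+3)) 1)
      (Seq (Add (tmp d) (tmp d) (tmp (d+3)))
           (Sub (tmp (d+1)) (tmp (d+1)) (tmp (d+3))))) (\<lambda>u s'. 2 + t + u \<le> t_com c N + 5 \<and> I n s')) ?s"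
    proof (rule com_okD[OF c r'])
      fix t r
      assume t: "t \<le> t_com c N" "rel N (den N c ((?it j)((2, v) := int j))) r"
        "\<forall>d'<d+3. r (tmp d') = ?s (tmp d')"
      show "wpt (Seq (Const (tmp (d+3)) 1)
      (Seq (Add (tmp d) (tmp d) (tmp (d+3)))
           (Sub (tmp (d+1)) (tmp (d+1)) (tmp (d+3))))) (\<lambda>u s'. 2 + t + u \<le> t_com c N + 5 \<and> I n s') r"
        using I t r(2) by (simp add: I_def j add.commute flip: j_def)
    qed
    then show "0 < s' (tmp (d+1)) \<and> wpt ?body (\<lambda>t s'. t \<le> t_com c N + 5 \<and> I n s') s'"
      using I r(2) by (simp add: I_def)
  qed
  have w: "rel N ((?it K)((2, v) := st (2, v))) (r(tmp (d+3) := 0, addr 2 v := st (2, v)))" if "I 0 r" for r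
    using that by (intro rel_put) (simp_all add: I_def)
  have KN: "K * B \<le> N * B" for B by (simp add: K_def)
  have loop2: "wpt (WhilePos (tmp (d+1)) ?body) (\<lambda>t s'. t \<le> 1 + N * (t_com c N + 5 + 1) \<and> I 0 s') s'" if "I K s'" for s'
    by (rule wpt_mono[OF loop[OF that]], elim conjE, intro conjI, erule order_trans, rule add_left_mono, rule KN, assumption)
  have main: "wpt (Seq (Add (tmp (d+2)) (addr 2 v) (tmp d))
     (Seq (WhilePos (tmp (d+1)) ?body) (Seq (Const (tmp (d+3)) 0) (Add (addr 2 v) (tmp (d+2)) (tmp (d+3))))))
     (\<lambda>t s'. t \<le> 5 + N * (t_com c N + 6) \<and> rel N ((?it K)((2, v) := st (2, v))) s' \<and> (\<forall>d'<d. s' (tmp d') = s (tmp d'))) r"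
    if r: "rel N st r" "r (tmp d) = 0" "r (tmp (d+1)) = int K" "\<forall>d'<d. r (tmp d') = s (tmp d')" for r
  proof -
    have v: "r (addr 2 v) = st (2, v)" using rel_get[OF r(1)] by simp
    have i: "I K (r(tmp (Suc (Suc d)) := st (2, v)))"
      using r by (simp add: I_def)
    show ?thesis using r v
      apply simp
      apply (rule wpt_mono[OF loop2[simplified]])
      using i apply simp
      using w apply (simp add: I_def add.commute)
      done
  qed
  show ?thesis
    unfolding c_com.simps wpt_Seq[of "c_exp f _"] wpt_Seq[of "c_clamp _"]
  proof (rule exp_okD[OF f s])
    fix t s1 assume 1: "t \<le> t_exp f N" "rel N st s1" "s1 (tmp (d+1)) = eval N f st" "\<forall>d'<d+1. s1 (tmp d') = s (tmp d')"
    show "wpt (c_clamp d) (\<lambda>u::nat. wpt (Seq (Add (tmp (d+2)) (addr 2 v) (tmp d))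
     (Seq (WhilePos (tmp (d+1)) ?body) (Seq (Const (tmp (d+3)) 0) (Add (addr 2 v) (tmp (d+2)) (tmp (d+3))))))
       (\<lambda>(ua::nat) s'. t + (u + ua) \<le> t_com (For v f c) N \<and> rel N (den N (For v f c) st) s' \<and>
     (\<forall>d'<d. s' (tmp d') = s (tmp d')))) s1"
    proof (rule wpt_mono[OF c_clamp[OF 1(2)]])
      fix u :: nat and r
      assume 2: "u \<le> 6 \<and> rel N st r \<and> r (tmp d) = 0 \<and>
        r (tmp (d+1)) = int (min N (nat (s1 (tmp (d+1))))) \<and> (\<forall>d'<d. r (tmp d') = s1 (tmp d'))"
      show "wpt (Seq (Add (tmp (d+2)) (addr 2 v) (tmp d))
     (Seq (WhilePos (tmp (d+1)) ?body) (Seq (Const (tmp (d+3)) 0) (Add (addr 2 v) (tmp (d+2)) (tmp (d+3))))))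
       (\<lambda>(ua::nat) s'. t + (u + ua) \<le> t_com (For v f c) N \<and> rel N (den N (For v f c) st) s' \<and>
     (\<forall>d'<d. s' (tmp d') = s (tmp d'))) r"
        by (rule wpt_mono[OF main]) (use 1 2 in \<open>auto simp: K_def\<close>)
    qed
  qed
qed

lemma c_com: "wf_com c \<Longrightarrow> com_ok N c"
proof (induction c)
  case Skip
  then show ?case by (simp add: com_ok_def nop_def)
next
  case (Put a e f)
  then have ok: "exp_ok N st e" "exp_ok N st f" for st by (auto intro: c_exp)
  show ?case unfolding com_ok_def c_com.simps
  proof (intro allI impI, rule exp_ok2[OF ok], assumption)
    fix st s d t s'
    assume p: "t \<le> t_exp e N + t_exp f N" "rel N st s'" "s' (tmp d) = eval N e st"
      "s' (tmp (d + 1)) = eval N f st" "\<forall>d'<d. s' (tmp d') = s (tmp d')"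
    have "wpt (c_addr a d (d+2)) (\<lambda>u::nat. wpt (Store (tmp d) (tmp (d+1)))
        (\<lambda>w::nat. \<lambda>s'. t + (u + w) \<le> t_com (Put a e f) N \<and> rel N (den N (Put a e f) st) s' \<and> (\<forall>d'<d. s' (tmp d') = s (tmp d')))) s'"
    proof (rule wpt_mono)
      show "wpt (c_addr a d (d+2)) (\<lambda>t r. t \<le> 10 \<and> (\<exists>x. r = s'(tmp (d+2) := x, tmp d := addr a (nat (s' (tmp d)))))) s'"
        by (rule c_addr) simp
      fix u :: nat and r assume u: "u \<le> 10 \<and> (\<exists>x. r = s'(tmp (d+2) := x, tmp d := addr a (nat (s' (tmp d)))))"
      then obtain x where r: "r = s'(tmp (d+2) := x, tmp d := addr a (nat (s' (tmp d))))" by blast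
      have "rel N (den N (Put a e f) st) (r(addr a (nat (s' (tmp d))) := s' (tmp (d+1))))"
        using p Put.prems unfolding r by (simp add: rel_put)
      then show "wpt (Store (tmp d) (tmp (d+1)))
        (\<lambda>w s'. t + (u + w) \<le> t_com (Put a e f) N \<and> rel N (den N (Put a e f) st) s' \<and> (\<forall>d'<d. s' (tmp d') = s (tmp d'))) r"
        using p u Put.prems unfolding r by simp
    qed
    then show "wpt (Seq (c_addr a d (d+2)) (Store (tmp d) (tmp (d+1))))
       (\<lambda>u s'. t + u \<le> t_com (Put a e f) N \<and> rel N (den N (Put a e f) st) s' \<and> (\<forall>d'<d. s' (tmp d') = s (tmp d'))) s'" by simp
  qed
next
  case (Comp b c)
  then have ok: "com_ok N b" "com_ok N c" by auto
  show ?case unfolding com_ok_def c_com.simps wpt_Seq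
  proof (intro allI impI, rule com_okD[OF ok(1)], assumption)
    fix st s d t s'
    assume p: "t \<le> t_com b N" "rel N (den N b st) s'" "\<forall>d'<d. s' (tmp d') = s (tmp d')"
    show "wpt (c_com c d) (\<lambda>u s'. t + u \<le> t_com (Comp b c) N \<and> rel N (den N (Comp b c) st) s'
       \<and> (\<forall>d'<d. s' (tmp d') = s (tmp d'))) s'"
      by (rule com_okD[OF ok(2) p(2)]) (use p in auto)
  qed
next
  case (When e b c)
  then have ok: "com_ok N b" "com_ok N c" and e: "\<And>st. exp_ok N st e" by (auto intro: c_exp)
  show ?case unfolding com_ok_def c_com.simps wpt_Seq
  proof (intro allI impI, rule exp_okD[OF e], assumption)
    fix st s d t s'
    assume p: "t \<le> t_exp e N" "rel N st s'" "s' (tmp d) = eval N e st" "\<forall>d'<d. s' (tmp d') = s (tmp d')"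
    have "wpt (c_com h d) (\<lambda>u s'. t + (1 + u) \<le> t_com (When e b c) N \<and> rel N (den N h st) s'
       \<and> (\<forall>d'<d. s' (tmp d') = s (tmp d'))) s'"
      if "com_ok N h" "t_com h N \<le> t_com b N + t_com c N" for h
      by (rule com_okD[OF that(1) p(2)]) (use p that(2) in auto)
    then show "wpt (IfPos (tmp d) (c_com b d) (c_com c d)) (\<lambda>u s'. t + u \<le> t_com (When e b c) N \<and>
       rel N (den N (When e b c) st) s' \<and> (\<forall>d'<d. s' (tmp d') = s (tmp d'))) s'"
      using ok p(3) by simp
  qed
next
  case (For v f c)
  then have "com_ok N c" "\<And>st. exp_ok N st f" by (auto intro: c_exp)
  then show ?case using c_for[of N c] unfolding com_ok_def[of N "For v f c"] by blast
qed

section \<open>Polynomial time\<close>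

definition poly_bdd :: "(nat \<Rightarrow> nat) \<Rightarrow> bool" where
  "poly_bdd f \<longleftrightarrow> (\<exists>p :: nat poly. \<forall>N. f N \<le> poly p N)"

lemma poly_bdd_const: "poly_bdd (\<lambda>_. c)"
  unfolding poly_bdd_def by (rule exI[of _ "[:c:]"]) simp

lemma poly_bdd_id: "poly_bdd (\<lambda>N. N)"
  unfolding poly_bdd_def by (rule exI[of _ "[:0, 1:]"]) simp

lemma poly_bdd_add: "poly_bdd f \<Longrightarrow> poly_bdd g \<Longrightarrow> poly_bdd (\<lambda>N. f N + g N)"
  unfolding poly_bdd_def by (metis add_mono poly_add)

lemma poly_bdd_mult: "poly_bdd f \<Longrightarrow> poly_bdd g \<Longrightarrow> poly_bdd (\<lambda>N. f N * g N)"
  unfolding poly_bdd_def by (metis mult_le_mono poly_mult)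

lemmas poly_bdd = poly_bdd_const poly_bdd_id poly_bdd_add poly_bdd_mult

lemma poly_bdd_exp: "poly_bdd (\<lambda>N. t_exp e N)"
  by (induction e) (auto intro!: poly_bdd simp del: One_nat_def)

lemma poly_bdd_com: "poly_bdd (\<lambda>N. t_com c N)"
  by (induction c) (auto intro!: poly_bdd poly_bdd_exp simp del: One_nat_def)

section \<open>The flow formulation\<close>

text \<open>A column \<open>l < b ^ 5\<close> of the constraint matrix is an arc whose digits in base \<open>b\<close> are the candidate,
  the score index, the number \<open>c\<close> and the total score \<open>s\<close> of the votes on smaller indices, and the number \<open>d\<close> of
  votes on the present index. The column \<open>b ^ 5\<close> is the homogenising constant. The rows below
  \<open>b ^ 4\<close> are flow conservation at the nodes, the later ones are the covering constraints.\<close>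

definition node :: "nat \<Rightarrow> nat \<Rightarrow> nat \<Rightarrow> nat \<Rightarrow> nat \<Rightarrow> nat" where
  "node b i j c s = ((i * b + j) * b + c) * b + s"

definition dig_d :: "nat \<Rightarrow> nat \<Rightarrow> nat" where "dig_d b l = l mod b"
definition dig_s :: "nat \<Rightarrow> nat \<Rightarrow> nat" where "dig_s b l = l div b mod b"
definition dig_c :: "nat \<Rightarrow> nat \<Rightarrow> nat" where "dig_c b l = l div b div b mod b"
definition dig_j :: "nat \<Rightarrow> nat \<Rightarrow> nat" where "dig_j b l = l div b div b div b mod b"
definition dig_i :: "nat \<Rightarrow> nat \<Rightarrow> nat" where "dig_i b l = l div b div b div b div b"
text \<open>The tail of the arc is \<open>l div b\<close>. The three summands raise the index, vote
  and score digits of the tail, without a carry if the arc is valid. The default 0 agrees with the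
  program, whose score array is 0 beyond the last score.\<close>

definition head :: "nat list \<Rightarrow> nat \<Rightarrow> nat \<Rightarrow> nat" where
  "head \<alpha> b l = l div b + b * b + dig_d b l * b +
     dig_d b l * (if dig_j b l < length \<alpha> then \<alpha> ! dig_j b l else 0)"

text \<open>The clauses for the first and the last index force a path through all layers to begin at
  the node \<open>(i, 0, 0, 0)\<close> and to end with \<open>k\<close> votes and an admissible
  score, so such paths are the configurations of candidate \<open>i\<close>.\<close>

definition valid :: "nat list \<Rightarrow> int list \<Rightarrow> nat \<Rightarrow> int \<Rightarrow> nat \<Rightarrow> nat \<Rightarrow> bool" where
  "valid \<alpha> \<sigma> k T b l \<longleftrightarrow> dig_i b l < length \<alpha> \<and> dig_j b l < length \<alpha> \<and>
     (dig_j b l = 0 \<longrightarrow> dig_c b l = 0 \<and> dig_s b l = 0) \<and>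
     dig_c b l + dig_d b l \<le> k \<and> dig_s b l + dig_d b l * \<alpha> ! dig_j b l < b \<and>
     (dig_j b l + 1 = length \<alpha> \<longrightarrow> dig_c b l + dig_d b l = k \<and>
        int (dig_s b l + dig_d b l * \<alpha> ! dig_j b l) \<le> T - \<sigma> ! dig_i b l)"

text \<open>A row below \<open>b ^ 4\<close> is inflow minus outflow, where the homogenising column
  supplies one unit to every source \<open>i * b ^ 3\<close>. Nodes beyond layer
  \<open>m - 1\<close> have zero rows, so paths may end there.\<close>

definition amat :: "nat list \<Rightarrow> nat \<Rightarrow> nat \<Rightarrow> nat \<Rightarrow> nat \<Rightarrow> int" where
  "amat \<alpha> k b r l =
    (if r < b ^ 4 then
       (if r div b div b mod b < length \<alpha> then
          (if l = b ^ 5 then of_bool (r mod b ^ 3 = 0 \<and> r div b ^ 3 < length \<alpha>)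
           else of_bool (r = head \<alpha> b l) - of_bool (r = l div b))
        else 0)
     else if l = b ^ 5 then - int k else of_bool (dig_j b l = r - b ^ 4) * int (dig_d b l))"

section \<open>Configurations as paths\<close>

definition cnt :: "nat list \<Rightarrow> nat \<Rightarrow> nat" where "cnt C j = (\<Sum>t<j. C ! t)"
definition wgt :: "nat list \<Rightarrow> nat list \<Rightarrow> nat \<Rightarrow> nat" where "wgt \<alpha> C j = (\<Sum>t<j. C ! t * \<alpha> ! t)"

definition path_node :: "nat list \<Rightarrow> nat \<Rightarrow> nat \<Rightarrow> nat \<Rightarrow> nat list \<Rightarrow> nat" where
  "path_node \<alpha> b i j C = node b i j (cnt C j) (wgt \<alpha> C j)"
definition arc :: "nat list \<Rightarrow> nat \<Rightarrow> nat \<Rightarrow> nat \<Rightarrow> nat list \<Rightarrow> nat" where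
  "arc \<alpha> b i j C = path_node \<alpha> b i j C * b + C ! j"

text \<open>The inequalities say that all digits of nodes on configuration paths fit into base
  \<open>b\<close>: the index goes up to \<open>m\<close>, the votes up to \<open>k\<close>, the
  score up to \<open>k * amax\<close>.\<close>

locale lp_instance =
  fixes \<alpha> :: "nat list" and \<sigma> :: "int list" and k :: nat and T :: int and b amax :: nat
  assumes m_pos: "0 < length \<alpha>" and k_pos: "0 < k"
    and m_b: "length \<alpha> < b" and k_b: "k < b"
    and amax: "\<And>j. j < length \<alpha> \<Longrightarrow> \<alpha> ! j \<le> amax" and ka_b: "k * amax < b"
begin

abbreviation "m \<equiv> length \<alpha>"
abbreviation "BC i \<equiv> bounded_configs \<alpha> \<sigma> k T i"
abbreviation "R \<equiv> b ^ 4 + m"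
abbreviation "arcs \<equiv> {l. valid \<alpha> \<sigma> k T b l}"
abbreviation "S0 \<equiv> insert (b ^ 5) arcs"
abbreviation "A \<equiv> amat \<alpha> k b"

lemma b_pos: "0 < b" using m_b by simp

lemma node_digits:
  assumes "j < b" "c < b" "s < b"
  shows "node b i j c s mod b = s" "node b i j c s div b mod b = c"
    "node b i j c s div b div b mod b = j" "node b i j c s div b div b div b = i"
  using assms by (simp_all add: node_def)

lemma node_lt: assumes "i < b" "j < b" "c < b" "s < b" shows "node b i j c s < b ^ 4"
proof -
  have *: "x * b + y < B * b" if "x < B" "y < b" for x y B :: nat
  proof -
    have "(x + 1) * b \<le> B * b" using that by (intro mult_right_mono) auto
    then show ?thesis using that by simp
  qed
  have "node b i j c s < b * b * b * b"
    unfolding node_def by (intro * assms)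
  then show ?thesis by (simp add: power4_eq_xxxx)
qed

lemma arc_digits:
  assumes "j < b" "c < b" "s < b" "d < b"
  shows "dig_d b (node b i j c s * b + d) = d" "dig_s b (node b i j c s * b + d) = s"
    "dig_c b (node b i j c s * b + d) = c" "dig_j b (node b i j c s * b + d) = j"
    "dig_i b (node b i j c s * b + d) = i" "(node b i j c s * b + d) div b = node b i j c s"
  using assms node_digits[of j c s] by (simp_all add: dig_d_def dig_s_def dig_c_def dig_j_def dig_i_def)

lemma tail_node: "l div b = node b (dig_i b l) (dig_j b l) (dig_c b l) (dig_s b l)"
  by (simp add: node_def dig_i_def dig_j_def dig_c_def dig_s_def)

lemma dig_lt: "dig_d b l < b" "dig_s b l < b" "dig_c b l < b" "dig_j b l < b"
  using b_pos by (simp_all add: dig_d_def dig_s_def dig_c_def dig_j_def)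

lemma head_node: "dig_j b l < m \<Longrightarrow> head \<alpha> b l = node b (dig_i b l) (dig_j b l + 1) (dig_c b l + dig_d b l)
    (dig_s b l + dig_d b l * \<alpha> ! dig_j b l)"
  unfolding head_def tail_node[of l] by (simp add: node_def algebra_simps)

lemma valid_lt: assumes "valid \<alpha> \<sigma> k T b l" shows "l < b ^ 5"
proof -
  have "l div b < b ^ 4"
    unfolding tail_node using assms dig_lt m_b by (intro node_lt) (auto simp: valid_def)
  then have "l < b ^ 4 * b" using b_pos by (simp add: div_less_iff_less_mult)
  then show ?thesis by (simp add: numeral_eq_Suc mult.commute)
qed

lemma valid_head:
  assumes "valid \<alpha> \<sigma> k T b l"
  shows "head \<alpha> b l < b ^ 4" "head \<alpha> b l div b div b mod b = dig_j b l + 1"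
proof -
  have "dig_j b l < m" "dig_i b l < b" "dig_j b l + 1 < b" "dig_c b l + dig_d b l < b"
    "dig_s b l + dig_d b l * \<alpha> ! dig_j b l < b"
    using assms m_b k_b by (auto simp: valid_def)
  then show "head \<alpha> b l < b ^ 4" "head \<alpha> b l div b div b mod b = dig_j b l + 1"
    using head_node[of l] by (auto intro: node_lt simp: node_digits)
qed

lemma finite_V: "finite arcs"
  by (rule finite_subset[of _ "{..<b ^ 5}"]) (auto dest: valid_lt)

lemma S0_sub: "S0 \<subseteq> {..<b ^ 5 + 1}" by (auto dest: valid_lt intro: less_trans)

lemma b5_V: "b ^ 5 \<notin> arcs" using valid_lt by blast

lemma amat_le: "\<bar>A r l\<bar> \<le> int b"
proof -
  have 1: "1 \<le> int b" using b_pos by simp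
  have 2: "\<bar>of_bool P - of_bool Q\<bar> \<le> int b" "\<bar>of_bool P :: int\<bar> \<le> int b" for P Q
    using 1 by (cases P; cases Q; simp)+
  have 3: "\<bar>of_bool P * int (dig_d b l)\<bar> \<le> int b" "\<bar>- int k\<bar> \<le> int b" for P
    using dig_lt(1)[of l] k_b by (cases P; simp)+
  show ?thesis
    unfolding amat_def
    by (cases "r < b ^ 4"; cases "r div b div b mod b < m"; cases "l = b ^ 5";
        simp only: refl if_True if_False 2 3 abs_zero of_nat_0_le_iff)
qed

lemma config_sum: assumes "C \<in> BC i" shows "length C = m" "cnt C m = k" "int (wgt \<alpha> C m) \<le> T - \<sigma> ! i"
proof -
  show l: "length C = m" using assms by (simp add: bounded_configs_def configs_def)
  show "cnt C m = k" using assms l by (simp add: bounded_configs_def configs_def cnt_def sum_list_sum_nth atLeast0LessThan)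
  show "int (wgt \<alpha> C m) \<le> T - \<sigma> ! i" using assms by (simp add: bounded_configs_def wgt_def)
qed

lemma cnt_mono: "j \<le> j' \<Longrightarrow> cnt C j \<le> cnt C j'"
  unfolding cnt_def by (intro sum_mono2) auto

lemma wgt_le: assumes "j \<le> m" shows "wgt \<alpha> C j \<le> cnt C j * amax"
  unfolding wgt_def cnt_def sum_distrib_right using assms amax by (intro sum_mono mult_left_mono) auto

lemma wgt_lt: assumes "j \<le> m" "cnt C j \<le> k" shows "wgt \<alpha> C j < b"
proof -
  have "wgt \<alpha> C j \<le> k * amax" using wgt_le[OF assms(1), of C] assms(2) mult_le_mono1 order_trans by blast
  then show ?thesis using ka_b by simp
qed

lemma path_bounds:
  assumes "C \<in> BC i" "j \<le> m"
  shows "cnt C j \<le> k" "wgt \<alpha> C j < b"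
  using cnt_mono[OF assms(2), of C] config_sum(2)[OF assms(1)] wgt_lt[OF assms(2), of C] by auto

lemma cnt_Suc: "cnt C (Suc j) = cnt C j + C ! j" and wgt_Suc: "wgt \<alpha> C (Suc j) = wgt \<alpha> C j + C ! j * \<alpha> ! j"
  by (simp_all add: cnt_def wgt_def)

lemma cnt_wgt_0: "cnt C 0 = 0" "wgt \<alpha> C 0 = 0"
  by (simp_all add: cnt_def wgt_def)

lemma path_arc:
  assumes C: "C \<in> BC i" and i: "i < m" and j: "j < m"
  shows "arc \<alpha> b i j C div b = path_node \<alpha> b i j C" "head \<alpha> b (arc \<alpha> b i j C) = path_node \<alpha> b i (Suc j) C"
    "dig_j b (arc \<alpha> b i j C) = j" "dig_d b (arc \<alpha> b i j C) = C ! j" "valid \<alpha> \<sigma> k T b (arc \<alpha> b i j C)"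
proof -
  have b1: "cnt C j \<le> k" "wgt \<alpha> C j < b" "cnt C (Suc j) \<le> k" "wgt \<alpha> C (Suc j) < b"
    using path_bounds[OF C, of j] path_bounds[OF C, of "Suc j"] j by auto
  then have lt: "j < b" "cnt C j < b" "wgt \<alpha> C j < b" "C ! j < b" using j m_b k_b by (auto simp: cnt_Suc)
  note d = arc_digits[OF lt, of i, folded path_node_def, folded arc_def]
  show "arc \<alpha> b i j C div b = path_node \<alpha> b i j C" "dig_j b (arc \<alpha> b i j C) = j"
    "dig_d b (arc \<alpha> b i j C) = C ! j" using d by (simp_all add: path_node_def)
  show "head \<alpha> b (arc \<alpha> b i j C) = path_node \<alpha> b i (Suc j) C"
    using head_node[of "arc \<alpha> b i j C"] j unfolding d by (simp add: path_node_def cnt_Suc wgt_Suc)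
  have last: "j + 1 = m \<Longrightarrow> cnt C (Suc j) = k \<and> int (wgt \<alpha> C (Suc j)) \<le> T - \<sigma> ! i"
    using config_sum[OF C] by simp
  show "valid \<alpha> \<sigma> k T b (arc \<alpha> b i j C)"
    unfolding valid_def d using i j b1 last cnt_Suc[of C j] wgt_Suc[of C j] cnt_wgt_0[of C] by auto
qed

text \<open>In a node row the path telescopes: inner nodes cancel, the end lies in layer
  \<open>m\<close>, where rows are zero, and one unit of outflow at the source remains. A covering
  row sees only the arc at its own index.\<close>

lemma row_path:
  assumes C: "C \<in> BC i" and i: "i < m"
  shows "(\<Sum>j<m. A r (arc \<alpha> b i j C)) =
     (if r < b ^ 4 then - of_bool (r = node b i 0 0 0) else if r - b ^ 4 < m then int (C ! (r - b ^ 4)) else 0)"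
proof -
  have ne: "arc \<alpha> b i j C \<noteq> b ^ 5" if "j < m" for j
    using path_arc(5)[OF C i that] b5_V by auto
  show ?thesis
  proof (cases "r < b ^ 4")
    case True
    show ?thesis
    proof (cases "r div b div b mod b < m")
      case lay: True
      have "(\<Sum>j<m. A r (arc \<alpha> b i j C)) =
         (\<Sum>j<m. of_bool (r = path_node \<alpha> b i (Suc j) C) - of_bool (r = path_node \<alpha> b i j C))"
        using True lay ne path_arc[OF C i] by (intro sum.cong) (auto simp: amat_def)
      also have "\<dots> = of_bool (r = path_node \<alpha> b i m C) - of_bool (r = path_node \<alpha> b i 0 C)"
        by (rule sum_lessThan_telescope)
      finally have eq: "(\<Sum>j<m. A r (arc \<alpha> b i j C)) =
         of_bool (r = path_node \<alpha> b i m C) - of_bool (r = path_node \<alpha> b i 0 C)" .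
      have "r \<noteq> path_node \<alpha> b i m C"
        using lay node_digits(3)[of m "cnt C m" "wgt \<alpha> C m" i] path_bounds[OF C, of m] m_b k_b
        by (auto simp: path_node_def)
      then show ?thesis using True unfolding eq by (simp add: path_node_def cnt_def wgt_def)
    next
      case lay: False
      then have "r \<noteq> node b i 0 0 0" using node_digits(3)[of 0 0 0 i] b_pos m_pos by auto
      then show ?thesis using True lay by (simp add: amat_def)
    qed
  next
    case False
    have "(\<Sum>j<m. A r (arc \<alpha> b i j C)) = (\<Sum>j<m. if j = r - b ^ 4 then int (C ! j) else 0)"
      using False ne path_arc[OF C i] by (intro sum.cong) (auto simp: amat_def)
    then show ?thesis using False by (simp add: sum.delta)
  qed
qed

lemma source_row:
  assumes "r < b ^ 4"
  shows "A r (b ^ 5) = (\<Sum>i<m. of_bool (r = node b i 0 0 0))"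
proof -
  have n: "node b i 0 0 0 = i * b ^ 3" for i by (simp add: node_def power3_eq_cube)
  show ?thesis
  proof (cases "r mod b ^ 3 = 0 \<and> r div b ^ 3 < m")
    case True
    then have r: "r = node b (r div b ^ 3) 0 0 0" unfolding n by auto
    have "r div b div b mod b = 0" by (subst r, subst node_digits) (use b_pos in auto)
    moreover have "(\<Sum>i<m. of_bool (r = node b i 0 0 0)) = (\<Sum>i<m. if i = r div b ^ 3 then 1 else (0::int))"
      using b_pos True by (intro sum.cong) (auto simp: n)
    ultimately show ?thesis using True assms m_pos by (simp add: amat_def)
  next
    case False
    have "r \<noteq> node b i 0 0 0" if "i < m" for i
      using False that b_pos by (auto simp: n)
    then show ?thesis using False assms by (simp add: amat_def sum.neutral)
  qed
qed

lemma feasible_tight: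
  assumes "lp_feasible \<alpha> \<sigma> k T x"
  shows "i < m \<Longrightarrow> (\<Sum>C\<in>BC i. x i C) = 1"
    "j < m \<Longrightarrow> (\<Sum>i<m. \<Sum>C\<in>BC i. real (C ! j) * x i C) = real k"
proof -
  let ?w = "\<lambda>i. \<Sum>C\<in>BC i. x i C"
  let ?c = "\<lambda>j. \<Sum>i<m. \<Sum>C\<in>BC i. real (C ! j) * x i C"
  have w: "?w i \<le> 1" if "i < m" for i using assms that by (simp add: lp_feasible_def)
  have c: "real k \<le> ?c j" if "j < m" for j using assms that by (simp add: lp_feasible_def)
  \<comment> \<open>Every configuration has \<open>k\<close> votes, so the coverings add up to
    \<open>k\<close> times the total weight. The covering constraints make this weight at least
    \<open>m\<close>, the other ones at most \<open>m\<close>.\<close>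
  have "(\<Sum>j<m. ?c j) = (\<Sum>i<m. \<Sum>C\<in>BC i. (\<Sum>j<m. real (C ! j)) * x i C)"
    unfolding sum_distrib_right by (subst sum.swap, rule sum.cong[OF refl], rule sum.swap)
  also have "\<dots> = (\<Sum>i<m. \<Sum>C\<in>BC i. real k * x i C)"
  proof (intro sum.cong refl)
    fix i C assume "C \<in> BC i"
    then have "(\<Sum>j<m. C ! j) = k" using config_sum(2) by (simp add: cnt_def)
    then show "(\<Sum>j<m. real (C ! j)) * x i C = real k * x i C" by (simp flip: of_nat_sum)
  qed
  also have "\<dots> = real k * (\<Sum>i<m. ?w i)" by (simp add: sum_distrib_left)
  finally have tot: "(\<Sum>j<m. ?c j) = real k * (\<Sum>i<m. ?w i)" .
  have "(\<Sum>j<m. real k) \<le> (\<Sum>j<m. ?c j)" using c by (intro sum_mono) auto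
  then have "real k * real m \<le> real k * (\<Sum>i<m. ?w i)" using tot by (simp add: mult.commute)
  then have g: "real m \<le> (\<Sum>i<m. ?w i)" using k_pos by simp
  have l: "(\<Sum>i<m. ?w i) \<le> (\<Sum>i<m. 1)" using w by (intro sum_mono) auto
  have "(\<Sum>i<m. 1 - ?w i) = 0" using g l by (simp add: sum_subtractf)
  then have "\<forall>i\<in>{..<m}. 1 - ?w i = 0" using w by (subst (asm) sum_nonneg_eq_0_iff) auto
  then show "i < m \<Longrightarrow> ?w i = 1" by auto
  have "(\<Sum>i<m. ?w i) = real m" using g l by simp
  then have "(\<Sum>j<m. ?c j - real k) = 0" using tot by (simp add: sum_subtractf)
  then have "\<forall>j\<in>{..<m}. ?c j - real k = 0" using c by (subst (asm) sum_nonneg_eq_0_iff) auto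
  then show "j < m \<Longrightarrow> ?c j = real k" by auto
qed

lemma path_indicator_sum:
  fixes F :: "nat \<Rightarrow> 'a::comm_ring_1"
  assumes C: "C \<in> BC i" and i: "i < m"
  shows "(\<Sum>l\<in>arcs. F l * (\<Sum>j<m. of_bool (arc \<alpha> b i j C = l))) = (\<Sum>j<m. F (arc \<alpha> b i j C))"
proof -
  have "(\<Sum>l\<in>arcs. F l * (\<Sum>j<m. of_bool (arc \<alpha> b i j C = l))) = (\<Sum>j<m. \<Sum>l\<in>arcs. F l * of_bool (arc \<alpha> b i j C = l))"
    unfolding sum_distrib_left by (rule sum.swap)
  also have "\<dots> = (\<Sum>j<m. F (arc \<alpha> b i j C))"
  proof (rule sum.cong[OF refl])
    fix j assume "j \<in> {..<m}"
    then have v: "arc \<alpha> b i j C \<in> arcs" using path_arc(5)[OF C i] by simp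
    show "(\<Sum>l\<in>arcs. F l * of_bool (arc \<alpha> b i j C = l)) = F (arc \<alpha> b i j C)"
      by (subst sum.remove[OF finite_V v]) (auto intro: sum.neutral)
  qed
  finally show ?thesis .
qed

text \<open>An arc carries the total weight of the configurations whose paths use it, and the
  homogenising coordinate is 1. The supply of exactly one unit per candidate, and of exactly
  \<open>k\<close> per index, is where tightness enters.\<close>

lemma flow_of_solution:
  assumes x: "lp_feasible \<alpha> \<sigma> k T x"
  shows "\<exists>X. kern A {..<R} S0 X \<and> (\<forall>l. 0 \<le> X l) \<and> 0 < X (b ^ 5)"
proof -
  define X where "X l = (if l = b ^ 5 then 1 else
    if l \<in> arcs then \<Sum>i<m. \<Sum>C\<in>BC i. x i C * (\<Sum>j<m. of_bool (arc \<alpha> b i j C = l)) else 0)" for l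
  have nn: "0 \<le> X l" for l
    unfolding X_def using x by (auto simp: lp_feasible_def intro!: sum_nonneg)
  have "(\<Sum>l\<in>S0. real_of_int (A r l) * X l) = 0" if r: "r < R" for r
  proof -
    have "(\<Sum>l\<in>arcs. real_of_int (A r l) * X l) =
      (\<Sum>l\<in>arcs. \<Sum>i<m. \<Sum>C\<in>BC i. x i C * (real_of_int (A r l) * (\<Sum>j<m. of_bool (arc \<alpha> b i j C = l))))"
      using b5_V by (intro sum.cong) (auto simp: X_def sum_distrib_left mult.left_commute)
    also have "\<dots> = (\<Sum>i<m. \<Sum>l\<in>arcs. \<Sum>C\<in>BC i. x i C * (real_of_int (A r l) * (\<Sum>j<m. of_bool (arc \<alpha> b i j C = l))))"
      by (rule sum.swap)
    also have "\<dots> = (\<Sum>i<m. \<Sum>C\<in>BC i. \<Sum>l\<in>arcs. x i C * (real_of_int (A r l) * (\<Sum>j<m. of_bool (arc \<alpha> b i j C = l))))"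
      by (rule sum.cong[OF refl], rule sum.swap)
    also have "\<dots> = (\<Sum>i<m. \<Sum>C\<in>BC i. x i C * real_of_int (\<Sum>j<m. A r (arc \<alpha> b i j C)))"
    proof (intro sum.cong refl)
      fix i C assume "i \<in> {..<m}" "C \<in> BC i"
      then have "(\<Sum>l\<in>arcs. real_of_int (A r l) * (\<Sum>j<m. of_bool (arc \<alpha> b i j C = l))) = (\<Sum>j<m. real_of_int (A r (arc \<alpha> b i j C)))"
        by (intro path_indicator_sum) auto
      then show "(\<Sum>l\<in>arcs. x i C * (real_of_int (A r l) * (\<Sum>j<m. of_bool (arc \<alpha> b i j C = l)))) =
          x i C * real_of_int (\<Sum>j<m. A r (arc \<alpha> b i j C))"
        by (simp only: sum_distrib_left[symmetric] of_int_sum)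
    qed
    finally have arcs: "(\<Sum>l\<in>arcs. real_of_int (A r l) * X l) =
      (\<Sum>i<m. \<Sum>C\<in>BC i. x i C * real_of_int (\<Sum>j<m. A r (arc \<alpha> b i j C)))" .
    have "(\<Sum>l\<in>S0. real_of_int (A r l) * X l) = real_of_int (A r (b ^ 5)) + (\<Sum>l\<in>arcs. real_of_int (A r l) * X l)"
      using finite_V b5_V by (simp add: X_def)
    also have "\<dots> = 0"
    proof (cases "r < b ^ 4")
      case True
      have "(\<Sum>l\<in>arcs. real_of_int (A r l) * X l) = (\<Sum>i<m. \<Sum>C\<in>BC i. x i C * (- of_bool (r = node b i 0 0 0)))"
        unfolding arcs using True by (intro sum.cong refl) (simp add: row_path)
      also have "\<dots> = (\<Sum>i<m. - of_bool (r = node b i 0 0 0) * (\<Sum>C\<in>BC i. x i C))"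
        by (simp only: mult.commute[of "- of_bool _"] sum_distrib_right)
      also have "\<dots> = (\<Sum>i<m. - of_bool (r = node b i 0 0 0))"
        using feasible_tight(1)[OF x] by (intro sum.cong) auto
      finally show ?thesis unfolding source_row[OF True] by (simp add: sum_negf)
    next
      case False
      then have j: "r - b ^ 4 < m" using r by simp
      have "(\<Sum>l\<in>arcs. real_of_int (A r l) * X l) = (\<Sum>i<m. \<Sum>C\<in>BC i. real (C ! (r - b ^ 4)) * x i C)"
        unfolding arcs using False j by (intro sum.cong refl) (simp add: row_path)
      also have "\<dots> = real k" by (rule feasible_tight(2)[OF x j])
      finally show ?thesis using False by (simp add: amat_def)
    qed
    finally show ?thesis .
  qed
  then have "kern A {..<R} S0 X" unfolding kern_def by blast
  then show ?thesis using nn by (intro exI[of _ X]) (simp add: X_def)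
qed

section \<open>Path decomposition\<close>

definition paths :: "lp_entry list \<Rightarrow> nat \<Rightarrow> int" where
  "paths es l = (\<Sum>(i, C, a, D)\<leftarrow>es. a * (\<Sum>j<m. of_bool (arc \<alpha> b i j C = l)))"

text \<open>Conservation is asked only beyond layer 0, so that removing a path, which lowers the
  outflow of its source, again leaves a flow.\<close>

definition is_flow :: "(nat \<Rightarrow> int) \<Rightarrow> bool" where
  "is_flow X \<longleftrightarrow> (\<forall>l. 0 \<le> X l) \<and> (\<forall>l. l \<notin> arcs \<longrightarrow> X l = 0) \<and>
     (\<forall>r<b ^ 4. 0 < r div b div b mod b \<longrightarrow> (\<Sum>l\<in>arcs. A r l * X l) = 0)"

text \<open>The invariant of the extraction: in every row, \<open>D\<close> times the homogenising
  column, the residual flow and the paths taken so far cancel. With the common denominator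
  \<open>D\<close> all amounts stay integers.\<close>

definition decomposed :: "int \<Rightarrow> (nat \<Rightarrow> int) \<Rightarrow> lp_entry list \<Rightarrow> bool" where
  "decomposed D X es \<longleftrightarrow> 0 < D \<and> is_flow X \<and>
     (\<forall>(i, C, a, D')\<in>set es. i < m \<and> C \<in> BC i \<and> 0 \<le> a \<and> D' = D) \<and>
     (\<forall>r<R. A r (b ^ 5) * D + (\<Sum>l\<in>arcs. A r l * X l) + (\<Sum>(i, C, a, D')\<leftarrow>es. a * (\<Sum>j<m. A r (arc \<alpha> b i j C))) = 0)"

lemma sum_V_split:
  assumes "r < b ^ 4" "r div b div b mod b < m"
  shows "(\<Sum>l\<in>arcs. A r l * X l) = (\<Sum>l\<in>arcs. of_bool (r = head \<alpha> b l) * X l) - (\<Sum>l\<in>arcs. of_bool (r = l div b) * X l)"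
proof -
  have "(\<Sum>l\<in>arcs. A r l * X l) = (\<Sum>l\<in>arcs. of_bool (r = head \<alpha> b l) * X l - of_bool (r = l div b) * X l)"
    using assms b5_V by (intro sum.cong) (auto simp: amat_def)
  then show ?thesis by (simp add: sum_subtractf)
qed

text \<open>The head of \<open>l\<close> receives flow and lies in a layer from 1 to
  \<open>m - 1\<close>, where conservation holds, so some arc leaving it carries flow.\<close>

lemma flow_next:
  assumes X: "is_flow X" and l: "0 < X l" "dig_j b l + 1 < m"
  shows "\<exists>d<b. 0 < X (head \<alpha> b l * b + d)"
proof (rule ccontr)
  assume no: "\<not> ?thesis"
  have v: "l \<in> arcs" using X l by (force simp: is_flow_def)
  define r where "r = head \<alpha> b l"
  have r: "r < b ^ 4" "r div b div b mod b = dig_j b l + 1" using v valid_head[of l] by (auto simp: r_def)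
  have "(\<Sum>l\<in>arcs. A r l * X l) = 0" using X r by (simp add: is_flow_def)
  then have e: "(\<Sum>l\<in>arcs. of_bool (r = head \<alpha> b l) * X l) = (\<Sum>l\<in>arcs. of_bool (r = l div b) * X l)"
    using sum_V_split[OF r(1), of X] r(2) l(2) by simp
  have "X l \<le> (\<Sum>l\<in>arcs. of_bool (r = head \<alpha> b l) * X l)"
    using member_le_sum[OF v, of "\<lambda>l. of_bool (r = head \<alpha> b l) * X l"] X finite_V by (auto simp: r_def is_flow_def)
  moreover have "(\<Sum>l\<in>arcs. of_bool (r = l div b) * X l) = 0"
  proof (intro sum.neutral ballI)
    fix l' assume "l' \<in> arcs"
    have "X l' = 0" if "r = l' div b"
    proof -
      have "l' = r * b + l' mod b" "l' mod b < b" using that b_pos by auto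
      then have "\<not> 0 < X l'" using no unfolding r_def by metis
      then show ?thesis using X by (metis is_flow_def antisym not_less)
    qed
    then show "of_bool (r = l' div b) * X l' = 0" by simp
  qed
  ultimately show False using e l(1) by simp
qed

text \<open>Converse of \<open>path_arc\<close>: by induction the tail of \<open>L j\<close> records
  the prefix sums of \<open>C\<close>, so validity of the last arc says that \<open>C\<close> has
  \<open>k\<close> votes and an admissible score.\<close>

lemma path_of_arcs:
  assumes v: "\<And>j. j < m \<Longrightarrow> valid \<alpha> \<sigma> k T b (L j)" and j0: "dig_j b (L 0) = 0"
    and step: "\<And>j. Suc j < m \<Longrightarrow> L (Suc j) div b = head \<alpha> b (L j)"
  defines "C \<equiv> map (\<lambda>j. dig_d b (L j)) [0..<m]" and "i \<equiv> dig_i b (L 0)"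
  shows "i < m" "C \<in> BC i" "j < m \<Longrightarrow> L j = arc \<alpha> b i j C"
proof -
  show i: "i < m" using v[of 0] m_pos by (simp add: valid_def i_def)
  have Cj: "C ! j = dig_d b (L j)" if "j < m" for j using that by (simp add: C_def)
  have key: "L j div b = path_node \<alpha> b i j C \<and> cnt C j \<le> k \<and> wgt \<alpha> C j < b" if "j < m" for j
    using that
  proof (induction j)
    case 0
    have "dig_c b (L 0) = 0" "dig_s b (L 0) = 0" using v[OF 0] j0 unfolding valid_def by blast+
    then have "L 0 div b = path_node \<alpha> b i 0 C"
      using tail_node[of "L 0"] j0 by (simp only: path_node_def cnt_wgt_0 i_def)
    then show ?case using b_pos by (simp add: cnt_wgt_0)
  next
    case (Suc j)
    then have IH: "L j div b = path_node \<alpha> b i j C" "cnt C j \<le> k" "wgt \<alpha> C j < b" and j: "j < m" by auto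
    have lt: "j < b" "cnt C j < b" "wgt \<alpha> C j < b" "dig_d b (L j) < b" using j IH m_b k_b dig_lt by auto
    have Lj: "node b i j (cnt C j) (wgt \<alpha> C j) * b + dig_d b (L j) = L j"
      unfolding dig_d_def path_node_def[symmetric] IH(1)[symmetric] by (rule div_mult_mod_eq)
    note d = arc_digits[OF lt, of i, unfolded Lj]
    have "head \<alpha> b (L j) = path_node \<alpha> b i (Suc j) C"
      using head_node[of "L j"] j unfolding d(2-5) by (simp add: path_node_def cnt_Suc wgt_Suc Cj[OF j])
    moreover have "cnt C (Suc j) \<le> k" "wgt \<alpha> C (Suc j) < b"
      using v[OF j] unfolding valid_def cnt_Suc wgt_Suc Cj[OF j] d(2-4) by blast+
    ultimately show ?case using step[OF Suc.prems] by simp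
  qed
  have L: "arc \<alpha> b i j C = L j" if "j < m" for j
    unfolding arc_def Cj[OF that] dig_d_def conjunct1[OF key[OF that], symmetric] by (rule div_mult_mod_eq)
  then show "j < m \<Longrightarrow> L j = arc \<alpha> b i j C" by simp
  define j where "j = m - 1"
  have j: "j < m" "Suc j = m" using m_pos by (auto simp: j_def)
  have lt: "j < b" "cnt C j < b" "wgt \<alpha> C j < b" "C ! j < b" using j key[OF j(1)] m_b k_b dig_lt Cj by auto
  note d = arc_digits[OF lt, of i, folded path_node_def, folded arc_def, unfolded L[OF j(1)]]
  have "cnt C (Suc j) = k" "int (wgt \<alpha> C (Suc j)) \<le> T - \<sigma> ! i"
    using v[OF j(1)] d j cnt_Suc[of C j] wgt_Suc[of C j] unfolding valid_def by auto
  then have "sum_list C = k" "(\<Sum>t<m. int (C ! t) * int (\<alpha> ! t)) \<le> T - \<sigma> ! i"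
    unfolding j by (simp_all add: cnt_def wgt_def sum_list_sum_nth atLeast0LessThan C_def)
  then show "C \<in> BC i" by (simp add: bounded_configs_def configs_def C_def)
qed

lemma decomposed_step:
  assumes dec: "decomposed D X es" and C: "C \<in> BC i" and i: "i < m"
    and a: "0 < a" "\<And>j. j < m \<Longrightarrow> a \<le> X (arc \<alpha> b i j C)"
  shows "decomposed D (\<lambda>l. X l - a * (\<Sum>j<m. of_bool (arc \<alpha> b i j C = l))) (es @ [(i, C, a, D)])"
proof -
  let ?I = "\<lambda>l. \<Sum>j<m. of_bool (arc \<alpha> b i j C = l) :: int"
  let ?X = "\<lambda>l. X l - a * ?I l"
  have X: "is_flow X" using dec by (simp add: decomposed_def)
  \<comment> \<open>The arcs of a path lie in different layers, so none is counted twice.\<close>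
  have I1: "?I l = 1" if "l = arc \<alpha> b i j C" "j < m" for l j
  proof -
    have "?I l = (\<Sum>j'<m. if j' = j then 1 else 0)"
      using that path_arc(3)[OF C i] by (intro sum.cong) (auto, metis)
    then show ?thesis using that by simp
  qed
  have I0: "?I l = 0" if "\<And>j. j < m \<Longrightarrow> l \<noteq> arc \<alpha> b i j C" for l
    using that by (intro sum.neutral) auto
  have nn: "0 \<le> ?X l" for l
  proof (cases "\<exists>j<m. l = arc \<alpha> b i j C")
    case True
    then obtain j where j: "j < m" "l = arc \<alpha> b i j C" by blast
    show ?thesis using I1[OF j(2,1)] a(2)[OF j(1)] j(2) by simp
  next
    case False
    then have "?I l = 0" by (intro I0) auto
    moreover have "0 \<le> X l" using X by (simp add: is_flow_def)
    ultimately show ?thesis by simp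
  qed
  have out: "?X l = 0" if "l \<notin> arcs" for l
  proof -
    have "?I l = 0" using that path_arc(5)[OF C i] by (intro I0) auto
    moreover have "X l = 0" using X that by (simp add: is_flow_def)
    ultimately show ?thesis by simp
  qed
  have row: "(\<Sum>l\<in>arcs. A r l * ?X l) = (\<Sum>l\<in>arcs. A r l * X l) - a * (\<Sum>j<m. A r (arc \<alpha> b i j C))" for r
  proof -
    have "(\<Sum>l\<in>arcs. A r l * ?X l) = (\<Sum>l\<in>arcs. A r l * X l - a * (A r l * ?I l))"
      by (simp only: right_diff_distrib mult.left_commute)
    also have "\<dots> = (\<Sum>l\<in>arcs. A r l * X l) - a * (\<Sum>l\<in>arcs. A r l * ?I l)"
      by (simp only: sum_subtractf sum_distrib_left)
    also have "(\<Sum>l\<in>arcs. A r l * ?I l) = (\<Sum>j<m. A r (arc \<alpha> b i j C))" by (rule path_indicator_sum[OF C i])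
    finally show ?thesis .
  qed
  have "(\<Sum>l\<in>arcs. A r l * ?X l) = 0" if "r < b ^ 4" "0 < r div b div b mod b" for r
  proof -
    have "r \<noteq> node b i 0 0 0" using that node_digits(3)[of 0 0 0 i] b_pos by auto
    then have "(\<Sum>j<m. A r (arc \<alpha> b i j C)) = 0" using row_path[OF C i, of r] that by simp
    then show ?thesis unfolding row using X that by (simp add: is_flow_def)
  qed
  then have fl: "is_flow ?X" using nn out unfolding is_flow_def by blast
  have rows: "A r (b ^ 5) * D + (\<Sum>l\<in>arcs. A r l * ?X l) +
      (\<Sum>(i, C, a, D')\<leftarrow>es @ [(i, C, a, D)]. a * (\<Sum>j<m. A r (arc \<alpha> b i j C))) = 0" if "r < R" for r
  proof -
    have "A r (b ^ 5) * D + (\<Sum>l\<in>arcs. A r l * X l) + (\<Sum>(i, C, a, D')\<leftarrow>es. a * (\<Sum>j<m. A r (arc \<alpha> b i j C))) = 0"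
      using dec that unfolding decomposed_def by blast
    then show ?thesis unfolding row by simp
  qed
  have "\<forall>(i, C, a, D')\<in>set (es @ [(i, C, a, D)]). i < m \<and> C \<in> BC i \<and> 0 \<le> a \<and> D' = D" "0 < D"
    using dec C i a(1) unfolding decomposed_def by auto
  then show ?thesis unfolding decomposed_def using fl rows by blast
qed

lemma decomposed_start:
  assumes D: "0 < X (b ^ 5)" and X: "\<And>l. 0 \<le> X l" "\<And>l. l \<notin> S0 \<Longrightarrow> X l = 0"
    and rows: "\<And>r. r < R \<Longrightarrow> (\<Sum>l\<in>S0. A r l * X l) = 0"
  shows "decomposed (X (b ^ 5)) (X(b ^ 5 := 0)) []"
proof -
  let ?X = "X(b ^ 5 := 0)"
  have r: "A r (b ^ 5) * X (b ^ 5) + (\<Sum>l\<in>arcs. A r l * ?X l) = 0" if "r < R" for r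
  proof -
    have "(\<Sum>l\<in>arcs. A r l * ?X l) = (\<Sum>l\<in>arcs. A r l * X l)" using b5_V by (intro sum.cong) auto
    then show ?thesis using rows[OF that] finite_V b5_V by simp
  qed
  have "(\<Sum>l\<in>arcs. A r l * ?X l) = 0" if "r < b ^ 4" "0 < r div b div b mod b" for r
  proof -
    have "r \<noteq> node b i 0 0 0" for i using that node_digits(3)[of 0 0 0 i] b_pos by auto
    then have "A r (b ^ 5) = 0" unfolding source_row[OF that(1)] by simp
    then show ?thesis using r[of r] that by simp
  qed
  then have "is_flow ?X" using X unfolding is_flow_def by auto
  then show ?thesis using r D unfolding decomposed_def by auto
qed

lemma sum_list_swap: "(\<Sum>x\<leftarrow>xs. \<Sum>j\<in>J. f x j) = (\<Sum>j\<in>J. \<Sum>x\<leftarrow>xs. f x j)"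
  by (induction xs) (simp_all add: sum.distrib)

text \<open>The residual flow is known to vanish only on the arcs leaving the sources. The source
  rows then give every candidate total weight exactly \<open>D\<close>. The covering rows only give
  at most \<open>k * D\<close> for each index, as the residual flow is nonnegative; but since each
  configuration has \<open>k\<close> votes, these amounts add up to \<open>m * k * D\<close>, so all
  of them are equal to \<open>k * D\<close>.\<close>

lemma decomposed_done:
  assumes dec: "decomposed D X es" and fin: "\<And>l. l \<in> arcs \<Longrightarrow> dig_j b l = 0 \<Longrightarrow> X l = 0"
  shows "lp_feasible \<alpha> \<sigma> k T (sparse_value es)"
proof -
  have D: "0 < D" and X: "is_flow X" and es: "\<forall>(i, C, a, D')\<in>set es. i < m \<and> C \<in> BC i \<and> 0 \<le> a \<and> D' = D"
    using dec by (auto simp: decomposed_def)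
  have rows: "A r (b ^ 5) * D + (\<Sum>l\<in>arcs. A r l * X l) + (\<Sum>(i, C, a, D')\<leftarrow>es. a * (\<Sum>j<m. A r (arc \<alpha> b i j C))) = 0"
    if "r < R" for r using dec that unfolding decomposed_def by blast
  have sv: "(\<Sum>C\<in>BC i. g C * sparse_value es i C) =
     (\<Sum>(i', C, a, D')\<leftarrow>es. of_bool (i' = i) * g C * real_of_int a) / real_of_int D" for i and g :: "nat list \<Rightarrow> real"
  proof -
    have "(\<Sum>C\<in>BC i. g C * sparse_value es i C) =
      (\<Sum>C\<in>BC i. \<Sum>(i', C', a, D')\<leftarrow>es. if i' = i \<and> C' = C then g C * (real_of_int a / real_of_int D) else 0)"
    proof (intro sum.cong refl)
      fix C
      have "g C * sparse_value es i C = (\<Sum>e\<leftarrow>es. g C * (case e of (i', C', a, b) \<Rightarrow> if i' = i \<and> C' = C then real_of_int a / real_of_int b else 0))"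
        unfolding sparse_value_def by (simp add: sum_list_const_mult)
      also have "\<dots> = (\<Sum>(i', C', a, D')\<leftarrow>es. if i' = i \<and> C' = C then g C * (real_of_int a / real_of_int D) else 0)"
        using es by (intro arg_cong[of _ _ sum_list] map_cong) auto
      finally show "g C * sparse_value es i C = \<dots>" .
    qed
    also have "\<dots> = (\<Sum>e\<leftarrow>es. \<Sum>C\<in>BC i. case e of (i', C', a, D') \<Rightarrow> if i' = i \<and> C' = C then g C * (real_of_int a / real_of_int D) else 0)"
      by (rule sum_list_swap[symmetric])
    also have "\<dots> = (\<Sum>e\<leftarrow>es. (case e of (i', C, a, D') \<Rightarrow> of_bool (i' = i) * g C * real_of_int a) * (1 / real_of_int D))"
    proof (intro arg_cong[of _ _ sum_list] map_cong refl)
      fix e assume e: "e \<in> set es"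
      obtain i' C' a D' where [simp]: "e = (i', C', a, D')" by (cases e)
      have "C' \<in> BC i'" using es e by auto
      then show "(\<Sum>C\<in>BC i. case e of (i', C', a, D') \<Rightarrow> if i' = i \<and> C' = C then g C * (real_of_int a / real_of_int D) else 0) =
        (case e of (i', C, a, D') \<Rightarrow> of_bool (i' = i) * g C * real_of_int a) * (1 / real_of_int D)"
        using finite_bounded_configs[of \<alpha> \<sigma> k T i] by (cases "i' = i") (auto simp: sum.delta')
    qed
    also have "\<dots> = (\<Sum>(i', C, a, D')\<leftarrow>es. of_bool (i' = i) * g C * real_of_int a) / real_of_int D"
      by (subst sum_list_mult_const) simp
    finally show ?thesis .
  qed
  have es_cong: "(\<Sum>e\<leftarrow>es. f e) = (\<Sum>e\<leftarrow>es. g e)"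
    if "\<And>i C a. i < m \<Longrightarrow> C \<in> BC i \<Longrightarrow> f (i, C, a, D) = g (i, C, a, D)" for f g :: "lp_entry \<Rightarrow> 'c::comm_monoid_add"
    using es that by (intro arg_cong[of _ _ sum_list] map_cong) auto
  have one: "(\<Sum>(i', C, a, D')\<leftarrow>es. of_bool (i' = i) * a) = D" if i: "i < m" for i
  proof -
    define r where "r = node b i 0 0 0"
    have r: "r < b ^ 4" "r div b div b mod b = 0"
      using i m_b b_pos node_digits(3)[of 0 0 0 i] by (auto simp: r_def intro!: node_lt)
    have inj: "r = node b i' 0 0 0 \<longleftrightarrow> i' = i" for i' using b_pos by (auto simp: r_def node_def)
    have a5: "A r (b ^ 5) = 1" unfolding source_row[OF r(1)] inj using i by (simp add: of_bool_def sum.delta')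
    \<comment> \<open>No arc ends in layer 0, and by hypothesis no residual flow leaves a source, so
      in this row the paths alone balance the supply \<open>D\<close>.\<close>
    have h0: "(\<Sum>l\<in>arcs. of_bool (r = head \<alpha> b l) * X l) = 0"
    proof (intro sum.neutral ballI)
      fix l assume "l \<in> arcs"
      then have "r \<noteq> head \<alpha> b l" using valid_head(2)[of l] r(2) by auto
      then show "of_bool (r = head \<alpha> b l) * X l = 0" by simp
    qed
    have t0: "(\<Sum>l\<in>arcs. of_bool (r = l div b) * X l) = 0"
    proof (intro sum.neutral ballI)
      fix l assume l: "l \<in> arcs"
      have "dig_j b l = 0" if "r = l div b" using r(2) that by (simp add: dig_j_def)
      then show "of_bool (r = l div b) * X l = 0" using fin[OF l] by auto
    qed
    have "(\<Sum>l\<in>arcs. A r l * X l) = 0" using sum_V_split[OF r(1), of X] r(2) m_pos h0 t0 by simp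
    moreover have "(\<Sum>(i, C, a, D')\<leftarrow>es. a * (\<Sum>j<m. A r (arc \<alpha> b i j C))) = (\<Sum>(i', C, a, D')\<leftarrow>es. - (of_bool (i' = i) * a))"
      by (rule es_cong) (simp add: row_path r(1) inj)
    moreover have "(\<Sum>(i', C, a, D')\<leftarrow>es. - (of_bool (i' = i) * a)) = - (\<Sum>(i', C, a, D')\<leftarrow>es. of_bool (i' = i) * a)"
      by (simp add: uminus_sum_list_map o_def case_prod_unfold)
    ultimately show ?thesis using rows[of r] r(1) a5 by simp
  qed
  let ?cov = "\<lambda>j. \<Sum>(i', C, a, D')\<leftarrow>es. a * int (C ! j)"
  have cov: "?cov j \<le> int k * D" if j: "j < m" for j
  proof -
    define r where "r = b ^ 4 + j"
    have "0 \<le> (\<Sum>l\<in>arcs. A r l * X l)"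
      using X b5_V by (intro sum_nonneg mult_nonneg_nonneg) (auto simp: r_def amat_def is_flow_def)
    moreover have "(\<Sum>(i, C, a, D')\<leftarrow>es. a * (\<Sum>j<m. A r (arc \<alpha> b i j C))) = ?cov j"
      by (rule es_cong) (simp add: row_path r_def j)
    ultimately show ?thesis using rows[of r] j by (simp add: r_def amat_def)
  qed
  have "(\<Sum>j<m. ?cov j) = (\<Sum>e\<leftarrow>es. \<Sum>j<m. case e of (i', C, a, D') \<Rightarrow> a * int (C ! j))"
    by (rule sum_list_swap[symmetric])
  also have "\<dots> = (\<Sum>e\<leftarrow>es. \<Sum>i<m. case e of (i', C, a, D') \<Rightarrow> int k * (of_bool (i' = i) * a))"
  proof (rule es_cong)
    fix i C a assume i: "i < m" and C: "C \<in> BC i"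
    have "(\<Sum>j<m. a * int (C ! j)) = a * int (cnt C m)" by (simp add: cnt_def sum_distrib_left)
    also have "\<dots> = int k * (\<Sum>i'<m. if i' = i then a else 0)" using config_sum(2)[OF C] i by simp
    also have "\<dots> = (\<Sum>i'<m. int k * (of_bool (i = i') * a))"
      unfolding sum_distrib_left by (intro sum.cong) auto
    finally show "(\<Sum>j<m. case (i, C, a, D) of (i', C, a, D') \<Rightarrow> a * int (C ! j)) =
      (\<Sum>i'<m. case (i, C, a, D) of (i'', C, a, D') \<Rightarrow> int k * (of_bool (i'' = i') * a))" by simp
  qed
  also have "\<dots> = (\<Sum>i<m. \<Sum>e\<leftarrow>es. case e of (i', C, a, D') \<Rightarrow> int k * (of_bool (i' = i) * a))"
    by (rule sum_list_swap)
  also have "\<dots> = (\<Sum>i<m. int k * D)"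
  proof (intro sum.cong refl)
    fix i assume "i \<in> {..<m}"
    have "(\<Sum>e\<leftarrow>es. case e of (i', C, a, D') \<Rightarrow> int k * (of_bool (i' = i) * a)) = int k * (\<Sum>(i', C, a, D')\<leftarrow>es. of_bool (i' = i) * a)"
      by (simp add: case_prod_unfold flip: sum_list_const_mult)
    then show "(\<Sum>e\<leftarrow>es. case e of (i', C, a, D') \<Rightarrow> int k * (of_bool (i' = i) * a)) = int k * D"
      using one \<open>i \<in> {..<m}\<close> by simp
  qed
  finally have "(\<Sum>j<m. int k * D - ?cov j) = 0" by (simp add: sum_subtractf)
  then have "\<forall>j\<in>{..<m}. int k * D - ?cov j = 0" using cov by (subst (asm) sum_nonneg_eq_0_iff) auto
  then have cov': "?cov j = int k * D" if "j < m" for j using that by simp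
  have ri1: "(\<Sum>(i', C, a, D')\<leftarrow>es. of_bool (i' = i) * 1 * real_of_int a) = real_of_int (\<Sum>(i', C, a, D')\<leftarrow>es. of_bool (i' = i) * a)" for i
    by (induction es) auto
  have ri2: "(\<Sum>(i', C, a, D')\<leftarrow>es. real (C ! j) * real_of_int a) = real_of_int (?cov j)" for j
    by (induction es) auto
  show ?thesis
    unfolding lp_feasible_def
  proof (intro conjI allI impI ballI)
    fix i C assume "i < m" "C \<in> BC i"
    show "0 \<le> sparse_value es i C"
      unfolding sparse_value_def using es D by (intro sum_list_nonneg) auto
  next
    fix i assume i: "i < m"
    have "(\<Sum>C\<in>BC i. 1 * sparse_value es i C) = real_of_int (\<Sum>(i', C, a, D')\<leftarrow>es. of_bool (i' = i) * a) / real_of_int D"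
      unfolding sv ri1 ..
    then show "(\<Sum>C\<in>BC i. sparse_value es i C) \<le> 1" using one[OF i] D by simp
  next
    fix j assume j: "j < m"
    have "(\<Sum>i<m. \<Sum>C\<in>BC i. real (C ! j) * sparse_value es i C) =
      (\<Sum>i<m. (\<Sum>(i', C, a, D')\<leftarrow>es. of_bool (i' = i) * real (C ! j) * real_of_int a)) / real_of_int D"
      unfolding sv by (simp add: sum_divide_distrib)
    also have "(\<Sum>i<m. (\<Sum>(i', C, a, D')\<leftarrow>es. of_bool (i' = i) * real (C ! j) * real_of_int a)) =
      (\<Sum>e\<leftarrow>es. \<Sum>i<m. case e of (i', C, a, D') \<Rightarrow> of_bool (i' = i) * real (C ! j) * real_of_int a)"
      by (rule sum_list_swap[symmetric])
    also have "\<dots> = (\<Sum>(i', C, a, D')\<leftarrow>es. real (C ! j) * real_of_int a)"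
      by (rule es_cong) (simp add: of_bool_def if_distrib[of "\<lambda>x. x * _"] sum.delta cong: if_cong)
    also have "\<dots> = real_of_int (?cov j)"
      by (rule ri2)
    finally show "real k \<le> (\<Sum>i<m. \<Sum>C\<in>BC i. real (C ! j) * sparse_value es i C)"
      using cov'[OF j] D by simp
  qed
qed

end

section \<open>Reasoning about programs\<close>

text \<open>A constant index denotes a single cell, any other index the whole array: precise enough
  for frame reasoning, because scalars are cells of array 2 with constant index.\<close>

fun cell :: "nat \<Rightarrow> exp \<Rightarrow> (nat \<times> nat) set" where
  "cell a (Num c) = {(a, nat c)}"
| "cell a _ = {a} \<times> UNIV"

primrec reads :: "exp \<Rightarrow> (nat \<times> nat) set" where
  "reads (Num c) = {}"
| "reads Bound = {}"
| "reads (Rd a e) = cell a e \<union> reads e"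
| "reads (Plus e f) = reads e \<union> reads f"
| "reads (Minus e f) = reads e \<union> reads f"
| "reads (Mul e f) = reads e \<union> reads f"
| "reads (Div e f) = reads e \<union> reads f"
| "reads (Cond e f g) = reads e \<union> (reads f \<union> reads g)"
| "reads (Sum v e f) = reads e \<union> (reads f - {(2, v)})"

primrec writes :: "com \<Rightarrow> (nat \<times> nat) set" where
  "writes Skip = {}"
| "writes (Put a e f) = cell a e"
| "writes (Comp c d) = writes c \<union> writes d"
| "writes (When e c d) = writes c \<union> writes d"
| "writes (For v e c) = writes c - {(2, v)}"

lemma cell_mem: "(a, nat (eval N e st)) \<in> cell a e"
  by (cases e) auto

lemma eval_cong: "(\<And>p. p \<in> reads e \<Longrightarrow> st p = st' p) \<Longrightarrow> eval N e st = eval N e st'"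
proof (induction e arbitrary: st st')
  case (Rd a e)
  have "eval N e st = eval N e st'" by (rule Rd.IH) (use Rd.prems in auto)
  moreover have "st (a, nat (eval N e st)) = st' (a, nat (eval N e st))"
    by (rule Rd.prems) (use cell_mem[of a N e st] in auto)
  ultimately show ?case by simp
next
  case (Plus e f)
  have "eval N e st = eval N e st'" "eval N f st = eval N f st'"
    by (rule Plus.IH; use Plus.prems in auto)+
  then show ?case by simp
next
  case (Minus e f)
  have "eval N e st = eval N e st'" "eval N f st = eval N f st'"
    by (rule Minus.IH; use Minus.prems in auto)+
  then show ?case by simp
next
  case (Mul e f)
  have "eval N e st = eval N e st'" "eval N f st = eval N f st'"
    by (rule Mul.IH; use Mul.prems in auto)+
  then show ?case by simp
next
  case (Div e f)
  have "eval N e st = eval N e st'" "eval N f st = eval N f st'"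
    by (rule Div.IH; use Div.prems in auto)+
  then show ?case by simp
next
  case (Cond e f g)
  have "eval N e st = eval N e st'" "eval N f st = eval N f st'" "eval N g st = eval N g st'"
    by (rule Cond.IH; use Cond.prems in auto)+
  then show ?case by simp
next
  case (Sum v e f)
  have "eval N e st = eval N e st'" by (rule Sum.IH; use Sum.prems in auto)
  moreover have "eval N f (st((2, v) := x)) = eval N f (st'((2, v) := x))" for x
    by (rule Sum.IH; use Sum.prems in auto)
  ultimately show ?case by simp
qed auto

lemma iter_inv:
  assumes "P 0 x" "\<And>i x. i < K \<Longrightarrow> P i x \<Longrightarrow> P (Suc i) (f i x)"
  shows "P K (iter f K x)"
proof -
  have "i \<le> K \<Longrightarrow> P i (iter f i x)" for i
    by (induction i) (use assms in auto)
  then show ?thesis by simp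
qed

lemma den_frame: "p \<notin> writes c \<Longrightarrow> den N c st p = st p"
proof (induction c arbitrary: st)
  case (Put a e f)
  then show ?case using cell_mem[of a N e st] by auto
next
  case (For v e c)
  show ?case
  proof (cases "p = (2, v)")
    case False
    then have p: "p \<notin> writes c" using For.prems by simp
    have "iter (\<lambda>i s. den N c (s((2, v) := int i))) (min N (nat (eval N e st))) st p = st p"
      by (rule iter_inv[where P = "\<lambda>i s. s p = st p"]) (use For.IH[OF p] False in auto)
    then show ?thesis using False by simp
  qed simp
qed auto

lemma For_inv:
  assumes K: "K = min N (nat (eval N e st))"
    and start: "P 0 st"
    and step: "\<And>i s. i < K \<Longrightarrow> P i s \<Longrightarrow> P (Suc i) (den N c (s((2, v) := int i)))"
    and restore: "\<And>s. P K s \<Longrightarrow> Q (s((2, v) := st (2, v)))"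
  shows "Q (den N (For v e c) st)"
  using restore[OF iter_inv[where P = P, OF start step]] K by simp

abbreviation V :: "nat \<Rightarrow> exp" where "V v \<equiv> Rd 2 (Num (int v))"
abbreviation Set :: "nat \<Rightarrow> exp \<Rightarrow> com" where "Set v e \<equiv> Put 2 (Num (int v)) e"

text \<open>The loop acts as a simultaneous assignment, provided that the value for index
  \<open>i\<close> does not depend on the cells filled before. The cell \<open>i\<close> itself
  still has its old content, so in-place updates are included.\<close>

lemma For_fill:
  assumes K: "K = min N (nat (eval N b st))" and a: "a \<noteq> 2"
    and e: "\<And>i s. i < K \<Longrightarrow> (\<And>p. p \<noteq> (2, v) \<Longrightarrow> p \<notin> {a} \<times> {..<i} \<Longrightarrow> s p = st p) \<Longrightarrow> s (2, v) = int i \<Longrightarrow> eval N e s = f i"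
  shows "den N (For v b (Put a (V v) e)) st = (\<lambda>p. if fst p = a \<and> snd p < K then f (snd p) else st p)"
proof -
  define P where "P i s \<longleftrightarrow> (\<forall>p. p \<noteq> (2, v) \<longrightarrow> s p = (if fst p = a \<and> snd p < i then f (snd p) else st p))" for i s
  have fin: "s = (\<lambda>p. if fst p = a \<and> snd p < K then f (snd p) else st p)"
    if "s (2, v) = st (2, v)" "P K s" for s
  proof
    fix p show "s p = (if fst p = a \<and> snd p < K then f (snd p) else st p)"
    proof (cases "p = (2, v)")
      case True
      then show ?thesis using that a by simp
    next
      case False
      then show ?thesis using that(2) unfolding P_def by blast
    qed
  qed
  show ?thesis
  proof (rule fin)
    show "den N (For v b (Put a (V v) e)) st (2, v) = st (2, v)" by (rule den_frame) simp
    show "P K (den N (For v b (Put a (V v) e)) st)"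
    proof (rule For_inv[OF K, where P = P and Q = "P K"])
      show "P 0 st" by (simp add: P_def)
      fix i s assume i: "i < K" "P i s"
      have "eval N e (s((2, v) := int i)) = f i"
      proof (rule e[OF i(1)])
        fix p assume p: "p \<noteq> (2, v)" "p \<notin> {a} \<times> {..<i}"
        have "s p = (if fst p = a \<and> snd p < i then f (snd p) else st p)" using i(2) p(1) unfolding P_def by blast
        then show "(s((2, v) := int i)) p = st p" using p by (cases p) auto
      qed simp
      then show "P (Suc i) (den N (Put a (V v) e) (s((2, v) := int i)))"
        using i(2) a by (auto simp: P_def less_Suc_eq)
    next
      fix s assume "P K s"
      then show "P K (s((2, v) := st (2, v)))" by (auto simp: P_def)
    qed
  qed
qed

text \<open>A test is an expression that is positive when it holds; over the integers a weak
  inequality is a strict one shifted by 1.\<close>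

definition lt :: "exp \<Rightarrow> exp \<Rightarrow> exp" where "lt e f = Minus f e"
definition le :: "exp \<Rightarrow> exp \<Rightarrow> exp" where "le e f = Plus (Minus f e) (Num 1)"
definition conj :: "exp \<Rightarrow> exp \<Rightarrow> exp" where "conj e f = Cond e f (Num 0)"
definition eq :: "exp \<Rightarrow> exp \<Rightarrow> exp" where "eq e f = conj (le e f) (le f e)"
definition rem :: "exp \<Rightarrow> exp \<Rightarrow> exp" where "rem e f = Minus e (Mul f (Div e f))"
definition indic :: "exp \<Rightarrow> exp" where "indic e = Cond e (Num 1) (Num 0)"

lemma eval_tests [simp]:
  "0 < eval N (lt e f) st \<longleftrightarrow> eval N e st < eval N f st"
  "0 < eval N (le e f) st \<longleftrightarrow> eval N e st \<le> eval N f st"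
  "0 < eval N (conj e f) st \<longleftrightarrow> 0 < eval N e st \<and> 0 < eval N f st"
  "0 < eval N (eq e f) st \<longleftrightarrow> eval N e st = eval N f st"
  "eval N (indic e) st = of_bool (0 < eval N e st)"
  by (auto simp: lt_def le_def conj_def eq_def indic_def)

lemma reads_tests [simp]:
  "reads (lt e f) = reads e \<union> reads f" "reads (le e f) = reads e \<union> reads f"
  "reads (conj e f) = reads e \<union> reads f" "reads (eq e f) = reads e \<union> reads f"
  "reads (rem e f) = reads e \<union> reads f" "reads (indic e) = reads e"
  by (auto simp: lt_def le_def conj_def eq_def rem_def indic_def)

lemma wf_tests [simp]:
  "wf_exp (lt e f) \<longleftrightarrow> wf_exp e \<and> wf_exp f" "wf_exp (le e f) \<longleftrightarrow> wf_exp e \<and> wf_exp f"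
  "wf_exp (conj e f) \<longleftrightarrow> wf_exp e \<and> wf_exp f" "wf_exp (eq e f) \<longleftrightarrow> wf_exp e \<and> wf_exp f"
  "wf_exp (rem e f) \<longleftrightarrow> wf_exp e \<and> wf_exp f" "wf_exp (indic e) \<longleftrightarrow> wf_exp e"
  by (auto simp: lt_def le_def conj_def eq_def rem_def indic_def)

lemma tmul_eq: "\<bar>x\<bar> < 2 ^ N \<Longrightarrow> tmul N x y = x * y"
  by (simp add: tmul_def)

lemma eval_Mul: "\<bar>eval N e st\<bar> < 2 ^ N \<Longrightarrow> eval N (Mul e f) st = eval N e st * eval N f st"
  by (simp add: tmul_def)

lemma eval_Div: "0 \<le> eval N e st \<Longrightarrow> eval N e st < 2 ^ N \<Longrightarrow> 0 < eval N f st \<Longrightarrow>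
    eval N (Div e f) st = eval N e st div eval N f st"
  by (simp add: tdiv_def)

lemma eval_rem: "0 \<le> eval N e st \<Longrightarrow> eval N e st < 2 ^ N \<Longrightarrow> 0 < eval N f st \<Longrightarrow> eval N f st < 2 ^ N \<Longrightarrow>
    eval N (rem e f) st = eval N e st mod eval N f st"
  unfolding rem_def by (simp add: tdiv_def tmul_def minus_mult_div_eq_mod)

lemma int_lt_pow: "i \<le> N \<Longrightarrow> int i < 2 ^ N"
proof -
  assume "i \<le> N"
  then have "i < 2 ^ N" by (meson le_less_trans less_exp)
  then have "int i < int (2 ^ N)" by (simp only: of_nat_less_iff)
  then show ?thesis by simp
qed

lemma abs_int_lt_pow: "i \<le> N \<Longrightarrow> \<bar>int i\<bar> < 2 ^ N"
  using int_lt_pow by simp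

section \<open>Greatest common divisors\<close>

text \<open>After the first step the product of the two numbers is at least halved by each step.\<close>

definition euclid :: com where
  "euclid = For 40 Bound (When (V 32)
     (Comp (Set 33 (rem (V 31) (V 32))) (Comp (Set 31 (V 32)) (Set 32 (V 33)))) Skip)"

text \<open>The quotient is at least 1, so \<open>g \<ge> h + g mod h\<close>, and \<open>h\<close>
  exceeds \<open>g mod h\<close>.\<close>

lemma mod_half: "0 < h \<Longrightarrow> h < g \<Longrightarrow> 2 * (g mod h) < (g::int)"
proof -
  assume h: "0 < h" "h < g"
  have "g mod h < h" "0 \<le> g mod h" using h by auto
  moreover have "g = g div h * h + g mod h" by simp
  moreover have "0 < g div h" using h by (simp add: pos_imp_zdiv_pos_iff)
  then have "1 * h \<le> g div h * h" using h by (intro mult_right_mono) auto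
  ultimately show ?thesis by linarith
qed

lemma euclid:
  assumes g: "0 < st (2, 31)" "st (2, 31) < 2 ^ B" and h: "0 \<le> st (2, 32)" "st (2, 32) < 2 ^ B" and B: "2 * B + 2 \<le> N"
  shows "den N euclid st (2, 31) = gcd (st (2, 31)) (st (2, 32))"
proof -
  \<comment> \<open>The exponent is \<open>i - 1\<close> because the first round may merely exchange
    the two numbers; only from then on is the first one the larger, so that the product
    halves.\<close>
  define I where "I i s \<longleftrightarrow> gcd (s (2, 31)) (s (2, 32)) = gcd (st (2, 31)) (st (2, 32)) \<and>
    0 < s (2, 31) \<and> s (2, 31) < 2 ^ B \<and> 0 \<le> s (2, 32) \<and> s (2, 32) < 2 ^ B \<and>
    (0 < i \<longrightarrow> s (2, 32) = 0 \<or> s (2, 32) < s (2, 31) \<and> s (2, 31) * s (2, 32) * 2 ^ (i - 1) \<le> 2 ^ (2 * B))" for i :: nat and s :: state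
  have BN: "(2::int) ^ B < 2 ^ N" using B by (intro power_strict_increasing) auto
  show ?thesis
    unfolding euclid_def
  proof (rule For_inv[where P = I and Q = "\<lambda>s. s (2, 31) = gcd (st (2, 31)) (st (2, 32))", OF refl])
    show "I 0 st" using g h by (simp add: I_def)
    fix i s assume I: "I i s"
    define a where "a = s (2, 31)"
    define c where "c = s (2, 32)"
    let ?s = "s((2, 40) := int i)"
    show "I (Suc i) (den N (When (V 32) (Comp (Set 33 (rem (V 31) (V 32))) (Comp (Set 31 (V 32)) (Set 32 (V 33)))) Skip) ?s)"
    proof (cases "0 < c")
      case False
      then show ?thesis using I by (auto simp: I_def c_def)
    next
      case True
      have ac: "0 < a" "a < 2 ^ B" "c < 2 ^ B" using I by (auto simp: I_def a_def c_def)
      have e: "eval N (rem (V 31) (V 32)) ?s = a mod c"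
        using ac BN True less_trans[OF ac(2) BN] less_trans[OF ac(3) BN]
        by (subst eval_rem) (auto simp: a_def c_def)
      have m: "0 \<le> a mod c" "a mod c < c" using True by auto
      have prod: "a mod c = 0 \<or> c * (a mod c) * 2 ^ i \<le> 2 ^ (2 * B)"
      proof (cases "i = 0")
        case True
        have "c * (a mod c) \<le> 2 ^ B * 2 ^ B" using ac m by (intro mult_mono) auto
        then show ?thesis using True by (simp add: mult_2 power_add)
      next
        case False
        then have lt: "c < a" and p: "a * c * 2 ^ (i - 1) \<le> 2 ^ (2 * B)" using I \<open>0 < c\<close> by (auto simp: I_def a_def c_def)
        have "c * (a mod c) * 2 ^ i = c * (2 * (a mod c)) * 2 ^ (i - 1)" using False by (cases i) auto
        also have "\<dots> \<le> c * a * 2 ^ (i - 1)" using mod_half[OF True lt] True by (intro mult_right_mono mult_left_mono) auto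
        finally show ?thesis using p by (simp add: mult.commute)
      qed
      have g: "gcd c (a mod c) = gcd a c" by (metis gcd.commute gcd_red_int)
      show ?thesis using I True e m ac prod g
        by (auto simp: I_def a_def[symmetric] c_def[symmetric])
    qed
  next
    let ?K = "min N (nat (eval N Bound st))"
    fix s assume I: "I ?K s"
    \<comment> \<open>If the second number were nonzero after \<open>N\<close> rounds, the product
      would be at least 1 and \<open>2 ^ (N - 1) \<le> 2 ^ (2 * B)\<close> would follow, against
      \<open>2 * B + 2 \<le> N\<close>.\<close>
    have "s (2, 32) = 0"
    proof (rule ccontr)
      assume nz: "s (2, 32) \<noteq> 0"
      then have pos: "0 < s (2, 31) * s (2, 32)" using I by (simp add: I_def)
      have "s (2, 31) * s (2, 32) * 2 ^ (N - 1) \<le> 2 ^ (2 * B)" using I nz B by (auto simp: I_def)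
      moreover have "1 * 2 ^ (N - 1) \<le> s (2, 31) * s (2, 32) * 2 ^ (N - 1)" using pos by (intro mult_right_mono) auto
      moreover have "(2::int) ^ (2 * B) < 2 ^ (N - 1)" using B by (intro power_strict_increasing) auto
      ultimately show False by linarith
    qed
    then show "(s((2, 40) := st (2, 40))) (2, 31) = gcd (st (2, 31)) (st (2, 32))"
      using I by (auto simp: I_def)
  qed
qed

lemma writes_euclid: "writes euclid = {(2, 31), (2, 32), (2, 33)}"
  by (auto simp: euclid_def)

section \<open>Chubanov's algorithm as a program\<close>

text \<open>Scalars below 20 and the arrays 3 (scores) and 4 (score limits) are constant during the main
  computation: 0 and 1 hold \<open>m\<close> and \<open>k\<close>, 3 holds \<open>b\<close>, 4 holds \<open>b ^ 4\<close>, 5 and 6 the numbers of columns and rows,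
  8 the square of the number of columns, 14 holds \<open>b ^ 3\<close>. The arrays 5 to 9 hold the weights, the
  projection (row by row), the vectors \<open>u\<close> and \<open>y\<close>, and the solution; scalar 30 is the denominator of the
  projection, 34 the current pivot, 35 tells that a positive solution was found, and 36 is 1 plus
  the result of a search, or 0.\<close>

definition protected :: "(nat \<times> nat) set" where
  "protected = {2} \<times> {..<20} \<union> {3, 4} \<times> UNIV"

definition eabs :: "exp \<Rightarrow> exp" where "eabs e = Cond e e (Minus (Num 0) e)"
definition quot :: "exp \<Rightarrow> exp \<Rightarrow> exp" where
  "quot e f = Cond e (Div e f) (Minus (Num 0) (Div (Minus (Num 0) e) f))"

lemma eval_eabs [simp]: "eval N (eabs e) st = \<bar>eval N e st\<bar>"
  by (simp add: eabs_def)

lemma eval_quot: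
  assumes "\<bar>eval N e st\<bar> < 2 ^ N" "0 < eval N f st" "eval N f st dvd eval N e st"
  shows "eval N (quot e f) st = eval N e st div eval N f st"
  using assms by (auto simp: quot_def tdiv_def dvd_neg_div)

text \<open>An entry of the matrix with columns scaled by the weights, for the row in scalar 20 and
  the column in scalar 21.\<close>

definition aw :: "exp \<Rightarrow> exp" where "aw eA = Mul eA (Rd 5 (V 21))"

definition proj_init :: com where
  "proj_init = Comp
    (For 23 (V 8) (Put 6 (V 23) (Cond (eq (Div (V 23) (V 5)) (rem (V 23) (V 5)))
       (indic (Rd 5 (rem (V 23) (V 5)))) (Num 0))))
    (Set 30 (Num 1))"

definition row_u :: "exp \<Rightarrow> com" where
  "row_u eA = For 22 (V 5) (Put 7 (V 22) (Sum 21 (V 5) (Mul (aw eA) (Rd 6 (Plus (Mul (V 21) (V 5)) (V 22))))))"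

definition row_beta :: "exp \<Rightarrow> com" where
  "row_beta eA = Set 34 (Sum 21 (V 5) (Mul (aw eA) (Rd 7 (V 21))))"

definition row_upd :: com where
  "row_upd = Comp
    (For 23 (V 8) (Put 6 (V 23) (Minus (Mul (V 34) (Rd 6 (V 23)))
       (Mul (Rd 7 (Div (V 23) (V 5))) (Rd 7 (rem (V 23) (V 5)))))))
    (Set 30 (Mul (V 34) (V 30)))"

definition row_gcd :: com where
  "row_gcd = Comp (Set 31 (V 30)) (For 23 (V 8) (Comp (Set 32 (eabs (Rd 6 (V 23)))) euclid))"

definition row_reduce :: com where
  "row_reduce = Comp
    (For 23 (V 8) (Put 6 (V 23) (quot (Rd 6 (V 23)) (V 31))))
    (Set 30 (Div (V 30) (V 31)))"

definition row :: "exp \<Rightarrow> com" where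
  "row eA = Comp (row_u eA) (Comp (row_beta eA)
     (When (V 34) (Comp row_upd (Comp row_gcd row_reduce)) Skip))"

definition project :: "exp \<Rightarrow> com" where
  "project eA = Comp proj_init (For 20 (V 6) (row eA))"

text \<open>The coordinate of \<open>G y\<close> whose index is in scalar 22.\<close>

definition zx :: exp where
  "zx = Sum 21 (V 5) (Mul (Rd 8 (V 21)) (Rd 6 (Plus (Mul (V 21) (V 5)) (V 22))))"

definition find :: "exp \<Rightarrow> com" where
  "find e = Comp (Set 36 (Num 0)) (For 22 (V 5) (When e (Set 36 (Plus (V 22) (Num 1))) Skip))"

text \<open>Only columns of positive weight are inspected. If none of them has a nonpositive
  coordinate in \<open>G y\<close>, a positive kernel vector has been found and scalar 35 is
  set.\<close>

definition perceptron :: com where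
  "perceptron = When (V 35) Skip (Comp (find (conj (Rd 5 (V 22)) (le zx (Num 0))))
     (When (V 36) (Put 8 (Minus (V 36) (Num 1)) (Plus (Rd 8 (Minus (V 36) (Num 1))) (Num 1)))
       (Set 35 (Num 1))))"

text \<open>The search asks for \<open>n * y j \<ge> N\<close>; such a \<open>j\<close> exists after
  \<open>N\<close> unsuccessful steps since the entries of \<open>y\<close> then add up to
  \<open>N\<close>. Integer division turns a weight of 1 into 0, which removes the column.\<close>

definition halve :: com where
  "halve = When (V 35) Skip (Comp (find (le Bound (Mul (V 5) (Rd 8 (V 22)))))
     (Put 5 (Minus (V 36) (Num 1)) (Div (Rd 5 (Minus (V 36) (Num 1))) (Num 2))))"

definition phase :: "exp \<Rightarrow> com" where
  "phase eA = When (V 35) Skip (Comp (project eA) (Comp (For 22 (V 5) (Put 8 (V 22) (Num 0)))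
     (Comp (For 24 Bound perceptron) halve)))"

lemma find:
  assumes K: "K = min N (nat (s (2, 5)))"
    and e: "\<And>j t. j < K \<Longrightarrow> (\<And>p. p \<noteq> (2, 22) \<Longrightarrow> p \<noteq> (2, 36) \<Longrightarrow> t p = s p) \<Longrightarrow> t (2, 22) = int j \<Longrightarrow>
      0 < eval N e t \<longleftrightarrow> P j"
  obtains k where "den N (find e) s = s((2, 36) := k)"
    "(k = 0 \<and> (\<forall>j<K. \<not> P j)) \<or> (\<exists>j<K. k = int j + 1 \<and> P j)"
proof -
  let ?s = "den N (find e) s"
  have fr: "?s p = s p" if "p \<noteq> (2, 36)" for p
    by (rule den_frame) (use that in \<open>auto simp: find_def\<close>)
  define I where "I i t \<longleftrightarrow> (\<forall>p. p \<noteq> (2, 22) \<longrightarrow> p \<noteq> (2, 36) \<longrightarrow> t p = s p) \<and>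
    ((t (2, 36) = 0 \<and> (\<forall>j<i. \<not> P j)) \<or> (\<exists>j<i. t (2, 36) = int j + 1 \<and> P j))" for i t
  have "(?s (2, 36) = 0 \<and> (\<forall>j<K. \<not> P j)) \<or> (\<exists>j<K. ?s (2, 36) = int j + 1 \<and> P j)"
    unfolding find_def den.simps(3)
  proof (rule For_inv[where P = I and K = K])
    show "K = min N (nat (eval N (V 5) (den N (Set 36 (Num 0)) s)))" using K by simp
    show "I 0 (den N (Set 36 (Num 0)) s)" by (simp add: I_def)
  next
    fix i t assume i: "i < K" and I: "I i t"
    have t: "(t((2, 22) := int i)) p = s p" if "p \<noteq> (2, 22)" "p \<noteq> (2, 36)" for p
      using I that unfolding I_def by (simp del: split_paired_All)
    have ev: "0 < eval N e (t((2, 22) := int i)) \<longleftrightarrow> P i"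
      by (rule e[OF i t]) auto
    have d: "den N (When e (Set 36 (Plus (V 22) (Num 1))) Skip) (t((2, 22) := int i)) =
        (if P i then t((2, 22) := int i, (2, 36) := int i + 1) else t((2, 22) := int i))"
      by (simp add: ev)
    have 1: "\<forall>p. p \<noteq> (2, 22) \<longrightarrow> p \<noteq> (2, 36) \<longrightarrow> t p = s p" using I unfolding I_def by blast
    have 2: "(t (2, 36) = 0 \<and> (\<forall>j<i. \<not> P j)) \<or> (\<exists>j<i. t (2, 36) = int j + 1 \<and> P j)" using I unfolding I_def by blast
    show "I (Suc i) (den N (When e (Set 36 (Plus (V 22) (Num 1))) Skip) (t((2, 22) := int i)))"
    proof (cases "P i")
      case True
      then have "\<exists>j<Suc i. (t((2, 22) := int i, (2, 36) := int i + 1)) (2, 36) = int j + 1 \<and> P j"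
        by (intro exI[of _ i]) simp
      then show ?thesis unfolding d I_def using 1 True by (simp del: split_paired_All)
    next
      case False
      have "(t (2, 36) = 0 \<and> (\<forall>j<Suc i. \<not> P j)) \<or> (\<exists>j<Suc i. t (2, 36) = int j + 1 \<and> P j)"
        using 2 False less_Suc_eq by metis
      then show ?thesis unfolding d I_def using 1 False by (simp del: split_paired_All)
    qed
  next
    fix t assume "I K t"
    then show "((t((2, 22) := den N (Set 36 (Num 0)) s (2, 22))) (2, 36) = 0 \<and> (\<forall>j<K. \<not> P j)) \<or>
      (\<exists>j<K. (t((2, 22) := den N (Set 36 (Num 0)) s (2, 22))) (2, 36) = int j + 1 \<and> P j)"
      by (simp add: I_def)
  qed
  moreover have "?s = s((2, 36) := ?s (2, 36))" using fr by auto
  ultimately show thesis by (rule that[rotated])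
qed

lemma siegel_bound_mono: "d \<le> d' \<Longrightarrow> siegel_bound d M \<le> siegel_bound d' M"
proof -
  assume d: "d \<le> d'"
  have "(2 * (d + 1) * M + 1) ^ d \<le> (2 * (d' + 1) * M + 1) ^ d"
    using d by (intro power_mono add_mono mult_mono) auto
  also have "\<dots> \<le> (2 * (d' + 1) * M + 1) ^ d'" using d by (intro power_increasing) auto
  finally show ?thesis by (simp add: siegel_bound_def)
qed

lemma siegel_bound_pos: "1 \<le> siegel_bound d M" by (simp add: siegel_bound_def)

lemma index_less: "i < n \<Longrightarrow> j < n \<Longrightarrow> i * n + j < n * (n::nat)"
proof -
  assume "i < n" "j < n"
  then have "(i + 1) * n \<le> n * n" by (intro mult_right_mono) auto
  then show ?thesis using \<open>j < n\<close> by simp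
qed

lemma index_div: "j < n \<Longrightarrow> (i * n + j) div n = i" and index_mod: "j < n \<Longrightarrow> (i * n + j) mod n = (j::nat)"
  by auto

section \<open>Correctness of a single phase\<close>

locale chubanov =
  fixes N n R L b B :: nat and A :: "nat \<Rightarrow> nat \<Rightarrow> int" and eA :: exp and st0 :: state
  assumes base: "st0 (2, 5) = int n" "st0 (2, 6) = int R" "st0 (2, 8) = int (n * n)"
    and eA: "\<And>st r l. \<lbrakk>\<forall>p\<in>protected. st p = st0 p; st (2, 20) = int r; st (2, 21) = int l; r < R; l < n\<rbrakk>
      \<Longrightarrow> eval N eA st = A r l"
    and A_le: "\<And>r l. \<bar>A r l\<bar> \<le> int b" and b_pos: "1 \<le> b" and n_pos: "1 \<le> n"
    and N: "4 * n ^ 3 \<le> N" "R \<le> N" "n * n \<le> N"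
    and big: "(n * (b * 2 ^ L) * siegel_bound (n + R) (b * 2 ^ L) ^ n)\<^sup>2 < 2 ^ B" "2 * B + 2 \<le> N"
begin

text \<open>\<open>M\<close> bounds the entries of the scaled matrix, \<open>Q\<close> the
  denominator and the entries of a reduced projection.\<close>

definition "M = b * 2 ^ L"
definition "Q = siegel_bound (n + R) M ^ n"

definition env :: "state \<Rightarrow> bool" where "env st \<longleftrightarrow> (\<forall>p\<in>protected. st p = st0 p)"

definition in_range :: "state \<Rightarrow> bool" where
  "in_range st \<longleftrightarrow> env st \<and> (\<forall>l<n. 0 \<le> st (5, l) \<and> st (5, l) \<le> 2 ^ L)"

definition alive :: "state \<Rightarrow> nat set" where "alive st = {l. l < n \<and> 0 < st (5, l)}"
text \<open>Zero outside the array, because \<open>is_proj\<close> speaks of all pairs of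
  indices.\<close>

definition gm :: "state \<Rightarrow> nat \<Rightarrow> nat \<Rightarrow> int" where
  "gm st i j = (if i < n \<and> j < n then st (6, i * n + j) else 0)"
definition wm :: "state \<Rightarrow> nat \<Rightarrow> nat \<Rightarrow> int" where "wm st r l = A r l * st (5, l)"

lemma nN: "n \<le> N" using N(3) n_pos by (meson le_trans le_square)

lemma pow_lt: assumes "x \<le> int ((n * M * Q)\<^sup>2)" shows "x < 2 ^ B" "x < 2 ^ N"
proof -
  have "int ((n * M * Q)\<^sup>2) < int (2 ^ B)" using big(1) unfolding M_def Q_def by (simp only: of_nat_less_iff)
  then show B: "x < 2 ^ B" using assms by simp
  have "(2::int) ^ B \<le> 2 ^ N" using big(2) by (intro power_increasing) auto
  then show "x < 2 ^ N" by (rule less_le_trans[OF B])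
qed

lemma MQ_pos: "1 \<le> M" "1 \<le> Q"
  using b_pos siegel_bound_pos by (simp_all add: M_def Q_def one_le_power Suc_leI siegel_bound_def)

lemma env_base: "env st \<Longrightarrow> st (2, 5) = int n" "env st \<Longrightarrow> st (2, 6) = int R" "env st \<Longrightarrow> st (2, 8) = int (n * n)"
  using base unfolding env_def protected_def by auto

lemma bound_n2: "env st \<Longrightarrow> n * n = min N (nat (st (2, 8)))"
  using N(3) by (simp add: env_base(3) del: of_nat_mult)

lemma env_cong: "env st \<Longrightarrow> (\<And>p. p \<in> protected \<Longrightarrow> st' p = st p) \<Longrightarrow> env st'"
  unfolding env_def by auto

lemma in_range_cong: "in_range st \<Longrightarrow> (\<And>p. p \<in> protected \<Longrightarrow> st' p = st p) \<Longrightarrow> (\<And>l. st' (5, l) = st (5, l)) \<Longrightarrow> in_range st'"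
  unfolding in_range_def using env_cong[of st st'] by auto

lemma bounds: "b \<le> (n * M * Q)\<^sup>2" "M \<le> (n * M * Q)\<^sup>2" "n * M * Q \<le> (n * M * Q)\<^sup>2" "Q \<le> (n * M * Q)\<^sup>2"
proof -
  let ?x = "n * M * Q"
  have p: "1 \<le> n * M" "1 \<le> M * Q" "1 \<le> n * Q" using MQ_pos n_pos by (simp_all add: Suc_leI)
  have q: "1 * Q \<le> n * M * Q" using p by (intro mult_right_mono) auto
  have "M * 1 \<le> M * (n * Q)" using p by (intro mult_left_mono) auto
  then have m: "M \<le> ?x" by (simp add: algebra_simps)
  have bm: "b * 1 \<le> M" unfolding M_def by (intro mult_left_mono) auto
  have "?x * 1 \<le> ?x * ?x" using p MQ_pos n_pos by (intro mult_left_mono) (auto simp: Suc_leI)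
  then show x: "?x \<le> ?x\<^sup>2" by (simp only: power2_eq_square mult_1_right)
  show "b \<le> ?x\<^sup>2" "M \<le> ?x\<^sup>2" "Q \<le> ?x\<^sup>2"
    using q m bm x by linarith+
qed

lemma eval_sum:
  assumes "env s" shows "eval N (Sum v (V 5) e) s = (\<Sum>l<n. eval N e (s((2, v) := int l)))"
  using env_base(1)[OF assms] nN by (simp add: min_absorb2)

lemma eval_A:
  assumes "env s" "s (2, 20) = int r" "r < R" "l < n"
  shows "eval N eA (s((2, 21) := int l)) = A r l"
  using assms by (intro eA) (auto simp: env_def protected_def)

lemma eval_aw:
  assumes "env s" "s (2, 20) = int r" "r < R" "l < n"
  shows "eval N (aw eA) (s((2, 21) := int l)) = wm s r l"
proof -
  have "\<bar>A r l\<bar> < 2 ^ N" using A_le[of r l] bounds(1) by (intro pow_lt) linarith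
  then show ?thesis unfolding aw_def wm_def using eval_A[OF assms] by (subst eval_Mul) auto
qed

lemma wm_le: assumes "in_range s" "l < n" shows "\<bar>wm s r l\<bar> \<le> int M"
proof -
  have "\<bar>wm s r l\<bar> = \<bar>A r l\<bar> * \<bar>s (5, l)\<bar>" by (simp add: wm_def abs_mult)
  also have "\<dots> \<le> int b * 2 ^ L" using assms A_le by (intro mult_mono) (auto simp: in_range_def)
  finally show ?thesis by (simp add: M_def)
qed

text \<open>The program sums over all columns; those of weight 0 drop out because the scaled matrix
  is 0 there.\<close>

lemma sum_alive:
  assumes "in_range s" shows "(\<Sum>l<n. wm s r l * f l) = (\<Sum>l\<in>alive s. wm s r l * f l)"
proof (rule sum.mono_neutral_right)
  show "\<forall>i\<in>{..<n} - alive s. wm s r i * f i = 0"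
    using assms by (force simp: alive_def wm_def in_range_def)
qed (auto simp: alive_def)

lemma alive_fin: "finite (alive s)" "card (alive s) \<le> n"
proof -
  have "alive s \<subseteq> {..<n}" by (auto simp: alive_def)
  then show "finite (alive s)" "card (alive s) \<le> n"
    using finite_subset card_mono[of "{..<n}" "alive s"] by auto
qed

definition reduced :: "state \<Rightarrow> bool" where
  "reduced s \<longleftrightarrow> Gcd (insert (s (2, 30)) {gm s i j | i j. True}) = 1"

definition proj_upto :: "nat \<Rightarrow> state \<Rightarrow> bool" where
  "proj_upto r s \<longleftrightarrow> is_proj (wm s) {..<r} (alive s) (gm s) (s (2, 30)) \<and> reduced s"

text \<open>Reducedness makes the bound independent of the number of rows treated, so numbers do not
  grow from row to row.\<close>

lemma q_le:
  assumes "in_range s" "proj_upto r s" "r \<le> R" shows "s (2, 30) \<le> int Q" "\<bar>gm s i j\<bar> \<le> int Q"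
proof -
  have P: "is_proj (wm s) {..<r} (alive s) (gm s) (s (2, 30))" using assms by (simp add: proj_upto_def)
  have "s (2, 30) \<le> int (siegel_bound (card (alive s) + card {..<r}) M ^ card (alive s))"
    using assms wm_le MQ_pos alive_fin
    by (intro is_proj_denominator[OF P]) (auto simp: proj_upto_def reduced_def alive_def)
  also have "siegel_bound (card (alive s) + card {..<r}) M ^ card (alive s) \<le> siegel_bound (n + R) M ^ card (alive s)"
    using assms(3) alive_fin by (intro power_mono siegel_bound_mono) (auto intro: add_mono)
  also have "\<dots> \<le> Q" unfolding Q_def using alive_fin siegel_bound_pos by (intro power_increasing) auto
  finally show "s (2, 30) \<le> int Q" by simp
  then show "\<bar>gm s i j\<bar> \<le> int Q" using is_proj_le[OF P alive_fin(1), of i j] by linarith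
qed

lemma proj_cong:
  assumes "\<And>l. s' (5, l) = s (5, l)" "\<And>p. s' (6, p) = s (6, p)" "s' (2, 30) = s (2, 30)"
  shows "proj_upto r s' = proj_upto r s"
proof -
  have "wm s' = wm s" "gm s' = gm s" "alive s' = alive s" using assms by (auto simp: wm_def gm_def alive_def fun_eq_iff)
  then show ?thesis using assms by (simp add: proj_upto_def reduced_def)
qed

lemma eval_div_mod:
  assumes "s (2, 23) = int p" "p < n * n" "s (2, 5) = int n"
  shows "eval N (Div (V 23) (V 5)) s = int (p div n)" "eval N (rem (V 23) (V 5)) s = int (p mod n)"
proof -
  have "int p < 2 ^ N" "int n < 2 ^ N" using assms N(3) nN int_lt_pow[of p N] int_lt_pow[of n N] by linarith+
  then show "eval N (Div (V 23) (V 5)) s = int (p div n)" "eval N (rem (V 23) (V 5)) s = int (p mod n)"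
    using assms n_pos by (simp_all add: tdiv_def eval_rem zdiv_int zmod_int)
qed

lemma proj_init:
  assumes s: "in_range s" shows "proj_upto 0 (den N proj_init s)"
proof -
  define f where "f p = (if p div n = p mod n \<and> 0 < s (5, p mod n) then 1 else 0 :: int)" for p
  note e = env_base[of s]
  have env: "env s" using s by (simp add: in_range_def)
  have d: "den N proj_init s = (\<lambda>p. if fst p = 6 \<and> snd p < n * n then f (snd p) else s p)((2, 30) := 1)"
    unfolding proj_init_def den.simps(3)
  proof (subst For_fill[where K = "n * n" and f = f])
    show "n * n = min N (nat (eval N (V 8) s))" using bound_n2[OF env] by simp
    fix i t assume i: "i < n * n" and t: "\<And>p. p \<noteq> (2, 23) \<Longrightarrow> p \<notin> {6} \<times> {..<i} \<Longrightarrow> t p = s p" "t (2, 23) = int i"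
    have n: "t (2, 5) = int n" using t(1)[of "(2, 5)"] e(1)[OF env] by simp
    have w: "t (5, l) = s (5, l)" for l using t(1) by simp
    show "eval N (Cond (eq (Div (V 23) (V 5)) (rem (V 23) (V 5))) (indic (Rd 5 (rem (V 23) (V 5)))) (Num 0)) t = f i"
      using eval_div_mod[OF t(2) i n] by (simp add: f_def w del: of_nat_numeral)
  qed auto
  have g: "gm (den N proj_init s) = (\<lambda>i j. of_bool (i = j \<and> i \<in> alive s))"
    unfolding d gm_def f_def by (auto simp: fun_eq_iff alive_def index_less index_div index_mod)
  have a: "alive (den N proj_init s) = alive s" unfolding d by (auto simp: alive_def)
  have q: "den N proj_init s (2, 30) = 1" unfolding d by simp
  show ?thesis
    unfolding proj_upto_def reduced_def g a q using is_proj_empty[OF alive_fin(1)] by simp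
qed

definition uv :: "nat \<Rightarrow> state \<Rightarrow> nat \<Rightarrow> int" where "uv r s j = (\<Sum>l\<in>alive s. wm s r l * gm s l j)"
definition bv :: "nat \<Rightarrow> state \<Rightarrow> int" where "bv r s = (\<Sum>j\<in>alive s. wm s r j * uv r s j)"

lemma row_u:
  assumes s: "in_range s" and r: "s (2, 20) = int r" "r < R"
  shows "den N (row_u eA) s = (\<lambda>p. if fst p = 7 \<and> snd p < n then uv r s (snd p) else s p)"
  unfolding row_u_def
proof (rule For_fill)
  have env: "env s" using s by (simp add: in_range_def)
  show "n = min N (nat (eval N (V 5) s))" using env_base(1)[OF env] nN by simp
  fix j t assume j: "j < n" and t: "\<And>p. p \<noteq> (2, 22) \<Longrightarrow> p \<notin> {7} \<times> {..<j} \<Longrightarrow> t p = s p" "t (2, 22) = int j"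
  have env': "env t" by (rule env_cong[OF env], rule t(1)) (auto simp: protected_def)
  have w: "t (5, l) = s (5, l)" "t (6, p) = s (6, p)" "t (2, 20) = int r" for l p using t(1) r by simp_all
  have wt: "in_range t" using s env' by (simp add: in_range_def w)
  have wms: "wm t r l = wm s r l" for l by (simp add: wm_def w)
  have "eval N (Mul (aw eA) (Rd 6 (Plus (Mul (V 21) (V 5)) (V 22)))) (t((2, 21) := int l)) = wm s r l * gm s l j" if l: "l < n" for l
  proof -
    have 1: "eval N (aw eA) (t((2, 21) := int l)) = wm s r l"
      using eval_aw[OF env' w(3) r(2) l] by (simp add: wms)
    have "\<bar>wm s r l\<bar> < 2 ^ N" using wm_le[OF s l, of r] bounds(2) by (intro pow_lt) linarith
    then have "eval N (Mul (aw eA) (Rd 6 (Plus (Mul (V 21) (V 5)) (V 22)))) (t((2, 21) := int l)) =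
      wm s r l * eval N (Rd 6 (Plus (Mul (V 21) (V 5)) (V 22))) (t((2, 21) := int l))"
      using 1 by (subst eval_Mul) auto
    also have "eval N (Rd 6 (Plus (Mul (V 21) (V 5)) (V 22))) (t((2, 21) := int l)) = gm s l j"
    proof -
      have "\<bar>int l\<bar> < 2 ^ N" using l nN by (intro abs_int_lt_pow) simp
      moreover have "nat (int l * int n + int j) = l * n + j" by (simp flip: of_nat_mult of_nat_add)
      ultimately show ?thesis using t(2) env_base(1)[OF env'] l j by (simp add: tmul_def gm_def w)
    qed
    finally show ?thesis .
  qed
  then show "eval N (Sum 21 (V 5) (Mul (aw eA) (Rd 6 (Plus (Mul (V 21) (V 5)) (V 22))))) t = uv r s j"
    unfolding eval_sum[OF env'] by (simp add: uv_def flip: sum_alive[OF s])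
qed auto

lemma row_beta:
  assumes s: "in_range s" and r: "s (2, 20) = int r" "r < R" and u: "\<And>j. j < n \<Longrightarrow> s (7, j) = u j"
  shows "den N (row_beta eA) s = s((2, 34) := \<Sum>j\<in>alive s. wm s r j * u j)"
proof -
  have env: "env s" using s by (simp add: in_range_def)
  have "eval N (Mul (aw eA) (Rd 7 (V 21))) (s((2, 21) := int l)) = wm s r l * u l" if l: "l < n" for l
  proof -
    have "\<bar>wm s r l\<bar> < 2 ^ N" using wm_le[OF s l, of r] bounds(2) by (intro pow_lt) linarith
    then show ?thesis using eval_aw[OF env r l] u[OF l] by (subst eval_Mul) auto
  qed
  then have "eval N (Sum 21 (V 5) (Mul (aw eA) (Rd 7 (V 21)))) s = (\<Sum>j\<in>alive s. wm s r j * u j)"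
    unfolding eval_sum[OF env] by (simp flip: sum_alive[OF s])
  then show ?thesis by (simp add: row_beta_def)
qed

lemma row_upd:
  assumes env: "env s" and b: "\<bar>s (2, 34)\<bar> < 2 ^ N" and u: "\<And>j. j < n \<Longrightarrow> \<bar>s (7, j)\<bar> < 2 ^ N"
  shows "den N row_upd s = (\<lambda>p. if fst p = 6 \<and> snd p < n * n then
      s (2, 34) * s (6, snd p) - s (7, snd p div n) * s (7, snd p mod n) else s p)((2, 30) := s (2, 34) * s (2, 30))"
  unfolding row_upd_def den.simps(3)
proof (subst For_fill[where K = "n * n" and f = "\<lambda>p. s (2, 34) * s (6, p) - s (7, p div n) * s (7, p mod n)"])
  show "n * n = min N (nat (eval N (V 8) s))" using bound_n2[OF env] by simp
  fix i t assume i: "i < n * n" and t: "\<And>p. p \<noteq> (2, 23) \<Longrightarrow> p \<notin> {6} \<times> {..<i} \<Longrightarrow> t p = s p" "t (2, 23) = int i"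
  have n: "t (2, 5) = int n" using t(1)[of "(2, 5)"] env_base(1)[OF env] by simp
  have w: "t (7, l) = s (7, l)" "t (2, 34) = s (2, 34)" "t (6, i) = s (6, i)" for l using t(1) by simp_all
  have "i div n < n" using i by (simp add: less_mult_imp_div_less)
  then have "\<bar>s (7, i div n)\<bar> < 2 ^ N" by (rule u)
  then show "eval N (Minus (Mul (V 34) (Rd 6 (V 23))) (Mul (Rd 7 (Div (V 23) (V 5))) (Rd 7 (rem (V 23) (V 5))))) t
      = s (2, 34) * s (6, i) - s (7, i div n) * s (7, i mod n)"
    using eval_div_mod[OF t(2) i n] b t(2) by (simp add: w tmul_def del: eval.simps(7))
next
  show "den N (Set 30 (Mul (V 34) (V 30))) (\<lambda>p. if fst p = 6 \<and> snd p < n * n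
         then s (2, 34) * s (6, snd p) - s (7, snd p div n) * s (7, snd p mod n) else s p) =
    (\<lambda>p. if fst p = 6 \<and> snd p < n * n then s (2, 34) * s (6, snd p) - s (7, snd p div n) * s (7, snd p mod n)
        else s p)((2, 30) := s (2, 34) * s (2, 30))"
    using b by (simp add: tmul_def)
qed auto

lemma row_gcd:
  assumes env: "env s" and q: "0 < s (2, 30)" "s (2, 30) < 2 ^ B" and g: "\<And>p. p < n * n \<Longrightarrow> \<bar>s (6, p)\<bar> < 2 ^ B"
  shows "den N row_gcd s (2, 31) = Gcd (insert (s (2, 30)) ((\<lambda>p. s (6, p)) ` {..<n * n}))"
proof -
  let ?s = "s((2, 31) := s (2, 30))"
  define I where "I i t \<longleftrightarrow> t (2, 31) = Gcd (insert (s (2, 30)) ((\<lambda>p. s (6, p)) ` {..<i})) \<and> (\<forall>p. t (6, p) = s (6, p))"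
    for i :: nat and t :: state
  have pos: "0 < Gcd (insert (s (2, 30)) X) \<and> Gcd (insert (s (2, 30)) X) < 2 ^ B" for X
  proof -
    have "Gcd (insert (s (2, 30)) X) dvd s (2, 30)" by (rule Gcd_dvd) simp
    then have "Gcd (insert (s (2, 30)) X) \<le> s (2, 30)" using q by (simp add: zdvd_imp_le)
    moreover have "Gcd (insert (s (2, 30)) X) \<noteq> 0" using q by auto
    moreover have "0 \<le> Gcd (insert (s (2, 30)) X)" by (rule Gcd_int_greater_eq_0)
    ultimately show ?thesis using q by linarith
  qed
  show ?thesis
    unfolding row_gcd_def den.simps(3)
  proof (rule For_inv[where P = I and K = "n * n"])
    show "n * n = min N (nat (eval N (V 8) (den N (Set 31 (V 30)) s)))" using bound_n2[OF env] by simp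
    show "I 0 (den N (Set 31 (V 30)) s)" using q by (simp add: I_def)
  next
    fix i t assume i: "i < n * n" and I: "I i t"
    let ?t = "t((2, 23) := int i)"
    define t2 where "t2 = ?t((2, 32) := \<bar>s (6, i)\<bar>)"
    have d: "den N (Comp (Set 32 (eabs (Rd 6 (V 23)))) euclid) ?t = den N euclid t2"
      using I by (simp add: t2_def I_def)
    have "den N euclid t2 (2, 31) = gcd (t2 (2, 31)) (t2 (2, 32))"
      using I pos g[OF i] big(2) by (intro euclid[of _ B]) (auto simp: I_def t2_def)
    also have "\<dots> = Gcd (insert (s (2, 30)) ((\<lambda>p. s (6, p)) ` {..<Suc i}))"
      using I by (simp add: I_def t2_def lessThan_Suc insert_commute[of "s (2, 30)"] gcd.commute)
    finally have "den N euclid t2 (2, 31) = \<dots>" .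
    moreover have "den N euclid t2 (6, p) = t2 (6, p)" for p
      by (rule den_frame) (simp add: writes_euclid)
    ultimately show "I (Suc i) (den N (Comp (Set 32 (eabs (Rd 6 (V 23)))) euclid) ?t)"
      unfolding d using I by (simp add: I_def t2_def)
  next
    fix t assume "I (n * n) t"
    then show "(t((2, 23) := den N (Set 31 (V 30)) s (2, 23))) (2, 31) = Gcd (insert (s (2, 30)) ((\<lambda>p. s (6, p)) ` {..<n * n}))"
      by (simp add: I_def)
  qed
qed

lemma row_reduce:
  assumes env: "env s" and g: "0 < s (2, 31)" and q: "0 \<le> s (2, 30)" "s (2, 30) < 2 ^ N"
    and G: "\<And>p. p < n * n \<Longrightarrow> \<bar>s (6, p)\<bar> < 2 ^ N \<and> s (2, 31) dvd s (6, p)"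
  shows "den N row_reduce s = (\<lambda>p. if fst p = 6 \<and> snd p < n * n then s (6, snd p) div s (2, 31) else s p)
     ((2, 30) := s (2, 30) div s (2, 31))"
  unfolding row_reduce_def den.simps(3)
proof (subst For_fill[where K = "n * n" and f = "\<lambda>p. s (6, p) div s (2, 31)"])
  show "n * n = min N (nat (eval N (V 8) s))" using bound_n2[OF env] by simp
  fix i t assume i: "i < n * n" and t: "\<And>p. p \<noteq> (2, 23) \<Longrightarrow> p \<notin> {6} \<times> {..<i} \<Longrightarrow> t p = s p" "t (2, 23) = int i"
  have w: "t (2, 31) = s (2, 31)" "t (6, i) = s (6, i)" using t(1) by simp_all
  show "eval N (quot (Rd 6 (V 23)) (V 31)) t = s (6, i) div s (2, 31)"
    using G[OF i] g t(2) by (subst eval_quot) (simp_all add: w)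
next
  show "den N (Set 30 (Div (V 30) (V 31))) (\<lambda>p. if fst p = 6 \<and> snd p < n * n then s (6, snd p) div s (2, 31) else s p) =
    (\<lambda>p. if fst p = 6 \<and> snd p < n * n then s (6, snd p) div s (2, 31) else s p)((2, 30) := s (2, 30) div s (2, 31))"
    using q g by (simp add: tdiv_def)
qed auto

lemma row_frame: "p \<notin> {6, 7} \<times> UNIV \<Longrightarrow> fst p \<noteq> 2 \<or> snd p \<notin> {30..36} \<Longrightarrow> den N (row eA) s p = s p"
  by (rule den_frame)
     (auto simp: row_def row_u_def row_beta_def row_upd_def row_gcd_def row_reduce_def writes_euclid)

lemma row_gcd_frame: "p \<notin> {(2, 31), (2, 32), (2, 33)} \<Longrightarrow> den N row_gcd s p = s p"
  by (rule den_frame) (auto simp: row_gcd_def writes_euclid)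

text \<open>Links the gcd over all index pairs, in the definition of \<open>reduced\<close>, to the
  one that the program computes over the array: they differ by the entry 0, which does not affect a
  gcd.\<close>

lemma gm_image: "insert q {gm s i j | i j. True} = insert q (insert 0 ((\<lambda>p. s (6, p)) ` {..<n * n}))"
proof -
  have "gm s i j \<in> insert 0 ((\<lambda>p. s (6, p)) ` {..<n * n})" for i j
    by (auto simp: gm_def index_less)
  moreover have "s (6, p) = gm s (p div n) (p mod n)" if "p < n * n" for p
    using that n_pos by (auto simp: gm_def less_mult_imp_div_less)
  moreover have "0 = gm s n n" by (simp add: gm_def)
  ultimately show ?thesis by (auto 4 4)
qed

lemma row:
  assumes s: "in_range s" and r: "s (2, 20) = int r" "r < R" and P: "proj_upto r s"
  shows "proj_upto (Suc r) (den N (row eA) s)"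
proof -
  define u where "u = uv r s"
  define c where "c = bv r s"
  define q where "q = s (2, 30)"
  have env: "env s" using s by (simp add: in_range_def)
  have isp: "is_proj (wm s) {..<r} (alive s) (gm s) q" using P by (simp add: proj_upto_def q_def)
  note step = is_proj_step[OF isp alive_fin(1) uv_def bv_def]
  have ins: "insert r {..<r} = {..<Suc r}" by (simp add: lessThan_Suc)
  have q: "0 < q" "q \<le> int Q" using is_projD(1)[OF isp] q_le[OF s P] r by (auto simp: q_def)
  have gQ: "\<bar>gm s i j\<bar> \<le> int Q" for i j using q_le(2)[OF s P] r by simp
  have sumle: "\<bar>\<Sum>l\<in>alive s. wm s r l * f l\<bar> \<le> int (n * M) * X" if f: "\<And>l. l \<in> alive s \<Longrightarrow> \<bar>f l\<bar> \<le> X" and X: "0 \<le> X" for f X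
  proof -
    have "\<bar>\<Sum>l\<in>alive s. wm s r l * f l\<bar> \<le> (\<Sum>l\<in>alive s. \<bar>wm s r l * f l\<bar>)" by (rule sum_abs)
    also have "\<dots> \<le> (\<Sum>l\<in>alive s. int M * X)"
      unfolding abs_mult using wm_le[OF s] f X by (intro sum_mono mult_mono) (auto simp: alive_def)
    also have "\<dots> = int (card (alive s)) * (int M * X)" by simp
    also have "\<dots> \<le> int n * (int M * X)" using alive_fin(2)[of s] X by (intro mult_right_mono) auto
    finally show ?thesis by simp
  qed
  have u_le: "\<bar>u j\<bar> \<le> int (n * M * Q)" for j
    unfolding u_def uv_def using sumle[of "\<lambda>l. gm s l j" "int Q"] gQ by simp
  have c_le: "\<bar>c\<bar> \<le> int (n * M) * int (n * M * Q)"
    unfolding c_def bv_def u_def[symmetric] using sumle[of u "int (n * M * Q)"] u_le by simp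
  define s2 where "s2 = (\<lambda>p. if fst p = 7 \<and> snd p < n then u (snd p) else s p)((2, 34) := c)"
  have d2: "den N (row_beta eA) (den N (row_u eA) s) = s2"
  proof -
    let ?s1 = "\<lambda>p. if fst p = 7 \<and> snd p < n then u (snd p) else s p"
    have 1: "den N (row_u eA) s = ?s1" unfolding u_def by (rule row_u[OF s r])
    have w: "in_range ?s1" by (rule in_range_cong[OF s]) (auto simp: protected_def)
    have m: "wm ?s1 = wm s" "alive ?s1 = alive s" by (auto simp: wm_def alive_def fun_eq_iff)
    have "den N (row_beta eA) ?s1 = ?s1((2, 34) := \<Sum>j\<in>alive ?s1. wm ?s1 r j * u j)"
      using r by (intro row_beta[OF w]) auto
    then show ?thesis unfolding 1 m by (simp add: s2_def c_def bv_def u_def)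
  qed
  have env2: "env s2" by (rule env_cong[OF env]) (auto simp: s2_def protected_def)
  have m2: "wm s2 = wm s" "alive s2 = alive s" "gm s2 = gm s" by (auto simp: s2_def wm_def alive_def gm_def fun_eq_iff)
  show ?thesis
  proof (cases "0 < c")
    case False
    then have "c = 0" using step(1)[of r] by (simp add: c_def)
    then have "is_proj (wm s) {..<Suc r} (alive s) (gm s) q" using step(2)[of r] by (simp add: c_def ins)
    then have "proj_upto (Suc r) s" using P by (simp add: proj_upto_def q_def)
    moreover have "den N (row eA) s = s2" using False by (simp add: row_def d2) (simp add: s2_def)
    moreover have "proj_upto (Suc r) s2 = proj_upto (Suc r) s" by (rule proj_cong) (simp_all add: s2_def)
    ultimately show ?thesis by simp
  next
    case c: True
    \<comment> \<open>\<open>c * q\<close> is the denominator before reduction, and by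
      \<open>is_proj_le\<close> it also bounds all entries. From
      \<open>c \<le> (n M) (n M Q)\<close> and \<open>q \<le> Q\<close> comes the square in the
      locale assumption on \<open>B\<close>.\<close>
    have cq: "c * q \<le> int ((n * M * Q)\<^sup>2)"
    proof -
      have "c * q \<le> (int (n * M) * int (n * M * Q)) * int Q" using c_le q c by (intro mult_mono) auto
      then show ?thesis by (simp add: power2_eq_square algebra_simps)
    qed
    have "c * 1 \<le> c * q" using c q by (intro mult_left_mono) auto
    then have cN: "\<bar>c\<bar> < 2 ^ N" using c cq by (intro pow_lt) linarith
    have uN: "\<bar>u j\<bar> < 2 ^ N" for j using u_le[of j] bounds(3) by (intro pow_lt) linarith
    define s3 where "s3 = den N row_upd s2"
    have s3: "s3 = (\<lambda>p. if fst p = 6 \<and> snd p < n * n then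
      c * s (6, snd p) - u (snd p div n) * u (snd p mod n) else s2 p)((2, 30) := c * q)"
    proof -
      have lt: "p div n < n" "p mod n < n" if "p < n * n" for p using that n_pos by (auto simp: less_mult_imp_div_less)
      show ?thesis
        unfolding s3_def using cN uN lt
        by (subst row_upd[OF env2]) (auto simp: s2_def q_def fun_eq_iff)
    qed
    have env3: "env s3" unfolding s3 by (rule env_cong[OF env2]) (auto simp: protected_def)
    have m3: "wm s3 = wm s" "alive s3 = alive s"
      unfolding m2(1,2)[symmetric] by (auto simp: s3 wm_def alive_def fun_eq_iff)
    have u0: "u j = 0" if "\<not> j < n" for j using that by (simp add: u_def uv_def gm_def)
    have g3: "gm s3 = (\<lambda>i j. c * gm s i j - u i * u j)"
      by (auto simp: fun_eq_iff gm_def s3 index_less index_div index_mod u0)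
    have q3: "s3 (2, 30) = c * q" by (simp add: s3)
    have P3: "is_proj (wm s) {..<Suc r} (alive s) (gm s3) (s3 (2, 30))"
      unfolding g3 q3 using step(3)[of r] c by (simp add: c_def u_def ins)
    have le3: "\<bar>gm s3 i j\<bar> \<le> c * q" for i j using is_proj_le[OF P3 alive_fin(1)] by (simp add: q3)
    have G3: "\<bar>s3 (6, p)\<bar> \<le> c * q" if "p < n * n" for p
    proof -
      have "s3 (6, p) = gm s3 (p div n) (p mod n)" using that n_pos by (auto simp: gm_def less_mult_imp_div_less)
      then show ?thesis using le3 by simp
    qed
    have cq0: "0 < c * q" using c q by simp
    define g where "g = Gcd (insert (s3 (2, 30)) ((\<lambda>p. s3 (6, p)) ` {..<n * n}))"
    have gg: "g = Gcd (insert (s3 (2, 30)) {gm s3 i j | i j. True})"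
      unfolding gm_image g_def by (simp add: insert_commute)
    define s4 where "s4 = den N row_gcd s3"
    have s4: "s4 (2, 31) = g"
      unfolding s4_def g_def using q3 cq0 pow_lt(1)[OF cq] G3 order_le_less_trans
      by (intro row_gcd[OF env3]) (auto intro: order_le_less_trans)
    have fr4: "s4 p = s3 p" if "p \<notin> {(2, 31), (2, 32), (2, 33)}" for p
      unfolding s4_def by (rule row_gcd_frame[OF that])
    have gd1: "g dvd s3 (2, 30)" unfolding g_def by (rule Gcd_dvd) simp
    have gd2: "g dvd gm s3 i j" for i j unfolding gg by (rule Gcd_dvd) blast
    have gd3: "g dvd s3 (6, p)" if "p < n * n" for p unfolding g_def using that by (intro Gcd_dvd) simp
    note gd = gd1 gd2 gd3
    have g0: "0 < g"
    proof -
      have "g \<noteq> 0" using gd(1) q3 cq0 by auto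
      moreover have "0 \<le> g" unfolding g_def by (rule Gcd_int_greater_eq_0)
      ultimately show ?thesis by simp
    qed
    define s5 where "s5 = den N row_reduce s4"
    have s5: "s5 = (\<lambda>p. if fst p = 6 \<and> snd p < n * n then s3 (6, snd p) div g else s4 p)((2, 30) := (c * q) div g)"
    proof -
      have "env s4" by (rule env_cong[OF env3], rule fr4) (auto simp: protected_def)
      then show ?thesis
        unfolding s5_def using g0 gd(3) cq0 pow_lt(2)[OF cq] G3
        by (subst row_reduce) (auto simp: s4 fr4 q3 fun_eq_iff intro: order_le_less_trans)
    qed
    have m5: "wm s5 = wm s" "alive s5 = alive s" unfolding m3[symmetric]
      by (auto simp: s5 fr4 wm_def alive_def fun_eq_iff)
    have g5: "gm s5 = (\<lambda>i j. gm s3 i j div g)" by (auto simp: fun_eq_iff gm_def s5 index_less)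
    have q5: "s5 (2, 30) = s3 (2, 30) div g" by (simp add: s5 q3)
    have P5: "is_proj (wm s5) {..<Suc r} (alive s5) (gm s5) (s5 (2, 30))"
      unfolding m5 g5 q5 by (rule is_proj_reduce[OF P3 g0 gd(1,2)])
    have "reduced s5"
    proof -
      let ?X = "insert (s5 (2, 30)) {gm s5 i j | i j. True}"
      have img: "(*) g ` ?X = insert (s3 (2, 30)) {gm s3 i j | i j. True}"
      proof -
        have 1: "g * s5 (2, 30) = s3 (2, 30)" "g * gm s5 i j = gm s3 i j" for i j
          using gd(1,2) by (simp_all add: q5 g5)
        have "(*) g ` {gm s5 i j | i j. True} = {g * gm s5 i j | i j. True}" by auto
        then show ?thesis by (simp add: 1)
      qed
      have "normalize (g * Gcd ?X) = Gcd ((*) g ` ?X)" by (rule Gcd_mult[symmetric])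
      also have "\<dots> = g" by (simp only: img gg[symmetric])
      finally have "g = g * Gcd ?X" using g0 Gcd_int_greater_eq_0[of ?X] by (simp add: abs_mult)
      then show ?thesis using g0 by (simp add: reduced_def)
    qed
    then have "proj_upto (Suc r) s5" using P5 by (simp add: proj_upto_def)
    moreover have "den N (row eA) s = s5"
      using c by (simp add: row_def d2 s5_def s4_def s3_def) (simp add: s2_def)
    ultimately show ?thesis by simp
  qed
qed

lemma project_frame: "p \<notin> {6, 7} \<times> UNIV \<Longrightarrow> fst p \<noteq> 2 \<or> snd p \<notin> {30..34} \<Longrightarrow> den N (project eA) s p = s p"
  by (rule den_frame)
     (auto simp: project_def proj_init_def row_def row_u_def row_beta_def row_upd_def row_gcd_def row_reduce_def writes_euclid)

lemma project:
  assumes s: "in_range s" shows "proj_upto R (den N (project eA) s)"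
proof -
  let ?s = "den N proj_init s"
  define I where "I i t \<longleftrightarrow> in_range t \<and> proj_upto i t" for i t
  have env: "env s" using s by (simp add: in_range_def)
  have fr: "?s p = s p" if "p \<notin> {6} \<times> UNIV" "p \<noteq> (2, 30)" for p
    by (rule den_frame) (use that in \<open>auto simp: proj_init_def\<close>)
  have w: "in_range ?s" by (rule in_range_cong[OF s]; rule fr) (auto simp: protected_def)
  then have env': "env ?s" by (simp add: in_range_def)
  have wu: "in_range (t((2, 20) := x)) = in_range t" for t x
    by (auto simp: in_range_def env_def protected_def)
  have pu: "proj_upto i (t((2, 20) := x)) = proj_upto i t" for t x i
    by (rule proj_cong) auto
  show ?thesis
    unfolding project_def den.simps(3)
  proof (rule For_inv[where P = I and K = R])
    show "R = min N (nat (eval N (V 6) ?s))" using env_base(2)[OF env'] N(2) by simp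
    show "I 0 ?s" using proj_init[OF s] w by (simp add: I_def)
  next
    fix i t assume i: "i < R" and I: "I i t"
    let ?t = "t((2, 20) := int i)"
    have t: "in_range ?t" "proj_upto i ?t" using I wu pu by (auto simp: I_def)
    have "in_range (den N (row eA) ?t)" by (rule in_range_cong[OF t(1)]; rule row_frame) (auto simp: protected_def)
    then show "I (Suc i) (den N (row eA) ?t)" using row[OF t(1) _ i t(2)] by (simp add: I_def)
  next
    fix t assume "I R t"
    then show "proj_upto R (t((2, 20) := ?s (2, 20)))" using pu by (simp add: I_def)
  qed
qed

definition zv :: "state \<Rightarrow> nat \<Rightarrow> int" where "zv s i = (\<Sum>l\<in>alive s. s (8, l) * gm s l i)"

lemma eval_zx:
  assumes s: "in_range s" and P: "proj_upto R s" and j: "s (2, 22) = int j" "j < n"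
    and y: "\<And>l. l < n \<Longrightarrow> 0 \<le> s (8, l) \<and> s (8, l) \<le> int N"
  shows "eval N zx s = zv s j"
proof -
  have env: "env s" using s by (simp add: in_range_def)
  have G0: "gm s l j = 0" if "l \<notin> alive s" for l
    using P that is_projD(3) by (fastforce simp: proj_upto_def)
  have "eval N (Mul (Rd 8 (V 21)) (Rd 6 (Plus (Mul (V 21) (V 5)) (V 22)))) (s((2, 21) := int l)) = s (8, l) * gm s l j"
    if l: "l < n" for l
  proof -
    have "\<bar>s (8, l)\<bar> < 2 ^ N" using y[OF l] int_lt_pow[OF le_refl, of N] by linarith
    moreover have "\<bar>int l\<bar> < 2 ^ N" using l nN by (intro abs_int_lt_pow) simp
    moreover have "nat (int l * int n + int j) = l * n + j" by (simp flip: of_nat_mult of_nat_add)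
    ultimately show ?thesis using env_base(1)[OF env] l j by (simp add: tmul_def gm_def)
  qed
  then have "eval N zx s = (\<Sum>l<n. s (8, l) * gm s l j)"
    unfolding zx_def eval_sum[OF env] by simp
  also have "\<dots> = zv s j"
    unfolding zv_def by (rule sum.mono_neutral_right) (use G0 in \<open>auto simp: alive_def\<close>)
  finally show ?thesis .
qed

text \<open>While scalar 35 is 0, exactly \<open>t\<close> steps have been made. Once it is set the
  remaining steps are idle, and \<open>t\<close> is merely an upper bound for \<open>y\<close>,
  which keeps the products with \<open>y\<close> below the cut-off.\<close>

definition ystate :: "nat \<Rightarrow> state \<Rightarrow> bool" where
  "ystate t s \<longleftrightarrow> in_range s \<and> proj_upto R s \<and> (\<forall>l<n. 0 \<le> s (8, l) \<and> s (8, l) \<le> int t \<and> (l \<notin> alive s \<longrightarrow> s (8, l) = 0)) \<and>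
    (if s (2, 35) = 0 then (\<Sum>l\<in>alive s. s (8, l)) = int t \<and>
        (\<Sum>i\<in>alive s. zv s i * zv s i) \<le> s (2, 30) * s (2, 30) * int t
     else s (2, 35) = 1 \<and> (\<forall>i\<in>alive s. 0 < zv s i))"

lemma ystate_cong:
  assumes "ystate t s" "\<And>p. p \<noteq> (2, 22) \<Longrightarrow> p \<noteq> (2, 24) \<Longrightarrow> p \<noteq> (2, 36) \<Longrightarrow> s' p = s p"
  shows "ystate t s'"
proof -
  have "in_range s'" by (rule in_range_cong[of s]) (use assms in \<open>auto simp: ystate_def protected_def\<close>)
  moreover have "proj_upto R s' = proj_upto R s" by (rule proj_cong) (use assms(2) in auto)
  moreover have ag: "alive s' = alive s" "gm s' = gm s" using assms(2) by (auto simp: alive_def gm_def fun_eq_iff)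
  moreover have "zv s' = zv s" using assms(2) by (simp add: zv_def ag fun_eq_iff)
  moreover have "s' (2, 35) = s (2, 35)" "s' (2, 30) = s (2, 30)" "\<And>l. s' (8, l) = s (8, l)"
    using assms(2) by auto
  ultimately show ?thesis using assms(1) by (simp add: ystate_def)
qed

lemma perceptron:
  assumes y: "ystate t s" and t: "t < N"
  shows "ystate (Suc t) (den N perceptron s)"
proof (cases "s (2, 35) = 0")
  case False
  then have "den N perceptron s = s" using y by (simp add: perceptron_def ystate_def)
  moreover have "ystate (Suc t) s" using y False by (force simp: ystate_def)
  ultimately show ?thesis by simp
next
  case f: True
  have w: "in_range s" and P: "proj_upto R s" and env: "env s" using y by (auto simp: ystate_def in_range_def)
  have yb: "0 \<le> s (8, l)" "s (8, l) \<le> int t" "l \<notin> alive s \<Longrightarrow> s (8, l) = 0" if "l < n" for l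
    using y that by (auto simp: ystate_def)
  have sums: "(\<Sum>l\<in>alive s. s (8, l)) = int t" "(\<Sum>i\<in>alive s. zv s i * zv s i) \<le> s (2, 30) * s (2, 30) * int t"
    using y f by (auto simp: ystate_def)
  let ?e = "conj (Rd 5 (V 22)) (le zx (Num 0))"
  have K: "n = min N (nat (s (2, 5)))" using env_base(1)[OF env] nN by simp
  obtain k where k: "den N (find ?e) s = s((2, 36) := k)"
    "(k = 0 \<and> (\<forall>j<n. \<not> (j \<in> alive s \<and> zv s j \<le> 0))) \<or> (\<exists>j<n. k = int j + 1 \<and> j \<in> alive s \<and> zv s j \<le> 0)"
  proof (rule find[of n N s, OF K, where P = "\<lambda>j. j \<in> alive s \<and> zv s j \<le> 0" and e = ?e])
    fix j u assume j: "j < n" and u: "\<And>p. p \<noteq> (2, 22) \<Longrightarrow> p \<noteq> (2, 36) \<Longrightarrow> u p = s p" "u (2, 22) = int j"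
    have wu: "in_range u" by (rule in_range_cong[OF w]; rule u(1)) (auto simp: protected_def)
    have Pu: "proj_upto R u" using P by (subst proj_cong[of u s]) (auto intro: u(1))
    have ag: "alive u = alive s" "gm u = gm s" using u(1) by (auto simp: alive_def gm_def fun_eq_iff)
    have au: "alive u = alive s" "zv u = zv s" using u(1) by (simp_all add: zv_def ag fun_eq_iff)
    have "0 \<le> u (8, l) \<and> u (8, l) \<le> int N" if "l < n" for l using yb[OF that] t u(1) by auto
    then have "eval N zx u = zv s j" using eval_zx[OF wu Pu u(2) j] au by simp
    moreover have "u (5, j) = s (5, j)" using u(1) by simp
    ultimately show "0 < eval N ?e u \<longleftrightarrow> j \<in> alive s \<and> zv s j \<le> 0"
      using j u(2) by (simp add: alive_def)
  qed blast
  let ?u = "s((2, 36) := k)"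
  have isp: "is_proj (wm s) {..<R} (alive s) (gm s) (s (2, 30))" using P by (simp add: proj_upto_def)
  show ?thesis
  proof (cases "k = 0")
    case True
    then have z: "\<forall>i\<in>alive s. 0 < zv s i" using k(2) by (force simp: alive_def)
    define v where "v = s((2, 36) := k, (2, 35) := 1)"
    have d: "den N perceptron s = v" using f k(1) True by (simp add: perceptron_def v_def)
    have "in_range v" by (rule in_range_cong[OF w]) (auto simp: v_def protected_def)
    moreover have "proj_upto R v" using P by (subst proj_cong[of v s]) (auto simp: v_def)
    moreover have ag: "alive v = alive s" "gm v = gm s" "v (2, 35) = 1" "\<And>l. v (8, l) = s (8, l)"
      by (auto simp: v_def alive_def gm_def fun_eq_iff)
    moreover have "zv v = zv s" by (simp add: zv_def ag fun_eq_iff)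
    ultimately show ?thesis unfolding d ystate_def using z yb by fastforce
  next
    case False
    then obtain j where j: "j < n" "k = int j + 1" "j \<in> alive s" "zv s j \<le> 0" using k(2) by blast
    define v where "v = s((2, 36) := k, (8, j) := s (8, j) + 1)"
    have d: "den N perceptron s = v" using f k(1) j by (simp add: perceptron_def v_def)
    have v: "alive v = alive s" "gm v = gm s" "v (2, 35) = 0" "v (2, 30) = s (2, 30)"
      using f by (auto simp: v_def alive_def gm_def fun_eq_iff)
    have yv: "v (8, l) = ((\<lambda>l. s (8, l))(j := s (8, j) + 1)) l" for l by (simp add: v_def)
    have "in_range v" by (rule in_range_cong[OF w]) (auto simp: v_def protected_def)
    moreover have "proj_upto R v" using P by (subst proj_cong[of v s]) (auto simp: v_def)
    moreover have "(\<Sum>l\<in>alive v. v (8, l)) = int (Suc t)"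
    proof -
      have "(\<Sum>l\<in>alive s. v (8, l)) = (s (8, j) + 1) + (\<Sum>l\<in>alive s - {j}. s (8, l))"
        unfolding yv using alive_fin(1) j(3) by (subst sum.remove[of _ j]) (auto intro!: sum.cong)
      also have "\<dots> = (\<Sum>l\<in>alive s. s (8, l)) + 1"
        using sum.remove[OF alive_fin(1) j(3), of "\<lambda>l. s (8, l)"] by simp
      finally show ?thesis using sums by (simp add: v)
    qed
    moreover have "(\<Sum>i\<in>alive v. zv v i * zv v i) \<le> v (2, 30) * v (2, 30) * int (Suc t)"
    proof -
      have "(\<Sum>i\<in>alive s. zv v i * zv v i) \<le> s (2, 30) * s (2, 30) * (int t + 1)"
        by (rule perceptron_step[OF isp alive_fin(1) zv_def sums(2) j(3,4)]) (simp add: zv_def v yv)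
      then show ?thesis by (simp add: v algebra_simps)
    qed
    moreover have "0 \<le> v (8, l) \<and> v (8, l) \<le> int (Suc t) \<and> (l \<notin> alive v \<longrightarrow> v (8, l) = 0)" if "l < n" for l
      using yb[OF that] j(3) by (auto simp: v yv)
    ultimately show ?thesis unfolding d ystate_def using v(3) by simp
  qed
qed

lemma phase:
  assumes s: "in_range s" "s (2, 35) = 0"
  defines "s' \<equiv> den N (phase eA) s"
  shows "(s' (2, 35) = 1 \<and> ystate N s' \<and> (\<forall>l. s' (5, l) = s (5, l))) \<or>
    (s' (2, 35) = 0 \<and> (\<exists>j\<in>alive s. (\<forall>l. s' (5, l) = (if l = j then s (5, j) div 2 else s (5, l))) \<and>
      (\<forall>x. kern (wm s) {..<R} (alive s) x \<longrightarrow> (\<forall>l\<in>alive s. 0 \<le> x l \<and> x l \<le> 1) \<longrightarrow> 2 * x j \<le> 1)))"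
    "env s'"
proof -
  let ?y = "For 22 (V 5) (Put 8 (V 22) (Num 0))"
  define s1 where "s1 = den N (project eA) s"
  define s2 where "s2 = den N ?y s1"
  define s3 where "s3 = den N (For 24 Bound perceptron) s2"
  have env: "env s" using s by (simp add: in_range_def)
  have f1: "s1 p = s p" if "p \<notin> {6, 7} \<times> UNIV" "fst p \<noteq> 2 \<or> snd p \<notin> {30..34}" for p
    unfolding s1_def by (rule project_frame[OF that])
  have w1: "in_range s1" by (rule in_range_cong[OF s(1)]; rule f1) (auto simp: protected_def)
  have P1: "proj_upto R s1" unfolding s1_def by (rule project[OF s(1)])
  have e1: "env s1" using w1 by (simp add: in_range_def)
  have s2: "s2 = (\<lambda>p. if fst p = 8 \<and> snd p < n then 0 else s1 p)"
    unfolding s2_def using env_base(1)[OF e1] nN by (subst For_fill[where f = "\<lambda>_. 0" and K = n]) auto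
  have w2: "in_range s2" by (rule in_range_cong[OF w1]) (auto simp: s2 protected_def)
  have P2: "proj_upto R s2" using P1 by (subst proj_cong[of s2 s1]) (auto simp: s2)
  have a12: "alive s2 = alive s" by (auto simp: alive_def s2 f1)
  have y2: "ystate 0 s2"
  proof -
    have z: "s2 (8, l) = 0" if "l \<in> alive s2" for l using that by (auto simp: s2 alive_def)
    have "zv s2 i = 0" for i unfolding zv_def by (rule sum.neutral) (simp add: z)
    moreover have "(\<Sum>l\<in>alive s2. s2 (8, l)) = 0" by (rule sum.neutral) (simp add: z)
    moreover have "s2 (2, 35) = 0" using s(2) by (simp add: s2 f1)
    ultimately show ?thesis using w2 P2 by (simp add: ystate_def) (simp add: s2)
  qed
  have f3: "s3 p = s2 p" if "p \<notin> {8} \<times> UNIV" "p \<notin> {(2, 35), (2, 36)}" for p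
    unfolding s3_def by (rule den_frame) (use that in \<open>auto simp: perceptron_def find_def\<close>)
  have y3: "ystate N s3"
    unfolding s3_def
  proof (rule For_inv[where P = ystate and K = N and Q = "ystate N"])
    show "N = min N (nat (eval N Bound s2))" by simp
    show "ystate 0 s2" by (rule y2)
  next
    fix i t assume i: "i < N" "ystate i t"
    have "ystate i (t((2, 24) := int i))" by (rule ystate_cong[OF i(2)]) auto
    then show "ystate (Suc i) (den N perceptron (t((2, 24) := int i)))" using i(1) by (rule perceptron)
  next
    fix t assume "ystate N t"
    then show "ystate N (t((2, 24) := s2 (2, 24)))" by (rule ystate_cong) auto
  qed
  have W3: "s3 (5, l) = s (5, l)" for l by (simp add: f3 s2 f1)
  have a3: "alive s3 = alive s" and m3: "wm s3 = wm s" by (auto simp: alive_def wm_def W3 fun_eq_iff)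
  have w3: "in_range s3" and P3: "proj_upto R s3" and e3: "env s3" using y3 by (auto simp: ystate_def in_range_def)
  have s': "s' = den N halve s3" using s(2) by (simp add: s'_def phase_def s3_def s2_def s1_def)
  show "env s'"
    unfolding s' by (rule env_cong[OF e3], rule den_frame) (auto simp: halve_def find_def protected_def)
  show "(s' (2, 35) = 1 \<and> ystate N s' \<and> (\<forall>l. s' (5, l) = s (5, l))) \<or>
    (s' (2, 35) = 0 \<and> (\<exists>j\<in>alive s. (\<forall>l. s' (5, l) = (if l = j then s (5, j) div 2 else s (5, l))) \<and>
      (\<forall>x. kern (wm s) {..<R} (alive s) x \<longrightarrow> (\<forall>l\<in>alive s. 0 \<le> x l \<and> x l \<le> 1) \<longrightarrow> 2 * x j \<le> 1)))"
  proof (cases "s3 (2, 35) = 0")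
    case False
    then have "s3 (2, 35) = 1" using y3 by (auto simp: ystate_def)
    then have "s' = s3" by (simp add: s' halve_def)
    then show ?thesis using y3 W3 \<open>s3 (2, 35) = 1\<close> by simp
  next
    case f: True
    have y: "0 \<le> s3 (8, l)" "s3 (8, l) \<le> int N" "l \<notin> alive s \<Longrightarrow> s3 (8, l) = 0" if "l < n" for l
      using y3 that by (auto simp: ystate_def a3)
    have sums: "(\<Sum>l\<in>alive s. s3 (8, l)) = int N" "(\<Sum>i\<in>alive s. zv s3 i * zv s3 i) \<le> s3 (2, 30) * s3 (2, 30) * int N"
      using y3 f by (auto simp: ystate_def a3)
    have Npos: "0 < N" using N(3) n_pos by (cases n) auto
    have n5: "s3 (2, 5) = int n" using env_base(1)[OF e3] .
    have K: "n = min N (nat (s3 (2, 5)))" using n5 nN by simp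
    obtain k where k: "den N (find (le Bound (Mul (V 5) (Rd 8 (V 22))))) s3 = s3((2, 36) := k)"
      "(k = 0 \<and> (\<forall>j<n. \<not> int N \<le> int n * s3 (8, j))) \<or> (\<exists>j<n. k = int j + 1 \<and> int N \<le> int n * s3 (8, j))"
    proof (rule find[of n N s3, OF K, where P = "\<lambda>j. int N \<le> int n * s3 (8, j)" and e = "le Bound (Mul (V 5) (Rd 8 (V 22)))"])
      fix j u assume j: "j < n" and u: "\<And>p. p \<noteq> (2, 22) \<Longrightarrow> p \<noteq> (2, 36) \<Longrightarrow> u p = s3 p" "u (2, 22) = int j"
      have "\<bar>int n\<bar> < 2 ^ N" by (rule abs_int_lt_pow[OF nN])
      then show "0 < eval N (le Bound (Mul (V 5) (Rd 8 (V 22)))) u \<longleftrightarrow> int N \<le> int n * s3 (8, j)"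
        using u n5 by (simp add: tmul_def)
    qed blast
    \<comment> \<open>Pigeonhole: at most \<open>n\<close> entries of \<open>y\<close> add up to
      \<open>N\<close>, so they cannot all be below \<open>N / n\<close>.\<close>
    have "k \<noteq> 0"
    proof
      assume "k = 0"
      then have lt: "int n * s3 (8, j) < int N" if "j < n" for j using k(2) that by force
      have ne: "alive s \<noteq> {}" using sums(1) Npos by auto
      have "int n * int N = (\<Sum>l\<in>alive s. int n * s3 (8, l))" by (simp add: sums(1) flip: sum_distrib_left)
      also have "\<dots> < (\<Sum>l\<in>alive s. int N)" using lt ne alive_fin(1) by (intro sum_strict_mono) (auto simp: alive_def)
      also have "\<dots> = int (card (alive s)) * int N" by simp
      also have "\<dots> \<le> int n * int N" using alive_fin(2) by (intro mult_right_mono) auto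
      finally show False by simp
    qed
    then obtain j where j: "j < n" "k = int j + 1" "int N \<le> int n * s3 (8, j)" using k(2) by blast
    have ja: "j \<in> alive s" using j y(3)[OF j(1)] Npos by (cases "j \<in> alive s") auto
    have "s3 (5, j) < 2 ^ N"
    proof -
      have "s3 (5, j) \<le> 2 ^ L" using w3 j(1) by (simp add: in_range_def)
      also have "(2::int) ^ L \<le> int M" using b_pos by (simp add: M_def)
      finally show ?thesis using bounds(2) by (intro pow_lt) linarith
    qed
    moreover have "0 \<le> s3 (5, j)" using w3 j(1) by (simp add: in_range_def)
    ultimately have d: "s' = s3((2, 36) := k, (5, j) := s (5, j) div 2)"
      using f k(1) j by (simp add: s' halve_def tdiv_def W3)
    have isp: "is_proj (wm s) {..<R} (alive s) (gm s3) (s3 (2, 30))"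
      using P3 by (simp add: proj_upto_def a3 m3)
    have "2 * x j \<le> 1" if x: "kern (wm s) {..<R} (alive s) x" "\<forall>l\<in>alive s. 0 \<le> x l \<and> x l \<le> 1" for x
      using x j(3) y alive_fin(2) N(1) Npos
      by (intro perceptron_half[OF isp alive_fin(1) zv_def[of s3, unfolded a3] sums(2) _ alive_fin(2) N(1) Npos ja])
         (auto simp: alive_def mult.commute)
    then show ?thesis using ja by (intro disjI2) (auto simp: d f W3)
  qed
qed

end

text \<open>A kernel vector \<open>z\<close> of the matrix scaled by \<open>W\<close> yields the
  kernel vector with entries \<open>W l * z l\<close> of the original matrix.\<close>

definition phases :: "exp \<Rightarrow> com" where
  "phases eA = Comp (Set 35 (Num 0)) (Comp (For 25 Bound (phase eA))
     (For 22 (V 5) (Put 9 (V 22) (Mul (Rd 5 (V 22)) zx))))"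

section \<open>Weights as upper bounds on solutions, and the number of phases\<close>

locale chubanov_phases = chubanov +
  fixes S0 :: "nat set"
  assumes S0: "S0 \<subseteq> {..<n}" and L: "siegel_bound (n + R) b \<le> 2 ^ L" and many: "n * (L + 1) < N"
begin

text \<open>For a weight \<open>2 ^ e\<close> this is \<open>e + 1\<close>; the sum of the levels decreases in every phase.\<close>

definition lev :: "int \<Rightarrow> nat" where "lev w = card {e. e \<le> L \<and> 2 ^ e \<le> w}"

lemma lev_pow: "e \<le> L \<Longrightarrow> lev (2 ^ e) = e + 1"
proof -
  assume "e \<le> L"
  then have "{e'. e' \<le> L \<and> (2::int) ^ e' \<le> 2 ^ e} = {..e}" by auto
  then show ?thesis by (simp add: lev_def)
qed

lemma lev_0: "lev 0 = 0"
proof -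
  have "{e. e \<le> L \<and> (2::int) ^ e \<le> 0} = {}" using zero_less_power[of "2::int"] by (auto simp: not_le)
  then show ?thesis by (simp add: lev_def)
qed

definition feas :: "(nat \<Rightarrow> real) \<Rightarrow> bool" where
  "feas x \<longleftrightarrow> kern A {..<R} S0 x \<and> (\<forall>l\<in>S0. 0 \<le> x l)"

definition weights :: "state \<Rightarrow> bool" where
  "weights s \<longleftrightarrow> env s \<and> (\<forall>l<n. s (5, l) = 0 \<or> (\<exists>e\<le>L. s (5, l) = 2 ^ e)) \<and>
     (\<forall>l<n. l \<notin> S0 \<longrightarrow> s (5, l) = 0) \<and>
     (\<forall>x. feas x \<longrightarrow> (\<forall>l\<in>S0. x l \<le> 1) \<longrightarrow> (\<forall>l\<in>S0. x l * 2 ^ L \<le> real_of_int (s (5, l))))"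

lemma weights_in_range: "weights s \<Longrightarrow> in_range s"
proof -
  assume w: "weights s"
  have "0 \<le> s (5, l) \<and> s (5, l) \<le> 2 ^ L" if "l < n" for l
  proof -
    have "s (5, l) = 0 \<or> (\<exists>e\<le>L. s (5, l) = 2 ^ e)" using w that by (simp add: weights_def)
    then show ?thesis by (auto intro: power_increasing)
  qed
  then show ?thesis using w by (simp add: weights_def in_range_def)
qed

lemma fin_S0: "finite S0" "card S0 \<le> n"
  using finite_subset[OF S0] card_mono[OF _ S0] by auto

lemma feas_pos:
  assumes x: "feas x" and j: "j \<in> S0" "0 < x j"
  obtains y where "feas y" "\<And>l. l \<in> S0 \<Longrightarrow> y l \<le> 1" "1 \<le> y j * 2 ^ L"
proof -
  have kx: "kern A {..<R} S0 x" "\<And>l. l \<in> S0 \<Longrightarrow> 0 \<le> x l" using x by (auto simp: feas_def)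
  obtain y where y: "kern A {..<R} S0 y" "\<And>l. 0 \<le> y l" "\<And>l. y l \<le> 1" "1 \<le> y j * real (siegel_bound (card S0 + card {..<R}) b)"
    by (rule basic_solution[OF finite_lessThan[of R] fin_S0(1) b_pos A_le kx j]; (rule that)?)
  have "siegel_bound (card S0 + card {..<R}) b \<le> siegel_bound (n + R) b" using fin_S0 by (intro siegel_bound_mono) simp
  then have "siegel_bound (card S0 + card {..<R}) b \<le> 2 ^ L" using L by simp
  then have "real (siegel_bound (card S0 + card {..<R}) b) \<le> real (2 ^ L)" by (simp only: of_nat_le_iff)
  then have "y j * real (siegel_bound (card S0 + card {..<R}) b) \<le> y j * real (2 ^ L)" using y(2) by (rule mult_left_mono)
  then show thesis using y by (intro that[of y]) (auto simp: feas_def)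
qed

lemma weights_halve:
  assumes s: "weights s" and j: "j \<in> alive s"
    and s': "env s'" "\<And>l. s' (5, l) = (if l = j then s (5, j) div 2 else s (5, l))"
    and half: "\<And>x. kern (wm s) {..<R} (alive s) x \<Longrightarrow> (\<And>l. l \<in> alive s \<Longrightarrow> 0 \<le> x l \<and> x l \<le> 1) \<Longrightarrow> 2 * x j \<le> 1"
  shows "weights s'" "(\<Sum>l<n. lev (s' (5, l))) + 1 = (\<Sum>l<n. lev (s (5, l)))"
proof -
  have jn: "j < n" "0 < s (5, j)" using j by (auto simp: alive_def)
  have out: "s (5, l) = 0" if "l < n" "l \<notin> S0" for l using s that unfolding weights_def by blast
  have aS: "alive s \<subseteq> S0"
  proof
    fix l assume "l \<in> alive s"
    then have "l < n" "0 < s (5, l)" by (auto simp: alive_def)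
    then show "l \<in> S0" using out[of l] by (cases "l \<in> S0") auto
  qed
  have jS: "j \<in> S0" using aS j by blast
  have "s (5, j) = 0 \<or> (\<exists>e\<le>L. s (5, j) = 2 ^ e)" using s jn unfolding weights_def by blast
  then obtain e where e: "e \<le> L" "s (5, j) = 2 ^ e" using jn by auto
  have x2: "2 * (x j * 2 ^ L) \<le> real_of_int (s (5, j))" if x: "feas x" "\<And>l. l \<in> S0 \<Longrightarrow> x l \<le> 1" for x
  proof -
    \<comment> \<open>The coordinates of \<open>x\<close> with respect to the scaled matrix. The
      invariant on the weights says precisely that \<open>z\<close> lies in the unit box.\<close>
    define z where "z l = x l * 2 ^ L / real_of_int (s (5, l))" for l
    have bx: "x l * 2 ^ L \<le> real_of_int (s (5, l))" if "l \<in> S0" for l using s x that by (simp add: weights_def)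
    have x0: "0 \<le> x l" if "l \<in> S0" for l using x that by (simp add: feas_def)
    have z01: "0 \<le> z l \<and> z l \<le> 1" if "l \<in> alive s" for l
    proof -
      have "0 < s (5, l)" "l \<in> S0" using that aS by (auto simp: alive_def)
      then show ?thesis using bx x0 by (simp add: z_def)
    qed
    have "(\<Sum>l\<in>alive s. real_of_int (wm s r l) * z l) = 0" if r: "r < R" for r
    proof -
      have "(\<Sum>l\<in>alive s. real_of_int (wm s r l) * z l) = (\<Sum>l\<in>alive s. (real_of_int (A r l) * x l) * 2 ^ L)"
        by (intro sum.cong) (auto simp: z_def wm_def alive_def)
      also have "\<dots> = (\<Sum>l\<in>alive s. real_of_int (A r l) * x l) * 2 ^ L" by (simp add: sum_distrib_right)
      also have "(\<Sum>l\<in>alive s. real_of_int (A r l) * x l) = (\<Sum>l\<in>S0. real_of_int (A r l) * x l)"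
      \<comment> \<open>Where the weight is 0 the invariant forces \<open>x l = 0\<close>, so
        columns dropped earlier do not matter.\<close>
      proof (rule sum.mono_neutral_left[OF fin_S0(1) aS], intro ballI)
        fix l assume l: "l \<in> S0 - alive s"
        then have "l < n" using S0 by auto
        then have "s (5, l) = 0" using l weights_in_range[OF s] by (auto simp: alive_def in_range_def)
        then have "x l * 2 ^ L \<le> 0" using bx[of l] l by simp
        then have "x l \<le> 0" by (meson mult_pos_pos not_le zero_less_numeral zero_less_power)
        then show "real_of_int (A r l) * x l = 0" using x0[of l] l by simp
      qed
      finally show ?thesis using x r by (simp add: feas_def kern_def)
    qed
    then have "kern (wm s) {..<R} (alive s) z" by (simp add: kern_def)
    then have "2 * z j \<le> 1" using half z01 by blast
    then show ?thesis using jn by (simp add: z_def field_simps)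
  qed
  \<comment> \<open>For \<open>e > 0\<close> halving is exact. A weight of 1 becomes 0, so
    \<open>x j\<close> must vanish: otherwise \<open>feas_pos\<close> gives a solution
    \<open>y\<close> in the box with \<open>y j * 2 ^ L \<ge> 1\<close>, while the halved bound
    allows at most 1/2.\<close>
  have new: "x j * 2 ^ L \<le> real_of_int (s (5, j) div 2)" if x: "feas x" "\<forall>l\<in>S0. x l \<le> 1" for x
  proof (cases e)
    case (Suc e')
    then show ?thesis using x2[of x] x e by simp
  next
    case 0
    have "x j \<le> 0"
    proof (rule ccontr)
      assume "\<not> x j \<le> 0"
      then obtain y where y: "feas y" "\<And>l. l \<in> S0 \<Longrightarrow> y l \<le> 1" "1 \<le> y j * 2 ^ L"
        using feas_pos[OF x(1) jS] by auto
      show False using x2[OF y(1,2)] y(3) e 0 by simp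
    qed
    then have "x j * 2 ^ L \<le> 0" by (simp add: mult_nonpos_nonneg)
    then show ?thesis using e 0 by simp
  qed
  have "s' (5, j) = 0 \<or> (\<exists>e\<le>L. s' (5, j) = 2 ^ e)"
    using e s'(2)[of j] by (cases e) auto
  then show "weights s'"
    using s s'(1) new jS unfolding weights_def s'(2) by auto
  have "lev (s (5, j)) = e + 1" using lev_pow[OF e(1)] e(2) by simp
  moreover have "lev (s' (5, j)) = e"
    using e s'(2)[of j] lev_0 lev_pow by (cases e) auto
  ultimately have "lev (s' (5, j)) + 1 = lev (s (5, j))" by simp
  then show "(\<Sum>l<n. lev (s' (5, l))) + 1 = (\<Sum>l<n. lev (s (5, l)))"
    using jn by (simp add: sum.remove[of "{..<n}" j] s'(2))
qed

lemma phases_loop: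
  assumes s: "env s" "s (2, 35) = 0" "\<And>l. l < n \<Longrightarrow> s (5, l) = (if l \<in> S0 then 2 ^ L else 0)"
  defines "s' \<equiv> den N (For 25 Bound (phase eA)) s"
  shows "weights s'" "s' (2, 35) = 1" "ystate N s'"
proof -
  \<comment> \<open>Each unsuccessful phase lowers the sum of the levels by 1, and it starts at no
    more than \<open>n * (L + 1)\<close>, which is less than \<open>N\<close>. So some phase
    succeeds.\<close>
  define I where "I i t \<longleftrightarrow> weights t \<and> ((t (2, 35) = 1 \<and> ystate N t) \<or>
     (t (2, 35) = 0 \<and> (\<Sum>l<n. lev (t (5, l))) + i \<le> n * (L + 1)))" for i t
  have "I N s' \<and> True"
    unfolding s'_def
  proof (rule For_inv[where P = I and K = N and Q = "\<lambda>t. I N t \<and> True"])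
    show "N = min N (nat (eval N Bound s))" by simp
    have "weights s"
      using s S0 by (auto simp: weights_def intro!: exI[of _ L])
    moreover have "lev (s (5, l)) \<le> L + 1" if "l < n" for l
      using s(3)[OF that] lev_0 lev_pow[of L] by auto
    then have "(\<Sum>l<n. lev (s (5, l))) \<le> n * (L + 1)"
      using sum_bounded_above[of "{..<n}" "\<lambda>l. lev (s (5, l))" "L + 1"] by simp
    ultimately show "I 0 s" using s(2) by (simp add: I_def)
  next
    fix i t assume i: "i < N" and I: "I i t"
    let ?t = "t((2, 25) := int i)"
    have wt: "weights t" using I by (simp add: I_def)
    have e: "env ?t" by (rule env_cong[of t]) (use wt in \<open>auto simp: weights_def protected_def\<close>)
    have w: "weights ?t" using wt e by (simp add: weights_def)
    show "I (Suc i) (den N (phase eA) ?t)"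
    proof (cases "t (2, 35) = 0")
      case False
      then have "t (2, 35) = 1" "ystate N t" using I by (auto simp: I_def)
      moreover have "den N (phase eA) ?t = ?t" using calculation by (simp add: phase_def)
      moreover have "ystate N ?t"
        using \<open>ystate N t\<close> e unfolding ystate_def
        by (auto simp: in_range_def proj_cong[of ?t t] alive_def zv_def gm_def)
      ultimately show ?thesis using w by (simp add: I_def)
    next
      case f: True
      let ?u = "den N (phase eA) ?t"
      have f': "?t (2, 35) = 0" using f by simp
      note ph = phase[of ?t, OF weights_in_range[OF w] f']
      from ph(1) show ?thesis
      proof (elim disjE conjE bexE)
        assume u: "?u (2, 35) = 1" "ystate N ?u" "\<forall>l. ?u (5, l) = ?t (5, l)"
        then have "weights ?u" using w ph(2) by (simp add: weights_def)
        then show ?thesis using u by (simp add: I_def)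
      next
        fix j assume u: "?u (2, 35) = 0" "j \<in> alive ?t" "\<forall>l. ?u (5, l) = (if l = j then ?t (5, j) div 2 else ?t (5, l))"
          "\<forall>x. kern (wm ?t) {..<R} (alive ?t) x \<longrightarrow> (\<forall>l\<in>alive ?t. 0 \<le> x l \<and> x l \<le> 1) \<longrightarrow> 2 * x j \<le> 1"
        have h: "weights ?u" "(\<Sum>l<n. lev (?u (5, l))) + 1 = (\<Sum>l<n. lev (?t (5, l)))"
          by (rule weights_halve[OF w u(2) ph(2)]; use u in blast)+
        moreover have "(\<Sum>l<n. lev (?t (5, l))) + i \<le> n * (L + 1)" using I f by (simp add: I_def)
        ultimately show ?thesis using u(1) by (simp add: I_def)
      qed
    qed
  next
    fix t assume I: "I N t"
    let ?t = "t((2, 25) := s (2, 25))"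
    have t: "t (2, 35) = 1" "ystate N t" "weights t" using I many by (auto simp: I_def)
    have e: "env ?t" by (rule env_cong[of t]) (use t in \<open>auto simp: weights_def protected_def\<close>)
    have "ystate N ?t"
      using t(2) e unfolding ystate_def
      by (auto simp: in_range_def proj_cong[of ?t t] alive_def zv_def gm_def)
    then show "I N ?t \<and> True" using t e by (simp add: I_def weights_def)
  qed
  then have I: "I N s'" by simp
  then show "weights s'" "s' (2, 35) = 1" "ystate N s'" using many by (auto simp: I_def)
qed

lemma phases:
  assumes s: "env s" "\<And>l. l < n \<Longrightarrow> s (5, l) = (if l \<in> S0 then 2 ^ L else 0)"
  defines "X \<equiv> \<lambda>l. if l < n then den N (phases eA) s (9, l) else 0"
  shows "env (den N (phases eA) s)" "\<And>l. 0 \<le> X l" "\<And>l. l \<notin> S0 \<Longrightarrow> X l = 0"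
    "\<And>r. r < R \<Longrightarrow> (\<Sum>l\<in>S0. A r l * X l) = 0"
    "\<And>x l. feas x \<Longrightarrow> l \<in> S0 \<Longrightarrow> 0 < x l \<Longrightarrow> 0 < X l"
proof -
  let ?F = "For 22 (V 5) (Put 9 (V 22) (Mul (Rd 5 (V 22)) zx))"
  define s1 where "s1 = s((2, 35) := 0)"
  define s2 where "s2 = den N (For 25 Bound (phase eA)) s1"
  have s1: "env s1" "s1 (2, 35) = 0" "\<And>l. l < n \<Longrightarrow> s1 (5, l) = (if l \<in> S0 then 2 ^ L else 0)"
    using s by (auto simp: s1_def env_def protected_def)
  have w: "weights s2" and f: "s2 (2, 35) = 1" and y: "ystate N s2"
    unfolding s2_def by (rule phases_loop[of s1, OF s1]; assumption)+
  have in_range: "in_range s2" and P: "proj_upto R s2" and e: "env s2" using y by (auto simp: ystate_def in_range_def)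
  have d: "den N (phases eA) s = (\<lambda>p. if fst p = 9 \<and> snd p < n then s2 (5, snd p) * zv s2 (snd p) else s2 p)"
    unfolding phases_def den.simps(3)
  proof -
    have 1: "den N (For 25 Bound (phase eA)) (den N (Set 35 (Num 0)) s) = s2" by (simp add: s2_def s1_def)
    show "den N ?F (den N (For 25 Bound (phase eA)) (den N (Set 35 (Num 0)) s)) =
       (\<lambda>p. if fst p = 9 \<and> snd p < n then s2 (5, snd p) * zv s2 (snd p) else s2 p)"
      unfolding 1
    proof (rule For_fill)
      show "n = min N (nat (eval N (V 5) s2))" using env_base(1)[OF e] nN by simp
      fix j t assume j: "j < n" and t: "\<And>p. p \<noteq> (2, 22) \<Longrightarrow> p \<notin> {9} \<times> {..<j} \<Longrightarrow> t p = s2 p" "t (2, 22) = int j"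
      have wt: "in_range t" by (rule in_range_cong[OF in_range]; rule t(1)) (auto simp: protected_def)
      have Pt: "proj_upto R t" using P by (subst proj_cong[of t s2]) (auto intro: t(1))
      have ag: "alive t = alive s2" "gm t = gm s2" using t(1) by (auto simp: alive_def gm_def fun_eq_iff)
      have z: "zv t = zv s2" using t(1) by (simp add: zv_def ag fun_eq_iff)
      have "0 \<le> t (8, l) \<and> t (8, l) \<le> int N" if "l < n" for l using y t(1) that by (simp add: ystate_def)
      then have ez: "eval N zx t = zv s2 j" using eval_zx[OF wt Pt t(2) j] z by simp
      have w5: "t (5, j) = s2 (5, j)" by (rule t(1)) auto
      have "\<bar>s2 (5, j)\<bar> < 2 ^ N"
      proof -
        have "\<bar>s2 (5, j)\<bar> \<le> 2 ^ L" using in_range j by (simp add: in_range_def)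
        also have "(2::int) ^ L \<le> int M" using b_pos by (simp add: M_def)
        finally show ?thesis using bounds(2) by (intro pow_lt) linarith
      qed
      then show "eval N (Mul (Rd 5 (V 22)) zx) t = s2 (5, j) * zv s2 j"
        using t(2) ez w5 by (subst eval_Mul) auto
    qed auto
  qed
  have X: "X l = (if l \<in> alive s2 then s2 (5, l) * zv s2 l else 0)" for l
    using in_range unfolding X_def d by (force simp: alive_def in_range_def)
  have zpos: "0 < zv s2 l" if "l \<in> alive s2" for l using y f that by (simp add: ystate_def)
  have aS: "alive s2 \<subseteq> S0"
  proof
    fix l assume "l \<in> alive s2"
    then have "l < n" "0 < s2 (5, l)" by (auto simp: alive_def)
    then show "l \<in> S0" using w unfolding weights_def by (metis less_irrefl)
  qed
  show "env (den N (phases eA) s)" unfolding d by (rule env_cong[OF e]) (auto simp: protected_def)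
  show "0 \<le> X l" for l using zpos[of l] by (auto simp: X alive_def)
  show "X l = 0" if "l \<notin> S0" for l using that aS by (auto simp: X)
  show "(\<Sum>l\<in>S0. A r l * X l) = 0" if r: "r < R" for r
  proof -
    have isp: "is_proj (wm s2) {..<R} (alive s2) (gm s2) (s2 (2, 30))" using P by (simp add: proj_upto_def)
    have "(\<Sum>l\<in>S0. A r l * X l) = (\<Sum>l\<in>alive s2. A r l * X l)"
      by (rule sum.mono_neutral_right[OF fin_S0(1) aS]) (auto simp: X)
    also have "\<dots> = (\<Sum>i\<in>alive s2. wm s2 r i * zv s2 i)"
      by (intro sum.cong) (auto simp: X wm_def)
    also have "\<dots> = (\<Sum>l\<in>alive s2. s2 (8, l) * (\<Sum>i\<in>alive s2. wm s2 r i * gm s2 i l))"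
      unfolding zv_def sum_distrib_left
      by (subst sum.swap) (simp add: algebra_simps is_projD(2)[OF isp])
    also have "\<dots> = 0" using is_projD(5)[OF isp] r by simp
    finally show ?thesis .
  qed
  \<comment> \<open>Maximal support: \<open>l\<close> is at least \<open>2 ^ (- L)\<close> in some
    solution in the box, so its weight has never dropped to 0, and on such columns the result is
    positive.\<close>
  fix x l assume x: "feas x" and l: "l \<in> S0" "0 < x l"
  obtain v where v: "feas v" "\<And>l. l \<in> S0 \<Longrightarrow> v l \<le> 1" "1 \<le> v l * 2 ^ L" using feas_pos[OF x l] by blast
  have "v l * 2 ^ L \<le> real_of_int (s2 (5, l))" using w v l by (simp add: weights_def)
  then have "0 < s2 (5, l)" using v(3) by simp
  then have "l \<in> alive s2" using l S0 by (auto simp: alive_def)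
  then show "0 < X l" using zpos[of l] by (simp add: X alive_def)
qed

end

section \<open>Extracting a sparse solution\<close>

definition e_t :: "exp \<Rightarrow> exp" where "e_t l = Div l (V 3)"
definition e_d :: "exp \<Rightarrow> exp" where "e_d l = rem l (V 3)"
definition e_s :: "exp \<Rightarrow> exp" where "e_s l = rem (e_t l) (V 3)"
definition e_c :: "exp \<Rightarrow> exp" where "e_c l = rem (Div (e_t l) (V 3)) (V 3)"
definition e_j :: "exp \<Rightarrow> exp" where "e_j l = rem (Div (Div (e_t l) (V 3)) (V 3)) (V 3)"
definition e_i :: "exp \<Rightarrow> exp" where "e_i l = Div (Div (Div (e_t l) (V 3)) (V 3)) (V 3)"
definition e_w :: "exp \<Rightarrow> exp" where "e_w l = Mul (e_d l) (Rd 3 (e_j l))"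
definition e_h :: "exp \<Rightarrow> exp" where
  "e_h l = Plus (Plus (e_t l) (Mul (V 3) (V 3))) (Plus (Mul (e_d l) (V 3)) (e_w l))"
text \<open>The homogenising column is the last one.\<close>

definition e_const :: exp where "e_const = Minus (V 5) (Num 1)"

definition e_valid :: "exp \<Rightarrow> exp" where
  "e_valid l = conj (lt (e_i l) (V 0)) (conj (lt (e_j l) (V 0))
     (conj (Cond (e_j l) (Num 1) (conj (eq (e_c l) (Num 0)) (eq (e_s l) (Num 0))))
     (conj (le (Plus (e_c l) (e_d l)) (V 1)) (conj (lt (Plus (e_s l) (e_w l)) (V 3))
     (Cond (eq (Plus (e_j l) (Num 1)) (V 0))
       (conj (eq (Plus (e_c l) (e_d l)) (V 1)) (le (Plus (e_s l) (e_w l)) (Rd 4 (e_i l)))) (Num 1))))))"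

definition e_A :: exp where
  "e_A = Cond (lt (V 20) (V 4))
    (Cond (lt (rem (Div (Div (V 20) (V 3)) (V 3)) (V 3)) (V 0))
      (Cond (eq (V 21) e_const)
        (indic (conj (eq (rem (V 20) (V 14)) (Num 0)) (lt (Div (V 20) (V 14)) (V 0))))
        (Minus (indic (eq (V 20) (e_h (V 21)))) (indic (eq (V 20) (e_t (V 21))))))
      (Num 0))
    (Cond (eq (V 21) e_const) (Minus (Num 0) (V 1))
      (Cond (eq (e_j (V 21)) (Minus (V 20) (V 4))) (e_d (V 21)) (Num 0)))"

text \<open>Scalar 54 is the arc reached, 56 the node where it ends, and 27 counts the
  extensions.\<close>

definition extend_path :: com where
  "extend_path = Comp (Set 56 (e_h (V 54)))
    (Comp (find (conj (Rd 9 (V 22)) (eq (e_t (V 22)) (V 56))))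
    (Comp (Set 54 (Minus (V 36) (Num 1)))
    (Comp (Put 10 (Plus (V 27) (Num 1)) (V 54))
      (When (lt (Rd 9 (V 54)) (V 55)) (Set 55 (Rd 9 (V 54))) Skip))))"

definition find_path :: com where
  "find_path = Comp (Set 54 (Minus (V 36) (Num 1))) (Comp (Set 55 (Rd 9 (V 54)))
    (Comp (Put 10 (Num 0) (V 54)) (For 27 (Minus (V 0) (Num 1)) extend_path)))"

definition remove_path :: com where
  "remove_path = For 27 (V 0) (Put 9 (Rd 10 (V 27)) (Minus (Rd 9 (Rd 10 (V 27))) (V 55)))"

definition write_entry :: com where
  "write_entry = Comp (Put 0 (V 52) (e_i (Rd 10 (Num 0))))
    (Comp (For 27 (V 0) (Put 0 (Plus (Plus (V 52) (Num 1)) (V 27)) (e_d (Rd 10 (V 27)))))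
    (Comp (Put 0 (Plus (Plus (V 52) (Num 1)) (V 0)) (V 55))
    (Comp (Put 0 (Plus (Plus (V 52) (Num 2)) (V 0)) (V 50))
    (Comp (Set 52 (Plus (Plus (V 52) (Num 3)) (V 0))) (Set 51 (Plus (V 51) (Num 1)))))))"

definition extract_step :: com where
  "extract_step = Comp (find (conj (Rd 9 (V 22)) (eq (e_j (V 22)) (Num 0))))
    (When (V 36) (Comp find_path (Comp remove_path write_entry)) Skip)"

text \<open>Scalar 50 is the common denominator, 51 counts the entries, 52 points behind the output
  written so far, 55 is the bottleneck of the current path, whose arcs are in array 10.\<close>

definition output_paths :: com where
  "output_paths = Comp (Set 50 (Rd 9 e_const)) (Comp (Put 9 e_const (Num 0))
    (Comp (Set 51 (Num 0)) (Comp (Set 52 (Num 2)) (Comp (For 26 Bound extract_step)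
    (Comp (Put 0 (Num 0) (Num 1)) (Put 0 (Num 1) (V 51)))))))"

section \<open>The matrix as seen by the program, and the extraction of paths\<close>

locale lp_program = lp_instance +
  fixes N :: nat and st0 :: state
  assumes sc: "st0 (2, 0) = int (length \<alpha>)" "st0 (2, 1) = int k" "st0 (2, 3) = int b" "st0 (2, 4) = int (b ^ 4)"
      "st0 (2, 5) = int (b ^ 5 + 1)" "st0 (2, 6) = int (b ^ 4 + length \<alpha>)"
      "st0 (2, 8) = int ((b ^ 5 + 1) * (b ^ 5 + 1))" "st0 (2, 14) = int (b ^ 3)"
    and ar: "\<And>j. j < length \<alpha> \<Longrightarrow> st0 (3, j) = int (\<alpha> ! j)" "\<And>j. \<not> j < length \<alpha> \<Longrightarrow> st0 (3, j) = 0"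
      "\<And>i. i < length \<alpha> \<Longrightarrow> st0 (4, i) = T - \<sigma> ! i"
    and NB: "b ^ 6 \<le> N" and b4: "4 \<le> b"
begin

abbreviation "nn \<equiv> b ^ 5 + 1"

definition env' :: "state \<Rightarrow> bool" where "env' st \<longleftrightarrow> (\<forall>p\<in>protected. st p = st0 p)"

lemma env'D:
  assumes "env' s"
  shows "s (2, 0) = int m" "s (2, 1) = int k" "s (2, 3) = int b" "s (2, 4) = int (b ^ 4)"
    "s (2, 5) = int nn" "s (2, 14) = int (b ^ 3)"
    "j < m \<Longrightarrow> s (3, j) = int (\<alpha> ! j)" "\<not> j < m \<Longrightarrow> s (3, j) = 0" "j < m \<Longrightarrow> s (4, j) = T - \<sigma> ! j"
  using assms sc ar unfolding env'_def protected_def by auto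

lemma env'_cong: "env' st \<Longrightarrow> (\<And>p. p \<in> protected \<Longrightarrow> st' p = st p) \<Longrightarrow> env' st'"
  unfolding env'_def by auto

lemma pows: "b \<le> b ^ 5" "b ^ 5 + 1 \<le> N" "b ^ 3 \<le> N" "b ^ 4 + b \<le> N" "b \<le> N"
proof -
  have i: "b ^ i \<le> b ^ j" if "i \<le> j" for i j using that b4 by (intro power_increasing) auto
  show "b \<le> b ^ 5" using i[of 1 5] by simp
  have "4 * b ^ 5 \<le> b * b ^ 5" using b4 by (intro mult_right_mono) auto
  then have 6: "4 * b ^ 5 \<le> N" using NB by (simp add: numeral_eq_Suc)
  moreover have "1 \<le> b ^ 5" using b4 by (simp add: Suc_leI)
  ultimately show "b ^ 5 + 1 \<le> N" by linarith
  show "b ^ 3 \<le> N" "b \<le> N" "b ^ 4 + b \<le> N" using 6 i[of 3 5] i[of 1 5] i[of 4 5] by simp_all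
qed

lemma eval_b:
  assumes s: "s (2, 3) = int b" and e: "eval N e s = int x" "x \<le> N"
  shows "eval N (Div e (V 3)) s = int (x div b)" "eval N (rem e (V 3)) s = int (x mod b)" "x div b \<le> N" "x mod b \<le> N"
proof -
  have "int x < 2 ^ N" "int b < 2 ^ N" using int_lt_pow e(2) pows(5) by blast+
  then show "eval N (Div e (V 3)) s = int (x div b)" "eval N (rem e (V 3)) s = int (x mod b)"
    using s e b_pos by (simp_all add: tdiv_def eval_rem zdiv_int zmod_int)
  show "x div b \<le> N" "x mod b \<le> N" using e(2) by (meson div_le_dividend mod_less_eq_dividend le_trans)+
qed

lemma eval_digits:
  assumes env: "env' s" and e: "eval N e s = int l" "l \<le> N"
  shows "eval N (e_t e) s = int (l div b)" "eval N (e_d e) s = int (dig_d b l)"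
    "eval N (e_s e) s = int (dig_s b l)" "eval N (e_c e) s = int (dig_c b l)"
    "eval N (e_j e) s = int (dig_j b l)" "eval N (e_i e) s = int (dig_i b l)"
    "eval N (e_w e) s = int (dig_d b l * (if dig_j b l < m then \<alpha> ! dig_j b l else 0))"
    "eval N (e_h e) s = int (head \<alpha> b l)"
proof -
  note s = env'D(3)[OF env]
  note 1 = eval_b[OF s e]
  note 2 = eval_b[OF s 1(1) 1(3)]
  note 3 = eval_b[OF s 2(1) 2(3)]
  note 4 = eval_b[OF s 3(1) 3(3)]
  show t: "eval N (e_t e) s = int (l div b)" and d: "eval N (e_d e) s = int (dig_d b l)"
    and "eval N (e_s e) s = int (dig_s b l)" "eval N (e_c e) s = int (dig_c b l)"
    and j: "eval N (e_j e) s = int (dig_j b l)" and "eval N (e_i e) s = int (dig_i b l)"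
    using 1 2 3 4 by (simp_all add: e_t_def e_d_def e_s_def e_c_def e_j_def e_i_def
      dig_d_def dig_s_def dig_c_def dig_j_def dig_i_def)
  have dN: "\<bar>int (dig_d b l)\<bar> < 2 ^ N" "\<bar>int b\<bar> < 2 ^ N"
    by (rule abs_int_lt_pow, use dig_lt(1)[of l] pows(5) in linarith)+
  show w: "eval N (e_w e) s = int (dig_d b l * (if dig_j b l < m then \<alpha> ! dig_j b l else 0))"
    using d j dN env'D(7,8)[OF env, of "dig_j b l"] by (simp add: e_w_def tmul_def)
  show "eval N (e_h e) s = int (head \<alpha> b l)"
    using t d w dN s by (simp add: e_h_def tmul_def head_def)
qed

lemma eval_const: "env' s \<Longrightarrow> eval N e_const s = int (b ^ 5)"
  by (simp add: e_const_def env'D(5))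

lemma eval_valid:
  assumes env: "env' s" and e: "eval N e s = int l" "l \<le> N"
  shows "0 < eval N (e_valid e) s \<longleftrightarrow> valid \<alpha> \<sigma> k T b l"
proof -
  note d = eval_digits[OF assms]
  note s = env'D[OF env]
  have g: "eval N (Plus (e_s e) (e_w e)) s = int (dig_s b l + dig_d b l * \<alpha> ! dig_j b l)" if "dig_j b l < m"
    using d that by simp
  show ?thesis
  proof (cases "dig_i b l < m \<and> dig_j b l < m")
    case False
    then show ?thesis unfolding e_valid_def valid_def using d s(1) by auto
  next
    case True
    note g = g[OF conjunct2[OF True]]
    have 4: "s (4, dig_i b l) = T - \<sigma> ! dig_i b l" using s(9) True by blast
    have j1: "int (dig_j b l) + 1 = int m \<longleftrightarrow> dig_j b l + 1 = m" by linarith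
    have lts: "(int (dig_s b l + dig_d b l * \<alpha> ! dig_j b l) < int b) = (dig_s b l + dig_d b l * \<alpha> ! dig_j b l < b)"
      by (rule of_nat_less_iff)
    have c1: "int (dig_c b l) + int (dig_d b l) \<le> int k \<longleftrightarrow> dig_c b l + dig_d b l \<le> k"
      "int (dig_c b l) + int (dig_d b l) = int k \<longleftrightarrow> dig_c b l + dig_d b l = k" by linarith+
    have tail: "0 < eval N (Cond (eq (Plus (e_j e) (Num 1)) (V 0))
       (conj (eq (Plus (e_c e) (e_d e)) (V 1)) (le (Plus (e_s e) (e_w e)) (Rd 4 (e_i e)))) (Num 1)) s \<longleftrightarrow>
      (dig_j b l + 1 = m \<longrightarrow> dig_c b l + dig_d b l = k \<and> int (dig_s b l + dig_d b l * \<alpha> ! dig_j b l) \<le> T - \<sigma> ! dig_i b l)"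
    proof -
      have 1: "eval N (Plus (e_j e) (Num 1)) s = int (dig_j b l) + 1" "eval N (V 0) s = int m" "eval N (V 1) s = int k"
        "eval N (Plus (e_c e) (e_d e)) s = int (dig_c b l) + int (dig_d b l)"
        "eval N (Rd 4 (e_i e)) s = T - \<sigma> ! dig_i b l"
        using d s(1,2) 4 by simp_all
      show ?thesis
        by (cases "dig_j b l + 1 = m")
           (simp_all only: eval.simps(8) eval_tests 1 g j1 c1(2) if_True if_False eval.simps(1) simp_thms zero_less_one)
    qed
    have mid: "0 < eval N (Cond (e_j e) (Num 1) (conj (eq (e_c e) (Num 0)) (eq (e_s e) (Num 0)))) s \<longleftrightarrow>
      (dig_j b l = 0 \<longrightarrow> dig_c b l = 0 \<and> dig_s b l = 0)"
      unfolding eval.simps(8) d(5) by (cases "dig_j b l = 0") (simp_all add: d)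
    have 2: "eval N (V 0) s = int m" "eval N (V 1) s = int k" "eval N (V 3) s = int b"
      "eval N (Plus (e_c e) (e_d e)) s = int (dig_c b l) + int (dig_d b l)"
      using d s(1,2,3) by simp_all
    show ?thesis
      unfolding e_valid_def eval_tests(1-4) tail mid g 2 d(5,6) lts c1 valid_def of_nat_less_iff by blast
  qed
qed

lemma eval_e_A:
  assumes env: "env' s" and r: "s (2, 20) = int r" "r < b ^ 4 + m" and l: "s (2, 21) = int l" "l < nn"
  shows "eval N e_A s = amat \<alpha> k b r l"
proof -
  note sd = env'D[OF env]
  have lN: "l \<le> N" and rN: "r \<le> N" using l r pows m_b by linarith+
  have v: "eval N (V 20) s = int r" "eval N (V 21) s = int l" "eval N (V 4) s = int (b ^ 4)" "eval N (V 0) s = int m"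
    "eval N (V 1) s = int k"
    using r l sd by simp_all
  note d = eval_digits[OF env v(2) lN]
  note r1 = eval_b[OF sd(3) v(1) rN]
  note r2 = eval_b[OF sd(3) r1(1) r1(3)]
  note r3 = eval_b[OF sd(3) r2(1) r2(3)]
  have b3: "0 < int (b ^ 3)" "int (b ^ 3) < 2 ^ N" "int r < 2 ^ N"
    using b_pos int_lt_pow[OF pows(3)] int_lt_pow[OF rN] by simp_all
  have v14: "eval N (V 14) s = int (b ^ 3)" using sd(6) by simp
  have rb: "eval N (rem (V 20) (V 14)) s = int (r mod b ^ 3)" "eval N (Div (V 20) (V 14)) s = int (r div b ^ 3)"
    using b3 v14 v(1) by (simp_all only: eval_rem eval_Div zdiv_int zmod_int of_nat_0_le_iff)
  have e5: "eval N e_const s = int (b ^ 5)" by (rule eval_const[OF env])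
  have z: "int (r mod b ^ 3) = 0 \<longleftrightarrow> r mod b ^ 3 = 0" by simp
  show ?thesis
  proof (cases "r < b ^ 4")
    case True
    show ?thesis
      unfolding e_A_def eval.simps(8) eval_tests v r3 e5 rb eval.simps(1) eval.simps(5) d of_nat_less_iff of_nat_eq_iff z amat_def
      using True by simp
  next
    case False
    have sub: "int (dig_j b l) = int r - int (b ^ 4) \<longleftrightarrow> dig_j b l = r - b ^ 4" using False by linarith
    show ?thesis
      unfolding e_A_def eval.simps(8) eval_tests v r3 e5 eval.simps(1) eval.simps(5) d of_nat_less_iff of_nat_eq_iff sub amat_def
      using False by simp
  qed
qed

lemma eval_e_A_protected:
  assumes "\<forall>p\<in>protected. st p = st0 p" "st (2, 20) = int r" "st (2, 21) = int l" "r < b ^ 4 + m" "l < nn"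
  shows "eval N e_A st = amat \<alpha> k b r l"
  using assms by (intro eval_e_A) (auto simp: env'_def)

definition enc :: "lp_entry list \<Rightarrow> int list" where "enc es = concat (map encode_entry es)"

text \<open>Entries are written from cell 2 on; the flag and the number of entries go to cells 0 and
  1 when all paths are known. Overwriting the input is harmless, as \<open>init1\<close> has copied
  it to other arrays.\<close>

definition ext :: "int \<Rightarrow> state \<Rightarrow> (nat \<Rightarrow> int) \<Rightarrow> lp_entry list \<Rightarrow> bool" where
  "ext D t X es \<longleftrightarrow> env' t \<and> (\<forall>l<nn. t (9, l) = X l) \<and> decomposed D X es \<and> t (2, 50) = D \<and>
     t (2, 51) = int (length es) \<and> t (2, 52) = int (2 + length (enc es)) \<and>
     (\<forall>a<length (enc es). t (0, 2 + a) = enc es ! a)"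

lemma flow_pos: assumes "is_flow X" "0 < X l" shows "valid \<alpha> \<sigma> k T b l" "l < b ^ 5" "l < nn" "l \<le> N"
proof -
  show v: "valid \<alpha> \<sigma> k T b l" using assms by (force simp: is_flow_def)
  then show "l < b ^ 5" "l < nn" "l \<le> N" using valid_lt[OF v] pows(2) by auto
qed

lemma find_K: "env' t \<Longrightarrow> nn = min N (nat (t (2, 5)))"
  unfolding env'D(5)[of t] nat_int using pows(2) by simp

lemma extend_path:
  assumes env: "env' t" and X: "\<And>l. l < nn \<Longrightarrow> t (9, l) = X l" "is_flow X"
    and l: "t (2, 54) = int l" "0 < X l" "dig_j b l + 1 < m" and j: "t (2, 27) = int j"
  shows "\<exists>l'. 0 < X l' \<and> l' div b = head \<alpha> b l \<and>
    (let u = den N extend_path t in u (2, 54) = int l' \<and> u (10, j + 1) = int l' \<and> u (2, 55) = min (t (2, 55)) (X l') \<and>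
      (\<forall>p. p \<notin> {2} \<times> {36, 54, 55, 56} \<longrightarrow> p \<noteq> (10, j + 1) \<longrightarrow> u p = t p))"
proof -
  note lv = flow_pos[OF X(2) l(2)]
  have lN: "eval N (V 54) t = int l" using l(1) by simp
  define t1 where "t1 = t((2, 56) := int (head \<alpha> b l))"
  have h: "eval N (e_h (V 54)) t = int (head \<alpha> b l)" by (rule eval_digits(8)[OF env lN lv(4)])
  have t1: "den N (Set 56 (e_h (V 54))) t = t1" using h by (simp add: t1_def)
  have env1: "env' t1" by (rule env'_cong[OF env]) (auto simp: t1_def protected_def)
  let ?e = "conj (Rd 9 (V 22)) (eq (e_t (V 22)) (V 56))"
  obtain k where k: "den N (find ?e) t1 = t1((2, 36) := k)"
    "(k = 0 \<and> (\<forall>j<nn. \<not> (0 < X j \<and> j div b = head \<alpha> b l))) \<or> (\<exists>j<nn. k = int j + 1 \<and> 0 < X j \<and> j div b = head \<alpha> b l)"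
  proof (rule find[of nn N t1, OF find_K[OF env1], where P = "\<lambda>j. 0 < X j \<and> j div b = head \<alpha> b l" and e = ?e])
    fix j u assume j: "j < nn" and u: "\<And>p. p \<noteq> (2, 22) \<Longrightarrow> p \<noteq> (2, 36) \<Longrightarrow> u p = t1 p" "u (2, 22) = int j"
    have envu: "env' u" by (rule env'_cong[OF env1]; rule u(1)) (auto simp: protected_def)
    have jN: "j \<le> N" using j pows(2) by simp
    have v: "eval N (V 22) u = int j" using u(2) by simp
    have 1: "u (9, j) = X j" "u (2, 56) = int (head \<alpha> b l)" using u(1)[of "(9, j)"] u(1)[of "(2, 56)"] X(1)[OF j] by (simp_all add: t1_def)
    have "eval N (e_t (V 22)) u = int (j div b)" by (rule eval_digits(1)[OF envu v jN])
    then show "0 < eval N ?e u \<longleftrightarrow> 0 < X j \<and> j div b = head \<alpha> b l"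
      using 1 u(2) by simp
  qed blast
  obtain d where d: "d < b" "0 < X (head \<alpha> b l * b + d)" using flow_next[OF X(2) l(2,3)] by blast
  have "(head \<alpha> b l * b + d) div b = head \<alpha> b l" using d(1) by simp
  then have "k \<noteq> 0" using k(2) d(2) flow_pos(3)[OF X(2) d(2)] by auto
  then obtain l' where l': "l' < nn" "k = int l' + 1" "0 < X l'" "l' div b = head \<alpha> b l" using k(2) by blast
  have t9: "t (9, l') = X l'" by (rule X(1)[OF l'(1)])
  have nj: "nat (int j + 1) = j + 1" by simp
  define u where "u = den N extend_path t"
  have u: "u = (let v = t1((2, 36) := k, (2, 54) := int l', (10, j + 1) := int l') in
      if X l' < t (2, 55) then v((2, 55) := X l') else v)"
    unfolding u_def extend_path_def den.simps(3) t1 k(1) using l' t9 j nj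
    by (simp add: t1_def Let_def)
  show ?thesis
    unfolding u_def[symmetric] Let_def
  proof (intro exI[of _ l'] conjI allI impI)
    show "0 < X l'" "l' div b = head \<alpha> b l" by (rule l')+
    show "u (2, 54) = int l'" "u (10, j + 1) = int l'" by (simp_all add: u Let_def)
    show "u (2, 55) = min (t (2, 55)) (X l')" by (simp add: u Let_def t1_def min_def)
    fix p :: "nat \<times> nat" assume "p \<notin> {2} \<times> {36, 54, 55, 56}" "p \<noteq> (10, j + 1)"
    then show "u p = t p" by (cases p) (auto simp: u Let_def t1_def)
  qed
qed

text \<open>By \<open>flow_next\<close> the walk cannot get stuck before the last index. That the
  bottleneck is attained on the path is recorded because it drives termination.\<close>

lemma find_path:
  assumes env: "env' s" and X: "\<And>l. l < nn \<Longrightarrow> s (9, l) = X l" "is_flow X"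
    and l0: "s (2, 36) = int l0 + 1" "0 < X l0" "dig_j b l0 = 0"
  defines "u \<equiv> den N find_path s"
  shows "\<exists>P. (\<forall>i<m. u (10, i) = int (P i) \<and> 0 < X (P i) \<and> u (2, 55) \<le> X (P i)) \<and> dig_j b (P 0) = 0 \<and>
    (\<forall>i. Suc i < m \<longrightarrow> P (Suc i) div b = head \<alpha> b (P i)) \<and> (\<exists>i<m. u (2, 55) = X (P i))"
    "p \<notin> {2} \<times> {36, 54, 55, 56} \<Longrightarrow> p \<notin> {10} \<times> UNIV \<Longrightarrow> u p = s p"
proof -
  have wr: "writes find_path \<subseteq> {2} \<times> {36, 54, 55, 56} \<union> {10} \<times> UNIV"
    by (auto simp: find_path_def extend_path_def find_def)
  show "p \<notin> {2} \<times> {36, 54, 55, 56} \<Longrightarrow> p \<notin> {10} \<times> UNIV \<Longrightarrow> u p = s p"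
    unfolding u_def by (rule den_frame) (use wr in auto)
  have s9: "s (9, l0) = X l0" by (rule X(1)[OF flow_pos(3)[OF X(2) l0(2)]])
  define s1 where "s1 = s((2, 54) := int l0, (2, 55) := X l0, (10, 0) := int l0)"
  have u: "u = den N (For 27 (Minus (V 0) (Num 1)) extend_path) s1"
    unfolding u_def find_path_def den.simps(3) using l0 s9 by (simp add: s1_def)
  define I where "I j t \<longleftrightarrow> (\<forall>p. p \<notin> {2} \<times> {27, 36, 54, 55, 56} \<longrightarrow> p \<notin> {10} \<times> UNIV \<longrightarrow> t p = s p) \<and>
    (\<exists>P. (\<forall>i\<le>j. t (10, i) = int (P i) \<and> 0 < X (P i) \<and> t (2, 55) \<le> X (P i) \<and> dig_j b (P i) = i) \<and>
      (\<forall>i<j. P (Suc i) div b = head \<alpha> b (P i)) \<and> (\<exists>i\<le>j. t (2, 55) = X (P i)) \<and> t (2, 54) = int (P j))" for j t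
  have "I (m - 1) u"
    unfolding u
  proof (rule For_inv[where P = I and K = "m - 1"])
    have "s1 (2, 0) = int m" using env'D(1)[OF env] by (simp add: s1_def)
    moreover have "m \<le> N" using m_b pows(5) by simp
    moreover have "nat (int m - 1) = m - 1" by simp
    ultimately show "m - 1 = min N (nat (eval N (Minus (V 0) (Num 1)) s1))" by simp
    show "I 0 s1"
      unfolding I_def by (intro conjI exI[of _ "\<lambda>_. l0"]) (auto simp: s1_def l0)
  next
    fix j t assume j: "j < m - 1" and I: "I j t"
    let ?t = "t((2, 27) := int j)"
    from I obtain P where P: "\<forall>i\<le>j. t (10, i) = int (P i) \<and> 0 < X (P i) \<and> t (2, 55) \<le> X (P i) \<and> dig_j b (P i) = i"
      "\<forall>i<j. P (Suc i) div b = head \<alpha> b (P i)" "\<exists>i\<le>j. t (2, 55) = X (P i)" "t (2, 54) = int (P j)"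
      unfolding I_def by blast
    have fr: "t p = s p" if "p \<notin> {2} \<times> {27, 36, 54, 55, 56}" "p \<notin> {10} \<times> UNIV" for p
      using I that unfolding I_def by blast
    have envt: "env' ?t"
    proof (rule env'_cong[OF env])
      fix p assume "p \<in> protected"
      then show "?t p = s p" using fr[of p] by (auto simp: protected_def)
    qed
    have 9: "?t (9, l) = X l" if "l < nn" for l using fr[of "(9, l)"] X(1)[OF that] by simp
    have Pj: "0 < X (P j)" "dig_j b (P j) = j" using P(1) by auto
    then have jm: "dig_j b (P j) + 1 < m" using j by simp
    have "?t (2, 54) = int (P j)" using P(4) by simp
    then obtain l' where l': "0 < X l'" "l' div b = head \<alpha> b (P j)"
      and u': "den N extend_path ?t (2, 54) = int l'" "den N extend_path ?t (10, j + 1) = int l'"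
        "den N extend_path ?t (2, 55) = min (?t (2, 55)) (X l')"
        "\<forall>p. p \<notin> {2} \<times> {36, 54, 55, 56} \<longrightarrow> p \<noteq> (10, j + 1) \<longrightarrow> den N extend_path ?t p = ?t p"
      using extend_path[OF envt 9 X(2) _ Pj(1) jm, of j] unfolding Let_def by auto
    define v where "v = den N extend_path ?t"
    define P' where "P' = P(Suc j := l')"
    have dl: "dig_j b l' = Suc j"
      using valid_head(2)[OF flow_pos(1)[OF X(2) Pj(1)]] l'(2) Pj(2) by (simp add: dig_j_def)
    have v10: "v (10, i) = t (10, i)" if "i \<le> j" for i using u'(4)[rule_format, of "(10, i)"] that by (simp add: v_def)
    have v55: "v (2, 55) = min (t (2, 55)) (X l')" using u'(3) by (simp add: v_def)
    show "I (Suc j) (den N extend_path ?t)"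
      unfolding I_def v_def[symmetric]
    proof (intro conjI exI[of _ P'] allI impI)
      fix p :: "nat \<times> nat" assume p: "p \<notin> {2} \<times> {27, 36, 54, 55, 56}" "p \<notin> {10} \<times> UNIV"
      then have "v p = ?t p" using u'(4)[rule_format, of p] unfolding v_def by (cases p) auto
      then show "v p = s p" using fr[OF p] p by (cases p) auto
    next
      fix i assume i: "i \<le> Suc j"
      show "v (10, i) = int (P' i)" "0 < X (P' i)" "v (2, 55) \<le> X (P' i)" "dig_j b (P' i) = i"
        using i P(1) l' dl u'(2) v10 v55 by (auto simp: P'_def v_def le_Suc_eq)
    next
      fix i assume "i < Suc j"
      then show "P' (Suc i) div b = head \<alpha> b (P' i)" using P(2) l'(2) by (auto simp: P'_def less_Suc_eq)
    next
      show "v (2, 54) = int (P' (Suc j))" using u'(1) by (simp add: v_def P'_def)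
      obtain i where i: "i \<le> j" "t (2, 55) = X (P i)" using P(3) by blast
      show "\<exists>i\<le>Suc j. v (2, 55) = X (P' i)"
      proof (cases "t (2, 55) \<le> X l'")
        case True
        then show ?thesis using i v55 by (intro exI[of _ i]) (simp add: P'_def)
      next
        case False
        then show ?thesis using v55 by (intro exI[of _ "Suc j"]) (simp add: P'_def)
      qed
    qed
  next
    fix t assume I: "I (m - 1) t"
    then show "I (m - 1) (t((2, 27) := s1 (2, 27)))" unfolding I_def by (auto simp del: split_paired_All)
  qed
  then obtain P where P: "\<forall>i\<le>m - 1. u (10, i) = int (P i) \<and> 0 < X (P i) \<and> u (2, 55) \<le> X (P i) \<and> dig_j b (P i) = i"
      "\<forall>i<m - 1. P (Suc i) div b = head \<alpha> b (P i)" "\<exists>i\<le>m - 1. u (2, 55) = X (P i)"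
    unfolding I_def by blast
  have lem: "i < m \<longleftrightarrow> i \<le> m - 1" "Suc i < m \<longleftrightarrow> i < m - 1" for i using m_pos by arith+
  show "\<exists>P. (\<forall>i<m. u (10, i) = int (P i) \<and> 0 < X (P i) \<and> u (2, 55) \<le> X (P i)) \<and> dig_j b (P 0) = 0 \<and>
    (\<forall>i. Suc i < m \<longrightarrow> P (Suc i) div b = head \<alpha> b (P i)) \<and> (\<exists>i<m. u (2, 55) = X (P i))"
    unfolding lem using P by (intro exI[of _ P]) auto
qed

lemma remove_path:
  assumes env: "env' s" and X: "\<And>l. l < nn \<Longrightarrow> s (9, l) = X l"
    and P: "\<And>i. i < m \<Longrightarrow> s (10, i) = int (P i)" "\<And>i. i < m \<Longrightarrow> P i < nn"
  defines "u \<equiv> den N remove_path s"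
  shows "l < nn \<Longrightarrow> u (9, l) = X l - s (2, 55) * (\<Sum>i<m. of_bool (P i = l))"
    "p \<notin> {9} \<times> UNIV \<Longrightarrow> u p = s p"
proof -
  show "p \<notin> {9} \<times> UNIV \<Longrightarrow> u p = s p"
    unfolding u_def by (rule den_frame) (auto simp: remove_path_def)
  define I where "I i t \<longleftrightarrow> (\<forall>p. p \<noteq> (2, 27) \<longrightarrow> p \<notin> {9} \<times> UNIV \<longrightarrow> t p = s p) \<and>
    (\<forall>l<nn. t (9, l) = X l - s (2, 55) * (\<Sum>j<i. of_bool (P j = l)))" for i t
  have "I m u"
    unfolding u_def remove_path_def
  proof (rule For_inv[where P = I and K = m])
    show "m = min N (nat (eval N (V 0) s))" using env'D(1)[OF env] m_b pows(5) by simp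
    show "I 0 s" using X by (simp add: I_def)
  next
    fix i t assume i: "i < m" and I: "I i t"
    have fr: "t p = s p" if "p \<noteq> (2, 27)" "p \<notin> {9} \<times> UNIV" for p using I that unfolding I_def by blast
    have t: "t (10, i) = int (P i)" "t (2, 55) = s (2, 55)" using fr[of "(10, i)"] fr[of "(2, 55)"] P(1)[OF i] by simp_all
    have 9: "t (9, l) = X l - s (2, 55) * (\<Sum>j<i. of_bool (P j = l))" if "l < nn" for l using I that unfolding I_def by blast
    have d: "den N (Put 9 (Rd 10 (V 27)) (Minus (Rd 9 (Rd 10 (V 27))) (V 55))) (t((2, 27) := int i)) =
      t((2, 27) := int i, (9, P i) := t (9, P i) - s (2, 55))"
      by (simp add: t)
    show "I (Suc i) (den N (Put 9 (Rd 10 (V 27)) (Minus (Rd 9 (Rd 10 (V 27))) (V 55))) (t((2, 27) := int i)))"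
      unfolding d I_def
    proof (intro conjI allI impI)
      fix p :: "nat \<times> nat" assume "p \<noteq> (2, 27)" "p \<notin> {9} \<times> UNIV"
      then show "(t((2, 27) := int i, (9, P i) := t (9, P i) - s (2, 55))) p = s p" using fr[of p] by auto
    next
      fix l assume "l < nn"
      then show "(t((2, 27) := int i, (9, P i) := t (9, P i) - s (2, 55))) (9, l) =
         X l - s (2, 55) * (\<Sum>j<Suc i. of_bool (P j = l))"
        using 9[of l] by (cases "P i = l") (auto simp: algebra_simps)
    qed
  next
    fix t assume "I m t"
    then show "I m (t((2, 27) := s (2, 27)))" unfolding I_def by (auto simp del: split_paired_All)
  qed
  then show "l < nn \<Longrightarrow> u (9, l) = X l - s (2, 55) * (\<Sum>i<m. of_bool (P i = l))"
    unfolding I_def by blast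
qed

lemma write_entry:
  assumes env: "env' s" and P: "\<And>i. i < m \<Longrightarrow> s (10, i) = int (P i)" "\<And>i. i < m \<Longrightarrow> P i \<le> N"
    and p: "s (2, 52) = int q"
  defines "u \<equiv> den N write_entry s" and "C \<equiv> map (\<lambda>j. dig_d b (P j)) [0..<m]"
  shows "c < q \<Longrightarrow> u (0, c) = s (0, c)"
    "c < m + 3 \<Longrightarrow> u (0, q + c) = encode_entry (dig_i b (P 0), C, s (2, 55), s (2, 50)) ! c"
    "u (2, 52) = int (q + m + 3)" "u (2, 51) = s (2, 51) + 1"
    "v \<notin> {0} \<times> UNIV \<Longrightarrow> v \<noteq> (2, 51) \<Longrightarrow> v \<noteq> (2, 52) \<Longrightarrow> u v = s v"
proof -
  show "v \<notin> {0} \<times> UNIV \<Longrightarrow> v \<noteq> (2, 51) \<Longrightarrow> v \<noteq> (2, 52) \<Longrightarrow> u v = s v"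
    unfolding u_def by (rule den_frame) (auto simp: write_entry_def)
  have P0: "eval N (e_i (Rd 10 (Num 0))) s = int (dig_i b (P 0))"
    using P[OF m_pos] by (intro eval_digits(6)[OF env]) simp_all
  define s1 where "s1 = s((0, q) := int (dig_i b (P 0)))"
  let ?L = "For 27 (V 0) (Put 0 (Plus (Plus (V 52) (Num 1)) (V 27)) (e_d (Rd 10 (V 27))))"
  have env1: "env' s1" by (rule env'_cong[OF env]) (auto simp: s1_def protected_def)
  define s2 where "s2 = den N ?L s1"
  define I where "I i t \<longleftrightarrow> (\<forall>v. v \<noteq> (2, 27) \<longrightarrow> v \<notin> {0} \<times> UNIV \<longrightarrow> t v = s1 v) \<and>
     (\<forall>c\<le>q. t (0, c) = s1 (0, c)) \<and> (\<forall>j<i. t (0, q + 1 + j) = int (dig_d b (P j)))" for i t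
  have I: "I m s2"
    unfolding s2_def
  proof (rule For_inv[where P = I and K = m])
    show "m = min N (nat (eval N (V 0) s1))" using env'D(1)[OF env1] m_b pows(5) by simp
    show "I 0 s1" by (simp add: I_def)
  next
    fix i t assume i: "i < m" and I: "I i t"
    have fr: "t v = s1 v" if "v \<noteq> (2, 27)" "v \<notin> {0} \<times> UNIV" for v using I that unfolding I_def by blast
    let ?t = "t((2, 27) := int i)"
    have envt: "env' ?t"
    proof (rule env'_cong[OF env1])
      fix v assume "v \<in> protected"
      then show "?t v = s1 v" using fr[of v] by (auto simp: protected_def)
    qed
    have t: "?t (10, i) = int (P i)" "?t (2, 52) = int q"
      using fr[of "(10, i)"] fr[of "(2, 52)"] P(1)[OF i] p by (simp_all add: s1_def)
    have "eval N (Rd 10 (V 27)) ?t = int (P i)" using t by simp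
    then have e: "eval N (e_d (Rd 10 (V 27))) ?t = int (dig_d b (P i))"
      using P(2)[OF i] by (intro eval_digits(2)[OF envt])
    have "nat (int q + 1 + int i) = q + 1 + i" by simp
    then have d: "den N (Put 0 (Plus (Plus (V 52) (Num 1)) (V 27)) (e_d (Rd 10 (V 27)))) ?t =
      ?t((0, q + 1 + i) := int (dig_d b (P i)))"
      using t e by simp
    show "I (Suc i) (den N (Put 0 (Plus (Plus (V 52) (Num 1)) (V 27)) (e_d (Rd 10 (V 27)))) ?t)"
      unfolding d I_def
    proof (intro conjI allI impI)
      fix v :: "nat \<times> nat" assume "v \<noteq> (2, 27)" "v \<notin> {0} \<times> UNIV"
      then show "(?t((0, q + 1 + i) := int (dig_d b (P i)))) v = s1 v" using fr[of v] by auto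
    next
      fix c assume "c \<le> q"
      then show "(?t((0, q + 1 + i) := int (dig_d b (P i)))) (0, c) = s1 (0, c)" using I by (simp add: I_def)
    next
      fix j assume "j < Suc i"
      then show "(?t((0, q + 1 + i) := int (dig_d b (P i)))) (0, q + 1 + j) = int (dig_d b (P j))"
        using I by (auto simp: I_def less_Suc_eq)
    qed
  next
    fix t assume "I m t"
    then show "I m (t((2, 27) := s1 (2, 27)))" unfolding I_def by (auto simp del: split_paired_All)
  qed
  have fr2: "s2 v = s1 v" if "v \<notin> {0} \<times> UNIV" for v
    unfolding s2_def by (rule den_frame) (use that in auto)
  have s2: "s2 (2, 52) = int q" "s2 (2, 0) = int m" "s2 (2, 55) = s (2, 55)" "s2 (2, 50) = s (2, 50)" "s2 (2, 51) = s (2, 51)"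
    using p env'D(1)[OF env] by (simp_all add: fr2 s1_def)
  have nat3: "nat (int q + 1 + int m) = q + 1 + m" "nat (int q + 2 + int m) = q + 2 + m" by simp_all
  have s1': "den N (Put 0 (V 52) (e_i (Rd 10 (Num 0)))) s = s1" using p P0 by (simp add: s1_def)
  have u: "u = s2((0, q + 1 + m) := s (2, 55), (0, q + 2 + m) := s (2, 50), (2, 52) := int q + 3 + int m, (2, 51) := s (2, 51) + 1)"
    unfolding u_def write_entry_def den.simps(3) s1' s2_def[symmetric] using s2 nat3 by simp
  show "u (2, 52) = int (q + m + 3)" "u (2, 51) = s (2, 51) + 1" by (simp_all add: u)
  have i0: "s2 (0, c) = s1 (0, c)" if "c \<le> q" for c using I that unfolding I_def by blast
  have i1: "s2 (0, q + 1 + j) = int (dig_d b (P j))" if "j < m" for j using I that unfolding I_def by blast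
  show "u (0, c) = s (0, c)" if "c < q" using that i0[of c] by (simp add: u s1_def)
  show "u (0, q + c) = encode_entry (dig_i b (P 0), C, s (2, 55), s (2, 50)) ! c" if c: "c < m + 3"
  proof -
    consider "c = 0" | j where "c = Suc j" "j < m" | "c = m + 1" | "c = m + 2"
      using c by (cases c) (auto, arith)
    then show ?thesis
    proof cases
      case 1
      then show ?thesis using i0[of q] by (simp add: u s1_def)
    next
      case (2 j)
      then show ?thesis using i1[of j] by (simp add: u C_def nth_append)
    next
      case 3
      then show ?thesis by (simp add: u C_def nth_append)
    next
      case 4
      then show ?thesis by (simp add: u C_def nth_append)
    qed
  qed
qed

text \<open>Subtracting the bottleneck from a path empties one of its arcs and fills none, so the
  number of arcs that carry flow decreases.\<close>

lemma extract_step: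
  assumes e: "ext D s X es"
  shows "(\<forall>l\<in>arcs. dig_j b l = 0 \<longrightarrow> X l = 0) \<and> ext D (den N extract_step s) X es \<or>
    \<not> (\<forall>l\<in>arcs. dig_j b l = 0 \<longrightarrow> X l = 0) \<and>
    (\<exists>X' e. ext D (den N extract_step s) X' (es @ [e]) \<and> card {l. 0 < X' l} < card {l. 0 < X l})"
proof -
  have env: "env' s" and X: "\<And>l. l < nn \<Longrightarrow> s (9, l) = X l" and dec: "decomposed D X es"
    and s: "s (2, 50) = D" "s (2, 51) = int (length es)" "s (2, 52) = int (2 + length (enc es))"
      "\<And>a. a < length (enc es) \<Longrightarrow> s (0, 2 + a) = enc es ! a"
    using e unfolding ext_def by auto
  have fl: "is_flow X" using dec by (simp add: decomposed_def)
  let ?e = "conj (Rd 9 (V 22)) (eq (e_j (V 22)) (Num 0))"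
  obtain kk where k: "den N (find ?e) s = s((2, 36) := kk)"
    "(kk = 0 \<and> (\<forall>j<nn. \<not> (0 < X j \<and> dig_j b j = 0))) \<or> (\<exists>j<nn. kk = int j + 1 \<and> 0 < X j \<and> dig_j b j = 0)"
  proof (rule find[of nn N s, OF find_K[OF env], where P = "\<lambda>j. 0 < X j \<and> dig_j b j = 0" and e = ?e])
    fix j u assume j: "j < nn" and u: "\<And>p. p \<noteq> (2, 22) \<Longrightarrow> p \<noteq> (2, 36) \<Longrightarrow> u p = s p" "u (2, 22) = int j"
    have envu: "env' u" by (rule env'_cong[OF env]; rule u(1)) (auto simp: protected_def)
    have jN: "j \<le> N" using j pows(2) by simp
    have v: "eval N (V 22) u = int j" using u(2) by simp
    have 1: "u (9, j) = X j" using u(1)[of "(9, j)"] X[OF j] by simp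
    have "eval N (e_j (V 22)) u = int (dig_j b j)" by (rule eval_digits(5)[OF envu v jN])
    then show "0 < eval N ?e u \<longleftrightarrow> 0 < X j \<and> dig_j b j = 0"
      using 1 u(2) by simp
  qed blast
  let ?s = "s((2, 36) := kk)"
  have env1: "env' ?s" by (rule env'_cong[OF env]) (auto simp: protected_def)
  show ?thesis
  proof (cases "kk = 0")
    case True
    have "X l = 0" if l: "l \<in> arcs" "dig_j b l = 0" for l
    proof -
      have "l < b ^ 5" using valid_lt l(1) by simp
      then have "l < nn" by simp
      then have "\<not> 0 < X l" using k(2) True l(2) by auto
      moreover have "0 \<le> X l" using fl by (simp add: is_flow_def)
      ultimately show ?thesis by simp
    qed
    moreover have "ext D ?s X es" using e env1 unfolding ext_def by simp
    moreover have "den N extract_step s = ?s" using True k(1) by (simp add: extract_step_def)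
    ultimately show ?thesis by simp
  next
    case False
    then obtain l0 where l0: "l0 < nn" "kk = int l0 + 1" "0 < X l0" "dig_j b l0 = 0" using k(2) by blast
    define s1 where "s1 = den N find_path ?s"
    define s2 where "s2 = den N remove_path s1"
    define s3 where "s3 = den N write_entry s2"
    have d: "den N extract_step s = s3" using l0 k(1) by (simp add: extract_step_def s1_def s2_def s3_def)
    have X1: "?s (9, l) = X l" if "l < nn" for l using X[OF that] by simp
    have k1: "?s (2, 36) = int l0 + 1" using l0 by simp
    obtain P where P: "\<forall>i<m. s1 (10, i) = int (P i) \<and> 0 < X (P i) \<and> s1 (2, 55) \<le> X (P i)" "dig_j b (P 0) = 0"
      "\<forall>i. Suc i < m \<longrightarrow> P (Suc i) div b = head \<alpha> b (P i)" "\<exists>i<m. s1 (2, 55) = X (P i)"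
      using find_path(1)[where s = ?s, OF env1 X1 fl k1 l0(3,4)] unfolding s1_def by blast
    have fr1: "s1 p = s p" if "p \<notin> {2} \<times> {36, 54, 55, 56}" "p \<notin> {10} \<times> UNIV" for p
      using find_path(2)[where s = ?s, OF env1 X1 fl k1 l0(3,4) that] that by (cases p) (auto simp: s1_def)
    have Pv: "valid \<alpha> \<sigma> k T b (P i)" "P i < nn" "P i \<le> N" if "i < m" for i using flow_pos[OF fl, of "P i"] P(1) that by auto
    define C where "C = map (\<lambda>j. dig_d b (P j)) [0..<m]"
    define i where "i = dig_i b (P 0)"
    define a where "a = s1 (2, 55)"
    have path: "i < m" "C \<in> BC i" "\<And>j. j < m \<Longrightarrow> P j = arc \<alpha> b i j C"
      using path_of_arcs[of P, OF Pv(1) P(2)] P(3) unfolding C_def i_def by blast+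
    have a0: "0 < a" using P(1,4) by (auto simp: a_def)
    have aX: "a \<le> X (arc \<alpha> b i j C)" if "j < m" for j using P(1) path(3)[OF that] that by (auto simp: a_def)
    define X' where "X' l = X l - a * (\<Sum>j<m. of_bool (arc \<alpha> b i j C = l))" for l
    have dec': "decomposed D X' (es @ [(i, C, a, D)])"
      unfolding X'_def[abs_def] by (rule decomposed_step[OF dec path(2,1) a0 aX])
    have env_s1: "env' s1" by (rule env'_cong[OF env]; rule fr1) (auto simp: protected_def)
    have X1': "s1 (9, l) = X l" if "l < nn" for l using fr1[of "(9, l)"] X[OF that] by simp
    have P1: "s1 (10, i) = int (P i)" if "i < m" for i using P(1) that by blast
    note rp = remove_path[OF env_s1 X1' P1 Pv(2), folded s2_def a_def]
    have s29: "s2 (9, l) = X' l" if "l < nn" for l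
      using rp(1)[OF _ _ _ that] path(3) unfolding X'_def by simp
    have fr2: "s2 p = s1 p" if "p \<notin> {9} \<times> UNIV" for p using rp(2)[OF _ _ _ that] by simp
    have env2: "env' s2" by (rule env'_cong[OF env_s1]; rule fr2) (auto simp: protected_def)
    have P2: "s2 (10, i) = int (P i)" if "i < m" for i using fr2[of "(10, i)"] P1[OF that] by simp
    have q: "s2 (2, 52) = int (2 + length (enc es))" using fr2[of "(2, 52)"] fr1[of "(2, 52)"] s(3) by simp
    have s2': "s2 (2, 55) = a" "s2 (2, 50) = D" "s2 (2, 51) = int (length es)"
      using fr2[of "(2, 55)"] fr2[of "(2, 50)"] fr2[of "(2, 51)"] fr1[of "(2, 50)"] fr1[of "(2, 51)"] s by (simp_all add: a_def)
    note we = write_entry[OF env2 P2 Pv(3) q, folded s3_def C_def i_def, unfolded s2']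
    have fr3: "s3 v = s2 v" if "v \<notin> {0} \<times> UNIV" "v \<noteq> (2, 51)" "v \<noteq> (2, 52)" for v using we(5)[OF _ _ that] by simp
    let ?e = "(i, C, a, D)"
    have le: "length (encode_entry ?e) = m + 3" by (simp add: C_def)
    have enc: "enc (es @ [?e]) = enc es @ encode_entry ?e" by (simp add: enc_def)
    have "ext D s3 X' (es @ [?e])"
      unfolding ext_def
    proof (intro conjI allI impI)
      show "env' s3" by (rule env'_cong[OF env2]; rule fr3) (auto simp: protected_def)
      show "s3 (9, l) = X' l" if "l < nn" for l using fr3[of "(9, l)"] s29[OF that] by simp
      show "decomposed D X' (es @ [?e])" by (rule dec')
      show "s3 (2, 50) = D" using fr3[of "(2, 50)"] s2' by simp
      show "s3 (2, 51) = int (length (es @ [?e]))" using we(4) by simp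
      show "s3 (2, 52) = int (2 + length (enc (es @ [?e])))" using we(3) unfolding enc length_append le by simp
      fix c assume c: "c < length (enc (es @ [?e]))"
      show "s3 (0, 2 + c) = enc (es @ [?e]) ! c"
      proof (cases "c < length (enc es)")
        case True
        then have "s3 (0, 2 + c) = s2 (0, 2 + c)" by (intro we(1)) auto
        also have "\<dots> = s (0, 2 + c)" using fr2[of "(0, 2 + c)"] fr1[of "(0, 2 + c)"] by simp
        finally show ?thesis using s(4)[OF True] True by (simp add: enc nth_append)
      next
        case False
        define c' where "c' = c - length (enc es)"
        have c': "c = length (enc es) + c'" "c' < m + 3" using False c unfolding enc length_append le by (auto simp: c'_def)
        have "s3 (0, 2 + length (enc es) + c') = encode_entry ?e ! c'" by (rule we(2)[OF _ _ c'(2)]) auto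
        then show ?thesis unfolding enc using c' by (simp add: nth_append add.assoc del: encode_entry.simps)
      qed
    qed
    moreover have "card {l. 0 < X' l} < card {l. 0 < X l}"
    proof (rule psubset_card_mono)
      show "finite {l. 0 < X l}" by (rule finite_subset[OF _ finite_V]) (use flow_pos(1)[OF fl] in auto)
      have le: "X' l \<le> X l" for l using a0 by (simp add: X'_def sum_nonneg)
      obtain i0 where i0: "i0 < m" "a = X (P i0)" using P(4) by (auto simp: a_def)
      have "1 \<le> (\<Sum>j<m. of_bool (arc \<alpha> b i j C = P i0) :: int)"
        using member_le_sum[of i0 "{..<m}" "\<lambda>j. of_bool (arc \<alpha> b i j C = P i0) :: int"] i0 path(3)[OF i0(1)] by simp
      then have "a * 1 \<le> a * (\<Sum>j<m. of_bool (arc \<alpha> b i j C = P i0))" using a0 by (intro mult_left_mono) auto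
      then have "\<not> 0 < X' (P i0)" using i0(2) by (simp add: X'_def)
      then show "{l. 0 < X' l} \<subset> {l. 0 < X l}" using le a0 i0(2) by (auto intro: less_le_trans)
    qed
    moreover have "\<not> (\<forall>l\<in>arcs. dig_j b l = 0 \<longrightarrow> X l = 0)"
      using flow_pos(1)[OF fl l0(3)] l0(3,4) by auto
    ultimately show ?thesis unfolding d by blast
  qed
qed

lemma output_paths:
  assumes env: "env' s" and X: "\<And>l. l < nn \<Longrightarrow> s (9, l) = X l"
    and fl: "0 < X (b ^ 5)" "\<And>l. 0 \<le> X l" "\<And>l. l \<notin> S0 \<Longrightarrow> X l = 0"
      "\<And>r. r < R \<Longrightarrow> (\<Sum>l\<in>S0. A r l * X l) = 0"
  defines "u \<equiv> den N output_paths s"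
  shows "\<exists>es. u (0, 0) = 1 \<and> u (0, 1) = int (length es) \<and> (\<forall>a<length (enc es). u (0, 2 + a) = enc es ! a) \<and>
    (\<forall>(i, C, a, D)\<in>set es. i < m \<and> C \<in> BC i \<and> 0 < D) \<and> lp_feasible \<alpha> \<sigma> k T (sparse_value es)"
proof -
  define D where "D = X (b ^ 5)"
  define X0 where "X0 = X(b ^ 5 := 0)"
  have dec0: "decomposed D X0 []" unfolding D_def X0_def by (rule decomposed_start[OF fl])
  define s1 where "s1 = s((2, 50) := D, (9, b ^ 5) := 0, (2, 51) := 0, (2, 52) := 2)"
  have s9: "s (9, b ^ 5) = D" using X by (simp add: D_def)
  have ec: "eval N e_const t = int (b ^ 5)" if "env' t" for t by (rule eval_const[OF that])
  have s1: "den N (Set 52 (Num 2)) (den N (Set 51 (Num 0)) (den N (Put 9 e_const (Num 0)) (den N (Set 50 (Rd 9 e_const)) s))) = s1"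
  proof -
    have "eval N (Rd 9 e_const) s = D" using ec[OF env] s9 by (simp only: eval.simps(3) nat_int)
    then have 1: "den N (Set 50 (Rd 9 e_const)) s = s((2, 50) := D)" by simp
    have "env' (s((2, 50) := D))" by (rule env'_cong[OF env]) (auto simp: protected_def)
    from ec[OF this] show ?thesis unfolding 1 by (simp add: s1_def del: of_nat_power)
  qed
  have "env' s1" by (rule env'_cong[OF env]) (auto simp: protected_def s1_def)
  then have e0: "ext D s1 X0 []" using dec0 X unfolding ext_def by (simp add: s1_def X0_def enc_def)
  \<comment> \<open>Each extraction lowers the number of arcs with flow, initially at most
    \<open>b ^ 5\<close>. As \<open>N > b ^ 5\<close>, only the first alternative is left after
    \<open>N\<close> rounds.\<close>
  define J where "J i t \<longleftrightarrow> (\<exists>X es. ext D t X es \<and> ((\<forall>l\<in>arcs. dig_j b l = 0 \<longrightarrow> X l = 0) \<or> card {l. 0 < X l} + i \<le> b ^ 5))" for i t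
  define s2 where "s2 = den N (For 26 Bound extract_step) s1"
  have upd: "ext D (t((2, 26) := x)) X es = ext D t X es" for t x X es
  proof -
    have "env' (t((2, 26) := x)) \<Longrightarrow> env' t" by (erule env'_cong) (auto simp: protected_def)
    moreover have "env' t \<Longrightarrow> env' (t((2, 26) := x))" by (erule env'_cong) (auto simp: protected_def)
    ultimately have "env' (t((2, 26) := x)) = env' t" by blast
    then show ?thesis by (simp add: ext_def)
  qed
  have "J N s2"
    unfolding s2_def
  proof (rule For_inv[where P = J and K = N])
    show "N = min N (nat (eval N Bound s1))" by simp
    have "{l. 0 < X0 l} \<subseteq> {..<b ^ 5}" using dec0 flow_pos(2)[of X0] by (auto simp: decomposed_def)
    then have "card {l. 0 < X0 l} \<le> b ^ 5" using card_mono[of "{..<b ^ 5}"] by force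
    then show "J 0 s1" using e0 unfolding J_def by (intro exI[of _ X0] exI[of _ "[]"] conjI disjI2) simp_all
  next
    fix i t assume i: "i < N" and J: "J i t"
    then obtain X es where e: "ext D t X es" and m: "(\<forall>l\<in>arcs. dig_j b l = 0 \<longrightarrow> X l = 0) \<or> card {l. 0 < X l} + i \<le> b ^ 5"
      unfolding J_def by blast
    have e': "ext D (t((2, 26) := int i)) X es" using e upd by simp
    from extract_step[OF e'] show "J (Suc i) (den N extract_step (t((2, 26) := int i)))"
    proof (elim disjE conjE exE)
      assume "\<forall>l\<in>arcs. dig_j b l = 0 \<longrightarrow> X l = 0" "ext D (den N extract_step (t((2, 26) := int i))) X es"
      then show ?thesis unfolding J_def by blast
    next
      fix X' e assume x: "\<not> (\<forall>l\<in>arcs. dig_j b l = 0 \<longrightarrow> X l = 0)" "ext D (den N extract_step (t((2, 26) := int i))) X' (es @ [e])" "card {l. 0 < X' l} < card {l. 0 < X l}"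
      show ?thesis
      proof (cases "\<forall>l\<in>arcs. dig_j b l = 0 \<longrightarrow> X' l = 0")
        case True
        then show ?thesis using x unfolding J_def by blast
      next
        case False
        have "card {l. 0 < X' l} + Suc i \<le> b ^ 5" using m x by auto
        then show ?thesis using x(2) unfolding J_def by blast
      qed
    qed
  next
    fix t assume "J N t"
    then show "J N (t((2, 26) := s1 (2, 26)))" using upd unfolding J_def by simp
  qed
  then obtain Y es where e: "ext D s2 Y es" and z: "\<forall>l\<in>arcs. dig_j b l = 0 \<longrightarrow> Y l = 0"
    unfolding J_def using pows(2) by auto
  have u: "u = s2((0, 0) := 1, (0, 1) := int (length es))"
  proof -
    have "s2 (2, 51) = int (length es)" using e by (simp add: ext_def)
    then show ?thesis unfolding u_def output_paths_def den.simps(3) s1 s2_def[symmetric] by simp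
  qed
  have dec: "decomposed D Y es" using e by (simp add: ext_def)
  show ?thesis
  proof (intro exI[of _ es] conjI)
    show "u (0, 0) = 1" "u (0, 1) = int (length es)" by (simp_all add: u)
    show "\<forall>a<length (enc es). u (0, 2 + a) = enc es ! a" using e by (simp add: u ext_def)
    show "\<forall>(i, C, a, D)\<in>set es. i < m \<and> C \<in> BC i \<and> 0 < D" using dec by (auto simp: decomposed_def)
    show "lp_feasible \<alpha> \<sigma> k T (sparse_value es)" by (rule decomposed_done[OF dec]) (use z in auto)
  qed
qed

end

section \<open>Initialisation\<close>

text \<open>The output will overwrite the input area, so scores and limits are first copied to the
  arrays 3 and 4. The limits are stored as \<open>T - \<sigma> ! i\<close>.\<close>

definition init1 :: com where
  "init1 = Comp (Set 0 (Rd 0 (Num 0))) (Comp (Set 1 (Rd 0 (Num 1))) (Comp (Set 2 (Rd 0 (Num 2)))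
    (Comp (For 21 (V 0) (Put 3 (V 21) (Rd 0 (Plus (V 21) (Num 3)))))
          (For 21 (V 0) (Put 4 (V 21) (Minus (V 2) (Rd 0 (Plus (Plus (V 21) (V 0)) (Num 3)))))))))"

text \<open>The scores are sorted, so the last one is the largest. Scalar 13 receives the exponent
  \<open>L = b ^ 14\<close>, by way of \<open>b ^ 2\<close>, \<open>b ^ 8\<close> and
  \<open>b ^ 12\<close> in 10, 11 and 12.\<close>

definition init2 :: com where
  "init2 = Comp (Set 7 (Plus (Plus (V 0) (V 1)) (Plus (Rd 3 (Minus (V 0) (Num 1))) (Num 2))))
    (Comp (Set 3 (Mul (V 7) (V 7))) (Comp (Set 10 (Mul (V 3) (V 3))) (Comp (Set 14 (Mul (V 3) (V 10)))
    (Comp (Set 4 (Mul (V 10) (V 10))) (Comp (Set 5 (Plus (Mul (V 3) (V 4)) (Num 1)))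
    (Comp (Set 6 (Plus (V 4) (V 0))) (Comp (Set 8 (Mul (V 5) (V 5)))
    (Comp (Set 11 (Mul (V 4) (V 4))) (Comp (Set 12 (Mul (V 11) (V 4))) (Set 13 (Mul (V 12) (V 10))))))))))))"

text \<open>A column that is no valid arc gets weight 0 and thus never takes part, so the matrix
  itself need not encode validity.\<close>

definition init3 :: com where
  "init3 = Comp (Set 9 (Num 1)) (Comp (For 21 (V 13) (Set 9 (Plus (V 9) (V 9))))
    (For 21 (V 5) (Put 5 (V 21) (Cond (eq (V 21) e_const) (V 9) (Cond (e_valid (V 21)) (V 9) (Num 0))))))"

text \<open>Scalar 9 is \<open>2 ^ L\<close> with \<open>L = b ^ 14\<close>.\<close>

definition core :: com where
  "core = Comp init1 (Comp init2 (Comp init3 (Comp (phases e_A)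
    (When (Rd 9 e_const) output_paths (Put 0 (Num 0) (Num 0))))))"

lemma cell_fst: "p \<in> cell a e \<Longrightarrow> fst p = a"
  by (cases e) auto

lemma pow_mono2: "1 \<le> b \<Longrightarrow> i \<le> j \<Longrightarrow> b ^ i \<le> (b::nat) ^ j"
  by (intro power_increasing) auto

lemma le_pow2: "x \<le> (2::nat) ^ x"
  using less_exp[of x] by simp

lemma mult_le_pow2: "x \<le> 2 ^ i \<Longrightarrow> y \<le> 2 ^ j \<Longrightarrow> i + j \<le> k \<Longrightarrow> x * y \<le> (2::nat) ^ k"
proof -
  assume a: "x \<le> 2 ^ i" "y \<le> 2 ^ j" "i + j \<le> k"
  have "x * y \<le> 2 ^ i * 2 ^ j" by (rule mult_le_mono[OF a(1,2)])
  also have "\<dots> = 2 ^ (i + j)" by (simp add: power_add)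
  also have "\<dots> \<le> 2 ^ k" using a(3) by (rule power_increasing) simp
  finally show ?thesis .
qed

lemma pow_le_pow2: "1 \<le> x \<Longrightarrow> x \<le> 2 ^ i \<Longrightarrow> d \<le> e \<Longrightarrow> i * e \<le> k \<Longrightarrow> x ^ d \<le> (2::nat) ^ k"
proof -
  assume a: "1 \<le> x" "x \<le> 2 ^ i" "d \<le> e" "i * e \<le> k"
  have "x ^ d \<le> x ^ e" using a by (intro power_increasing) auto
  also have "\<dots> \<le> (2 ^ i) ^ e" using a(2) by (rule power_mono) simp
  also have "\<dots> = 2 ^ (i * e)" by (simp add: power_mult)
  also have "\<dots> \<le> 2 ^ k" using a(4) by (rule power_increasing) simp
  finally show ?thesis .
qed

text \<open>With at most \<open>b ^ 6\<close> rows and columns, the base in Siegel's bound is at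
  most \<open>2 ^ (b ^ 8)\<close>, whence \<open>L = b ^ 14\<close>. For the scaled matrix the base
  is at most \<open>2 ^ (b ^ 15)\<close>, the bound \<open>2 ^ (b ^ 21)\<close>, its
  \<open>n\<close>-th power \<open>2 ^ (b ^ 27)\<close>; the factor \<open>n M\<close> leads to
  \<open>2 ^ (b ^ 28)\<close> and squaring to \<open>2 ^ (b ^ 29)\<close>. So \<open>b ^ 30\<close>
  would do for the bit lengths; 64 is a power of two, which allows \<open>N\<close> to be reached by
  squaring.\<close>

lemma parameter_bounds:
  fixes b m :: nat
  assumes b: "16 \<le> b" and m: "m < b"
  defines "n \<equiv> b ^ 5 + 1" and "R \<equiv> b ^ 4 + m" and "L \<equiv> b ^ 14"
  shows "siegel_bound (n + R) b \<le> 2 ^ L" "(n * (b * 2 ^ L) * siegel_bound (n + R) (b * 2 ^ L) ^ n)\<^sup>2 < 2 ^ (b ^ 29)"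
    "2 * b ^ 29 + 2 \<le> b ^ 64" "4 * n ^ 3 \<le> b ^ 64" "R \<le> b ^ 64" "n * n \<le> b ^ 64" "n * (L + 1) < b ^ 64"
proof -
  have b1: "1 \<le> b" using b by simp
  have up: "16 * b ^ i \<le> b ^ Suc i" for i using b by simp
  note mono = pow_mono2[OF b1]
  have one: "1 \<le> b ^ i" for i using b1 by (simp add: one_le_power)
  have n6: "n \<le> b ^ 6" "1 \<le> n" using up[of 5] one[of 5] by (simp_all add: n_def)
  have d6: "n + R + 1 \<le> b ^ 6"
    using up[of 5] one[of 5] mono[of 4 5] mono[of 1 5] m by (simp add: n_def R_def)
  have base: "2 * (n + R + 1) * b + 1 \<le> b ^ 8"
  proof -
    have "2 * (n + R + 1) * b + 1 \<le> 2 * b ^ 6 * b + 1" using d6 by (intro add_mono mult_le_mono) auto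
    also have "\<dots> = 2 * b ^ 7 + 1" using power_add[of b 6 1] by simp
    also have "\<dots> \<le> b ^ 8" using up[of 7] one[of 7] by simp
    finally show ?thesis .
  qed
  then have base': "2 * (n + R + 1) * b + 1 \<le> 2 ^ (b ^ 8)" using le_pow2[of "b ^ 8"] by linarith
  have m14: "b ^ 8 * b ^ 6 = b ^ 14" by (simp flip: power_add)
  show "siegel_bound (n + R) b \<le> 2 ^ L"
    unfolding siegel_bound_def L_def using base' d6 m14 by (intro pow_le_pow2[where e = "b ^ 6"]) auto
  have base2: "2 * (n + R + 1) * (b * 2 ^ L) + 1 \<le> 2 ^ (b ^ 15)"
  proof -
    have "2 * (n + R + 1) * (b * 2 ^ L) + 1 \<le> (2 * (n + R + 1) * b + 1) * 2 ^ L"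
      by (simp add: algebra_simps)
    also have "\<dots> \<le> 2 ^ (b ^ 15)"
      by (rule mult_le_pow2[OF base' order_refl]) (use up[of 14] mono[of 8 14] in \<open>simp add: L_def\<close>)
    finally show ?thesis .
  qed
  have m21: "b ^ 15 * b ^ 6 = b ^ 21" "b ^ 21 * b ^ 6 = b ^ 27" by (simp_all flip: power_add)
  have h21: "siegel_bound (n + R) (b * 2 ^ L) \<le> 2 ^ (b ^ 21)"
    unfolding siegel_bound_def using base2 d6 m21 by (intro pow_le_pow2[where e = "b ^ 6"]) auto
  have h27: "siegel_bound (n + R) (b * 2 ^ L) ^ n \<le> 2 ^ (b ^ 27)"
    using h21 siegel_bound_pos n6 m21 by (intro pow_le_pow2[where e = "b ^ 6"]) auto
  have nb: "n * (b * 2 ^ L) \<le> 2 ^ (b ^ 15)"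
  proof -
    have "n * b \<le> b ^ 6 * b" using n6 by (intro mult_le_mono) auto
    also have "\<dots> = b ^ 7" using power_add[of b 6 1] by simp
    also have "\<dots> \<le> 2 ^ (b ^ 7)" by (rule le_pow2)
    finally have "n * b * 2 ^ L \<le> 2 ^ (b ^ 15)"
      by (rule mult_le_pow2[OF _ order_refl]) (use up[of 14] mono[of 7 14] in \<open>simp add: L_def\<close>)
    then show ?thesis by (simp add: mult.assoc)
  qed
  have le28: "n * (b * 2 ^ L) * siegel_bound (n + R) (b * 2 ^ L) ^ n \<le> 2 ^ (b ^ 28)"
    by (rule mult_le_pow2[OF nb h27]) (use up[of 27] mono[of 15 27] in simp)
  have "(n * (b * 2 ^ L) * siegel_bound (n + R) (b * 2 ^ L) ^ n)\<^sup>2 \<le> 2 ^ (b ^ 28 + b ^ 28)"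
    using mult_le_pow2[OF le28 le28 order_refl] by (simp only: power2_eq_square)
  also have "(2::nat) ^ (b ^ 28 + b ^ 28) < 2 ^ (b ^ 29)"
    using up[of 28] one[of 28] by (intro power_strict_increasing) auto
  finally show "(n * (b * 2 ^ L) * siegel_bound (n + R) (b * 2 ^ L) ^ n)\<^sup>2 < 2 ^ (b ^ 29)" .
  show "2 * b ^ 29 + 2 \<le> b ^ 64" using up[of 29] one[of 29] mono[of 30 64] by simp
  have "n ^ 3 \<le> (b ^ 6) ^ 3" using n6 by (intro power_mono) auto
  also have "\<dots> = b ^ 18" by (simp flip: power_mult)
  finally show "4 * n ^ 3 \<le> b ^ 64" using up[of 18] mono[of 19 64] by simp
  show "R \<le> b ^ 64" using d6 mono[of 6 64] by simp
  have "n * n \<le> b ^ 6 * b ^ 6" using n6 by (intro mult_le_mono) auto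
  also have "\<dots> = b ^ 12" by (simp flip: power_add)
  finally show "n * n \<le> b ^ 64" using mono[of 12 64] by simp
  have "n * (L + 1) \<le> b ^ 6 * b ^ 15"
    using n6 up[of 14] one[of 14] by (intro mult_le_mono) (auto simp: L_def)
  also have "\<dots> = b ^ 21" by (simp flip: power_add)
  finally show "n * (L + 1) < b ^ 64" using up[of 21] one[of 21] mono[of 22 64] by simp
qed

section \<open>The whole program on a nontrivial input\<close>

locale lp_run =
  fixes \<alpha> :: "nat list" and \<sigma> :: "int list" and k :: nat and T :: int and N :: nat and st :: state
  assumes m1: "1 \<le> length \<alpha>" and k1: "1 \<le> k" and len: "length \<sigma> = length \<alpha>" and sorted: "sorted \<alpha>"
    and N: "N = (length \<alpha> + k + last \<alpha> + 2) ^ 128"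
    and inp: "\<And>c. c < 2 * length \<alpha> + 3 \<Longrightarrow> st (0, c) = ([int (length \<alpha>), int k, T] @ map int \<alpha> @ \<sigma>) ! c"
    and zero: "\<And>j. st (3, j) = 0"
begin

abbreviation "m \<equiv> length \<alpha>"
definition "b0 = m + k + last \<alpha> + 2"
text \<open>The square makes \<open>b\<close> exceed the total score
  \<open>k * last \<alpha>\<close> as well.\<close>

definition "b = b0 * b0"

lemma b0: "4 \<le> b0" "m < b0" "k < b0" "last \<alpha> < b0" using m1 k1 by (auto simp: b0_def)

lemma b: "16 \<le> b" "m < b" "k < b" "k * last \<alpha> < b"
proof -
  have "4 * 4 \<le> b" unfolding b_def using b0 by (intro mult_le_mono) auto
  then show "16 \<le> b" by simp
  have "b0 * 1 \<le> b" unfolding b_def using b0 by (intro mult_le_mono) auto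
  then show "m < b" "k < b" using b0 by auto
  have "k * last \<alpha> < b0 * b0" using b0 by (intro mult_strict_mono) auto
  then show "k * last \<alpha> < b" by (simp add: b_def)
qed

lemma Nb: "N = b ^ 64"
proof -
  have "b ^ 64 = b0 ^ 64 * b0 ^ 64" by (simp add: b_def power_mult_distrib)
  also have "\<dots> = b0 ^ 128" by (simp flip: power_add)
  finally show ?thesis by (simp add: N b0_def)
qed

lemma bN: "b ^ i \<le> N" if "i \<le> 64"
  unfolding Nb using b(1) that by (intro pow_mono2) auto

lemma last_nth: "\<alpha> ! (m - 1) = last \<alpha>" using m1 by (metis last_conv_nth length_0_conv not_one_le_zero)

lemma le_last: "j < m \<Longrightarrow> \<alpha> ! j \<le> last \<alpha>"
  using sorted_nth_mono[OF sorted, of j "m - 1"] last_nth m1 by simp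

lemma mN: "m \<le> N" using bN[of 1] b by simp

definition "s1 = den N init1 st"

lemma s1: "s1 (2, 0) = int m" "s1 (2, 1) = int k" "s1 (2, 2) = T" "j < m \<Longrightarrow> s1 (3, j) = int (\<alpha> ! j)"
  "\<not> j < m \<Longrightarrow> s1 (3, j) = 0" "j < m \<Longrightarrow> s1 (4, j) = T - \<sigma> ! j"
proof -
  have i: "st (0, 0) = int m" "st (0, 1) = int k" "st (0, 2) = T"
    "\<And>j. j < m \<Longrightarrow> st (0, j + 3) = int (\<alpha> ! j)" "\<And>j. j < m \<Longrightarrow> st (0, j + m + 3) = \<sigma> ! j"
    using inp[of 0] inp[of 1] inp[of 2] inp[of "j + 3" for j] inp[of "j + m + 3" for j] len
    by (auto simp: nth_append nth_Cons' numeral_eq_Suc)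
  define t where "t = st((2, 0) := int m, (2, 1) := int k, (2, 2) := T)"
  have t: "den N (Set 2 (Rd 0 (Num 2))) (den N (Set 1 (Rd 0 (Num 1))) (den N (Set 0 (Rd 0 (Num 0))) st)) = t"
    using i(1-3) by (simp add: t_def)
  define t3 where "t3 = (\<lambda>p. if fst p = 3 \<and> snd p < m then int (\<alpha> ! snd p) else t p)"
  have t3: "den N (For 21 (V 0) (Put 3 (V 21) (Rd 0 (Plus (V 21) (Num 3))))) t = t3"
    unfolding t3_def
  proof (rule For_fill)
    show "m = min N (nat (eval N (V 0) t))" using mN by (simp add: t_def)
    fix j s assume j: "j < m" and s: "\<And>p. p \<noteq> (2, 21) \<Longrightarrow> p \<notin> {3} \<times> {..<j} \<Longrightarrow> s p = t p" "s (2, 21) = int j"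
    have "nat (int j + 3) = j + 3" by simp
    moreover have "s (0, j + 3) = int (\<alpha> ! j)" using s(1)[of "(0, j + 3)"] i(4)[OF j] by (simp add: t_def)
    ultimately show "eval N (Rd 0 (Plus (V 21) (Num 3))) s = int (\<alpha> ! j)" using s(2) by simp
  qed auto
  define t4 where "t4 = (\<lambda>p. if fst p = 4 \<and> snd p < m then T - \<sigma> ! snd p else t3 p)"
  have t4: "den N (For 21 (V 0) (Put 4 (V 21) (Minus (V 2) (Rd 0 (Plus (Plus (V 21) (V 0)) (Num 3)))))) t3 = t4"
    unfolding t4_def
  proof (rule For_fill)
    show "m = min N (nat (eval N (V 0) t3))" using mN by (simp add: t_def t3_def)
    fix j s assume j: "j < m" and s: "\<And>p. p \<noteq> (2, 21) \<Longrightarrow> p \<notin> {4} \<times> {..<j} \<Longrightarrow> s p = t3 p" "s (2, 21) = int j"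
    have "nat (int j + int m + 3) = j + m + 3" by simp
    moreover have "s (0, j + m + 3) = \<sigma> ! j" using s(1)[of "(0, j + m + 3)"] i(5)[OF j] by (simp add: t_def t3_def)
    moreover have "s (2, 0) = int m" "s (2, 2) = T" using s(1)[of "(2, 0)"] s(1)[of "(2, 2)"] by (simp_all add: t_def t3_def)
    ultimately show "eval N (Minus (V 2) (Rd 0 (Plus (Plus (V 21) (V 0)) (Num 3)))) s = T - \<sigma> ! j" using s(2) by simp
  qed auto
  have s1: "s1 = t4" unfolding s1_def init1_def den.simps(3) t t3 t4 ..
  show "s1 (2, 0) = int m" "s1 (2, 1) = int k" "s1 (2, 2) = T" "j < m \<Longrightarrow> s1 (3, j) = int (\<alpha> ! j)"
    "\<not> j < m \<Longrightarrow> s1 (3, j) = 0" "j < m \<Longrightarrow> s1 (4, j) = T - \<sigma> ! j"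
    by (simp_all add: s1 t4_def t3_def t_def zero)
qed

definition "s2 = den N init2 s1"

lemma lt: "i \<le> 64 \<Longrightarrow> int b ^ i < 2 ^ N"
proof -
  assume "i \<le> 64"
  then have "int (b ^ i) < 2 ^ N" by (intro int_lt_pow bN)
  then show ?thesis by simp
qed

lemma s2: "s2 = s1((2, 7) := int b0, (2, 3) := int b, (2, 10) := int b ^ 2, (2, 14) := int b ^ 3, (2, 4) := int b ^ 4,
   (2, 5) := int b ^ 5 + 1, (2, 6) := int b ^ 4 + int m, (2, 8) := (int b ^ 5 + 1) * (int b ^ 5 + 1),
   (2, 11) := int b ^ 8, (2, 12) := int b ^ 12, (2, 13) := int b ^ 14)"
proof -
  have "nat (int m - 1) = m - 1" using m1 by simp
  moreover have "s1 (3, m - 1) = int (last \<alpha>)" using s1(4)[of "m - 1"] last_nth m1 by simp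
  ultimately have 7: "eval N (Plus (Plus (V 0) (V 1)) (Plus (Rd 3 (Minus (V 0) (Num 1))) (Num 2))) s1 = int b0"
    using s1(1,2) by (simp add: b0_def)
  have p: "int b0 * int b0 = int b" "int b * int b = int b ^ 2" "int b * int b ^ 2 = int b ^ 3" "int b ^ 2 * int b ^ 2 = int b ^ 4"
    "int b * int b ^ 4 = int b ^ 5" "int b ^ 4 * int b ^ 4 = int b ^ 8" "int b ^ 8 * int b ^ 4 = int b ^ 12" "int b ^ 12 * int b ^ 2 = int b ^ 14"
    by (simp_all add: b_def flip: power_add power_Suc power2_eq_square)
  have l: "tmul N (int b0) y = int b0 * y" "tmul N (int b) y = int b * y" "tmul N (int b ^ 2) y = int b ^ 2 * y"
    "tmul N (int b ^ 4) y = int b ^ 4 * y" "tmul N (int b ^ 5 + 1) y = (int b ^ 5 + 1) * y"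
    "tmul N (int b ^ 8) y = int b ^ 8 * y" "tmul N (int b ^ 12) y = int b ^ 12 * y" for y
  proof -
    have "b0 * 1 \<le> b" unfolding b_def using b0 by (intro mult_le_mono) auto
    then have 0: "int b0 < 2 ^ N" using lt[of 1] by simp
    have "b ^ 5 + 1 \<le> b ^ 6"
    proof -
      have "2 * b ^ 5 \<le> b * b ^ 5" using b(1) by (intro mult_right_mono) auto
      moreover have "1 \<le> b ^ 5" using b(1) by (simp add: one_le_power)
      moreover have "b ^ 6 = b * b ^ 5" using power_add[of b 1 5] by simp
      ultimately show ?thesis by linarith
    qed
    then have 5: "int (b ^ 5 + 1) < 2 ^ N" by (intro int_lt_pow) (use bN[of 6] in simp)
    show "tmul N (int b0) y = int b0 * y" "tmul N (int b) y = int b * y" "tmul N (int b ^ 2) y = int b ^ 2 * y"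
    "tmul N (int b ^ 4) y = int b ^ 4 * y" "tmul N (int b ^ 5 + 1) y = (int b ^ 5 + 1) * y"
    "tmul N (int b ^ 8) y = int b ^ 8 * y" "tmul N (int b ^ 12) y = int b ^ 12 * y"
      using 0 5 lt[of 1] lt[of 2] lt[of 4] lt[of 8] lt[of 12] by (auto intro!: tmul_eq)
  qed
  have d7: "den N (Set 7 (Plus (Plus (V 0) (V 1)) (Plus (Rd 3 (Minus (V 0) (Num 1))) (Num 2)))) s1 = s1((2, 7) := int b0)"
    unfolding den.simps(2) 7 by simp
  show ?thesis
    unfolding s2_def init2_def den.simps(3) d7 using s1(1) by (simp add: l p)
qed

definition "s3 = den N init3 s2"

lemma s2_prog: "lp_program \<alpha> \<sigma> k T b (last \<alpha>) N s2"
proof -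
  have 8: "s2 (2, 8) = int ((b ^ 5 + 1) * (b ^ 5 + 1))" by (simp add: s2 algebra_simps)
  show ?thesis
    by (unfold_locales; (rule 8 | use m1 k1 b s1 bN[of 6] le_last in \<open>auto simp: s2\<close>))
qed

lemma s3: "s3 p = (if fst p = 5 \<and> snd p < b ^ 5 + 1 then
     (if snd p = b ^ 5 \<or> valid \<alpha> \<sigma> k T b (snd p) then 2 ^ (b ^ 14) else 0) else if p = (2, 9) then 2 ^ (b ^ 14) else s2 p)"
proof -
  interpret P: lp_program \<alpha> \<sigma> k T b "last \<alpha>" N s2 by (rule s2_prog)
  define t where "t = s2((2, 9) := 2 ^ (b ^ 14))"
  have t: "den N (For 21 (V 13) (Set 9 (Plus (V 9) (V 9)))) (den N (Set 9 (Num 1)) s2) = t"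
  proof (rule For_inv[where P = "\<lambda>i u. \<forall>p. p \<noteq> (2, 21) \<longrightarrow> u p = (s2((2, 9) := 2 ^ i)) p" and K = "b ^ 14" and Q = "\<lambda>u. u = t"])
    have "nat (int b ^ 14) = b ^ 14" by (metis nat_int of_nat_power)
    then show "b ^ 14 = min N (nat (eval N (V 13) (den N (Set 9 (Num 1)) s2)))" using bN[of 14] by (simp add: s2)
    show "\<forall>p. p \<noteq> (2, 21) \<longrightarrow> den N (Set 9 (Num 1)) s2 p = (s2((2, 9) := 2 ^ 0)) p" by simp
  next
    fix i and u :: state assume u: "\<forall>p. p \<noteq> (2, 21) \<longrightarrow> u p = (s2((2, 9) := 2 ^ i)) p"
    then have "u (2, 9) = 2 ^ i" by simp
    then show "\<forall>p. p \<noteq> (2, 21) \<longrightarrow> den N (Set 9 (Plus (V 9) (V 9))) (u((2, 21) := int i)) p = (s2((2, 9) := 2 ^ Suc i)) p"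
      using u by (simp del: split_paired_All)
  next
    fix u :: state assume u: "\<forall>p. p \<noteq> (2, 21) \<longrightarrow> u p = (s2((2, 9) := 2 ^ (b ^ 14))) p"
    show "u((2, 21) := den N (Set 9 (Num 1)) s2 (2, 21)) = t"
    proof
      fix p show "(u((2, 21) := den N (Set 9 (Num 1)) s2 (2, 21))) p = t p"
        using u[rule_format, of p] by (cases "p = (2, 21)") (auto simp: t_def)
    qed
  qed
  let ?f = "\<lambda>l. if l = b ^ 5 \<or> valid \<alpha> \<sigma> k T b l then 2 ^ (b ^ 14) else 0 :: int"
  have "s3 = (\<lambda>p. if fst p = 5 \<and> snd p < b ^ 5 + 1 then ?f (snd p) else t p)"
    unfolding s3_def init3_def den.simps(3) t
  proof (rule For_fill)
    have "nat (int b ^ 5 + 1) = b ^ 5 + 1" by (metis nat_int of_nat_power of_nat_1 of_nat_add)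
    then show "b ^ 5 + 1 = min N (nat (eval N (V 5) t))" using P.pows(2) by (simp add: t_def s2)
    fix l u assume l: "l < b ^ 5 + 1" and u: "\<And>p. p \<noteq> (2, 21) \<Longrightarrow> p \<notin> {5} \<times> {..<l} \<Longrightarrow> u p = t p" "u (2, 21) = int l"
    \<comment> \<open>Scalar 9 is protected but has just been set, so \<open>u\<close> violates
      \<open>P.env'\<close>. The expressions evaluated below, \<open>e_valid\<close> and
      \<open>e_const\<close>, do not read it and have the same value in \<open>u'\<close>, where the
      old content is put back.\<close>
    define u' where "u' = u((2, 9) := s2 (2, 9))"
    have eu: "P.env' u'"
      unfolding P.env'_def
    proof
      fix p assume "p \<in> protected"
      then show "u' p = s2 p" using u(1)[of p] by (cases "p = (2, 9)") (auto simp: protected_def u'_def t_def)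
    qed
    have lN: "l \<le> N" using l P.pows(2) by simp
    have v: "eval N (V 21) u' = int l" using u(2) by (simp add: u'_def)
    have ind: "eval N e u = eval N e u'" if "(2, 9) \<notin> reads e" for e
      by (rule eval_cong) (use that in \<open>auto simp: u'_def\<close>)
    have va: "0 < eval N (e_valid (V 21)) u \<longleftrightarrow> valid \<alpha> \<sigma> k T b l"
    proof -
      have "eval N (e_valid (V 21)) u = eval N (e_valid (V 21)) u'"
        by (rule ind) (auto simp: e_valid_def e_i_def e_j_def e_c_def e_s_def e_d_def e_t_def e_w_def dest: cell_fst)
      then show ?thesis using P.eval_valid[OF eu v lN] by (simp only:)
    qed
    have co: "eval N e_const u = int (b ^ 5)"
    proof -
      have "eval N e_const u = eval N e_const u'" by (rule ind) (simp add: e_const_def)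
      then show ?thesis using P.eval_const[OF eu] by (simp only:)
    qed
    have "u (2, 9) = 2 ^ (b ^ 14)" using u(1)[of "(2, 9)"] by (simp add: t_def)
    moreover have "int l = int (b ^ 5) \<longleftrightarrow> l = b ^ 5" by (rule of_nat_eq_iff)
    moreover have "eval N (V 21) u = int l" using u(2) by simp
    ultimately show "eval N (Cond (eq (V 21) e_const) (V 9) (Cond (e_valid (V 21)) (V 9) (Num 0))) u = ?f l"
      unfolding eval.simps(8) eval_tests va co by simp
  qed auto
  then show ?thesis by (auto simp: t_def)
qed

lemma s3_prog: "lp_program \<alpha> \<sigma> k T b (last \<alpha>) N s3"
proof -
  interpret P: lp_program \<alpha> \<sigma> k T b "last \<alpha>" N s2 by (rule s2_prog)
  show ?thesis
    using P.sc P.ar P.NB P.b4 by unfold_locales (auto simp: s3)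
qed

text \<open>A solution of the LP is a flow with positive homogenising coordinate, and the computed
  vector is then positive there by maximal support. Conversely, a computed vector that is positive
  there decomposes into a solution.\<close>

lemma core:
  defines "u \<equiv> den N core st"
  shows "if \<exists>x. lp_feasible \<alpha> \<sigma> k T x
    then \<exists>es. u (0, 0) = 1 \<and> u (0, 1) = int (length es) \<and>
      (\<forall>a<length (concat (map encode_entry es)). u (0, 2 + a) = concat (map encode_entry es) ! a) \<and>
      (\<forall>(i, C, a, D)\<in>set es. i < m \<and> C \<in> bounded_configs \<alpha> \<sigma> k T i \<and> 0 < D) \<and> lp_feasible \<alpha> \<sigma> k T (sparse_value es)
    else u (0, 0) = 0"
proof -
  interpret P: lp_program \<alpha> \<sigma> k T b "last \<alpha>" N s3 by (rule s3_prog)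
  note num = parameter_bounds[OF b(1,2)]
  interpret C: chubanov_phases N "b ^ 5 + 1" "b ^ 4 + m" "b ^ 14" b "b ^ 29" "amat \<alpha> k b" e_A s3 "insert (b ^ 5) {l. valid \<alpha> \<sigma> k T b l}"
  proof (unfold_locales, goal_cases)
    case (4 t r l)
    then show ?case by (intro P.eval_e_A_protected)
  qed (use P.sc num P.S0_sub P.amat_le b in \<open>auto simp: Nb simp del: of_nat_power of_nat_add of_nat_mult\<close>)
  have env: "C.env s3" by (simp add: C.env_def)
  have W: "s3 (5, l) = (if l \<in> insert (b ^ 5) {l. valid \<alpha> \<sigma> k T b l} then 2 ^ (b ^ 14) else 0)" if "l < b ^ 5 + 1" for l
    using that by (simp add: s3)
  define s4 where "s4 = den N (phases e_A) s3"
  define X where "X l = (if l < b ^ 5 + 1 then s4 (9, l) else 0)" for l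
  note ph = C.phases[OF env W, folded s4_def, folded X_def]
  have env4: "P.env' s4" using ph(1) by (simp add: C.env_def P.env'_def)
  have c: "eval N (Rd 9 e_const) s4 = X (b ^ 5)" using P.eval_const[OF env4] by (simp add: X_def del: of_nat_power)
  have u: "u = (if 0 < X (b ^ 5) then den N output_paths s4 else s4((0, 0) := 0))"
    unfolding u_def core_def den.simps(3) s1_def[symmetric] s2_def[symmetric] s3_def[symmetric] s4_def[symmetric] den.simps(4) c
    by simp
  show ?thesis
  proof (cases "0 < X (b ^ 5)")
    case True
    have X9: "s4 (9, l) = X l" if "l < b ^ 5 + 1" for l using that by (simp add: X_def)
    have "\<exists>es. u (0, 0) = 1 \<and> u (0, 1) = int (length es) \<and>
      (\<forall>a<length (P.enc es). u (0, 2 + a) = P.enc es ! a) \<and>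
      (\<forall>(i, C, a, D)\<in>set es. i < m \<and> C \<in> bounded_configs \<alpha> \<sigma> k T i \<and> 0 < D) \<and> lp_feasible \<alpha> \<sigma> k T (sparse_value es)"
      unfolding u if_P[OF True] by (rule P.output_paths[OF env4 X9 True ph(2-4)])
    then show ?thesis unfolding P.enc_def by auto
  next
    case False
    have "\<not> lp_feasible \<alpha> \<sigma> k T x" for x
    proof
      assume "lp_feasible \<alpha> \<sigma> k T x"
      from P.flow_of_solution[OF this] obtain Y where Y: "kern (amat \<alpha> k b) {..<b ^ 4 + m} (insert (b ^ 5) {l. valid \<alpha> \<sigma> k T b l}) Y"
        "\<forall>l. 0 \<le> Y l" "0 < Y (b ^ 5)" by blast
      have "C.feas Y" using Y by (simp add: C.feas_def)
      then have "0 < X (b ^ 5)" using ph(5)[OF _ \<open>C.feas Y\<close> _ Y(3)] by simp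
      then show False using False by simp
    qed
    moreover have "u (0, 0) = 0" using False by (simp add: u)
    ultimately show ?thesis by simp
  qed
qed

end

section \<open>The polynomial time bound\<close>

lemma poly_nat_mono: "x \<le> y \<Longrightarrow> poly p x \<le> poly p (y :: nat)"
  by (induction p) (auto intro: add_mono mult_le_mono)

lemma poly2_hom: "poly2 (P + P') x y = poly2 P x y + poly2 P' x y" "poly2 (P * P') x y = poly2 P x y * poly2 P' x y"
  "poly2 (P ^ d) x y = poly2 P x y ^ d" "poly2 [:q:] x y = poly q x" "poly2 [:0, 1:] x y = y"
  by (simp_all add: poly2_def)

lemma poly2_compose: "\<exists>P. \<forall>x y. poly2 P x y = poly p (poly2 F x y)"
proof (induction p)
  case 0
  show ?case by (intro exI[of _ 0]) (simp add: poly2_def)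
next
  case (pCons a p)
  then obtain P where "\<forall>x y. poly2 P x y = poly p (poly2 F x y)" by blast
  then show ?case by (intro exI[of _ "[:[:a:]:] + F * P"]) (simp add: poly2_hom)
qed

section \<open>The loop bound\<close>

definition same :: "mem \<Rightarrow> mem \<Rightarrow> bool" where
  "same s0 s \<longleftrightarrow> (\<forall>a<16. \<forall>i. s (addr a i) = s0 (addr a i))"

lemma same_upd [simp]:
  "same s0 (s(tmp d := x)) = same s0 s" "same s0 (s(-16 := x)) = same s0 s" "same s0 (s(-32 := x)) = same s0 s"
  unfolding same_def by (simp_all cong: imp_cong)

text \<open>The constants 1 and 0 are kept in temporaries for decrementing counters and for
  copying.\<close>

definition ready :: "mem \<Rightarrow> nat \<Rightarrow> mem \<Rightarrow> bool" where
  "ready s0 x s \<longleftrightarrow> same s0 s \<and> s (-16) = int x \<and> s (tmp 0) = 1 \<and> s (tmp 3) = 0"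

text \<open>Compiled products need \<open>N\<close> and \<open>2 ^ N\<close> in memory, so here the
  square is formed by \<open>x\<close> additions. This is affordable because \<open>x\<close> never
  exceeds \<open>N\<close>, which is itself polynomial.\<close>

definition square :: prog where
  "square = Seq (Const (tmp 4) 0) (Seq (Add (tmp 5) (-16) (tmp 3))
     (Seq (WhilePos (tmp 5) (Seq (Add (tmp 4) (tmp 4) (-16)) (Sub (tmp 5) (tmp 5) (tmp 0))))
          (Add (-16) (tmp 4) (tmp 3))))"

primrec squares :: "nat \<Rightarrow> prog" where
  "squares 0 = Const (tmp 4) 0"
| "squares (Suc d) = Seq square (squares d)"

definition double :: prog where
  "double = Seq (Const (-32) 1) (Seq (Add (tmp 5) (-16) (tmp 3))
     (WhilePos (tmp 5) (Seq (Add (-32) (-32) (-32)) (Sub (tmp 5) (tmp 5) (tmp 0)))))"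

definition power_up :: prog where
  "power_up = Seq (squares 7) double"

text \<open>Three header cells precede the scores, so cell \<open>m + 2\<close> holds the last and
  largest one. The seven squarings that follow give the exponent 128.\<close>

definition prelude :: prog where
  "prelude = Seq (Const (tmp 0) 1) (Seq (Const (tmp 1) 2) (Seq (Const (tmp 3) 0)
     (Seq (Add (tmp 2) 0 (tmp 1)) (Seq (Load (tmp 2) (tmp 2)) (Seq (Add (tmp 1) (tmp 1) 0)
     (Seq (Add (tmp 1) (tmp 1) 1) (Seq (Add (tmp 1) (tmp 1) (tmp 2)) (Seq (Add (-16) (tmp 1) (tmp 3))
     power_up))))))))"

lemma square:
  assumes r: "ready s0 x s"
  shows "wpt square (\<lambda>t s'. t \<le> 10 + 3 * x \<and> ready s0 (x * x) s') s"
proof -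
  define I where "I n s' \<longleftrightarrow> n \<le> x \<and> ready s0 x s' \<and> s' (tmp 5) = int n \<and> s' (tmp 4) = int (x * (x - n))" for n s'
  let ?body = "Seq (Add (tmp 4) (tmp 4) (-16)) (Sub (tmp 5) (tmp 5) (tmp 0))"
  have loop: "wpt (WhilePos (tmp 5) ?body) (\<lambda>t s'. t \<le> 1 + x * (2 + 1) \<and> I 0 s') s'" if "I x s'" for s'
  proof (rule wpt_While_count[of I])
    show "I x s'" by (rule that)
  next
    fix s' assume "I 0 s'"
    then show "s' (tmp 5) \<le> 0" by (simp add: I_def)
  next
    fix n s' assume I: "I (Suc n) s'"
    have "x * (x - n) = x * (x - Suc n) + x"
    proof -
      have "x - n = Suc (x - Suc n)" using I by (auto simp: I_def)
      then show ?thesis by simp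
    qed
    then show "0 < s' (tmp 5) \<and> wpt ?body (\<lambda>t s'. t \<le> 2 \<and> I n s') s'"
      using I by (simp add: I_def ready_def)
  qed
  have i: "I x (s(tmp 4 := 0, tmp 5 := int x))" using r by (simp add: I_def ready_def)
  show ?thesis
    using r unfolding square_def
    apply (simp add: ready_def)
    apply (rule wpt_mono[OF loop])
    using i apply simp
    apply (simp add: I_def ready_def)
    done
qed

lemma squares:
  "1 \<le> x \<Longrightarrow> ready s0 x s \<Longrightarrow> wpt (squares d) (\<lambda>t s'. t \<le> 1 + d * (10 + 3 * x ^ 2 ^ d) \<and> ready s0 (x ^ 2 ^ d) s') s"
proof (induction d arbitrary: x s)
  case 0
  then show ?case by (simp add: ready_def)
next
  case (Suc d)
  have e: "(x * x) ^ 2 ^ d = x ^ 2 ^ Suc d" by (simp add: power_mult power2_eq_square)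
  have le: "x \<le> x ^ 2 ^ Suc d" using Suc.prems(1) by (intro self_le_power) auto
  show ?case
    unfolding squares.simps wpt_Seq
  proof (rule wpt_mono[OF square[OF Suc.prems(2)]])
    fix t s' assume t: "t \<le> 10 + 3 * x \<and> ready s0 (x * x) s'"
    have "1 \<le> x * x" using Suc.prems(1) by simp
    from Suc.IH[OF this] t have "wpt (squares d) (\<lambda>u s'. u \<le> 1 + d * (10 + 3 * x ^ 2 ^ Suc d) \<and> ready s0 (x ^ 2 ^ Suc d) s') s'"
      unfolding e by blast
    then show "wpt (squares d) (\<lambda>u s'. t + u \<le> 1 + Suc d * (10 + 3 * x ^ 2 ^ Suc d) \<and> ready s0 (x ^ 2 ^ Suc d) s') s'"
    proof (rule wpt_mono)
      fix u s'' assume "u \<le> 1 + d * (10 + 3 * x ^ 2 ^ Suc d) \<and> ready s0 (x ^ 2 ^ Suc d) s''"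
      moreover have "10 + 3 * x \<le> 10 + 3 * x ^ 2 ^ Suc d" using le by linarith
      ultimately show "t + u \<le> 1 + Suc d * (10 + 3 * x ^ 2 ^ Suc d) \<and> ready s0 (x ^ 2 ^ Suc d) s''"
        using t by simp
    qed
  qed
qed

lemma double:
  assumes r: "ready s0 x s"
  shows "wpt double (\<lambda>t s'. t \<le> 10 + 3 * x \<and> same s0 s' \<and> s' (-16) = int x \<and> s' (-32) = 2 ^ x) s"
proof -
  define I where "I n s' \<longleftrightarrow> n \<le> x \<and> ready s0 x s' \<and> s' (tmp 5) = int n \<and> s' (-32) = 2 ^ (x - n)" for n s'
  let ?body = "Seq (Add (-32) (-32) (-32)) (Sub (tmp 5) (tmp 5) (tmp 0))"
  have loop: "wpt (WhilePos (tmp 5) ?body) (\<lambda>t s'. t \<le> 1 + x * (2 + 1) \<and> I 0 s') s'" if "I x s'" for s'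
  proof (rule wpt_While_count[of I])
    show "I x s'" by (rule that)
  next
    fix s' assume "I 0 s'"
    then show "s' (tmp 5) \<le> 0" by (simp add: I_def)
  next
    fix n s' assume I: "I (Suc n) s'"
    have "x - n = Suc (x - Suc n)" using I by (auto simp: I_def)
    then show "0 < s' (tmp 5) \<and> wpt ?body (\<lambda>t s'. t \<le> 2 \<and> I n s') s'"
      using I by (simp add: I_def ready_def)
  qed
  have i: "I x (s(-32 := 1, tmp 5 := int x))" using r by (simp add: I_def ready_def)
  show ?thesis
    using r unfolding double_def
    apply (simp add: ready_def)
    apply (rule wpt_mono[OF loop])
    using i apply simp
    apply (simp add: I_def ready_def)
    done
qed

lemma prelude:
  assumes s0: "s0 0 = int m" "s0 1 = int k" "s0 (int m + 2) = int a"
  defines "N \<equiv> (m + k + a + 2) ^ 128"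
  shows "wpt prelude (\<lambda>t s. t \<le> 200 + 30 * N \<and> same s0 s \<and> s (-16) = int N \<and> s (-32) = 2 ^ N) s0"
proof -
  define x where "x = m + k + a + 2"
  have N: "x ^ 2 ^ 7 = N" by (simp add: x_def N_def)
  define s where "s = s0(tmp 0 := 1, tmp 3 := 0, tmp 2 := int a, tmp 1 := int x, -16 := int x)"
  have ne: "tmp d \<noteq> int c" "int c \<noteq> tmp d" "(0::int) \<noteq> tmp d" "(1::int) \<noteq> tmp d" "int c + 2 \<noteq> tmp d" for d c
    by (auto simp: tmp_def)
  have "same s0 s0" by (simp add: same_def)
  then have r: "ready s0 x s" by (simp add: s_def ready_def)
  have step: "wpt power_up (\<lambda>t s. t \<le> 100 + 30 * N \<and> same s0 s \<and> s (-16) = int N \<and> s (-32) = 2 ^ N) s"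
    unfolding power_up_def wpt_Seq
  proof (rule wpt_mono[OF squares[OF _ r, of 7, unfolded N]])
    show "1 \<le> x" by (simp add: x_def)
    fix t u assume t: "t \<le> 1 + 7 * (10 + 3 * N) \<and> ready s0 N u"
    show "wpt double (\<lambda>v s. t + v \<le> 100 + 30 * N \<and> same s0 s \<and> s (-16) = int N \<and> s (-32) = 2 ^ N) u"
      by (rule wpt_mono[OF double]) (use t in auto)
  qed
  have e: "s0(tmp 0 := 1, tmp 3 := 0, tmp 2 := int a, tmp (Suc 0) := 2 + int m + int k + int a, -16 := 2 + int m + int k + int a) = s"
    by (simp add: s_def x_def algebra_simps)
  show ?thesis
    unfolding prelude_def
    apply (simp add: s0 ne e)
    apply (rule wpt_mono[OF step])
    apply simp
    done
qed

lemma wf_core: "wf_com core"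
  by (simp add: core_def init1_def init2_def init3_def phases_def phase_def output_paths_def extract_step_def
    find_path_def extend_path_def remove_path_def write_entry_def halve_def perceptron_def find_def project_def
    proj_init_def row_def row_u_def row_beta_def row_upd_def row_gcd_def row_reduce_def euclid_def
    eabs_def quot_def aw_def zx_def e_A_def e_valid_def e_const_def e_h_def e_w_def e_i_def e_j_def e_c_def
    e_s_def e_d_def e_t_def)

text \<open>Without candidates or without manipulators the zero vector satisfies all constraints, so
  the empty list is written.\<close>

definition trivial :: prog where "trivial = Seq (Const 0 1) (Const 1 0)"

definition solver :: prog where
  "solver = IfPos 0 (IfPos 1 (Seq prelude (c_com core 0)) trivial) trivial"

lemma trivial_feasible:
  assumes "length \<alpha> = 0 \<or> k = 0"
  shows "lp_feasible \<alpha> \<sigma> k T (sparse_value [])"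
  using assms by (auto simp: lp_feasible_def sparse_value_def)

lemma trivial_solves:
  assumes "length \<alpha> = 0 \<or> k = 0"
  shows "solves_lp \<alpha> \<sigma> k T (s(0 := 1, 1 := 0))"
proof -
  have "holds (s(0 := 1, 1 := 0)) [1, 0]" by (auto simp: holds_def less_Suc_eq)
  then have "outputs_solution \<alpha> \<sigma> k T (s(0 := 1, 1 := 0))"
    unfolding outputs_solution_def using trivial_feasible[OF assms] by (intro exI[of _ "[]"]) simp
  then show ?thesis using trivial_feasible[OF assms] by (auto simp: solves_lp_def)
qed

lemma lp_input_nth: "c < 2 * length \<alpha> + 3 \<Longrightarrow> length \<sigma> = length \<alpha> \<Longrightarrow>
    lp_input \<alpha> \<sigma> k T (int c) = ([int (length \<alpha>), int k, T] @ map int \<alpha> @ \<sigma>) ! c"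
  by (simp add: lp_input_def mem_of_def)

lemma solver_main:
  assumes m: "1 \<le> length \<alpha>" and k: "1 \<le> k" and len: "length \<sigma> = length \<alpha>" and sorted: "sorted \<alpha>"
  defines "N \<equiv> (length \<alpha> + k + last \<alpha> + 2) ^ 128"
  shows "wpt (Seq prelude (c_com core 0)) (\<lambda>t s. t \<le> 200 + 30 * N + t_com core N \<and> solves_lp \<alpha> \<sigma> k T s) (lp_input \<alpha> \<sigma> k T)"
proof -
  let ?s0 = "lp_input \<alpha> \<sigma> k T"
  define st :: state where "st p = ?s0 (addr (fst p) (snd p))" for p
  have nth: "?s0 (int c) = ([int (length \<alpha>), int k, T] @ map int \<alpha> @ \<sigma>) ! c" if "c < 2 * length \<alpha> + 3" for c
    by (rule lp_input_nth[OF that len])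
  have i0: "?s0 0 = int (length \<alpha>)" "?s0 1 = int k" using nth[of 0] nth[of 1] by simp_all
  have ne: "\<alpha> \<noteq> []" using m by auto
  have "?s0 (int (length \<alpha> + 2)) = int (\<alpha> ! (length \<alpha> - 1))"
    using nth[of "length \<alpha> + 2"] m ne by (simp add: nth_append nth_Cons' numeral_eq_Suc)
  then have i2: "?s0 (int (length \<alpha>) + 2) = int (last \<alpha>)" using ne by (simp add: last_conv_nth add.commute)
  have run: "lp_run \<alpha> \<sigma> k T N st"
  proof (unfold_locales)
    show "1 \<le> length \<alpha>" "1 \<le> k" "length \<sigma> = length \<alpha>" "sorted \<alpha>" by fact+
    show "N = (length \<alpha> + k + last \<alpha> + 2) ^ 128" by (simp add: N_def)
    show "st (0, c) = ([int (length \<alpha>), int k, T] @ map int \<alpha> @ \<sigma>) ! c" if "c < 2 * length \<alpha> + 3" for c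
      using nth[OF that] by (simp add: st_def addr_def)
    show "st (3, j) = 0" for j by (simp add: st_def addr_def lp_input_def mem_of_def)
  qed
  show ?thesis
    unfolding wpt_Seq
  proof (rule wpt_mono[OF prelude[OF i0 i2, folded N_def]])
    fix t s assume t: "t \<le> 200 + 30 * N \<and> same ?s0 s \<and> s (-16) = int N \<and> s (-32) = 2 ^ N"
    have rel: "rel N st s"
      unfolding rel_def st_def using t by (simp only: same_def fst_conv snd_conv) blast
    have ok: "com_ok N core" by (rule c_com[OF wf_core])
    show "wpt (c_com core 0) (\<lambda>u s. t + u \<le> 200 + 30 * N + t_com core N \<and> solves_lp \<alpha> \<sigma> k T s) s"
    proof (rule com_okD[OF ok rel])
      fix u s' assume u: "u \<le> t_com core N" and r: "rel N (den N core st) s'"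
      have get: "s' (int c) = den N core st (0, c)" for c
        using rel_get[OF r, of 0 c] by (simp add: addr_def)
      have "solves_lp \<alpha> \<sigma> k T s'"
      proof (cases "\<exists>x. lp_feasible \<alpha> \<sigma> k T x")
        case True
        then obtain es where es: "den N core st (0, 0) = 1" "den N core st (0, 1) = int (length es)"
          "\<forall>a<length (concat (map encode_entry es)). den N core st (0, 2 + a) = concat (map encode_entry es) ! a"
          "\<forall>(i, C, a, D)\<in>set es. i < length \<alpha> \<and> C \<in> bounded_configs \<alpha> \<sigma> k T i \<and> 0 < D"
          "lp_feasible \<alpha> \<sigma> k T (sparse_value es)"
          using lp_run.core[OF run] by auto
        have "holds s' (1 # int (length es) # concat (map encode_entry es))"
          unfolding holds_def
        proof (intro allI impI)
          fix c assume c: "c < length (1 # int (length es) # concat (map encode_entry es))"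
          consider "c = 0" | "c = 1" | d where "c = 2 + d" by (metis One_nat_def add_2_eq_Suc nat.exhaust)
          then show "s' (int c) = (1 # int (length es) # concat (map encode_entry es)) ! c"
          proof cases
            case (3 d)
            then show ?thesis using es(3) c unfolding get by simp
          qed (use es(1,2) in \<open>simp_all only: get, simp_all\<close>)
        qed
        then have "outputs_solution \<alpha> \<sigma> k T s'" unfolding outputs_solution_def using es(4,5) by blast
        then show ?thesis using True by (simp add: solves_lp_def)
      next
        case False
        then have "den N core st (0, 0) = 0" using lp_run.core[OF run] by simp
        then have "outputs_infeasible s'" using get[of 0] by (simp add: outputs_infeasible_def)
        then show ?thesis using False by (simp add: solves_lp_def)
      qed
      then show "t + u \<le> 200 + 30 * N + t_com core N \<and> solves_lp \<alpha> \<sigma> k T s'" using t u by simp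
    qed
  qed
qed

theorem theorem3:
  fixes q :: "nat poly"
  shows "\<exists>(c :: prog) (p :: nat poly poly).
           \<forall>(\<alpha> :: nat list) (\<sigma> :: int list) (k :: nat) (T :: int).
             sorted \<alpha> \<longrightarrow> length \<sigma> = length \<alpha> \<longrightarrow> (\<forall>a\<in>set \<alpha>. a \<le> poly q (length \<alpha>)) \<longrightarrow>
             (\<exists>t s. exec c (lp_input \<alpha> \<sigma> k T) t s \<and> t \<le> poly2 p (length \<alpha>) k \<and>
                    solves_lp \<alpha> \<sigma> k T s)"
proof -
  \<comment> \<open>The constant is the 200 of the prelude plus the two tests of
    \<open>solver\<close>.\<close>
  have "poly_bdd (\<lambda>N. 202 + 30 * N + t_com core N)"
    by (intro poly_bdd poly_bdd_com)
  then obtain r where r: "\<And>N. 202 + 30 * N + t_com core N \<le> poly r N" unfolding poly_bdd_def by blast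
  \<comment> \<open>A bound on \<open>N\<close>, with \<open>q\<close> in place of the largest
    score. The outer variable of the polynomial is \<open>k\<close>, the inner one
    \<open>m\<close>.\<close>
  define F :: "nat poly poly" where "F = ([:[:0, 1:]:] + [:0, 1:] + [:q:] + [:[:2:]:]) ^ 128"
  have F: "poly2 F x y = (x + y + poly q x + 2) ^ 128" for x y
    unfolding F_def poly2_hom by simp
  obtain p where p: "\<And>x y. poly2 p x y = poly r (poly2 F x y)" using poly2_compose by blast
  show ?thesis
  proof (intro exI[of _ solver] exI[of _ p] allI impI)
    fix \<alpha> :: "nat list" and \<sigma> :: "int list" and k :: nat and T :: int
    assume sorted: "sorted \<alpha>" and len: "length \<sigma> = length \<alpha>" and bd: "\<forall>a\<in>set \<alpha>. a \<le> poly q (length \<alpha>)"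
    let ?s0 = "lp_input \<alpha> \<sigma> k T"
    have i: "?s0 0 = int (length \<alpha>)" "?s0 1 = int k"
      using lp_input_nth[of 0 \<alpha> \<sigma> k T] lp_input_nth[of 1 \<alpha> \<sigma> k T] len by simp_all
    have "wpt solver (\<lambda>t s. t \<le> poly2 p (length \<alpha>) k \<and> solves_lp \<alpha> \<sigma> k T s) ?s0"
    proof (cases "length \<alpha> = 0 \<or> k = 0")
      case True
      have "4 \<le> poly2 p (length \<alpha>) k" unfolding p using r[of "poly2 F (length \<alpha>) k"] by linarith
      then show ?thesis using True i trivial_solves[OF True, of \<sigma> T ?s0]
        by (auto simp: solver_def trivial_def)
    next
      case False
      define N where "N = (length \<alpha> + k + last \<alpha> + 2) ^ 128"
      have m: "1 \<le> length \<alpha>" and k: "1 \<le> k" using False by linarith+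
      have "last \<alpha> \<le> poly q (length \<alpha>)" using bd m by (intro bd[rule_format] last_in_set) auto
      then have "N \<le> poly2 F (length \<alpha>) k" unfolding F N_def by (intro power_mono) auto
      then have le: "202 + 30 * N + t_com core N \<le> poly2 p (length \<alpha>) k"
        unfolding p using r[of N] poly_nat_mono le_trans by blast
      have "wpt (Seq prelude (c_com core 0)) (\<lambda>t s. 1 + (1 + t) \<le> poly2 p (length \<alpha>) k \<and> solves_lp \<alpha> \<sigma> k T s) ?s0"
        by (rule wpt_mono[OF solver_main[OF m k len sorted, folded N_def]]) (use le in auto)
      moreover have "0 < ?s0 0" "0 < ?s0 1" using i m k by linarith+
      ultimately show ?thesis unfolding solver_def by (simp only: wpt_If if_True)
    qed
    then show "\<exists>t s. exec solver ?s0 t s \<and> t \<le> poly2 p (length \<alpha>) k \<and> solves_lp \<alpha> \<sigma> k T s"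
      unfolding wpt_def by blast
  qed
qed

end
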